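(* Let $T:X\to X$, $X=[0,1]^2$, be the baker's transformation with parameter $\gamma\in(0,1/2)$ defined in the context, and let $\mu$ be its SRB measure. Let $\tau>0$, let $z\in X$ be a point for which the limit $$\lim_{r\to0^+}\frac{\log\mu(B(z,r))}{\log r}=d$$ exists ($d$ as in the context), and let $(u_n)$ be a sequence of real numbers such that $n\,\mu(B_n)\to\tau$ as $n\to\infty$, where $B_n=B(z,e^{-u_n})$. Put $v_n=\lfloor\tau/\mu(B_n)\rfloor$ and consider the point process on $[0,\infty)$ $$N_n(x)(J)=\sum_{l\in v_nJ\cap\mathbb N_0}\mathbf 1_{B_n}(T^l x),\qquad x\in X,$$ regarded as a random counting measure on the probability space $(X,\mu)$. (1) If $z$ is not a periodic point of $T$ and the balls $B_n$ are taken in the Euclidean metric, then $N_n$ converges in distribution to a standard Poisson point process of intensity $\tau$. (2) If $z$ is a periodic point of $T$ of minimal period $p$ and the balls $B_n$ are taken in the $\ell^\infty$ metric, then $N_n$ converges in distribution to a compound point process of Pólya–Aeppli type, namely the compound point process with intensity $\tau\theta$ and cluster size distribution $\rho_l=\theta(1-\theta)^{l-1}$, $l\ge1$, where $\theta=1-\lim_{n\to\infty}\frac{\mu(T^{-p}B_n\cap B_n)}{\mu(B_n)}$.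
   Context: The baker's transformation: fix $\alpha=1/2$ and $\gamma\in(0,1/2)$ (so $\gamma_a=\gamma_b=\gamma$). On $X=[0,1]^2$ put $T(x,y)=(\gamma x,\,2y)$ if $y<1/2$ and $T(x,y)=((1-\gamma)+\gamma x,\,2y-1)$ if $y\ge 1/2$ (the value on the $\mu$-null line $y=1/2$ is a convention). Unstable leaves are the vertical segments $\{x\}\times[0,1]$. The SRB measure $\mu$ is the unique $T$-invariant Borel probability measure on $X$ whose conditional measures on the vertical unstable leaves are normalized Lebesgue (arclength) measure. $B(z,r)$ is the open ball in $X$ for the metric specified (Euclidean, or $\ell^\infty$: $|(x,y)|_\infty=\max\{|x|,|y|\}$). The number $d=1+\frac{\log 2}{\log\gamma^{-1}}$ is the Hausdorff dimension of $\mu$; the limit does not depend on which of the two metrics is used. Point processes: $\mathcal N_p([0,\infty))$ is the set of counting measures $\sum_i\delta_{x_i}$ on $[0,\infty)$, with the $\sigma$-algebra generated by the evaluation maps and with the vague topology (convergence against continuous compactly supported functions). A point process is a measurable map from a probability space to $\mathcal N_p([0,\infty))$; $N_n$ converges in distribution to $N$ if the law of $N_n$ converges weakly to the law of $N$. For $J\subset[0,\infty)$ and $v>0$, $vJ=\{vs:s\in J\}$. A standard Poisson point process of intensity $\tau$ is a point process $\tilde N$ such that for disjoint bounded measurable sets $I_1,\dots,I_m$ and integers $k_1,\dots,k_m\ge0$, the probability that $\tilde N(I_l)=k_l$ for all $l$ equals $\prod_{l=1}^m e^{-\tau\mathrm{Leb}(I_l)}\frac{(\tau\mathrm{Leb}(I_l))^{k_l}}{k_l!}$.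 A compound Poisson random variable with intensity $s$ and cluster size distribution $(\rho_l)_{l\ge1}$ is $\sum_{j=1}^{K}X_j$ with $K$ Poisson of parameter $s$, independent of the i.i.d. variables $X_j$ with $\mathbb P(X_j=l)=\rho_l$. A compound point process with intensity $t>0$ and cluster size distribution $(\rho_l)_{l\ge1}$ is a point process $N$ such that $N(A_1),\dots,N(A_k)$ are independent for mutually disjoint measurable $A_1,\dots,A_k\subset[0,\infty)$, and for each measurable $A$ of finite Lebesgue measure $N(A)$ is compound Poisson with intensity $t\,\mathrm{Leb}(A)$ and cluster size distribution $(\rho_l)_{l\ge1}$. *)

theory Defs
  imports "HOL-Probability.Probability"
begin

section \<open>The baker's transformation and its SRB measure\<close>

definition unit_square :: "(real \<times> real) set" where
  "unit_square = {0..1} \<times> {0..1}"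

definition baker :: "real \<Rightarrow> real \<times> real \<Rightarrow> real \<times> real" where
  "baker \<gamma> = (\<lambda>(x, y). if y < 1/2 then (\<gamma> * x, 2 * y) else ((1 - \<gamma>) + \<gamma> * x, 2 * y - 1))"

text \<open>Arclength on the unstable leaf \<open>{x} \<times> [0,1]\<close>; it is already normalized, since
  the leaf has length one.\<close>

definition leaf_lebesgue :: "real \<Rightarrow> (real \<times> real) measure" where
  "leaf_lebesgue x =
     distr (restrict_space lborel {0..1}) (restrict_space borel unit_square) (\<lambda>y. (x, y))"

text \<open>The last clause is the disintegration of \<open>\<mu>\<close> along the partition into vertical leaves,
  \<open>\<mu>(A) = \<integral> \<mu>\<^sub>w(A) d\<mu>(w)\<close>, where the conditional measure \<open>\<mu>\<^sub>w\<close> is carried by the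
  leaf \<open>{fst w} \<times> [0,1]\<close> through \<open>w\<close> and is required to be normalized Lebesgue measure there.\<close>

definition srb_measure :: "real \<Rightarrow> (real \<times> real) measure \<Rightarrow> bool" where
  "srb_measure \<gamma> \<mu> \<longleftrightarrow>
     prob_space \<mu> \<and>
     space \<mu> = unit_square \<and> sets \<mu> = sets (restrict_space borel unit_square) \<and>
     baker \<gamma> \<in> measurable \<mu> \<mu> \<and> distr \<mu> \<mu> (baker \<gamma>) = \<mu> \<and>
     (\<forall>A\<in>sets \<mu>. emeasure \<mu> A = (\<integral>\<^sup>+ w. emeasure (leaf_lebesgue (fst w)) A \<partial>\<mu>))"

definition linf_dist :: "real \<times> real \<Rightarrow> real \<times> real \<Rightarrow> real" where
  "linf_dist z w = max \<bar>fst z - fst w\<bar> \<bar>snd z - snd w\<bar>"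

text \<open>Open balls of the space \<open>X = [0,1]\<^sup>2\<close> itself, for the metric \<open>D\<close>.\<close>

definition square_ball ::
    "(real \<times> real \<Rightarrow> real \<times> real \<Rightarrow> real) \<Rightarrow> real \<times> real \<Rightarrow> real \<Rightarrow> (real \<times> real) set" where
  "square_ball D z r = {w \<in> unit_square. D z w < r}"

definition periodic_point :: "('a \<Rightarrow> 'a) \<Rightarrow> 'a \<Rightarrow> bool" where
  "periodic_point T z \<longleftrightarrow> (\<exists>p\<ge>1. (T ^^ p) z = z)"

definition minimal_period :: "('a \<Rightarrow> 'a) \<Rightarrow> 'a \<Rightarrow> nat \<Rightarrow> bool" where
  "minimal_period T z p \<longleftrightarrow> p \<ge> 1 \<and> (T ^^ p) z = z \<and> (\<forall>q. 1 \<le> q \<and> q < p \<longrightarrow> (T ^^ q) z \<noteq> z)"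


section \<open>Point processes on the half-line\<close>

definition half_line :: "real measure" where
  "half_line = restrict_space borel {0..}"

text \<open>The measure \<open>distr (count_space I) half_line x\<close> is \<open>\<Sum>i\<in>I. \<delta>\<^bsub>x i\<^esub>\<close>; points may be
  repeated. Counting measures are taken to be locally finite, as the vague topology requires.\<close>

definition counting_measures :: "real measure set" where
  "counting_measures =
     {distr (count_space I) half_line x | (I :: nat set) x.
        x \<in> I \<rightarrow> {0..} \<and> (\<forall>t. finite {i \<in> I. x i \<le> t})}"

text \<open>The \<open>\<sigma>\<close>-algebra generated by the evaluation maps \<open>\<nu> \<mapsto> \<nu>(A)\<close>.\<close>

definition counting_measure_space :: "real measure measure" where
  "counting_measure_space =
     sigma counting_measures
       {{\<nu> \<in> counting_measures. emeasure \<nu> A \<in> B} | A B. A \<in> sets half_line \<and> B \<in> sets borel}"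

text \<open>Continuous functions on \<open>[0,\<infinity>)\<close> with compact support in \<open>[0,\<infinity>)\<close>; they need not
  vanish at \<open>0\<close>, and their values on negative reals are irrelevant.\<close>

definition compactly_supported :: "(real \<Rightarrow> real) set" where
  "compactly_supported = {f. continuous_on {0..} f \<and> (\<exists>t. \<forall>x>t. f x = 0)}"

definition vague_topology :: "real measure topology" where
  "vague_topology =
     topology_generated_by
       {{\<nu> \<in> counting_measures. (\<integral>x. f x \<partial>\<nu>) \<in> U} | f U. f \<in> compactly_supported \<and> open U}"

definition point_process :: "'a measure \<Rightarrow> ('a \<Rightarrow> real measure) \<Rightarrow> bool" where
  "point_process M N \<longleftrightarrow> prob_space M \<and> N \<in> measurable M counting_measure_space"

definition converges_in_distribution ::
    "'a measure \<Rightarrow> (nat \<Rightarrow> 'a \<Rightarrow> real measure) \<Rightarrow> 'b measure \<Rightarrow> ('b \<Rightarrow> real measure) \<Rightarrow> bool" where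
  "converges_in_distribution M Ns M' N \<longleftrightarrow>
     (\<forall>n. point_process M (Ns n)) \<and> point_process M' N \<and>
     (\<forall>F. continuous_map vague_topology euclideanreal F \<and> bounded (F ` counting_measures) \<longrightarrow>
        (\<lambda>n. \<integral>\<nu>. F \<nu> \<partial>distr M counting_measure_space (Ns n))
          \<longlonglongrightarrow> (\<integral>\<nu>. F \<nu> \<partial>distr M' counting_measure_space N))"

definition poisson_process :: "'a measure \<Rightarrow> ('a \<Rightarrow> real measure) \<Rightarrow> real \<Rightarrow> bool" where
  "poisson_process M N \<tau> \<longleftrightarrow>
     \<tau> > 0 \<and> point_process M N \<and>
     (\<forall>(m::nat) (I :: nat \<Rightarrow> real set) (k :: nat \<Rightarrow> nat).
        (\<forall>l<m. I l \<in> sets half_line \<and> bounded (I l)) \<and> disjoint_family_on I {..<m} \<longrightarrow>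
        measure M {\<omega> \<in> space M. \<forall>l<m. emeasure (N \<omega>) (I l) = of_nat (k l)} =
          (\<Prod>l<m. exp (- \<tau> * measure lborel (I l)) * (\<tau> * measure lborel (I l)) ^ k l / fact (k l)))"

text \<open>The law of \<open>X\<^sub>1 + \<dots> + X\<^sub>K\<close>, where \<open>K\<close> is Poisson of parameter \<open>s\<close> and, given \<open>K = k\<close>,
  the list \<open>(X\<^sub>1, \<dots>, X\<^sub>k)\<close> is drawn i.i.d. from \<open>P\<close>, so that \<open>K\<close> and the \<open>X\<^sub>j\<close> are
  independent. The library's Poisson law is only supported for positive rates.\<close>

definition compound_poisson_pmf :: "real \<Rightarrow> nat pmf \<Rightarrow> nat pmf" where
  "compound_poisson_pmf s P =
     bind_pmf (if s = 0 then return_pmf 0 else poisson_pmf s)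
       (\<lambda>k. map_pmf sum_list (replicate_pmf k P))"

text \<open>The cluster size distribution is the sequence \<open>(\<rho> l)\<close> with \<open>l \<ge> 1\<close>; the value \<open>\<rho> 0\<close> is
  irrelevant. It is required to be a probability distribution on the positive integers, given
  by the pmf \<open>P\<close>.\<close>

definition compound_point_process ::
    "'a measure \<Rightarrow> ('a \<Rightarrow> real measure) \<Rightarrow> real \<Rightarrow> (nat \<Rightarrow> real) \<Rightarrow> bool" where
  "compound_point_process M N t \<rho> \<longleftrightarrow>
     t > 0 \<and> point_process M N \<and>
     (\<forall>(k::nat) (A :: nat \<Rightarrow> real set).
        (\<forall>i<k. A i \<in> sets half_line) \<and> disjoint_family_on A {..<k} \<longrightarrow>
        prob_space.indep_vars M (\<lambda>_. borel) (\<lambda>i \<omega>. emeasure (N \<omega>) (A i)) {..<k}) \<and>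
     (\<exists>P :: nat pmf. pmf P 0 = 0 \<and> (\<forall>l\<ge>1. pmf P l = \<rho> l) \<and>
        (\<forall>A\<in>sets half_line. emeasure lborel A < \<infinity> \<longrightarrow>
           (\<forall>k::nat. measure M {\<omega> \<in> space M. emeasure (N \<omega>) A = of_nat k} =
              pmf (compound_poisson_pmf (t * measure lborel A) P) k)))"

text \<open>The random measure \<open>J \<mapsto> \<Sum>l \<in> v J \<inter> \<nat>. 1\<^sub>B(T\<^sup>l x)\<close>. For \<open>v = 0\<close> this formula is not a
  measure in \<open>J\<close> unless it vanishes, and \<open>measure_of\<close> then yields the zero measure.\<close>

definition hit_process ::
    "('a \<Rightarrow> 'a) \<Rightarrow> 'a set \<Rightarrow> nat \<Rightarrow> 'a \<Rightarrow> real measure" where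
  "hit_process T B v x =
     measure_of {0..} (sets half_line)
       (\<lambda>J. \<Sum>l::nat. indicator ((\<lambda>s. real v * s) ` J) (real l) * indicator B ((T ^^ l) x))"

lemma hit_process_eq_distr:
  assumes "v > 0"
  shows "hit_process T B v x = distr (count_space {l. (T ^^ l) x \<in> B}) half_line (\<lambda>l. real l / real v)"
    (is "_ = ?D")
proof -
  have D: "sets ?D = sets half_line" "space ?D = {0..}"
    by (auto simp: half_line_def space_restrict_space)
  have meas: "(\<lambda>l. real l / real v) \<in> measurable (count_space {l. (T ^^ l) x \<in> B}) half_line"
    by (auto simp: half_line_def space_restrict_space)
  have "emeasure ?D J =
      (\<Sum>l::nat. indicator ((\<lambda>s. real v * s) ` J) (real l) * indicator B ((T ^^ l) x))"
    if J: "J \<in> sets half_line" for J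
  proof -
    have ind: "indicator ((\<lambda>s. real v * s) ` J) (real l) = (indicator J (real l / real v) :: ennreal)"
      for l :: nat
      using assms by (auto simp: indicator_def image_iff intro: bexI[of _ "real l / real v"])
    have "emeasure ?D J =
        emeasure (count_space {l. (T ^^ l) x \<in> B}) ((\<lambda>l. real l / real v) -` J \<inter> {l. (T ^^ l) x \<in> B})"
      using J meas by (simp add: emeasure_distr)
    also have "\<dots> = emeasure (count_space UNIV) ((\<lambda>l. real l / real v) -` J \<inter> {l. (T ^^ l) x \<in> B})"
      by (simp add: emeasure_count_space)
    also have "\<dots> = (\<integral>\<^sup>+ l. indicator ((\<lambda>l. real l / real v) -` J \<inter> {l. (T ^^ l) x \<in> B}) l
        \<partial>count_space UNIV)"
      by simp
    also have "\<dots> = (\<Sum>l::nat. indicator ((\<lambda>l. real l / real v) -` J \<inter> {l. (T ^^ l) x \<in> B}) l)"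
      by (rule nn_integral_count_space_nat)
    also have "\<dots> = (\<Sum>l::nat. indicator ((\<lambda>s. real v * s) ` J) (real l) * indicator B ((T ^^ l) x))"
      unfolding ind by (intro suminf_cong) (auto simp: indicator_def)
    finally show ?thesis .
  qed
  then have "hit_process T B v x = measure_of (space ?D) (sets ?D) (emeasure ?D)"
    unfolding hit_process_def D using sets.sigma_sets_eq[of half_line] sets.sets_into_space[of _ half_line]
    by (intro measure_of_eq) (auto simp: half_line_def space_restrict_space)
  then show ?thesis
    by (simp only: measure_of_of_measure)
qed

end

theory Submission
  imports Defs
begin

text \<open>The generating function of the numbers of hits of \<open>B\<^sub>n\<close> during consecutive blocks of times is an
  integral of a product of weights \<open>s\<close> at the hits, and it is computed by adding one time step in
  front. The step changes the integral by \<open>1 - s\<close> times the integral over \<open>B\<^sub>n\<close> of the remaining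
  weights. After a gap that is long compared with mixing but short compared with \<open>1 / \<mu>(B\<^sub>n)\<close> the
  position in \<open>B\<^sub>n\<close> is forgotten, and during the gap the only returns that matter are those forced by
  periodicity, namely to the nested sets of points that come back at the times \<open>p, 2p, \<dots>, i p\<close>, of
  measure \<open>q\<^sup>i \<mu>(B\<^sub>n)\<close> with \<open>q = 2\<^sup>-\<^sup>p\<close> (\<open>q = 0\<close> if \<open>z\<close> is not periodic). Hence each time step
  contributes a factor \<open>1 - (1 - s) (1 - q) / (1 - s q) \<mu>(B\<^sub>n)\<close>, and in the limit one obtains the
  generating function of the Poisson or the compound Poisson law. The points \<open>s = (1/2)\<^sup>a\<close> suffice to
  identify joint laws of counts, and a vaguely continuous bounded function of a counting measure
  lies between two functions of the counts in a grid that agree in the limit of fine grids.\<close>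

section \<open>Counting measures and the vague topology\<close>

text \<open>The weights behind a gap are products of arbitrarily many discontinuous factors. What
  controls them is that points of equal height on two leaves follow the same branches forever:
  leaves are compared in L1, and the discrepancies of the factors form a geometric series whose sum
  does not depend on their number. The errors left by a gap of g steps are exponentially small in g,
  but must be small relative to \<mu>(B_n). The local dimension supplies this: it gives r^4 \<le>
  \<mu>(B_n) for the radius r, so a gap of length about r^(-1/2) is long enough, while g r still
  tends to 0. In the maximum metric the returning points at a periodic point form rectangles over
  one common base, whose heights shrink by 2^p, so their masses are in exact geometric proportion;
  the returning points of a Euclidean disc have no such proportional heights. At a nonperiodic point
  short returns must be excluded, and the obstacle is that the orbit may pass through the
  discontinuity at y = 1/2; limits of orbit segments are therefore taken in the closure of the graph
  of T.\<close>

lemma space_half_line [simp]: "space half_line = {0..}"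
  by (simp add: half_line_def space_restrict_space)

lemma sets_half_line_iff: "A \<in> sets half_line \<longleftrightarrow> A \<in> sets borel \<and> A \<subseteq> {0..}"
  by (auto simp: half_line_def sets_restrict_space_iff)

lemma counting_measuresD:
  assumes "\<nu> \<in> counting_measures"
  shows sets_counting_measure: "sets \<nu> = sets half_line"
    and space_counting_measure: "space \<nu> = {0..}"
    and counting_measure_bounded:
      "\<And>A. A \<in> sets half_line \<Longrightarrow> bounded A \<Longrightarrow> \<exists>k::nat. emeasure \<nu> A = of_nat k"
proof -
  obtain I :: "nat set" and x where \<nu>: "\<nu> = distr (count_space I) half_line x"
    and x: "x \<in> I \<rightarrow> {0..}" and fin: "\<And>t. finite {i \<in> I. x i \<le> t}"
    using assms by (auto simp: counting_measures_def)
  show "sets \<nu> = sets half_line" "space \<nu> = {0..}"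
    by (simp_all add: \<nu>)
  show "\<exists>k::nat. emeasure \<nu> A = of_nat k" if A: "A \<in> sets half_line" "bounded A" for A
  proof -
    obtain t where "\<And>y. y \<in> A \<Longrightarrow> \<bar>y\<bar> \<le> t"
      using A(2) by (auto simp: bounded_iff)
    then have "x -` A \<inter> I \<subseteq> {i \<in> I. x i \<le> t}" by force
    then have "finite (x -` A \<inter> I)" using fin finite_subset by blast
    moreover have "emeasure \<nu> A = emeasure (count_space I) (x -` A \<inter> I)"
      unfolding \<nu> using A x by (subst emeasure_distr) auto
    ultimately show ?thesis by (auto simp: emeasure_count_space)
  qed
qed

lemma distr_count_space_counting_measure:
  fixes I :: "'i::countable set"
  assumes "x \<in> I \<rightarrow> {0..}" and "\<And>t. finite {i \<in> I. x i \<le> t}"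
  shows "distr (count_space I) half_line x \<in> counting_measures"
proof -
  let ?I = "to_nat ` I" and ?x = "x \<circ> from_nat"
  have "count_space ?I = distr (count_space I) (count_space ?I) to_nat"
    by (rule distr_bij_count_space[symmetric]) (simp add: bij_betw_def)
  then have "distr (count_space ?I) half_line ?x
      = distr (distr (count_space I) (count_space ?I) to_nat) half_line ?x"
    by simp
  also have "\<dots> = distr (count_space I) half_line (?x \<circ> to_nat)"
    using assms(1) by (intro distr_distr) (auto simp: measurable_def)
  finally have "distr (count_space I) half_line x = distr (count_space ?I) half_line ?x"
    by (simp add: comp_def)
  moreover have "finite {i \<in> ?I. ?x i \<le> t}" for t
    by (rule finite_subset[of _ "to_nat ` {i \<in> I. x i \<le> t}"]) (use assms(2) in auto)
  ultimately show ?thesis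
    using assms(1) by (auto simp: counting_measures_def intro!: exI[of _ ?I] exI[of _ ?x])
qed

lemma space_counting_measure_space [simp]: "space counting_measure_space = counting_measures"
  by (auto simp: counting_measure_space_def intro!: space_measure_of)

lemma measurable_emeasure_counting_measure_space [measurable]:
  assumes "A \<in> sets half_line"
  shows "(\<lambda>\<nu>. emeasure \<nu> A) \<in> borel_measurable counting_measure_space"
proof (rule measurableI)
  fix B :: "ennreal set" assume "B \<in> sets borel"
  then have "{\<nu> \<in> counting_measures. emeasure \<nu> A \<in> B} \<in> sets counting_measure_space"
    unfolding counting_measure_space_def using assms
    by (subst sets_measure_of) (auto intro: sigma_sets.Basic)
  then show "(\<lambda>\<nu>. emeasure \<nu> A) -` B \<inter> space counting_measure_space \<in> sets counting_measure_space"
    by (simp add: vimage_def Int_def conj_commute)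
qed auto

lemma measurable_counting_measure_spaceI:
  assumes "\<And>\<omega>. \<omega> \<in> space M \<Longrightarrow> N \<omega> \<in> counting_measures"
    and "\<And>A. A \<in> sets half_line \<Longrightarrow> (\<lambda>\<omega>. emeasure (N \<omega>) A) \<in> borel_measurable M"
  shows "N \<in> measurable M counting_measure_space"
  unfolding counting_measure_space_def
proof (rule measurable_measure_of)
  fix S assume "S \<in> {{\<nu> \<in> counting_measures. emeasure \<nu> A \<in> B} |A B. A \<in> sets half_line \<and> B \<in> sets borel}"
  then obtain A B where S: "S = {\<nu> \<in> counting_measures. emeasure \<nu> A \<in> B}"
    and "A \<in> sets half_line" "B \<in> sets borel" by auto
  then have "(\<lambda>\<omega>. emeasure (N \<omega>) A) -` B \<inter> space M \<in> sets M"
    using assms(2) by (intro measurable_sets) auto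
  also have "(\<lambda>\<omega>. emeasure (N \<omega>) A) -` B \<inter> space M = N -` S \<inter> space M"
    using assms(1) S by auto
  finally show "N -` S \<inter> space M \<in> sets M" .
qed (use assms(1) in auto)

section \<open>Counts in the cells of a grid and vague neighbourhoods\<close>

definition grid :: "nat \<Rightarrow> nat \<Rightarrow> real set" where
  "grid m j = {real j / real m ..< real (Suc j) / real m}"

text \<open>With \<open>m * m\<close> half-open cells of length \<open>1 / m\<close> one parameter
  refines the mesh and enlarges the window [0, m) at the same time. The floor only changes the type,
  since counting measures have natural values on cells; lists of naturals are a countable type, so
  laws of counts are discrete.\<close>

definition grid_counts :: "nat \<Rightarrow> real measure \<Rightarrow> nat list" where
  "grid_counts m \<nu> = map (\<lambda>j. nat \<lfloor>measure \<nu> (grid m j)\<rfloor>) [0..<m * m]"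

lemma grid_sets [measurable]: "grid m j \<in> sets half_line"
  by (auto simp: grid_def sets_half_line_iff intro: order_trans[rotated])

lemma bounded_grid: "bounded (grid m j)"
  by (simp add: grid_def)

lemma grid_iff: "m > 0 \<Longrightarrow> x \<ge> 0 \<Longrightarrow> x \<in> grid m j \<longleftrightarrow> j = nat \<lfloor>x * real m\<rfloor>"
  unfolding grid_def by (auto simp: field_simps) linarith+

lemma disjoint_grid: "disjoint_family_on (grid m) I"
  by (auto simp: disjoint_family_on_def grid_def divide_le_cancel divide_less_cancel)

lemma grid_counts_eqD:
  assumes "\<nu> \<in> counting_measures" "\<nu>' \<in> counting_measures" "grid_counts m \<nu>' = grid_counts m \<nu>"
    and "j < m * m"
  shows "measure \<nu>' (grid m j) = measure \<nu> (grid m j)"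
proof -
  have "real (nat \<lfloor>measure \<kappa> (grid m j)\<rfloor>) = measure \<kappa> (grid m j)" if "\<kappa> \<in> counting_measures" for \<kappa>
  proof -
    obtain k :: nat where "emeasure \<kappa> (grid m j) = of_nat k"
      using counting_measure_bounded[OF \<open>\<kappa> \<in> counting_measures\<close> grid_sets bounded_grid] by blast
    then show ?thesis by (simp add: measure_def)
  qed
  moreover have "nat \<lfloor>measure \<nu>' (grid m j)\<rfloor> = nat \<lfloor>measure \<nu> (grid m j)\<rfloor>"
    using assms(3,4) by (auto simp: grid_counts_def)
  ultimately show ?thesis using assms(1,2) by metis
qed

lemma finite_counting_measure:
  assumes "\<nu> \<in> counting_measures" "A \<in> sets half_line" "bounded A"
  shows "emeasure \<nu> A < \<infinity>"
  using counting_measure_bounded[OF assms] by (auto simp: of_nat_less_top)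

text \<open>On each cell \<open>f\<close> is its value at the left endpoint plus a deviation of at
  most \<eta>, and the deviations integrate to at most \<eta> times the mass of the cells. The value
  at \<open>real J / real m\<close> is a hypothesis of its own because this point may equal
  \<open>t\<close>.\<close>

lemma integral_step_approx:
  assumes \<kappa>: "\<kappa> \<in> counting_measures" and f: "continuous_on {0..} f" and t: "\<And>x. x > t \<Longrightarrow> f x = 0"
    and m: "m > 0" and J: "t \<le> real J / real m"
    and \<eta>: "\<And>j x. j < J \<Longrightarrow> x \<in> grid m j \<Longrightarrow> \<bar>f x - f (real j / real m)\<bar> \<le> \<eta>"
    and zero: "f (real J / real m) = 0"
  shows "\<bar>(\<integral>x. f x \<partial>\<kappa>) - (\<Sum>j<J. f (real j / real m) * measure \<kappa> (grid m j))\<bar>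
           \<le> \<eta> * (\<Sum>j<J. measure \<kappa> (grid m j))"
proof -
  have fm: "f \<in> borel_measurable \<kappa>"
    unfolding measurable_cong_sets[OF sets_counting_measure[OF \<kappa>] refl] half_line_def
    by (rule borel_measurable_continuous_on_restrict[OF f])
  have gs: "grid m j \<in> sets \<kappa>" for j
    by (simp add: sets_counting_measure[OF \<kappa>] grid_sets)
  have fin: "emeasure \<kappa> (grid m j) < \<infinity>" for j
    by (rule finite_counting_measure[OF \<kappa> grid_sets bounded_grid])
  have int1: "integrable \<kappa> (\<lambda>x. indicator (grid m j) x * (f x - f (real j / real m)))" if "j < J" for j
    by (rule integrableI_bounded_set[of "grid m j" _ _ \<eta>])
       (use gs fin fm \<eta>[OF that] in \<open>auto simp: indicator_def\<close>)
  have int2: "integrable \<kappa> (indicat_real (grid m j))" for j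
    using gs fin by (simp add: integrable_indicator_iff)
  have int3: "integrable \<kappa> (\<lambda>x. f (real j / real m) * indicat_real (grid m j) x)" for j
    using int2 by simp
  have eq: "f x = (\<Sum>j<J. indicator (grid m j) x * (f x - f (real j / real m))
      + f (real j / real m) * indicator (grid m j) x)"
    if "x \<in> space \<kappa>" for x
  proof -
    have x: "x \<ge> 0" using that space_counting_measure[OF \<kappa>] by auto
    have "(\<Sum>j<J. indicator (grid m j) x * (f x - f (real j / real m))
      + f (real j / real m) * indicator (grid m j) x) = (\<Sum>j<J. if j = nat \<lfloor>x * real m\<rfloor> then f x else 0)"
      by (intro sum.cong) (auto simp: grid_iff[OF m x] indicator_def)
    also have "\<dots> = (if nat \<lfloor>x * real m\<rfloor> < J then f x else 0)"
      by (simp add: sum.delta)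
    also have "\<dots> = f x"
    proof (cases "nat \<lfloor>x * real m\<rfloor> < J")
      case False
      then have "int J \<le> \<lfloor>x * real m\<rfloor>"
        using x m by (simp add: not_less le_nat_iff)
      then have "real J \<le> x * real m" by (simp add: le_floor_iff)
      then have "real J / real m \<le> x" using m by (simp add: pos_divide_le_eq)
      then have "x = real J / real m \<or> x > t" using J by linarith
      then show ?thesis using False t[of x] zero by auto
    qed simp
    finally show ?thesis by simp
  qed
  have "(\<integral>x. f x \<partial>\<kappa>) = (\<integral>x. (\<Sum>j<J. indicator (grid m j) x * (f x - f (real j / real m))
      + f (real j / real m) * indicator (grid m j) x) \<partial>\<kappa>)"
    by (rule Bochner_Integration.integral_cong[OF refl eq])
  also have "\<dots> = (\<Sum>j<J. (\<integral>x. indicator (grid m j) x * (f x - f (real j / real m)) \<partial>\<kappa>)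
      + f (real j / real m) * measure \<kappa> (grid m j))"
    using int1 int3 gs fin
    by (subst Bochner_Integration.integral_sum) (auto intro!: sum.cong Bochner_Integration.integrable_add
      simp: Bochner_Integration.integral_add measure_def sets.Int_space_eq2 less_top)
  finally have "(\<integral>x. f x \<partial>\<kappa>) - (\<Sum>j<J. f (real j / real m) * measure \<kappa> (grid m j))
      = (\<Sum>j<J. \<integral>x. indicator (grid m j) x * (f x - f (real j / real m)) \<partial>\<kappa>)"
    by (simp add: sum.distrib)
  also have "\<bar>\<dots>\<bar> \<le> (\<Sum>j<J. \<bar>\<integral>x. indicator (grid m j) x * (f x - f (real j / real m)) \<partial>\<kappa>\<bar>)"
    by (rule sum_abs)
  also have "\<dots> \<le> (\<Sum>j<J. \<eta> * measure \<kappa> (grid m j))"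
  proof (rule sum_mono)
    fix j assume "j \<in> {..<J}" then have j: "j < J" by simp
    have "\<bar>\<integral>x. indicator (grid m j) x * (f x - f (real j / real m)) \<partial>\<kappa>\<bar>
        \<le> (\<integral>x. \<bar>indicator (grid m j) x * (f x - f (real j / real m))\<bar> \<partial>\<kappa>)"
      by (rule integral_abs_bound)
    also have "\<dots> \<le> (\<integral>x. \<eta> * indicator (grid m j) x \<partial>\<kappa>)"
    proof (rule integral_mono)
      show "integrable \<kappa> (\<lambda>x. \<bar>indicator (grid m j) x * (f x - f (real j / real m))\<bar>)"
        by (rule integrable_abs[OF int1[OF j]])
      show "integrable \<kappa> (\<lambda>x. \<eta> * indicat_real (grid m j) x)"
        using int2 by simp
    qed (use \<eta>[OF j] in \<open>auto simp: indicator_def\<close>)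
    also have "\<dots> = \<eta> * measure \<kappa> (grid m j)"
      using gs by (simp add: sets.Int_space_eq2)
    finally show "\<bar>\<integral>x. indicator (grid m j) x * (f x - f (real j / real m)) \<partial>\<kappa>\<bar> \<le> \<dots>" .
  qed
  finally show ?thesis by (simp add: sum_distrib_left)
qed

text \<open>The step approximation depends on the cell masses alone, so measures with equal counts
  share it. Both errors are \<eta> times the mass of a fixed window; this mass is read off from
  \<open>\<nu>\<close>, which makes \<open>m0\<close> depend on \<open>\<nu>\<close> and not on
  \<open>\<nu>'\<close>.\<close>

lemma integral_close_of_grid_counts:
  assumes \<nu>: "\<nu> \<in> counting_measures" and f: "f \<in> compactly_supported" and \<epsilon>: "\<epsilon> > 0"
  shows "\<exists>m0. \<forall>m\<ge>m0. \<forall>\<nu>'\<in>counting_measures. grid_counts m \<nu>' = grid_counts m \<nu> \<longrightarrow>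
           \<bar>(\<integral>x. f x \<partial>\<nu>') - (\<integral>x. f x \<partial>\<nu>)\<bar> < \<epsilon>"
proof -
  obtain t0 where fc: "continuous_on {0..} f" and t0: "\<And>x. x > t0 \<Longrightarrow> f x = 0"
    using f by (auto simp: compactly_supported_def)
  define t where "t = max t0 0"
  have t: "t \<ge> 0" "\<And>x. x > t \<Longrightarrow> f x = 0" using t0 by (auto simp: t_def)
  define c where "c = measure \<nu> {0..t+1}"
  have c: "c \<ge> 0" by (simp add: c_def)
  \<comment> \<open>The two approximation errors together are at most 2 \<eta> (c + 1) = \<epsilon>
    / 2; the summand 1 covers c = 0.\<close>
  define \<eta> where "\<eta> = \<epsilon> / (4 * (c + 1))"
  have \<eta>: "\<eta> > 0" using \<epsilon> c by (simp add: \<eta>_def)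
  have "uniformly_continuous_on {0..t+1} f"
    by (rule compact_uniformly_continuous[OF continuous_on_subset[OF fc]]) auto
  then obtain \<delta> where \<delta>: "\<delta> > 0"
    "\<And>x y. x \<in> {0..t+1} \<Longrightarrow> y \<in> {0..t+1} \<Longrightarrow> dist y x < \<delta> \<Longrightarrow> dist (f y) (f x) < \<eta>"
    using \<eta> unfolding uniformly_continuous_on_def by metis
  \<comment> \<open>\<open>m \<ge> t + 2\<close> puts the \<open>J\<close> cells that cover [0, t]
    among the \<open>m * m\<close> cells of the grid, and 1 / m < \<delta> makes the oscillation of
    \<open>f\<close> on such a cell at most \<eta>.\<close>
  define m0 where "m0 = nat \<lceil>t + 2\<rceil> + nat \<lceil>1 / \<delta>\<rceil> + 1"
  have "\<bar>(\<integral>x. f x \<partial>\<nu>') - (\<integral>x. f x \<partial>\<nu>)\<bar> < \<epsilon>"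
    if m0: "m \<ge> m0" and \<nu>': "\<nu>' \<in> counting_measures" and eq: "grid_counts m \<nu>' = grid_counts m \<nu>" for m \<nu>'
  proof -
    have m: "m > 0" "real m \<ge> t + 2" "real m > 1 / \<delta>"
      using m0 unfolding m0_def by linarith+
    have m\<delta>: "1 / real m < \<delta>" using m \<delta>(1) by (simp add: field_simps)
    define J where "J = nat \<lfloor>t * real m\<rfloor> + 1"
    have J: "t < real J / real m" "real J \<le> t * real m + 1"
    proof -
      have "t * real m < real J" "real J \<le> t * real m + 1"
        using t(1) unfolding J_def by (simp_all add: of_nat_nat) linarith?
      then show "t < real J / real m" "real J \<le> t * real m + 1"
        using m(1) by (simp_all add: pos_less_divide_eq)
    qed
    have J1: "real J / real m \<le> t + 1"
    proof -
      have "real J \<le> (t + 1) * real m"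
        using J(2) m(1) by (simp add: distrib_right)
      then show ?thesis using m(1) by (simp add: pos_divide_le_eq)
    qed
    have "t * real m + 1 \<le> real m * real m"
    proof -
      have "t * real m + 1 \<le> t * real m + real m" using m(1) by simp
      also have "\<dots> = (t + 1) * real m" by (simp add: algebra_simps)
      also have "\<dots> \<le> real m * real m" using m by (intro mult_right_mono) auto
      finally show ?thesis .
    qed
    then have "real J \<le> real (m * m)" using J(2) by simp
    then have Jm: "J \<le> m * m" by linarith
    have osc: "\<bar>f x - f (real j / real m)\<bar> \<le> \<eta>" if "j < J" "x \<in> grid m j" for j x
    proof -
      have "real (Suc j) / real m \<le> real J / real m" using that(1) by (intro divide_right_mono) auto
      then have x: "real j / real m \<le> x" "x < real j / real m + 1 / real m" "x \<le> t + 1"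
        using that(2) J1 by (auto simp: grid_def add_divide_distrib)
      have "0 \<le> real j / real m" by simp
      then have "dist (f x) (f (real j / real m)) < \<eta>"
        using order_trans[OF _ x(1), of 0] x m\<delta> by (intro \<delta>(2)) (auto simp: dist_real_def)
      then show ?thesis by (simp add: dist_real_def)
    qed
    let ?S = "\<Sum>j<J. measure \<nu> (grid m j)"
    have meq: "measure \<nu>' (grid m j) = measure \<nu> (grid m j)" if "j < J" for j
      using grid_counts_eqD[OF \<nu> \<nu>' eq] that Jm by auto
    have "measure \<nu> (\<Union>j\<in>{..<J}. grid m j) = ?S"
    proof (rule measure_finite_Union)
      show "disjoint_family_on (grid m) {..<J}" by (rule disjoint_grid)
      show "grid m ` {..<J} \<subseteq> sets \<nu>"
        by (simp add: image_subset_iff sets_counting_measure[OF \<nu>] grid_sets)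
      show "emeasure \<nu> (grid m i) \<noteq> \<infinity>" if "i \<in> {..<J}" for i
        using finite_counting_measure[OF \<nu> grid_sets bounded_grid, of m i] by auto
    qed simp
    moreover have "measure \<nu> (\<Union>j\<in>{..<J}. grid m j) \<le> c"
      unfolding c_def
    proof (rule measure_mono_fmeasurable)
      show "(\<Union>j\<in>{..<J}. grid m j) \<subseteq> {0..t+1}"
      proof (safe, goal_cases)
        case (1 x j)
        have "real (Suc j) / real m \<le> real J / real m" using 1 by (intro divide_right_mono) auto
        moreover have "0 \<le> x"
          using 1 by (auto simp: grid_def intro: order_trans[of 0 "real j / real m"])
        ultimately show ?case using 1 J1 by (auto simp: grid_def)
      qed
      show "{0..t+1} \<in> fmeasurable \<nu>"
        using finite_counting_measure[OF \<nu>, of "{0..t+1}"] sets_counting_measure[OF \<nu>]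
        by (auto simp: fmeasurable_def sets_half_line_iff)
      show "(\<Union>j\<in>{..<J}. grid m j) \<in> sets \<nu>"
        unfolding sets_counting_measure[OF \<nu>] by (intro sets.finite_UN) (simp_all add: grid_sets)
    qed
    ultimately have Sc: "?S \<le> c" by simp
    have z: "f (real J / real m) = 0" using t(2) J(1) by simp
    have 1: "\<bar>(\<integral>x. f x \<partial>\<nu>) - (\<Sum>j<J. f (real j / real m) * measure \<nu> (grid m j))\<bar> \<le> \<eta> * ?S"
      by (rule integral_step_approx[OF \<nu> fc t(2) m(1) _ osc z]) (use J(1) in auto)
    have 2: "\<bar>(\<integral>x. f x \<partial>\<nu>') - (\<Sum>j<J. f (real j / real m) * measure \<nu>' (grid m j))\<bar>
        \<le> \<eta> * (\<Sum>j<J. measure \<nu>' (grid m j))"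
      by (rule integral_step_approx[OF \<nu>' fc t(2) m(1) _ osc z]) (use J(1) in auto)
    have "\<bar>(\<integral>x. f x \<partial>\<nu>') - (\<integral>x. f x \<partial>\<nu>)\<bar> \<le> 2 * (\<eta> * ?S)"
      using 1 2 by (simp add: meq)
    also have "\<dots> \<le> 2 * (\<eta> * c)" using Sc \<eta> by simp
    also have "\<dots> \<le> 2 * (\<eta> * (c + 1))" using \<eta> by simp
    also have "\<dots> = \<epsilon> / 2"
    proof -
      have "4 * (c + 1) \<noteq> 0" using c by simp
      then have "\<eta> * (4 * (c + 1)) = \<epsilon>" by (metis \<eta>_def nonzero_divide_eq_eq)
      then show ?thesis by (simp add: algebra_simps)
    qed
    also have "\<dots> < \<epsilon>" using \<epsilon> by simp
    finally show ?thesis .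
  qed
  then show ?thesis by blast
qed

lemma topspace_vague_topology [simp]: "topspace vague_topology = counting_measures"
proof -
  have "counting_measures = {\<nu> \<in> counting_measures. (\<integral>x. 0 \<partial>\<nu>) \<in> (UNIV::real set)}" by simp
  moreover have "(\<lambda>x. 0) \<in> compactly_supported" by (simp add: compactly_supported_def)
  ultimately have "counting_measures \<in> {{\<nu> \<in> counting_measures. (\<integral>x. f x \<partial>\<nu>) \<in> U} | f U.
      f \<in> compactly_supported \<and> open U}"
    using open_UNIV by blast
  then show ?thesis
    unfolding vague_topology_def topology_generated_by_topspace by blast
qed

text \<open>Sets of measures with prescribed grid counts shrink to the given measure: on the subbase
  this is the integral estimate, a finite intersection takes the larger threshold, and a union
  inherits the threshold of the member that contains the measure.\<close>

lemma vague_neighbourhood_grid_counts: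
  assumes "openin vague_topology U" "\<nu> \<in> U" "\<nu> \<in> counting_measures"
  shows "\<exists>m0. \<forall>m\<ge>m0. \<forall>\<nu>'\<in>counting_measures. grid_counts m \<nu>' = grid_counts m \<nu> \<longrightarrow> \<nu>' \<in> U"
proof -
  have "generate_topology_on {{\<nu> \<in> counting_measures. (\<integral>x. f x \<partial>\<nu>) \<in> U} | f U.
      f \<in> compactly_supported \<and> open U} U"
    using assms(1) unfolding vague_topology_def by (rule openin_topology_generated_by)
  then show ?thesis using assms(2)
  proof (induction rule: generate_topology_on.induct)
    case (Int a b)
    then obtain m1 m2 where "\<forall>m\<ge>m1. \<forall>\<nu>'\<in>counting_measures. grid_counts m \<nu>' = grid_counts m \<nu> \<longrightarrow> \<nu>' \<in> a"
      "\<forall>m\<ge>m2. \<forall>\<nu>'\<in>counting_measures. grid_counts m \<nu>' = grid_counts m \<nu> \<longrightarrow> \<nu>' \<in> b" by blast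
    then show ?case by (intro exI[of _ "max m1 m2"]) auto
  next
    case (UN K) then show ?case by (meson Union_iff)
  next
    case (Basis s)
    then obtain f V where s: "s = {\<nu> \<in> counting_measures. (\<integral>x. f x \<partial>\<nu>) \<in> V}"
      and f: "f \<in> compactly_supported" and V: "open V" by auto
    then have "(\<integral>x. f x \<partial>\<nu>) \<in> V" using Basis by auto
    then obtain \<epsilon> where "\<epsilon> > 0" "\<And>y. \<bar>y - (\<integral>x. f x \<partial>\<nu>)\<bar> < \<epsilon> \<Longrightarrow> y \<in> V"
      using V by (auto simp: open_dist dist_real_def)
    then show ?case using integral_close_of_grid_counts[OF assms(3) f, of \<epsilon>] unfolding s by blast
  qed simp
qed

section \<open>Convergence of discrete laws and of vaguely continuous functionals\<close>

lemma expectation_discrete_approx: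
  fixes Y :: "'a \<Rightarrow> 'c::countable" and g :: "'c \<Rightarrow> real"
  assumes "prob_space M" and Y: "Y \<in> measurable M (count_space UNIV)"
    and g: "\<And>l. \<bar>g l\<bar> \<le> C" and L: "finite L"
  shows "\<bar>(\<integral>\<omega>. g (Y \<omega>) \<partial>M) - (\<Sum>l\<in>L. g l * measure M {\<omega> \<in> space M. Y \<omega> = l})\<bar>
           \<le> C * (1 - (\<Sum>l\<in>L. measure M {\<omega> \<in> space M. Y \<omega> = l}))"
proof -
  interpret prob_space M by fact
  note Y[measurable]
  have int: "integrable M (\<lambda>\<omega>. h (Y \<omega>))" if "\<And>l. \<bar>h l\<bar> \<le> C" for h :: "'c \<Rightarrow> real" and C
    by (rule integrable_const_bound[of _ C]) (use that in auto)
  have gY: "integrable M (\<lambda>\<omega>. g (Y \<omega>))" using g by (rule int)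
  have ev: "{\<omega> \<in> space M. Y \<omega> = l} \<in> events" for l by measurable
  have ind: "integrable M (indicat_real {\<omega> \<in> space M. Y \<omega> = l})" for l
    using ev by (simp add: integrable_indicator_iff less_top[symmetric])
  have s: "(\<integral>\<omega>. (\<Sum>l\<in>L. k l * indicator {\<omega> \<in> space M. Y \<omega> = l} \<omega>) \<partial>M)
      = (\<Sum>l\<in>L. k l * measure M {\<omega> \<in> space M. Y \<omega> = l})" for k :: "'c \<Rightarrow> real"
    using ind ev by (subst Bochner_Integration.integral_sum) (auto simp: Int_absorb2 intro!: sum.cong)
  have si: "integrable M (\<lambda>\<omega>. (\<Sum>l\<in>L. k l * indicator {\<omega> \<in> space M. Y \<omega> = l} \<omega>))" for k :: "'c \<Rightarrow> real"
    using ind by auto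
  have sv: "(\<Sum>l\<in>L. k l * indicator {\<omega> \<in> space M. Y \<omega> = l} \<omega>) = (if Y \<omega> \<in> L then k (Y \<omega>) else 0)"
    if "\<omega> \<in> space M" for k :: "'c \<Rightarrow> real" and \<omega>
  proof -
    have "(\<Sum>l\<in>L. k l * indicator {\<omega> \<in> space M. Y \<omega> = l} \<omega>) = (\<Sum>l\<in>L. if l = Y \<omega> then k l else 0)"
      by (intro sum.cong) (auto simp: that)
    then show ?thesis using L by simp
  qed
  have "\<bar>(\<integral>\<omega>. g (Y \<omega>) \<partial>M) - (\<Sum>l\<in>L. g l * measure M {\<omega> \<in> space M. Y \<omega> = l})\<bar>
     = \<bar>\<integral>\<omega>. g (Y \<omega>) - (\<Sum>l\<in>L. g l * indicator {\<omega> \<in> space M. Y \<omega> = l} \<omega>) \<partial>M\<bar>"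
    using gY si by (simp add: s)
  also have "\<dots> \<le> (\<integral>\<omega>. \<bar>g (Y \<omega>) - (\<Sum>l\<in>L. g l * indicator {\<omega> \<in> space M. Y \<omega> = l} \<omega>)\<bar> \<partial>M)"
    by (rule integral_abs_bound)
  also have "\<dots> \<le> (\<integral>\<omega>. C * (1 - (\<Sum>l\<in>L. 1 * indicator {\<omega> \<in> space M. Y \<omega> = l} \<omega>)) \<partial>M)"
  proof (rule integral_mono)
    show "integrable M (\<lambda>\<omega>. \<bar>g (Y \<omega>) - (\<Sum>l\<in>L. g l * indicator {\<omega> \<in> space M. Y \<omega> = l} \<omega>)\<bar>)"
      using gY si by auto
    show "integrable M (\<lambda>\<omega>. C * (1 - (\<Sum>l\<in>L. 1 * indicator {\<omega> \<in> space M. Y \<omega> = l} \<omega>)))"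
      using si[of "\<lambda>_. 1"] by auto
  qed (unfold sv, use g in auto)
  also have "\<dots> = C * (1 - (\<Sum>l\<in>L. measure M {\<omega> \<in> space M. Y \<omega> = l}))"
    using si[of "\<lambda>_. 1"] s[of "\<lambda>_. 1"] by (simp add: prob_space)
  finally show ?thesis .
qed

text \<open>Convergence of the point masses suffices because the limit is again a probability law:
  almost all of its mass sits on a finite set, hence eventually so does that of \<open>Y n\<close>,
  and no mass escapes.\<close>

lemma expectation_discrete_tendsto:
  fixes Y :: "nat \<Rightarrow> 'a \<Rightarrow> 'c::countable" and Y' :: "'b \<Rightarrow> 'c" and g :: "'c \<Rightarrow> real"
  assumes M: "prob_space M" "\<And>n. Y n \<in> measurable M (count_space UNIV)"
    and M': "prob_space M'" "Y' \<in> measurable M' (count_space UNIV)"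
    and g: "\<And>l. \<bar>g l\<bar> \<le> C"
    and conv: "\<And>l. (\<lambda>n. measure M {\<omega> \<in> space M. Y n \<omega> = l}) \<longlonglongrightarrow> measure M' {\<omega> \<in> space M'. Y' \<omega> = l}"
  shows "(\<lambda>n. \<integral>\<omega>. g (Y n \<omega>) \<partial>M) \<longlonglongrightarrow> (\<integral>\<omega>. g (Y' \<omega>) \<partial>M')"
proof (rule tendstoI)
  fix \<epsilon> :: real assume \<epsilon>: "\<epsilon> > 0"
  interpret M': prob_space M' by fact
  note M'(2)[measurable]
  have C: "C \<ge> 0" using g[of undefined] by linarith
  let ?P = "\<lambda>n l. measure M {\<omega> \<in> space M. Y n \<omega> = l}" and ?P' = "\<lambda>l. measure M' {\<omega> \<in> space M'. Y' \<omega> = l}"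
  have "(\<lambda>k. measure M' {\<omega> \<in> space M'. to_nat (Y' \<omega>) < k}) \<longlonglongrightarrow> measure M' (\<Union>k. {\<omega> \<in> space M'. to_nat (Y' \<omega>) < k})"
    by (rule M'.finite_Lim_measure_incseq) (auto simp: incseq_def)
  also have "(\<Union>k. {\<omega> \<in> space M'. to_nat (Y' \<omega>) < k}) = space M'" by auto
  finally have "(\<lambda>k. measure M' {\<omega> \<in> space M'. to_nat (Y' \<omega>) < k}) \<longlonglongrightarrow> 1" by (simp add: M'.prob_space)
  moreover have "1 - \<epsilon> / (4 * (C + 1)) < 1" using \<epsilon> C by simp
  ultimately have "eventually (\<lambda>k. 1 - \<epsilon> / (4 * (C + 1)) < measure M' {\<omega> \<in> space M'. to_nat (Y' \<omega>) < k}) sequentially"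
    by (rule order_tendstoD)
  then obtain k where k: "1 - \<epsilon> / (4 * (C + 1)) < measure M' {\<omega> \<in> space M'. to_nat (Y' \<omega>) < k}"
    by (auto simp: eventually_sequentially)
  \<comment> \<open>An initial segment of an enumeration of the countable type, carrying all but
    \<epsilon> / (4 (C + 1)) of the limit mass.\<close>
  define L where "L = {l :: 'c. to_nat l < k}"
  have L: "finite L" unfolding L_def
    by (rule finite_imageD[of to_nat]) (auto intro: finite_subset[of _ "{..<k}"])
  have "{\<omega> \<in> space M'. to_nat (Y' \<omega>) < k} = (\<Union>l\<in>L. {\<omega> \<in> space M'. Y' \<omega> = l})"
    by (auto simp: L_def)
  then have "measure M' {\<omega> \<in> space M'. to_nat (Y' \<omega>) < k} = (\<Sum>l\<in>L. ?P' l)"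
    using L by (simp, subst M'.finite_measure_finite_Union) (auto simp: disjoint_family_on_def)
  with k have sL: "C * (1 - (\<Sum>l\<in>L. ?P' l)) < \<epsilon> / 4"
  proof -
    have "C * (1 - (\<Sum>l\<in>L. ?P' l)) \<le> C * (\<epsilon> / (4 * (C + 1)))"
      using k C \<open>measure M' _ = _\<close> by (intro mult_left_mono) auto
    also have "\<dots> < \<epsilon> / 4" using C \<epsilon> by (simp add: field_simps)
    finally show ?thesis .
  qed
  have "(\<lambda>n. C * (1 - (\<Sum>l\<in>L. ?P n l))) \<longlonglongrightarrow> C * (1 - (\<Sum>l\<in>L. ?P' l))"
    by (intro tendsto_intros conv)
  then have e1: "eventually (\<lambda>n. C * (1 - (\<Sum>l\<in>L. ?P n l)) < \<epsilon> / 4) sequentially"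
    using sL by (rule order_tendstoD)
  have "(\<lambda>n. \<Sum>l\<in>L. g l * ?P n l) \<longlonglongrightarrow> (\<Sum>l\<in>L. g l * ?P' l)"
    by (intro tendsto_intros conv)
  then have e2: "eventually (\<lambda>n. dist (\<Sum>l\<in>L. g l * ?P n l) (\<Sum>l\<in>L. g l * ?P' l) < \<epsilon> / 4) sequentially"
    by (rule tendstoD) (use \<epsilon> in simp)
  show "eventually (\<lambda>n. dist (\<integral>\<omega>. g (Y n \<omega>) \<partial>M) (\<integral>\<omega>. g (Y' \<omega>) \<partial>M') < \<epsilon>) sequentially"
    using e1 e2
  proof eventually_elim
    case (elim n)
    then show ?case
      using expectation_discrete_approx[where g = g, OF M(1) M(2)[of n] g L]
        expectation_discrete_approx[where g = g, OF M'(1) M'(2) g L] sL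
      unfolding dist_real_def by linarith
  qed
qed

text \<open>\<open>F\<close> lies between the infimum and the supremum of its values over all
  measures with the same grid counts. Both envelopes are functions of discrete counts, whose
  expectations converge for fixed \<open>m\<close>, and both tend to \<open>F\<close> as
  \<open>m\<close> grows. The mesh \<open>m\<close> is chosen from the limit process before
  \<open>n\<close> is sent to infinity.\<close>

lemma converges_in_distribution_gridI:
  assumes N: "\<And>n. point_process M (Ns n)" and N': "point_process M' N'"
    and conv: "\<And>m l. m > 0 \<Longrightarrow> (\<lambda>n. measure M {\<omega> \<in> space M. grid_counts m (Ns n \<omega>) = l})
        \<longlonglongrightarrow> measure M' {\<omega> \<in> space M'. grid_counts m (N' \<omega>) = l}"
  shows "converges_in_distribution M Ns M' N'"
  unfolding converges_in_distribution_def
proof (intro conjI allI impI N N')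
  fix F :: "real measure \<Rightarrow> real"
  assume "continuous_map vague_topology euclideanreal F \<and> bounded (F ` counting_measures)"
  then have F: "continuous_map vague_topology euclideanreal F" and bF: "bounded (F ` counting_measures)" by auto
  obtain C where C: "\<And>\<nu>. \<nu> \<in> counting_measures \<Longrightarrow> \<bar>F \<nu>\<bar> \<le> C"
    using bF by (auto simp: bounded_iff)
  interpret M: prob_space M using N by (auto simp: point_process_def)
  interpret M': prob_space M' using N' by (auto simp: point_process_def)
  have mN[measurable]: "Ns n \<in> measurable M counting_measure_space" for n
    using N by (auto simp: point_process_def)
  have mN'[measurable]: "N' \<in> measurable M' counting_measure_space"
    using N' by (auto simp: point_process_def)
  have gc_meas[measurable]: "grid_counts m \<in> measurable counting_measure_space (count_space UNIV)" for m
  proof -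
    have nm: "(\<lambda>\<nu>. nat \<lfloor>measure \<nu> (grid m j)\<rfloor>) \<in> measurable counting_measure_space (count_space UNIV)" for j
      unfolding measure_def by measurable
    have "(\<lambda>\<nu>. map (\<lambda>j. nat \<lfloor>measure \<nu> (grid m j)\<rfloor>) xs) \<in> measurable counting_measure_space (count_space UNIV)"
      for xs
    proof (induction xs)
      case (Cons j xs)
      have "(\<lambda>\<nu>. nat \<lfloor>measure \<nu> (grid m j)\<rfloor> # map (\<lambda>j. nat \<lfloor>measure \<nu> (grid m j)\<rfloor>) xs)
        \<in> measurable counting_measure_space (count_space UNIV)"
        by (rule measurable_compose_countable[OF _ nm[of j], where f = "\<lambda>k \<nu>. k # map (\<lambda>j. nat \<lfloor>measure \<nu> (grid m j)\<rfloor>) xs"])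
           (rule measurable_compose[OF Cons], simp)
      then show ?case by simp
    qed simp
    then show ?thesis by (simp add: grid_counts_def[abs_def])
  qed
  define cyl where "cyl m l = {\<nu> \<in> counting_measures. grid_counts m \<nu> = l}" for m l
  \<comment> \<open>The value 0 on impossible count lists keeps both envelopes bounded by
    \<open>C\<close>.\<close>
  define up where "up m l = (if cyl m l = {} then 0 else Sup (F ` cyl m l))" for m l
  define lo where "lo m l = (if cyl m l = {} then 0 else Inf (F ` cyl m l))" for m l
  have C0: "C \<ge> 0" using C[of "N' undefined"] M'.not_empty mN'[THEN measurable_space] C
    by (metis abs_ge_zero ex_in_conv order_trans space_counting_measure_space)
  have bd: "bdd_above (F ` cyl m l)" "bdd_below (F ` cyl m l)" for m l
    by (rule bdd_aboveI[of _ C] bdd_belowI[of _ "-C"]; use C in \<open>force simp: cyl_def abs_le_iff\<close>)+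
  have upC: "\<bar>up m l\<bar> \<le> C" for m l
  proof (cases "cyl m l = {}")
    case False
    then obtain \<nu> where \<nu>: "\<nu> \<in> cyl m l" by auto
    have "Sup (F ` cyl m l) \<le> C" using False C by (intro cSUP_least) (auto simp: cyl_def abs_le_iff)
    moreover have "F \<nu> \<le> Sup (F ` cyl m l)" using \<nu> bd by (intro cSUP_upper)
    moreover have "F \<nu> \<ge> - C" using \<nu> C[of \<nu>] by (auto simp: cyl_def)
    ultimately show ?thesis using False by (auto simp: up_def)
  qed (simp add: up_def C0)
  have loC: "\<bar>lo m l\<bar> \<le> C" for m l
  proof (cases "cyl m l = {}")
    case False
    then obtain \<nu> where \<nu>: "\<nu> \<in> cyl m l" by auto
    have "Inf (F ` cyl m l) \<ge> -C" using False C by (intro cINF_greatest) (auto simp: cyl_def abs_le_iff minus_le_iff)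
    moreover have "F \<nu> \<ge> Inf (F ` cyl m l)" using \<nu> bd by (intro cINF_lower)
    moreover have "F \<nu> \<le> C" using \<nu> C[of \<nu>] by (auto simp: cyl_def)
    ultimately show ?thesis using False by (auto simp: lo_def)
  qed (simp add: lo_def C0)
  have sandwich: "lo m (grid_counts m \<nu>) \<le> F \<nu>" "F \<nu> \<le> up m (grid_counts m \<nu>)" if "\<nu> \<in> counting_measures" for m \<nu>
  proof -
    have "\<nu> \<in> cyl m (grid_counts m \<nu>)" using that by (simp add: cyl_def)
    then show "lo m (grid_counts m \<nu>) \<le> F \<nu>" "F \<nu> \<le> up m (grid_counts m \<nu>)"
      using bd by (auto simp: lo_def up_def intro!: cINF_lower cSUP_upper)
  qed
  have lim: "(\<lambda>m. up m (grid_counts m \<nu>)) \<longlonglongrightarrow> F \<nu>" "(\<lambda>m. lo m (grid_counts m \<nu>)) \<longlonglongrightarrow> F \<nu>"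
    if \<nu>: "\<nu> \<in> counting_measures" for \<nu>
  proof -
    have ev: "\<exists>m0. \<forall>m\<ge>m0. \<forall>\<nu>'\<in>cyl m (grid_counts m \<nu>). \<bar>F \<nu>' - F \<nu>\<bar> < \<epsilon>" if "\<epsilon> > 0" for \<epsilon>
    proof -
      have "openin vague_topology {\<nu>' \<in> topspace vague_topology. F \<nu>' \<in> ball (F \<nu>) \<epsilon>}"
        using F by (rule openin_continuous_map_preimage) auto
      from vague_neighbourhood_grid_counts[OF this _ \<nu>] \<nu> that show ?thesis
        by (simp add: cyl_def dist_real_def abs_minus_commute Ball_def) blast
    qed
    have ne: "\<nu> \<in> cyl m (grid_counts m \<nu>)" for m using \<nu> by (simp add: cyl_def)
    have cl: "\<exists>m0. \<forall>m\<ge>m0. \<bar>up m (grid_counts m \<nu>) - F \<nu>\<bar> < \<epsilon> \<and> \<bar>lo m (grid_counts m \<nu>) - F \<nu>\<bar> < \<epsilon>"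
      if "\<epsilon> > 0" for \<epsilon>
    proof -
      obtain m0 where m0: "\<And>m \<nu>'. m \<ge> m0 \<Longrightarrow> \<nu>' \<in> cyl m (grid_counts m \<nu>) \<Longrightarrow> \<bar>F \<nu>' - F \<nu>\<bar> < \<epsilon>/2"
        using ev[of "\<epsilon>/2"] \<open>\<epsilon> > 0\<close> by auto
      have "\<bar>up m (grid_counts m \<nu>) - F \<nu>\<bar> < \<epsilon> \<and> \<bar>lo m (grid_counts m \<nu>) - F \<nu>\<bar> < \<epsilon>" if "m \<ge> m0" for m
      proof -
        have "Sup (F ` cyl m (grid_counts m \<nu>)) \<le> F \<nu> + \<epsilon>/2"
        proof (intro cSUP_least)
          show "F x \<le> F \<nu> + \<epsilon>/2" if "x \<in> cyl m (grid_counts m \<nu>)" for x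
            using m0[OF \<open>m \<ge> m0\<close> that] by linarith
        qed (use ne[of m] in auto)
        moreover have "Inf (F ` cyl m (grid_counts m \<nu>)) \<ge> F \<nu> - \<epsilon>/2"
        proof (intro cINF_greatest)
          show "F \<nu> - \<epsilon>/2 \<le> F x" if "x \<in> cyl m (grid_counts m \<nu>)" for x
            using m0[OF \<open>m \<ge> m0\<close> that] by linarith
        qed (use ne[of m] in auto)
        ultimately show ?thesis using sandwich[OF \<nu>, of m] ne[of m] \<open>\<epsilon> > 0\<close>
          by (auto simp: up_def lo_def)
      qed
      then show ?thesis by blast
    qed
    show "(\<lambda>m. up m (grid_counts m \<nu>)) \<longlonglongrightarrow> F \<nu>" "(\<lambda>m. lo m (grid_counts m \<nu>)) \<longlonglongrightarrow> F \<nu>"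
      using cl by (auto simp: LIMSEQ_iff) blast+
  qed
  \<comment> \<open>Continuity refers to the vague topology, measurability to the evaluation maps;
    the link is that \<open>F\<close> is a pointwise limit of functions of the grid counts.\<close>
  have Fm[measurable]: "F \<in> borel_measurable counting_measure_space"
    by (rule borel_measurable_LIMSEQ_real[OF lim(1)]) auto
  have iF: "integrable M (\<lambda>\<omega>. F (Ns n \<omega>))" for n
    by (rule M.integrable_const_bound[of _ C])
       (use C measurable_space[OF mN] in \<open>auto intro!: AE_I2\<close>)
  have iG: "integrable M (\<lambda>\<omega>. G (grid_counts m (Ns n \<omega>)))" if "\<And>l. \<bar>G l\<bar> \<le> C" for G :: "nat list \<Rightarrow> real" and m n
    by (rule M.integrable_const_bound[of _ C]) (use that in auto)
  have b1: "(\<integral>\<omega>. F (Ns n \<omega>) \<partial>M) \<le> (\<integral>\<omega>. up m (grid_counts m (Ns n \<omega>)) \<partial>M)"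
    "(\<integral>\<omega>. F (Ns n \<omega>) \<partial>M) \<ge> (\<integral>\<omega>. lo m (grid_counts m (Ns n \<omega>)) \<partial>M)" for m n
    by (rule integral_mono[OF iF iG[OF upC]] integral_mono[OF iG[OF loC] iF],
        use sandwich measurable_space[OF mN] in auto)+
  have b2: "(\<lambda>m. \<integral>\<omega>. G m (grid_counts m (N' \<omega>)) \<partial>M') \<longlonglongrightarrow> (\<integral>\<omega>. F (N' \<omega>) \<partial>M')"
    if "\<And>m l. \<bar>G m l\<bar> \<le> C" "\<And>\<nu>. \<nu> \<in> counting_measures \<Longrightarrow> (\<lambda>m. G m (grid_counts m \<nu>)) \<longlonglongrightarrow> F \<nu>"
    for G :: "nat \<Rightarrow> nat list \<Rightarrow> real"
    by (rule integral_dominated_convergence[where w = "\<lambda>_. C"])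
       (use that measurable_space[OF mN'] in \<open>auto intro!: AE_I2\<close>)
  have b3: "(\<lambda>n. \<integral>\<omega>. G (grid_counts m (Ns n \<omega>)) \<partial>M) \<longlonglongrightarrow> (\<integral>\<omega>. G (grid_counts m (N' \<omega>)) \<partial>M')"
    if "\<And>l. \<bar>G l\<bar> \<le> C" "m > 0" for G :: "nat list \<Rightarrow> real" and m
    by (rule expectation_discrete_tendsto[where C = C, OF M.prob_space_axioms _ M'.prob_space_axioms])
       (use that conv in auto)
  have "(\<lambda>n. \<integral>\<omega>. F (Ns n \<omega>) \<partial>M) \<longlonglongrightarrow> (\<integral>\<omega>. F (N' \<omega>) \<partial>M')"
  proof (rule tendstoI)
    fix \<epsilon> :: real assume \<epsilon>: "\<epsilon> > 0"
    have "eventually (\<lambda>m. dist (\<integral>\<omega>. up m (grid_counts m (N' \<omega>)) \<partial>M') (\<integral>\<omega>. F (N' \<omega>) \<partial>M') < \<epsilon>/2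
       \<and> dist (\<integral>\<omega>. lo m (grid_counts m (N' \<omega>)) \<partial>M') (\<integral>\<omega>. F (N' \<omega>) \<partial>M') < \<epsilon>/2 \<and> m > 0) sequentially"
      using tendstoD[OF b2[OF upC lim(1)], of "\<epsilon>/2"] tendstoD[OF b2[OF loC lim(2)], of "\<epsilon>/2"] \<epsilon> eventually_gt_at_top[of 0]
      by (auto elim!: eventually_elim2 simp: eventually_conj_iff)
    then obtain m where m: "m > 0"
      "dist (\<integral>\<omega>. up m (grid_counts m (N' \<omega>)) \<partial>M') (\<integral>\<omega>. F (N' \<omega>) \<partial>M') < \<epsilon>/2"
      "dist (\<integral>\<omega>. lo m (grid_counts m (N' \<omega>)) \<partial>M') (\<integral>\<omega>. F (N' \<omega>) \<partial>M') < \<epsilon>/2"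
      by (auto simp: eventually_sequentially)
    from tendstoD[OF b3[of "up m", OF upC m(1)], of "\<epsilon>/2"] tendstoD[OF b3[of "lo m", OF loC m(1)], of "\<epsilon>/2"]
    have "eventually (\<lambda>n. dist (\<integral>\<omega>. up m (grid_counts m (Ns n \<omega>)) \<partial>M) (\<integral>\<omega>. up m (grid_counts m (N' \<omega>)) \<partial>M') < \<epsilon>/2
      \<and> dist (\<integral>\<omega>. lo m (grid_counts m (Ns n \<omega>)) \<partial>M) (\<integral>\<omega>. lo m (grid_counts m (N' \<omega>)) \<partial>M') < \<epsilon>/2) sequentially"
      using \<epsilon> by (simp add: eventually_conj_iff)
    then show "eventually (\<lambda>n. dist (\<integral>\<omega>. F (Ns n \<omega>) \<partial>M) (\<integral>\<omega>. F (N' \<omega>) \<partial>M') < \<epsilon>) sequentially"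
    proof eventually_elim
      case (elim n)
      then show ?case using b1(1)[of n m] b1(2)[of m n] m(2,3) unfolding dist_real_def by linarith
    qed
  qed
  then show "(\<lambda>n. \<integral>\<nu>. F \<nu> \<partial>distr M counting_measure_space (Ns n))
       \<longlonglongrightarrow> (\<integral>\<nu>. F \<nu> \<partial>distr M' counting_measure_space N')"
    by (simp add: integral_distr)
qed

section \<open>Generating functions and joint laws\<close>

text \<open>The numbers (1/2)^n accumulate only at 0, so for finite \<open>S\<close> some continuous
  function on [0,1] takes the values of the indicator there. A polynomial close to it
  (Stone-Weierstrass), evaluated at (1/2)^n, is a combination of the powers (1/2)^(i n).\<close>

lemma indicator_approx_half_powers:
  fixes S :: "nat set"
  assumes "finite S" and \<epsilon>: "\<epsilon> > 0"
  shows "\<exists>c K. \<forall>n. \<bar>indicator S n - (\<Sum>i\<le>K. c i * (1/2::real) ^ (i * n))\<bar> < \<epsilon>"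
proof -
  \<comment> \<open>A tent of height 1 at (1/2)^g that reaches 0 at distance (1/2)^(g + 1), which is
    the distance to the nearest other power.\<close>
  define h :: "nat \<Rightarrow> real \<Rightarrow> real" where "h g x = max 0 (1 - \<bar>x - (1/2)^g\<bar> * 2^(g+1))" for g x
  have h: "h g ((1/2)^n) = (if n = g then 1 else 0)" for g n
  proof (cases n g rule: linorder_cases)
    case less
    then have "(1/2::real)^n \<ge> (1/2)^g * 2"
      using power_decreasing[of n "g - 1" "1/2::real"] by (cases g) auto
    then have "\<bar>(1/2)^n - (1/2)^g\<bar> \<ge> (1/2::real)^g" by linarith
    then have "\<bar>(1/2)^n - (1/2)^g\<bar> * 2^(g+1) \<ge> (1/2::real)^g * 2^(g+1)" by (intro mult_right_mono) auto
    then show ?thesis using less by (simp add: h_def power_one_over)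
  next
    case greater
    then have "(1/2::real)^n \<le> (1/2)^g / 2"
      using power_decreasing[of "Suc g" n "1/2::real"] by auto
    then have "\<bar>(1/2)^n - (1/2)^g\<bar> \<ge> (1/2::real)^g / 2" by linarith
    then have "\<bar>(1/2)^n - (1/2)^g\<bar> * 2^(g+1) \<ge> (1/2::real)^g / 2 * 2^(g+1)" by (intro mult_right_mono) auto
    then show ?thesis using greater by (simp add: h_def power_one_over)
  qed (simp add: h_def)
  define H where "H x = (\<Sum>g\<in>S. h g x)" for x
  have H: "H ((1/2)^n) = indicator S n" for n
    using assms(1) by (simp add: H_def h indicator_def)
  have "continuous_on {0..1} H" unfolding H_def h_def by (intro continuous_intros)
  then obtain q where q: "real_polynomial_function q" "\<And>x. x \<in> {0..1} \<Longrightarrow> \<bar>H x - q x\<bar> < \<epsilon>"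
    using Stone_Weierstrass_real_polynomial_function[of "{0..1}" H \<epsilon>] \<epsilon> by auto
  obtain c K where c: "q = (\<lambda>x. \<Sum>i\<le>K. c i * x ^ i)"
    using q(1) unfolding real_polynomial_function_iff_sum by blast
  have "\<bar>indicator S n - (\<Sum>i\<le>K. c i * (1/2::real) ^ (i * n))\<bar> < \<epsilon>" for n
    using q(2)[of "(1/2)^n"] by (simp add: H c power_mult[symmetric] mult.commute power_le_one)
  then show ?thesis by blast
qed

lemma abs_mult_diff_le: "\<bar>X * Y - x * y\<bar> \<le> \<bar>X - x\<bar> * \<bar>Y\<bar> + \<bar>x\<bar> * \<bar>Y - y\<bar>" for X Y x y :: real
proof -
  have "X * Y - x * y = (X - x) * Y + x * (Y - y)" by (simp add: algebra_simps)
  then show ?thesis using abs_triangle_ineq[of "(X - x) * Y" "x * (Y - y)"] by (simp add: abs_mult)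
qed

text \<open>Combinations of such powers are closed under multiplication, so the coordinates are
  added one at a time.\<close>

lemma prod_indicator_approx_half_powers:
  fixes S :: "'j \<Rightarrow> nat set"
  assumes "finite J" and "\<And>j. j \<in> J \<Longrightarrow> finite (S j)" and "\<epsilon> > 0"
  shows "\<exists>(K::nat) c (a :: nat \<Rightarrow> 'j \<Rightarrow> nat).
    \<forall>n. \<bar>(\<Prod>j\<in>J. indicator (S j) (n j)) - (\<Sum>i<K. c i * (\<Prod>j\<in>J. (1/2::real) ^ (a i j * n j)))\<bar> < \<epsilon>"
  using assms
proof (induction J arbitrary: \<epsilon> rule: finite_induct)
  case empty
  then show ?case by (intro exI[of _ 1] exI[of _ "\<lambda>_. 1"]) auto
next
  case (insert j J)
  obtain c1 :: "nat \<Rightarrow> real" and K1 where 1: "\<And>n. \<bar>indicator (S j) n - (\<Sum>i\<le>K1. c1 i * (1/2::real) ^ (i * n))\<bar> < \<epsilon> / 2"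
    using indicator_approx_half_powers[of "S j" "\<epsilon>/2"] insert.prems by auto
  \<comment> \<open>Bounds the first approximant for all \<open>n\<close>, since the powers are at
    most 1; the accuracy asked of the second factor is divided by \<open>C + 1\<close>.\<close>
  define C where "C = (\<Sum>i\<le>K1. \<bar>c1 i\<bar>)"
  have C: "C \<ge> 0" by (simp add: C_def sum_nonneg)
  have Cb: "\<bar>\<Sum>i\<le>K1. c1 i * (1/2::real) ^ (i * n)\<bar> \<le> C" for n
  proof -
    have "\<bar>\<Sum>i\<le>K1. c1 i * (1/2::real) ^ (i * n)\<bar> \<le> (\<Sum>i\<le>K1. \<bar>c1 i * (1/2::real) ^ (i * n)\<bar>)" by (rule sum_abs)
    also have "\<dots> \<le> C" unfolding C_def
      by (intro sum_mono) (auto simp: abs_mult power_le_one intro!: mult_left_le)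
    finally show ?thesis .
  qed
  have "\<epsilon> / (2 * (C + 1)) > 0" using C insert.prems by simp
  then have "\<exists>(K2::nat) c2 (a2 :: nat \<Rightarrow> 'j \<Rightarrow> nat). \<forall>n. \<bar>(\<Prod>j\<in>J. indicator (S j) (n j))
      - (\<Sum>i<K2. c2 i * (\<Prod>j\<in>J. (1/2::real) ^ (a2 i j * n j)))\<bar> < \<epsilon> / (2 * (C + 1))"
    by (intro insert.IH insert.prems) auto
  then obtain K2 :: nat and c2 and a2 :: "nat \<Rightarrow> 'j \<Rightarrow> nat" where 2: "\<And>n. \<bar>(\<Prod>j\<in>J. indicator (S j) (n j)) - (\<Sum>i<K2. c2 i * (\<Prod>j\<in>J. (1/2::real) ^ (a2 i j * n j)))\<bar> < \<epsilon> / (2 * (C + 1))"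
    by blast
  \<comment> \<open>The double sum over (p, q) is written as a single sum over m = p * K2 +
    q.\<close>
  define K where "K = Suc K1 * K2"
  define c where "c m = c1 (m div K2) * c2 (m mod K2)" for m
  define a where "a m i = (if i = j then m div K2 else a2 (m mod K2) i)" for m i
  have "\<bar>(\<Prod>i\<in>insert j J. indicator (S i) (n i)) - (\<Sum>m<K. c m * (\<Prod>i\<in>insert j J. (1/2::real) ^ (a m i * n i)))\<bar> < \<epsilon>" for n
  proof -
    let ?X = "indicator (S j) (n j) :: real" and ?x = "\<Sum>i\<le>K1. c1 i * (1/2::real) ^ (i * n j)"
    let ?Y = "(\<Prod>i\<in>J. indicator (S i) (n i)) :: real" and ?y = "\<Sum>i<K2. c2 i * (\<Prod>j\<in>J. (1/2::real) ^ (a2 i j * n j))"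
    have "(\<Sum>m<K. c m * (\<Prod>i\<in>insert j J. (1/2::real) ^ (a m i * n i)))
      = (\<Sum>m<Suc K1 * K2. (\<lambda>(p, q). (c1 p * (1/2) ^ (p * n j)) * (c2 q * (\<Prod>i\<in>J. (1/2::real) ^ (a2 q i * n i)))) (m div K2, m mod K2))"
      unfolding K_def
    proof (intro sum.cong refl)
      fix m
      have "(\<Prod>i\<in>J. (1/2::real) ^ (a m i * n i)) = (\<Prod>i\<in>J. (1/2::real) ^ (a2 (m mod K2) i * n i))"
        using insert.hyps by (intro prod.cong) (auto simp: a_def)
      then show "c m * (\<Prod>i\<in>insert j J. (1/2::real) ^ (a m i * n i)) = (\<lambda>(p, q). (c1 p * (1/2) ^ (p * n j)) * (c2 q * (\<Prod>i\<in>J. (1/2::real) ^ (a2 q i * n i)))) (m div K2, m mod K2)"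
        using insert.hyps by (simp add: c_def a_def)
    qed
    also have "\<dots> = (\<Sum>(p, q)\<in>{..<Suc K1} \<times> {..<K2}. (c1 p * (1/2) ^ (p * n j)) * (c2 q * (\<Prod>i\<in>J. (1/2::real) ^ (a2 q i * n i))))"
    proof (cases "K2 = 0")
      case False
      show ?thesis
      proof (rule sum.reindex_bij_witness[of _ "\<lambda>(p, q). p * K2 + q" "\<lambda>m. (m div K2, m mod K2)"], goal_cases)
        case (2 m)
        then show ?case using False by (simp add: less_mult_imp_div_less)
      next
        case (4 b)
        then obtain p q where b: "b = (p, q)" "p \<le> K1" "q < K2" by auto
        then have "p * K2 + q < Suc p * K2" by simp
        also have "\<dots> \<le> Suc K1 * K2" using b by (intro mult_right_mono) auto
        finally show ?case using b by simp
      qed (use False in auto)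
    qed simp
    also have "\<dots> = ?x * ?y"
      unfolding sum_product sum.cartesian_product lessThan_Suc_atMost ..
    finally have e: "(\<Sum>m<K. c m * (\<Prod>i\<in>insert j J. (1/2::real) ^ (a m i * n i))) = ?x * ?y" .
    have "\<bar>?X * ?Y - ?x * ?y\<bar> \<le> \<bar>?X - ?x\<bar> * \<bar>?Y\<bar> + \<bar>?x\<bar> * \<bar>?Y - ?y\<bar>"
      by (rule abs_mult_diff_le)
    moreover have "\<bar>?X - ?x\<bar> * \<bar>?Y\<bar> \<le> \<bar>?X - ?x\<bar> * 1"
      by (intro mult_left_mono) (auto simp: abs_prod intro!: prod_le_1)
    moreover have "\<bar>?x\<bar> * \<bar>?Y - ?y\<bar> \<le> C * (\<epsilon> / (2 * (C + 1)))"
      using Cb[of "n j"] 2[of n] C by (intro mult_mono) auto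
    moreover have "C * (\<epsilon> / (2 * (C + 1))) \<le> \<epsilon> / 2"
      using C insert.prems by (simp add: field_simps)
    ultimately have "\<bar>?X * ?Y - ?x * ?y\<bar> < \<epsilon>" using 1[of "n j"] by linarith
    then show ?thesis using insert.hyps e by simp
  qed
  then show ?case by blast
qed

text \<open>Uniform approximation transfers convergence from generating functions at the points
  (1/2)^a to probabilities of finite rectangles of counts. For a constant sequence it identifies a
  law by its generating function.\<close>

lemma tendsto_prod_indicator_of_half_powers:
  fixes X :: "nat \<Rightarrow> 'j \<Rightarrow> 'a \<Rightarrow> nat" and X' :: "'j \<Rightarrow> 'b \<Rightarrow> nat" and S :: "'j \<Rightarrow> nat set"
  assumes J: "finite J" and S: "\<And>j. j \<in> J \<Longrightarrow> finite (S j)"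
    and M: "prob_space M" "\<And>n j. j \<in> J \<Longrightarrow> X n j \<in> measurable M (count_space UNIV)"
    and M': "prob_space M'" "\<And>j. j \<in> J \<Longrightarrow> X' j \<in> measurable M' (count_space UNIV)"
    and conv: "\<And>a :: 'j \<Rightarrow> nat. (\<lambda>n. \<integral>\<omega>. (\<Prod>j\<in>J. (1/2::real) ^ (a j * X n j \<omega>)) \<partial>M)
       \<longlonglongrightarrow> (\<integral>\<omega>. (\<Prod>j\<in>J. (1/2::real) ^ (a j * X' j \<omega>)) \<partial>M')"
  shows "(\<lambda>n. measure M {\<omega> \<in> space M. \<forall>j\<in>J. X n j \<omega> \<in> S j})
     \<longlonglongrightarrow> measure M' {\<omega> \<in> space M'. \<forall>j\<in>J. X' j \<omega> \<in> S j}"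
proof (rule tendstoI)
  fix \<epsilon> :: real assume \<epsilon>: "\<epsilon> > 0"
  obtain K :: nat and c and a :: "nat \<Rightarrow> 'j \<Rightarrow> nat" where app: "\<And>n.
    \<bar>(\<Prod>j\<in>J. indicator (S j) (n j)) - (\<Sum>i<K. c i * (\<Prod>j\<in>J. (1/2::real) ^ (a i j * n j)))\<bar> < \<epsilon> / 4"
    using prod_indicator_approx_half_powers[of J S "\<epsilon>/4"] J S \<epsilon> by auto
  have gen: "\<bar>measure L {\<omega> \<in> space L. \<forall>j\<in>J. Y j \<omega> \<in> S j}
      - (\<Sum>i<K. c i * (\<integral>\<omega>. (\<Prod>j\<in>J. (1/2::real) ^ (a i j * Y j \<omega>)) \<partial>L))\<bar> \<le> \<epsilon> / 4"
    if L: "prob_space L" and Y: "\<And>j. j \<in> J \<Longrightarrow> Y j \<in> measurable L (count_space UNIV)" for L :: "'c measure" and Y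
  proof -
    interpret prob_space L by fact
    have int: "integrable L (\<lambda>\<omega>. (\<Prod>j\<in>J. (1/2::real) ^ (a i j * Y j \<omega>)))" for i
      by (rule integrable_const_bound[of _ 1])
         (use Y in \<open>auto simp: abs_prod power_le_one intro!: prod_le_1 borel_measurable_prod
            measurable_compose[OF Y]\<close>)
    have ev: "{\<omega> \<in> space L. \<forall>j\<in>J. Y j \<omega> \<in> S j} \<in> events"
      using J by (intro sets.sets_Collect_finite_All) (auto intro!: measurable_sets_Collect[OF Y])
    have ind: "(\<Prod>j\<in>J. indicat_real (S j) (Y j \<omega>)) = indicator {\<omega> \<in> space L. \<forall>j\<in>J. Y j \<omega> \<in> S j} \<omega>"
      if "\<omega> \<in> space L" for \<omega>
    proof (cases "\<forall>j\<in>J. Y j \<omega> \<in> S j")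
      case False
      then show ?thesis using J that by (auto simp: indicator_def)
    qed (use that in auto)
    have iI: "integrable L (indicat_real {\<omega> \<in> space L. \<forall>j\<in>J. Y j \<omega> \<in> S j})"
      using ev by (simp add: integrable_indicator_iff less_top[symmetric])
    have "measure L {\<omega> \<in> space L. \<forall>j\<in>J. Y j \<omega> \<in> S j}
      - (\<Sum>i<K. c i * (\<integral>\<omega>. (\<Prod>j\<in>J. (1/2::real) ^ (a i j * Y j \<omega>)) \<partial>L))
      = (\<integral>\<omega>. indicator {\<omega> \<in> space L. \<forall>j\<in>J. Y j \<omega> \<in> S j} \<omega>
          - (\<Sum>i<K. c i * (\<Prod>j\<in>J. (1/2::real) ^ (a i j * Y j \<omega>))) \<partial>L)"
      using ev int iI by (simp add: Int_absorb2)
    also have "\<bar>\<dots>\<bar> \<le> (\<integral>\<omega>. \<bar>indicator {\<omega> \<in> space L. \<forall>j\<in>J. Y j \<omega> \<in> S j} \<omega>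
          - (\<Sum>i<K. c i * (\<Prod>j\<in>J. (1/2::real) ^ (a i j * Y j \<omega>)))\<bar> \<partial>L)"
      by (rule integral_abs_bound)
    also have "\<dots> \<le> (\<integral>\<omega>. \<epsilon> / 4 \<partial>L)"
    proof (rule integral_mono)
      show "integrable L (\<lambda>\<omega>. \<bar>indicator {\<omega> \<in> space L. \<forall>j\<in>J. Y j \<omega> \<in> S j} \<omega>
          - (\<Sum>i<K. c i * (\<Prod>j\<in>J. (1/2::real) ^ (a i j * Y j \<omega>)))\<bar>)"
        using iI int by auto
      show "\<bar>indicator {\<omega> \<in> space L. \<forall>j\<in>J. Y j \<omega> \<in> S j} \<omega>
          - (\<Sum>i<K. c i * (\<Prod>j\<in>J. (1/2::real) ^ (a i j * Y j \<omega>)))\<bar> \<le> \<epsilon> / 4" if "\<omega> \<in> space L" for \<omega>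
        using app[of "\<lambda>j. Y j \<omega>"] ind[OF that] by simp
    qed simp
    finally show ?thesis by (simp add: prob_space)
  qed
  have "(\<lambda>n. \<Sum>i<K. c i * (\<integral>\<omega>. (\<Prod>j\<in>J. (1/2::real) ^ (a i j * X n j \<omega>)) \<partial>M))
     \<longlonglongrightarrow> (\<Sum>i<K. c i * (\<integral>\<omega>. (\<Prod>j\<in>J. (1/2::real) ^ (a i j * X' j \<omega>)) \<partial>M'))"
    by (intro tendsto_intros conv)
  then have "eventually (\<lambda>n. dist (\<Sum>i<K. c i * (\<integral>\<omega>. (\<Prod>j\<in>J. (1/2::real) ^ (a i j * X n j \<omega>)) \<partial>M))
     (\<Sum>i<K. c i * (\<integral>\<omega>. (\<Prod>j\<in>J. (1/2::real) ^ (a i j * X' j \<omega>)) \<partial>M')) < \<epsilon>/4) sequentially"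
    by (rule tendstoD) (use \<epsilon> in simp)
  then show "eventually (\<lambda>n. dist (measure M {\<omega> \<in> space M. \<forall>j\<in>J. X n j \<omega> \<in> S j})
     (measure M' {\<omega> \<in> space M'. \<forall>j\<in>J. X' j \<omega> \<in> S j}) < \<epsilon>) sequentially"
  proof eventually_elim
    case (elim n)
    then show ?case
      using gen[OF M(1), of "X n", OF M(2)] gen[OF M'(1), of X', OF M'(2)] \<epsilon> unfolding dist_real_def
      by linarith
  qed
qed

section \<open>Decorrelation along vertical leaves\<close>

text \<open>Segments are anchored at 0 because the doubling map sends such a segment to full leaves
  and at most one shorter segment, which is again anchored at 0; other segments arise as
  differences.\<close>

definition int0 :: "(real \<Rightarrow> real) \<Rightarrow> real \<Rightarrow> real" where
  "int0 k a = (\<integral>y. indicator {0..<a} y * k y \<partial>lborel)"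

lemma int0_cong: "(\<And>y. 0 \<le> y \<Longrightarrow> y < a \<Longrightarrow> k y = k' y) \<Longrightarrow> int0 k a = int0 k' a"
  unfolding int0_def by (intro Bochner_Integration.integral_cong) (auto simp: indicator_def)

lemma int0_zero [simp]: "int0 k 0 = 0" "int0 (\<lambda>_. 0) a = 0"
  by (simp_all add: int0_def)

lemma int0_const: "a \<ge> 0 \<Longrightarrow> int0 (\<lambda>_. c) a = a * c"
  by (simp add: int0_def)

lemma int0_half: "int0 k a = int0 (\<lambda>y. k (y / 2)) (2 * a) / 2"
proof -
  have "int0 k a = \<bar>1/2\<bar> *\<^sub>R (\<integral>y. indicator {0..<a} (0 + 1/2 * y) * k (0 + 1/2 * y) \<partial>lborel)"
    unfolding int0_def by (rule lborel_integral_real_affine) simp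
  also have "(\<integral>y. indicator {0..<a} (0 + 1/2 * y) * k (0 + 1/2 * y) \<partial>lborel) = int0 (\<lambda>y. k (y / 2)) (2 * a)"
    unfolding int0_def by (intro Bochner_Integration.integral_cong) (auto simp: indicator_def)
  finally show ?thesis by simp
qed

lemma integrable_bounded_interval:
  fixes k :: "real \<Rightarrow> real"
  assumes "k \<in> borel_measurable borel" "\<And>y. \<bar>k y\<bar> \<le> C"
  shows "integrable lborel (\<lambda>y. indicator {a..<b} y * k y)"
  by (rule integrableI_bounded_set[of "{a..<b}" _ _ C])
     (use assms emeasure_bounded_finite[of "{a..<b}"] in \<open>auto simp: indicator_def\<close>)

lemma int0_diff:
  assumes "k \<in> borel_measurable borel" "\<And>y. \<bar>k y\<bar> \<le> C" "0 \<le> a" "a \<le> b"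
  shows "int0 k b - int0 k a = (\<integral>y. indicator {a..<b} y * k y \<partial>lborel)"
proof -
  have "indicator {0..<b} y * k y - indicator {0..<a} y * k y = indicator {a..<b} y * k y" for y
    using assms(3,4) by (auto simp: indicator_def)
  then show ?thesis
    unfolding int0_def
    by (subst Bochner_Integration.integral_diff[symmetric])
       (auto intro!: integrable_bounded_interval[OF assms(1,2)])
qed

lemma int0_split:
  assumes "k \<in> borel_measurable borel" "\<And>y. \<bar>k y\<bar> \<le> C" "a \<ge> 1/2"
  shows "int0 k a = (int0 (\<lambda>y. k (y / 2)) 1 + int0 (\<lambda>y. k ((y + 1) / 2)) (2 * a - 1)) / 2"
proof -
  have "int0 k a - int0 k (1/2) = (\<integral>y. indicator {1/2..<a} y * k y \<partial>lborel)"
    by (rule int0_diff[OF assms(1,2)]) (use assms(3) in auto)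
  also have "\<dots> = \<bar>1/2\<bar> *\<^sub>R (\<integral>y. indicator {1/2..<a} (1/2 + 1/2 * y) * k (1/2 + 1/2 * y) \<partial>lborel)"
    by (rule lborel_integral_real_affine) simp
  also have "(\<integral>y. indicator {1/2..<a} (1/2 + 1/2 * y) * k (1/2 + 1/2 * y) \<partial>lborel)
      = int0 (\<lambda>y. k ((y + 1) / 2)) (2 * a - 1)"
    unfolding int0_def by (intro Bochner_Integration.integral_cong) (auto simp: indicator_def add_divide_distrib add.commute)
  finally show ?thesis using int0_half[of k "1/2"] by simp
qed

lemma int0_mono:
  assumes "k \<in> borel_measurable borel" "\<And>y. \<bar>k y\<bar> \<le> C" "k' \<in> borel_measurable borel" "\<And>y. \<bar>k' y\<bar> \<le> C'"
    and "\<And>y. 0 \<le> y \<Longrightarrow> y < a \<Longrightarrow> k y \<le> k' y"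
  shows "int0 k a \<le> int0 k' a"
  unfolding int0_def
  by (intro integral_mono integrable_bounded_interval[OF assms(1,2)] integrable_bounded_interval[OF assms(3,4)])
     (auto simp: indicator_def assms(5))

lemma int0_add:
  assumes "k \<in> borel_measurable borel" "\<And>y. \<bar>k y\<bar> \<le> C" "k' \<in> borel_measurable borel" "\<And>y. \<bar>k' y\<bar> \<le> C'"
  shows "int0 (\<lambda>y. k y + k' y) a = int0 k a + int0 k' a"
  unfolding int0_def distrib_left
  by (intro Bochner_Integration.integral_add integrable_bounded_interval[OF assms(1,2)] integrable_bounded_interval[OF assms(3,4)])

lemma int0_diff_fun:
  assumes "k \<in> borel_measurable borel" "\<And>y. \<bar>k y\<bar> \<le> C" "k' \<in> borel_measurable borel" "\<And>y. \<bar>k' y\<bar> \<le> C'"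
  shows "int0 (\<lambda>y. k y - k' y) a = int0 k a - int0 k' a"
  unfolding int0_def right_diff_distrib
  by (intro Bochner_Integration.integral_diff integrable_bounded_interval[OF assms(1,2)] integrable_bounded_interval[OF assms(3,4)])

lemma int0_nonneg: "(\<And>y. 0 \<le> k y) \<Longrightarrow> 0 \<le> int0 k a"
  unfolding int0_def by (intro Bochner_Integration.integral_nonneg) auto

lemma int0_abs_le: "\<bar>int0 k a\<bar> \<le> int0 (\<lambda>y. \<bar>k y\<bar>) a"
proof -
  have "\<bar>int0 k a\<bar> \<le> (\<integral>y. \<bar>indicator {0..<a} y * k y\<bar> \<partial>lborel)" unfolding int0_def by (rule integral_abs_bound)
  then show ?thesis by (simp add: int0_def abs_mult)
qed

text \<open>Inside the leaf, the open section and the half-open segment differ at most in the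
  endpoint c - h, a null set.\<close>

lemma int0_section:
  fixes c h :: real
  assumes k: "k \<in> borel_measurable borel" "\<And>y. \<bar>k y\<bar> \<le> C" and c: "0 \<le> c" "c \<le> 1" "h \<ge> 0"
  shows "int0 (\<lambda>y. indicator {y \<in> {0..1}. \<bar>y - c\<bar> < h} y * k y) 1
      = int0 k (min 1 (c + h)) - int0 k (max 0 (c - h))"
proof -
  have "int0 k (min 1 (c + h)) - int0 k (max 0 (c - h))
      = (\<integral>y. indicator {max 0 (c - h)..<min 1 (c + h)} y * k y \<partial>lborel)"
    by (rule int0_diff[OF k]) (use c in auto)
  also have "\<dots> = (\<integral>y. indicator {0..<1} y * (indicator {y \<in> {0..1}. \<bar>y - c\<bar> < h} y * k y) \<partial>lborel)"
  proof (rule integral_cong_AE)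
    show "AE y in lborel. indicator {max 0 (c - h)..<min 1 (c + h)} y * k y
        = indicator {0..<1} y * (indicator {y \<in> {0..1}. \<bar>y - c\<bar> < h} y * k y)"
      using AE_lborel_singleton[of "c - h"] by eventually_elim (auto simp: indicator_def abs_less_iff)
    have "{y \<in> {0..1}. \<bar>y - c\<bar> < h} \<in> sets borel" by measurable
    then show "(\<lambda>y. indicator {0..<1} y * (indicator {y \<in> {0..1}. \<bar>y - c\<bar> < h} y * k y)) \<in> borel_measurable lborel"
      using k(1) by measurable
  qed (use k(1) in measurable)
  finally show ?thesis by (simp add: int0_def)
qed

text \<open>The bounds are imposed on the whole plane, where T is defined; so the class is closed
  under products and under composition with iterates of T, and its members are integrable for every
  probability measure in play.\<close>

definition unit_fun :: "(real \<times> real \<Rightarrow> real) \<Rightarrow> bool" where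
  "unit_fun \<phi> \<longleftrightarrow> \<phi> \<in> borel_measurable borel \<and> (\<forall>w. 0 \<le> \<phi> w \<and> \<phi> w \<le> 1)"

lemma unit_funD:
  assumes "unit_fun \<phi>"
  shows "\<phi> \<in> borel_measurable borel" "0 \<le> \<phi> w" "\<phi> w \<le> 1" "\<bar>\<phi> w\<bar> \<le> 1"
    "(\<lambda>y. \<phi> (x, y)) \<in> borel_measurable borel"
proof -
  show m: "\<phi> \<in> borel_measurable borel" and b: "0 \<le> \<phi> w" "\<phi> w \<le> 1" for w
    using assms unfolding unit_fun_def by blast+
  from b[of w] show "\<bar>\<phi> w\<bar> \<le> 1" by simp
  have "(\<lambda>y. (x, y)) \<in> borel \<rightarrow>\<^sub>M (borel :: (real \<times> real) measure)"
    by (simp add: borel_prod[symmetric])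
  from measurable_compose[OF this m] show "(\<lambda>y. \<phi> (x, y)) \<in> borel_measurable borel" .
qed

lemma unit_fun_mult: "unit_fun \<phi> \<Longrightarrow> unit_fun \<psi> \<Longrightarrow> unit_fun (\<lambda>w. \<phi> w * \<psi> w)"
  unfolding unit_fun_def by (auto intro: mult_le_one)

lemma unit_fun_indicator: "B \<in> sets borel \<Longrightarrow> unit_fun (indicator B)"
  unfolding unit_fun_def by auto

lemma baker_low: "y < 1 \<Longrightarrow> baker \<gamma> (x, y / 2) = (\<gamma> * x, y)"
  by (simp add: baker_def)

lemma baker_high: "0 \<le> y \<Longrightarrow> baker \<gamma> (x, (y + 1) / 2) = (1 - \<gamma> + \<gamma> * x, y)"
  by (simp add: baker_def field_simps)

lemma measurable_baker [measurable]: "baker \<gamma> \<in> borel \<rightarrow>\<^sub>M borel"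
  unfolding baker_def borel_prod[symmetric] split_beta by measurable

lemma measurable_baker_iterate [measurable]: "baker \<gamma> ^^ n \<in> borel \<rightarrow>\<^sub>M borel"
  by (induction n) (auto simp: id_def[symmetric] simp del: id_apply intro: measurable_comp[OF _ measurable_baker])

lemma unit_fun_baker: "unit_fun \<phi> \<Longrightarrow> unit_fun (\<lambda>w. \<phi> ((baker \<gamma> ^^ n) w))"
  unfolding unit_fun_def using measurable_compose[OF measurable_baker_iterate] by blast

lemma unit_fun_baker1: "unit_fun \<phi> \<Longrightarrow> unit_fun (\<lambda>w. \<phi> (baker \<gamma> w))"
  using unit_fun_baker[where n = 1] by simp

section \<open>Integrals along vertical segments under the map\<close>

definition cell_int :: "(real \<times> real \<Rightarrow> real) \<Rightarrow> real \<Rightarrow> real \<Rightarrow> real" where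
  "cell_int \<phi> x a = int0 (\<lambda>y. \<phi> (x, y)) a"

lemma cell_int_bounds:
  assumes "unit_fun \<phi>" "0 \<le> a"
  shows "0 \<le> cell_int \<phi> x a" "cell_int \<phi> x a \<le> a"
proof -
  show "0 \<le> cell_int \<phi> x a" unfolding cell_int_def using unit_funD[OF assms(1)] by (intro int0_nonneg) auto
  have "cell_int \<phi> x a \<le> int0 (\<lambda>_. 1) a" unfolding cell_int_def
    by (rule int0_mono[where C = 1 and C' = 1]) (use unit_funD[OF assms(1)] in auto)
  then show "cell_int \<phi> x a \<le> a" using assms(2) by (simp add: int0_const)
qed

lemma cell_int_mono:
  assumes "unit_fun \<phi>" "a \<le> b"
  shows "cell_int \<phi> x a \<le> cell_int \<phi> x b"
  unfolding cell_int_def int0_def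
  by (intro integral_mono integrable_bounded_interval[where C = 1])
     (use assms(2) unit_funD[OF assms(1)] in \<open>auto simp: indicator_def\<close>)

lemma cell_int_baker_low:
  assumes "0 \<le> a" "a \<le> 1/2"
  shows "cell_int (\<lambda>w. \<phi> (baker \<gamma> w)) x a = cell_int \<phi> (\<gamma> * x) (2 * a) / 2"
  unfolding cell_int_def
  by (subst int0_half, rule arg_cong[where f = "\<lambda>t. t / 2"], rule int0_cong) (use assms in \<open>auto simp: baker_def\<close>)

text \<open>T stretches the lower half of the leaf over \<open>x\<close> to the full leaf over
  \<gamma> x and the upper half to the leaf over 1 - \<gamma> + \<gamma> x; a segment of length at
  least 1/2 covers the first of these leaves entirely.\<close>

lemma cell_int_baker_high:
  assumes \<phi>: "unit_fun \<phi>" and "1/2 \<le> a"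
  shows "cell_int (\<lambda>w. \<phi> (baker \<gamma> w)) x a
      = (cell_int \<phi> (\<gamma> * x) 1 + cell_int \<phi> (1 - \<gamma> + \<gamma> * x) (2 * a - 1)) / 2"
proof -
  have "cell_int (\<lambda>w. \<phi> (baker \<gamma> w)) x a = (int0 (\<lambda>y. \<phi> (baker \<gamma> (x, y / 2))) 1
      + int0 (\<lambda>y. \<phi> (baker \<gamma> (x, (y + 1) / 2))) (2 * a - 1)) / 2"
    unfolding cell_int_def
    by (rule int0_split[where C = 1]) (use assms unit_funD[OF unit_fun_baker1[OF \<phi>]] in auto)
  also have "int0 (\<lambda>y. \<phi> (baker \<gamma> (x, y / 2))) 1 = cell_int \<phi> (\<gamma> * x) 1"
    unfolding cell_int_def by (rule int0_cong) (simp add: baker_low baker_high)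
  also have "int0 (\<lambda>y. \<phi> (baker \<gamma> (x, (y + 1) / 2))) (2 * a - 1) = cell_int \<phi> (1 - \<gamma> + \<gamma> * x) (2 * a - 1)"
    unfolding cell_int_def by (rule int0_cong) (simp add: baker_low baker_high)
  finally show ?thesis .
qed

text \<open>Points of equal height are compared since they take the same branch at every step: their
  images keep equal heights while the horizontal distance shrinks by \<gamma>.\<close>

definition leaf_dist :: "(real \<times> real \<Rightarrow> real) \<Rightarrow> real \<Rightarrow> real \<Rightarrow> real" where
  "leaf_dist \<phi> x x' = int0 (\<lambda>y. \<bar>\<phi> (x, y) - \<phi> (x', y)\<bar>) 1"

lemma abs_diff_unit: "unit_fun \<phi> \<Longrightarrow> unit_fun \<psi> \<Longrightarrow> \<bar>\<phi> w - \<psi> w'\<bar> \<le> 1"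
  using unit_funD(2,3)[of \<phi> w] unit_funD(2,3)[of \<psi> w'] by auto

lemma leaf_dist_baker:
  assumes \<phi>: "unit_fun \<phi>"
  shows "leaf_dist (\<lambda>w. \<phi> (baker \<gamma> w)) x x'
      = (leaf_dist \<phi> (\<gamma> * x) (\<gamma> * x') + leaf_dist \<phi> (1 - \<gamma> + \<gamma> * x) (1 - \<gamma> + \<gamma> * x')) / 2"
proof -
  have "leaf_dist (\<lambda>w. \<phi> (baker \<gamma> w)) x x'
    = (int0 (\<lambda>y. \<bar>\<phi> (baker \<gamma> (x, y / 2)) - \<phi> (baker \<gamma> (x', y / 2))\<bar>) 1
      + int0 (\<lambda>y. \<bar>\<phi> (baker \<gamma> (x, (y + 1) / 2)) - \<phi> (baker \<gamma> (x', (y + 1) / 2))\<bar>) (2 * 1 - 1)) / 2"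
    unfolding leaf_dist_def
    using unit_funD(5)[OF unit_fun_baker1[OF \<phi>]]
    by (intro int0_split[where C = 1 and a = 1]) (auto intro: abs_diff_unit[OF \<phi> \<phi>])
  also have "int0 (\<lambda>y. \<bar>\<phi> (baker \<gamma> (x, y / 2)) - \<phi> (baker \<gamma> (x', y / 2))\<bar>) 1 = leaf_dist \<phi> (\<gamma> * x) (\<gamma> * x')"
    unfolding leaf_dist_def by (rule int0_cong) (simp add: baker_low baker_high)
  also have "int0 (\<lambda>y. \<bar>\<phi> (baker \<gamma> (x, (y + 1) / 2)) - \<phi> (baker \<gamma> (x', (y + 1) / 2))\<bar>) (2 * 1 - 1)
     = leaf_dist \<phi> (1 - \<gamma> + \<gamma> * x) (1 - \<gamma> + \<gamma> * x')"
    unfolding leaf_dist_def by simp (rule int0_cong, simp add: baker_high)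
  finally show ?thesis .
qed

lemma cell_int_leaf_dist:
  assumes \<phi>: "unit_fun \<phi>"
  shows "\<bar>cell_int \<phi> x 1 - cell_int \<phi> x' 1\<bar> \<le> leaf_dist \<phi> x x'"
proof -
  have "cell_int \<phi> x 1 - cell_int \<phi> x' 1 = int0 (\<lambda>y. \<phi> (x, y) - \<phi> (x', y)) 1"
    unfolding cell_int_def by (rule int0_diff_fun[symmetric, where C = 1 and C' = 1]) (use unit_funD[OF \<phi>] in auto)
  then show ?thesis unfolding leaf_dist_def using int0_abs_le by metis
qed

lemma branch_unit:
  assumes "0 < \<gamma>" "\<gamma> < (1/2::real)" "x \<in> {0..1}"
  shows "\<gamma> * x \<in> {0..1}" "1 - \<gamma> + \<gamma> * x \<in> {0..1}"
proof -
  have "0 \<le> \<gamma> * x" "\<gamma> * x \<le> \<gamma>" using assms mult_left_le[of x \<gamma>] by auto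
  then show "\<gamma> * x \<in> {0..1}" "1 - \<gamma> + \<gamma> * x \<in> {0..1}"
    using assms(1,2) unfolding atLeastAtMost_iff by linarith+
qed

text \<open>Full leaves are mapped to full leaves, so an iterate averages leaf integrals that obey
  one common bound and adds no error.\<close>

lemma cell_int_baker_iterate_full:
  assumes \<gamma>: "0 < \<gamma>" "\<gamma> < 1/2" and \<phi>: "unit_fun \<phi>"
    and H: "\<And>x. x \<in> {0..1} \<Longrightarrow> \<bar>cell_int \<phi> x 1 - c\<bar> \<le> \<epsilon>" and x: "x \<in> {0..1}"
  shows "\<bar>cell_int (\<lambda>w. \<phi> ((baker \<gamma> ^^ g) w)) x 1 - c\<bar> \<le> \<epsilon>"
  using x
proof (induction g arbitrary: x)
  case 0 then show ?case using H by simp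
next
  case (Suc g)
  have "cell_int (\<lambda>w. \<phi> ((baker \<gamma> ^^ Suc g) w)) x 1
     = (cell_int (\<lambda>w. \<phi> ((baker \<gamma> ^^ g) w)) (\<gamma> * x) 1 + cell_int (\<lambda>w. \<phi> ((baker \<gamma> ^^ g) w)) (1 - \<gamma> + \<gamma> * x) 1) / 2"
    using cell_int_baker_high[OF unit_fun_baker[OF \<phi>, where \<gamma> = \<gamma> and n = g], of 1 \<gamma> x]
    by (simp only: funpow_Suc_right o_apply) simp
  then show ?case using Suc.IH[OF branch_unit(1)[OF \<gamma> Suc.prems]] Suc.IH[OF branch_unit(2)[OF \<gamma> Suc.prems]]
    unfolding abs_le_iff by simp
qed

text \<open>Arithmetic of the induction step for segments of length a \<ge> 1/2: \<open>A\<close>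
  belongs to the full leaf, \<open>B\<close> to the remaining segment, p = a c, q = a \<epsilon> and
  e = \<epsilon>. The error \<open>e\<close> of the full leaf is exactly what the remaining segment
  saves.\<close>

lemma average_bound:
  fixes K A B p q c e R :: real
  assumes "K = (A + B) / 2" "\<bar>B - (2 * p - c)\<bar> \<le> 2 * q - e + R" "\<bar>A - c\<bar> \<le> e"
  shows "\<bar>K - p\<bar> \<le> q + R / 2"
  using assms(2,3) unfolding assms(1) abs_le_iff by (auto simp: field_simps)

text \<open>The iterate \<open>T\<^sup>g\<close> stretches vertical segments over \<open>2\<^sup>g\<close> full leaves up to at most one incomplete
  leaf, whence the last error term.\<close>

lemma cell_int_baker_iterate:
  assumes \<gamma>: "0 < \<gamma>" "\<gamma> < 1/2" and \<phi>: "unit_fun \<phi>"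
    and H: "\<And>x. x \<in> {0..1} \<Longrightarrow> \<bar>cell_int \<phi> x 1 - c\<bar> \<le> \<epsilon>" and c: "c \<ge> 0" and x: "x \<in> {0..1}" "a \<in> {0..1}"
  shows "\<bar>cell_int (\<lambda>w. \<phi> ((baker \<gamma> ^^ g) w)) x a - a * c\<bar> \<le> a * \<epsilon> + (c + \<epsilon>) / 2 ^ g"
  using x
proof (induction g arbitrary: x a)
  case 0
  have e: "\<epsilon> \<ge> 0" using H[OF 0(1)] by linarith
  have "cell_int \<phi> x a \<le> cell_int \<phi> x 1" by (rule cell_int_mono[OF \<phi>]) (use 0 in auto)
  then have "cell_int \<phi> x a \<le> c + \<epsilon>" using H[OF 0(1)] by linarith
  moreover have "0 \<le> cell_int \<phi> x a" using cell_int_bounds[OF \<phi>] 0 by auto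
  moreover have "0 \<le> a * c" "a * c \<le> c" using 0 c by (auto intro: mult_left_le_one_le)
  moreover have "0 \<le> a * \<epsilon>" using 0 e by auto
  ultimately show ?case using e by (auto simp: abs_le_iff)
next
  case (Suc g)
  note \<phi>g = unit_fun_baker[OF \<phi>, where \<gamma> = \<gamma> and n = g]
  define R where "R = (c + \<epsilon>) / 2 ^ g"
  have pw: "(c + \<epsilon>) / 2 ^ Suc g = R / 2" by (simp add: R_def)
  let ?K = "\<lambda>n. cell_int (\<lambda>w. \<phi> ((baker \<gamma> ^^ n) w))"
  show ?case
  proof (cases "a \<le> 1/2")
    case True
    then have "?K (Suc g) x a = ?K g (\<gamma> * x) (2 * a) / 2"
      using cell_int_baker_low[of a "\<lambda>w. \<phi> ((baker \<gamma> ^^ g) w)" \<gamma> x] Suc.prems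
      by (simp only: funpow_Suc_right o_apply) simp
    moreover have "\<bar>?K g (\<gamma> * x) (2 * a) - 2 * a * c\<bar> \<le> 2 * a * \<epsilon> + R"
      unfolding R_def by (rule Suc.IH[OF branch_unit(1)[OF \<gamma> Suc.prems(1)]]) (use True Suc.prems in auto)
    ultimately show ?thesis unfolding pw left_diff_distrib mult_1_left mult.assoc by linarith
  next
    case False
    then have "?K (Suc g) x a = (?K g (\<gamma> * x) 1 + ?K g (1 - \<gamma> + \<gamma> * x) (2 * a - 1)) / 2"
      using cell_int_baker_high[OF \<phi>g, of a \<gamma> x]
      by (simp only: funpow_Suc_right o_apply)
    moreover have "\<bar>?K g (1 - \<gamma> + \<gamma> * x) (2 * a - 1) - (2 * a - 1) * c\<bar> \<le> (2 * a - 1) * \<epsilon> + R"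
      unfolding R_def by (rule Suc.IH[OF branch_unit(2)[OF \<gamma> Suc.prems(1)]]) (use False Suc.prems in auto)
    moreover have "\<bar>?K g (\<gamma> * x) 1 - c\<bar> \<le> \<epsilon>"
      by (rule cell_int_baker_iterate_full[OF \<gamma> \<phi> H branch_unit(1)[OF \<gamma> Suc.prems(1)]])
    ultimately show ?thesis unfolding pw left_diff_distrib mult_1_left mult.assoc by (rule average_bound)
  qed
qed

section \<open>Products of weights at the hits\<close>

definition hit_weight :: "'a set \<Rightarrow> real \<Rightarrow> 'a \<Rightarrow> real" where
  "hit_weight B s w = (if w \<in> B then s else 1)"

definition hit_step :: "('a \<Rightarrow> 'a) \<Rightarrow> 'a set \<Rightarrow> real \<Rightarrow> ('a \<Rightarrow> real) \<Rightarrow> 'a \<Rightarrow> real" where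
  "hit_step T B s G w = hit_weight B s w * G (T w)"

text \<open>The functions that can describe the future behind a gap: products of weights at finitely
  many consecutive times, with \<open>s\<close> free to change from one time to the next because
  different blocks carry different parameters. Estimates for this class have to be uniform in the
  number of factors.\<close>

inductive hit_fun :: "('a \<Rightarrow> 'a) \<Rightarrow> 'a set \<Rightarrow> ('a \<Rightarrow> real) \<Rightarrow> bool" for T B where
  one: "hit_fun T B (\<lambda>_. 1)"
| step: "hit_fun T B G \<Longrightarrow> 0 \<le> s \<Longrightarrow> s \<le> 1 \<Longrightarrow> hit_fun T B (hit_step T B s G)"

lemma hit_fun_steps: "hit_fun T B G \<Longrightarrow> 0 \<le> s \<Longrightarrow> s \<le> 1 \<Longrightarrow> hit_fun T B ((hit_step T B s ^^ n) G)"
  by (induction n) (auto intro: hit_fun.step)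

lemma hit_steps_eq:
  "(hit_step T B s ^^ n) G w = (\<Prod>i<n. hit_weight B s ((T ^^ i) w)) * G ((T ^^ n) w)"
proof (induction n arbitrary: w)
  case (Suc n)
  have "(\<Prod>i<Suc n. hit_weight B s ((T ^^ i) w)) = hit_weight B s w * (\<Prod>i<n. hit_weight B s ((T ^^ i) (T w)))"
    by (subst prod.lessThan_Suc_shift) (simp add: funpow_swap1)
  moreover have "(hit_step T B s ^^ Suc n) G w = hit_weight B s w * (hit_step T B s ^^ n) G (T w)"
    by (simp only: funpow.simps o_apply hit_step_def)
  moreover have "(T ^^ Suc n) w = (T ^^ n) (T w)" by (simp add: funpow_swap1)
  ultimately show ?case by (simp only: Suc.IH mult.assoc)
qed simp

lemma unit_fun_hit_weight: "B \<in> sets borel \<Longrightarrow> 0 \<le> s \<Longrightarrow> s \<le> 1 \<Longrightarrow> unit_fun (hit_weight B s)"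
  unfolding unit_fun_def hit_weight_def[abs_def] by auto

lemma unit_fun_hit_fun:
  assumes "hit_fun (baker \<gamma>) B G" "B \<in> sets borel"
  shows "unit_fun G"
  using assms(1)
proof induction
  case one then show ?case by (simp add: unit_fun_def)
next
  case (step G s)
  then show ?case unfolding hit_step_def[abs_def]
    by (intro unit_fun_mult unit_fun_hit_weight unit_fun_baker1 assms)
qed

text \<open>A product of numbers in [0,1] changes by at most the sum of the changes of its factors.
  The factor at the k-th later time contributes at most C \<rho>^(g + k), and the geometric series
  bounds products of every length.\<close>

lemma leaf_dist_hit_fun:
  assumes B: "B \<in> sets borel" and \<rho>: "0 \<le> \<rho>" "\<rho> < 1"
    and D: "\<And>g x x'. x \<in> {0..1} \<Longrightarrow> x' \<in> {0..1} \<Longrightarrow>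
       leaf_dist (\<lambda>w. indicator B ((baker \<gamma> ^^ g) w)) x x' \<le> C * \<rho> ^ g"
    and G: "hit_fun (baker \<gamma>) B G" and x: "x \<in> {0..1}" "x' \<in> {0..1}"
  shows "leaf_dist (\<lambda>w. G ((baker \<gamma> ^^ g) w)) x x' \<le> C * \<rho> ^ g / (1 - \<rho>)"
  using G
proof (induction arbitrary: g)
  case one
  have "0 \<le> leaf_dist (\<lambda>w. indicator B ((baker \<gamma> ^^ g) w)) x x'"
    unfolding leaf_dist_def by (rule int0_nonneg) simp
  also have "\<dots> \<le> C * \<rho> ^ g" using D x by blast
  finally show ?case using \<rho> by (simp add: leaf_dist_def)
next
  case (step G s)
  let ?I = "\<lambda>w. indicator B ((baker \<gamma> ^^ g) w) :: real" and ?G = "\<lambda>w. G ((baker \<gamma> ^^ Suc g) w)"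
  have uG: "unit_fun G" by (rule unit_fun_hit_fun[OF step(1) B])
  have u: "unit_fun ?I" "unit_fun ?G"
    by (rule unit_fun_baker[OF unit_fun_indicator[OF B]], rule unit_fun_baker[OF uG])
  have u': "unit_fun (\<lambda>w. hit_step (baker \<gamma>) B s G ((baker \<gamma> ^^ g) w))"
    by (rule unit_fun_baker[OF unit_fun_hit_fun[OF _ B]]) (use step hit_fun.step in blast)
  have "leaf_dist (\<lambda>w. hit_step (baker \<gamma>) B s G ((baker \<gamma> ^^ g) w)) x x'
     \<le> int0 (\<lambda>y. \<bar>?I (x, y) - ?I (x', y)\<bar> + \<bar>?G (x, y) - ?G (x', y)\<bar>) 1"
    unfolding leaf_dist_def
  proof (rule int0_mono[where C = 1 and C' = 2])
    fix y
    show "\<bar>hit_step (baker \<gamma>) B s G ((baker \<gamma> ^^ g) (x, y)) - hit_step (baker \<gamma>) B s G ((baker \<gamma> ^^ g) (x', y))\<bar>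
       \<le> \<bar>?I (x, y) - ?I (x', y)\<bar> + \<bar>?G (x, y) - ?G (x', y)\<bar>"
    proof -
      let ?a = "(baker \<gamma> ^^ g) (x, y)" and ?b = "(baker \<gamma> ^^ g) (x', y)"
      have "\<bar>hit_weight B s ?a * G (baker \<gamma> ?a) - hit_weight B s ?b * G (baker \<gamma> ?b)\<bar>
        \<le> \<bar>hit_weight B s ?a - hit_weight B s ?b\<bar> * \<bar>G (baker \<gamma> ?a)\<bar> + \<bar>hit_weight B s ?b\<bar> * \<bar>G (baker \<gamma> ?a) - G (baker \<gamma> ?b)\<bar>"
        by (rule abs_mult_diff_le)
      also have "\<dots> \<le> \<bar>hit_weight B s ?a - hit_weight B s ?b\<bar> * 1 + 1 * \<bar>G (baker \<gamma> ?a) - G (baker \<gamma> ?b)\<bar>"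
        using unit_funD(4)[OF uG] step(2,3) by (intro add_mono mult_left_mono mult_right_mono) (auto simp: hit_weight_def)
      also have "\<bar>hit_weight B s ?a - hit_weight B s ?b\<bar> \<le> \<bar>indicator B ?a - indicator B ?b\<bar>"
        using step(2,3) by (auto simp: hit_weight_def indicator_def)
      finally show ?thesis by (simp add: hit_step_def)
    qed
    show "\<bar>\<bar>?I (x, y) - ?I (x', y)\<bar> + \<bar>?G (x, y) - ?G (x', y)\<bar>\<bar> \<le> 2"
      using abs_diff_unit[OF u(1) u(1), of "(x, y)" "(x', y)"] abs_diff_unit[OF u(2) u(2), of "(x, y)" "(x', y)"] by linarith
    show "\<bar>\<bar>hit_step (baker \<gamma>) B s G ((baker \<gamma> ^^ g) (x, y)) - hit_step (baker \<gamma>) B s G ((baker \<gamma> ^^ g) (x', y))\<bar>\<bar> \<le> 1"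
      using abs_diff_unit[OF u' u', of "(x, y)" "(x', y)"] by simp
  qed (use unit_funD(5)[OF u(1)] unit_funD(5)[OF u(2)] unit_funD(5)[OF u'] in measurable)
  also have "\<dots> = leaf_dist ?I x x' + leaf_dist ?G x x'"
    unfolding leaf_dist_def
  proof (rule int0_add[where C = 1 and C' = 1])
    show "\<bar>\<bar>?I (x, y) - ?I (x', y)\<bar>\<bar> \<le> 1" "\<bar>\<bar>?G (x, y) - ?G (x', y)\<bar>\<bar> \<le> 1" for y
      using abs_diff_unit[OF u(1) u(1), of "(x, y)" "(x', y)"] abs_diff_unit[OF u(2) u(2), of "(x, y)" "(x', y)"] by auto
  qed (use unit_funD(5)[OF u(1)] unit_funD(5)[OF u(2)] in measurable)
  also have "\<dots> \<le> C * \<rho> ^ g + C * \<rho> ^ Suc g / (1 - \<rho>)"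
    by (intro add_mono D x step.IH)
  also have "\<dots> = C * \<rho> ^ g / (1 - \<rho>)" using \<rho> by (simp add: field_simps)
  finally show ?case .
qed

text \<open>Balls of both metrics and the sets of points with prescribed periodic returns are all of
  this shape, with one centre \<open>c\<close> and a half-height depending on the leaf; half-height
  0 gives an empty fibre.\<close>

definition vertical_section :: "real \<Rightarrow> (real \<Rightarrow> real) \<Rightarrow> (real \<times> real) set" where
  "vertical_section c h = {w \<in> unit_square. \<bar>snd w - c\<bar> < h (fst w)}"

lemma unit_square_borel [measurable]: "unit_square \<in> sets borel"
  unfolding unit_square_def borel_prod[symmetric] by measurable

lemma vertical_section_borel:
  assumes "h \<in> borel_measurable borel"
  shows "vertical_section c h \<in> sets borel"
proof -
  have [measurable]: "(\<lambda>w. h (fst w)) \<in> borel_measurable (borel :: (real \<times> real) measure)"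
    by (rule measurable_compose[OF _ assms]) (simp add: borel_prod[symmetric])
  have "{w \<in> space (borel :: (real \<times> real) measure). \<bar>snd w - c\<bar> < h (fst w)} \<in> sets borel"
    unfolding borel_prod[symmetric] using assms by measurable
  moreover have "vertical_section c h = unit_square \<inter> {w \<in> space borel. \<bar>snd w - c\<bar> < h (fst w)}"
    by (auto simp: vertical_section_def)
  ultimately show ?thesis using unit_square_borel by simp
qed

section \<open>The SRB measure as a product, and decorrelation of vertical sections\<close>

locale baker_srb =
  fixes \<gamma> :: real and \<mu> :: "(real \<times> real) measure"
  assumes \<gamma>: "0 < \<gamma>" "\<gamma> < 1/2" and srb: "srb_measure \<gamma> \<mu>"
begin

abbreviation T :: "real \<times> real \<Rightarrow> real \<times> real" where "T \<equiv> baker \<gamma>"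

sublocale prob_space \<mu> using srb unfolding srb_measure_def by blast

lemma space_\<mu>: "space \<mu> = unit_square" and sets_\<mu>: "sets \<mu> = sets (restrict_space borel unit_square)"
  and T_measurable: "T \<in> measurable \<mu> \<mu>" and T_invariant: "distr \<mu> \<mu> T = \<mu>"
  and disintegration: "A \<in> sets \<mu> \<Longrightarrow> emeasure \<mu> A = (\<integral>\<^sup>+ w. emeasure (leaf_lebesgue (fst w)) A \<partial>\<mu>)"
  using srb unfolding srb_measure_def by blast+

lemma measurable_\<mu>: "f \<in> measurable borel N \<Longrightarrow> f \<in> measurable \<mu> N"
  unfolding measurable_cong_sets[OF sets_\<mu> refl] by (rule measurable_restrict_space1)

lemma sets_\<mu>_I: "A \<in> sets borel \<Longrightarrow> A \<subseteq> unit_square \<Longrightarrow> A \<in> sets \<mu>"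
  unfolding sets_\<mu> by (subst sets_restrict_space_iff) auto

text \<open>The transverse measure on the leaves. Invariance makes it the self-similar Cantor
  measure of the two contractions with equal weights.\<close>

definition \<nu> :: "real measure" where "\<nu> = distr \<mu> borel fst"

lemma fst_measurable: "fst \<in> measurable \<mu> borel"
  by (rule measurable_\<mu>) (simp add: borel_prod[symmetric])

lemma sets_\<nu> [simp]: "sets \<nu> = sets borel" and space_\<nu> [simp]: "space \<nu> = UNIV"
  by (simp_all add: \<nu>_def)

sublocale \<nu>: prob_space \<nu>
  unfolding \<nu>_def by (rule prob_space_distr[OF fst_measurable])

lemma AE_\<nu>: "AE x in \<nu>. x \<in> {0..1}"
proof -
  have "AE w in \<mu>. fst w \<in> {0..1}" by (rule AE_I2) (auto simp: space_\<mu> unit_square_def)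
  then show ?thesis unfolding \<nu>_def by (subst AE_distr_iff[OF fst_measurable]) simp_all
qed

text \<open>Lebesgue measure of a leaf as a measure on the whole line, so that its product with
  \<open>\<nu>\<close> lives on the Borel sets of the plane.\<close>

definition leaf :: "real measure" where "leaf = density lborel (\<lambda>y. ennreal (indicator {0..1} y))"

lemma sets_leaf [simp]: "sets leaf = sets borel" by (simp add: leaf_def)

lemma prob_space_leaf: "prob_space leaf"
  by standard (simp add: leaf_def emeasure_density ennreal_indicator)

lemma emeasure_leaf_lebesgue:
  assumes "x \<in> {0..1}" "A \<in> sets borel" "A \<subseteq> unit_square"
  shows "emeasure (leaf_lebesgue x) A = emeasure leaf (Pair x -` A)"
proof -
  let ?R = "restrict_space lborel {0..1::real}"
  have m: "(\<lambda>y. (x, y)) \<in> borel \<rightarrow>\<^sub>M (borel :: (real \<times> real) measure)" by (simp add: borel_prod[symmetric])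
  then have "(\<lambda>y. (x, y)) \<in> lborel \<rightarrow>\<^sub>M borel" by simp
  then have "(\<lambda>y. (x, y)) \<in> ?R \<rightarrow>\<^sub>M restrict_space borel unit_square"
    by (intro measurable_restrict_space2 measurable_restrict_space1)
       (use assms in \<open>auto simp: unit_square_def space_restrict_space\<close>)
  moreover have "A \<in> sets (restrict_space borel unit_square)"
    using assms by (subst sets_restrict_space_iff) auto
  ultimately have "emeasure (leaf_lebesgue x) A = emeasure ?R ((\<lambda>y. (x, y)) -` A \<inter> space ?R)"
    unfolding leaf_lebesgue_def by (rule emeasure_distr)
  also have "(\<lambda>y. (x, y)) -` A \<inter> space ?R = Pair x -` A"
    using assms by (auto simp: space_restrict_space unit_square_def)
  also have "emeasure ?R (Pair x -` A) = emeasure lborel (Pair x -` A)"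
    using assms(3) by (subst emeasure_restrict_space) (auto simp: unit_square_def)
  also have "\<dots> = emeasure leaf (Pair x -` A)"
  proof -
    have "Pair x -` A \<in> sets borel" using measurable_sets[OF m assms(2)] by simp
    moreover have "ennreal (indicator {0..1} y) * indicator (Pair x -` A) y = indicator (Pair x -` A) y" for y
      using assms(3) by (auto simp: unit_square_def indicator_def)
    ultimately show ?thesis unfolding leaf_def by (subst emeasure_density) simp_all
  qed
  finally show ?thesis .
qed

text \<open>The conditional measure at a point depends only on its leaf and looks the same on every
  leaf, so the disintegration formula is Fubini's formula. The map \<open>\<lambda>w. w\<close>
  regards \<mu> as a measure on the whole plane.\<close>

lemma \<mu>_eq_product: "distr \<mu> borel (\<lambda>w. w) = \<nu> \<Otimes>\<^sub>M leaf"
proof (rule measure_eqI)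
  show s: "sets (distr \<mu> borel (\<lambda>w. w)) = sets (\<nu> \<Otimes>\<^sub>M leaf)"
    by (simp add: borel_prod[symmetric] cong: sets_pair_measure_cong)
  interpret leaf: prob_space leaf by (rule prob_space_leaf)
  fix A assume "A \<in> sets (distr \<mu> borel (\<lambda>w. w))"
  then have A: "A \<in> sets (borel :: (real \<times> real) measure)" by simp
  have A': "A \<inter> unit_square \<in> sets borel" using A by simp
  have "emeasure (distr \<mu> borel (\<lambda>w. w)) A = emeasure \<mu> (A \<inter> unit_square)"
    using A by (subst emeasure_distr[OF measurable_\<mu>]) (auto simp: space_\<mu>)
  also have "\<dots> = (\<integral>\<^sup>+ w. emeasure (leaf_lebesgue (fst w)) (A \<inter> unit_square) \<partial>\<mu>)"
    by (rule disintegration[OF sets_\<mu>_I[OF A']]) auto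
  also have "\<dots> = (\<integral>\<^sup>+ w. emeasure leaf (Pair (fst w) -` A) \<partial>\<mu>)"
  proof (rule nn_integral_cong)
    fix w assume "w \<in> space \<mu>"
    then have w: "fst w \<in> {0..1}" by (auto simp: space_\<mu> unit_square_def)
    have "emeasure (leaf_lebesgue (fst w)) (A \<inter> unit_square) = emeasure leaf (Pair (fst w) -` (A \<inter> unit_square))"
      by (rule emeasure_leaf_lebesgue[OF w A']) auto
    also have "\<dots> = emeasure leaf (Pair (fst w) -` A)"
    proof -
      have m: "Pair (fst w) \<in> borel \<rightarrow>\<^sub>M (borel :: (real \<times> real) measure)" by (simp add: borel_prod[symmetric])
      have "Pair (fst w) -` A \<in> sets borel" "Pair (fst w) -` (A \<inter> unit_square) \<in> sets borel"
        using measurable_sets[OF m A] measurable_sets[OF m A'] by simp_all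
      moreover have "ennreal (indicator {0..1} y) * indicator (Pair (fst w) -` (A \<inter> unit_square)) y
        = ennreal (indicator {0..1} y) * indicator (Pair (fst w) -` A) y" for y
        using w by (auto simp: unit_square_def indicator_def)
      ultimately show ?thesis unfolding leaf_def by (simp add: emeasure_density)
    qed
    finally show "emeasure (leaf_lebesgue (fst w)) (A \<inter> unit_square) = emeasure leaf (Pair (fst w) -` A)" .
  qed
  also have "\<dots> = (\<integral>\<^sup>+ x. emeasure leaf (Pair x -` A) \<partial>\<nu>)"
    unfolding \<nu>_def
  proof (rule nn_integral_distr[OF fst_measurable, symmetric])
    have "A \<in> sets (borel \<Otimes>\<^sub>M leaf)"
      using A by (simp add: borel_prod[symmetric] cong: sets_pair_measure_cong)
    then show "(\<lambda>x. emeasure leaf (Pair x -` A)) \<in> borel_measurable (distr \<mu> borel fst)"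
      using leaf.measurable_emeasure_Pair[of A borel] by simp
  qed
  also have "\<dots> = emeasure (\<nu> \<Otimes>\<^sub>M leaf) A"
    using A s by (subst leaf.emeasure_pair_measure_alt) auto
  finally show "emeasure (distr \<mu> borel (\<lambda>w. w)) A = emeasure (\<nu> \<Otimes>\<^sub>M leaf) A" .
qed

lemma cell_int_measurable:
  assumes "unit_fun \<phi>"
  shows "(\<lambda>x. cell_int \<phi> x 1) \<in> borel_measurable borel"
proof -
  have [measurable]: "(\<lambda>(x, y). \<phi> (x, y)) \<in> borel_measurable (borel \<Otimes>\<^sub>M borel)"
    using unit_funD(1)[OF assms] by (simp add: borel_prod split_beta)
  have "(\<lambda>(x, y). indicator {0..<1} y * \<phi> (x, y)) \<in> borel_measurable (borel \<Otimes>\<^sub>M lborel)"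
    by measurable
  then show ?thesis unfolding cell_int_def int0_def
    by (rule lborel.borel_measurable_lebesgue_integral)
qed

lemma integrable_unit_fun:
  assumes "unit_fun \<phi>"
  shows "integrable \<mu> \<phi>"
  by (rule integrable_const_bound[of _ 1])
     (simp_all add: unit_funD(4)[OF assms] measurable_\<mu>[OF unit_funD(1)[OF assms]])

lemma integrable_cell_int: "unit_fun \<phi> \<Longrightarrow> integrable \<nu> (\<lambda>x. cell_int \<phi> x 1)"
  by (rule \<nu>.integrable_const_bound[of _ 1])
     (use cell_int_bounds[of \<phi> 1] cell_int_measurable[of \<phi>] in \<open>auto simp: measurable_cong_sets[OF sets_\<nu> refl]\<close>)

lemma integral_\<mu>:
  assumes \<phi>: "unit_fun \<phi>"
  shows "(\<integral>w. \<phi> w \<partial>\<mu>) = (\<integral>x. cell_int \<phi> x 1 \<partial>\<nu>)"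
proof -
  interpret leaf: prob_space leaf by (rule prob_space_leaf)
  interpret P: pair_prob_space \<nu> leaf ..
  have m: "\<phi> \<in> borel_measurable (\<nu> \<Otimes>\<^sub>M leaf)"
    using unit_funD(1)[OF \<phi>] by (simp add: \<mu>_eq_product[symmetric])
  have "(\<integral>w. \<phi> w \<partial>\<mu>) = (\<integral>w. \<phi> w \<partial>distr \<mu> borel (\<lambda>w. w))"
    using unit_funD(1)[OF \<phi>] by (subst integral_distr[OF measurable_\<mu>]) auto
  also have "\<dots> = (\<integral>x. (\<integral>y. \<phi> (x, y) \<partial>leaf) \<partial>\<nu>)"
    unfolding \<mu>_eq_product
    by (rule P.integral_fst'[symmetric], rule P.integrable_const_bound[of _ 1])
       (use m unit_funD[OF \<phi>] in auto)
  also have "(\<lambda>x. \<integral>y. \<phi> (x, y) \<partial>leaf) = (\<lambda>x. cell_int \<phi> x 1)"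
  proof
    fix x
    have "(\<integral>y. \<phi> (x, y) \<partial>leaf) = (\<integral>y. indicator {0..1} y *\<^sub>R \<phi> (x, y) \<partial>lborel)"
      unfolding leaf_def by (rule integral_density) (auto simp: unit_funD(5)[OF \<phi>])
    also have "\<dots> = cell_int \<phi> x 1"
      unfolding cell_int_def int0_def
    proof (rule integral_cong_AE)
      show "AE y in lborel. indicator {0..1} y *\<^sub>R \<phi> (x, y) = indicator {0..<1} y * \<phi> (x, y)"
        using AE_lborel_singleton[of 1] by eventually_elim (auto simp: indicator_def)
    qed (use unit_funD(5)[OF \<phi>] in measurable)
    finally show "(\<integral>y. \<phi> (x, y) \<partial>leaf) = cell_int \<phi> x 1" .
  qed
  finally show ?thesis .
qed

lemma integral_T:
  assumes \<phi>: "unit_fun \<phi>"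
  shows "(\<integral>w. \<phi> (T w) \<partial>\<mu>) = (\<integral>w. \<phi> w \<partial>\<mu>)"
  using integral_distr[OF T_measurable measurable_\<mu>[OF unit_funD(1)[OF \<phi>]]] by (simp add: T_invariant)

lemma integral_T_iterate:
  assumes \<phi>: "unit_fun \<phi>"
  shows "(\<integral>w. \<phi> ((T ^^ n) w) \<partial>\<mu>) = (\<integral>w. \<phi> w \<partial>\<mu>)"
  using assms
proof (induction n arbitrary: \<phi>)
  case (Suc n)
  have "(\<integral>w. \<phi> ((T ^^ Suc n) w) \<partial>\<mu>) = (\<integral>w. \<phi> (T ((T ^^ n) w)) \<partial>\<mu>)" by simp
  also have "\<dots> = (\<integral>w. \<phi> (T w) \<partial>\<mu>)" by (rule Suc.IH[OF unit_fun_baker1[OF Suc.prems]])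
  finally show ?case using integral_T[OF Suc.prems] by simp
qed simp

lemma integral_indicator_\<mu>: "A \<in> sets borel \<Longrightarrow> (\<integral>w. indicator A w \<partial>\<mu>) = measure \<mu> (A \<inter> unit_square)"
  by (simp add: space_\<mu>)

lemma integral_\<mu>_bounds:
  assumes "unit_fun \<phi>"
  shows "0 \<le> (\<integral>w. \<phi> w \<partial>\<mu>)" "(\<integral>w. \<phi> w \<partial>\<mu>) \<le> 1"
proof -
  show "0 \<le> (\<integral>w. \<phi> w \<partial>\<mu>)" by (rule Bochner_Integration.integral_nonneg) (rule unit_funD[OF assms])
  have "(\<integral>w. \<phi> w \<partial>\<mu>) \<le> (\<integral>w. 1 \<partial>\<mu>)"
    by (rule integral_mono) (simp_all add: integrable_unit_fun[OF assms] unit_funD(3)[OF assms])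
  then show "(\<integral>w. \<phi> w \<partial>\<mu>) \<le> 1" by (simp add: prob_space)
qed

lemma cell_int_vertical_section:
  assumes \<phi>: "unit_fun \<phi>" and x: "x \<in> {0..1}" and c: "c \<in> {0..1}" and h: "0 \<le> h x"
  shows "cell_int (\<lambda>w. indicator (vertical_section c h) w * \<phi> w) x 1
     = cell_int \<phi> x (min 1 (c + h x)) - cell_int \<phi> x (max 0 (c - h x))"
proof -
  have "cell_int (\<lambda>w. indicator (vertical_section c h) w * \<phi> w) x 1
     = int0 (\<lambda>y. indicator {y \<in> {0..1}. \<bar>y - c\<bar> < h x} y * \<phi> (x, y)) 1"
    unfolding cell_int_def by (rule int0_cong) (use x in \<open>auto simp: vertical_section_def unit_square_def indicator_def\<close>)
  also have "\<dots> = cell_int \<phi> x (min 1 (c + h x)) - cell_int \<phi> x (max 0 (c - h x))"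
    unfolding cell_int_def by (rule int0_section[where C = 1]) (use unit_funD[OF \<phi>] c h in auto)
  finally show ?thesis .
qed

lemma cell_int_vertical_section_one:
  assumes x: "x \<in> {0..1}" and c: "c \<in> {0..1}" and h: "0 \<le> h x"
  shows "cell_int (indicator (vertical_section c h)) x 1 = min 1 (c + h x) - max 0 (c - h x)"
  using cell_int_vertical_section[of "\<lambda>_. 1" x c h] assms
  by (simp add: unit_fun_def cell_int_def int0_const)

text \<open>Both the position along the leaf and the leaf itself are forgotten: \<open>T\<^sup>g\<close> spreads a vertical segment
  over \<open>2\<^sup>g\<close> leaves, and the next \<open>g\<close> steps contract the horizontal direction.\<close>

lemma vertical_section_decorrelation:
  assumes h: "h \<in> borel_measurable borel" "\<And>x. 0 \<le> h x" and c: "c \<in> {0..1}" and G: "unit_fun G"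
    and D: "\<And>x x'. x \<in> {0..1} \<Longrightarrow> x' \<in> {0..1} \<Longrightarrow> leaf_dist (\<lambda>w. G ((T ^^ g) w)) x x' \<le> \<epsilon>"
  shows "\<bar>(\<integral>w. indicator (vertical_section c h) w * G ((T ^^ (g + g)) w) \<partial>\<mu>)
      - measure \<mu> (vertical_section c h) * (\<integral>w. G w \<partial>\<mu>)\<bar> \<le> 4 * \<epsilon> + 2 / 2 ^ g"
proof -
  let ?R = "vertical_section c h" and ?G = "\<lambda>w. G ((T ^^ g) w)"
  define m where "m = (\<integral>w. G w \<partial>\<mu>)"
  have uG: "unit_fun ?G" by (rule unit_fun_baker[OF G])
  have R: "?R \<in> sets borel" by (rule vertical_section_borel[OF h(1)])
  have m: "0 \<le> m" "m \<le> 1" unfolding m_def using integral_\<mu>_bounds[OF G] by auto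
  have mG: "m = (\<integral>x. cell_int ?G x 1 \<partial>\<nu>)"
    unfolding m_def integral_\<mu>[OF uG, symmetric] integral_T_iterate[OF G] ..
  \<comment> \<open>Averaging the second leaf over \<open>\<nu>\<close> turns closeness of any two
    leaves into closeness to the mean, which by invariance is the mean of \<open>G\<close>
    itself.\<close>
  have H: "\<bar>cell_int ?G x 1 - m\<bar> \<le> \<epsilon>" if x: "x \<in> {0..1}" for x
  proof -
    have i: "integrable \<nu> (\<lambda>x'. cell_int ?G x 1 - cell_int ?G x' 1)"
      using integrable_cell_int[OF uG] by simp
    have "cell_int ?G x 1 - m = (\<integral>x'. cell_int ?G x 1 - cell_int ?G x' 1 \<partial>\<nu>)"
      unfolding mG using integrable_cell_int[OF uG] by (simp add: \<nu>.prob_space[unfolded space_\<nu>])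
    also have "\<bar>\<dots>\<bar> \<le> (\<integral>x'. \<bar>cell_int ?G x 1 - cell_int ?G x' 1\<bar> \<partial>\<nu>)" by (rule integral_abs_bound)
    also have "\<dots> \<le> (\<integral>x'. \<epsilon> \<partial>\<nu>)"
    proof (rule integral_mono_AE)
      show "AE x' in \<nu>. \<bar>cell_int ?G x 1 - cell_int ?G x' 1\<bar> \<le> \<epsilon>"
        using AE_\<nu> by eventually_elim (use cell_int_leaf_dist[OF uG] D[OF x] in \<open>blast intro: order_trans\<close>)
    qed (use i in auto)
    finally show ?thesis by (simp add: \<nu>.prob_space[unfolded space_\<nu>])
  qed
  have e: "0 \<le> \<epsilon>" using H[of 0] by auto
  have uGg: "unit_fun (\<lambda>w. ?G ((T ^^ g) w))" by (rule unit_fun_baker[OF uG])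
  let ?F = "\<lambda>w. indicator ?R w * ?G ((T ^^ g) w)"
  have uF: "unit_fun ?F" by (rule unit_fun_mult[OF unit_fun_indicator[OF R] uGg])
  have bound: "\<bar>cell_int ?F x 1 - m * cell_int (indicator ?R) x 1\<bar> \<le> 4 * \<epsilon> + 2 / 2 ^ g"
    if x: "x \<in> {0..1}" for x
  proof -
    let ?b = "min 1 (c + h x)" and ?a = "max 0 (c - h x)"
    have ab: "?a \<in> {0..1}" "?b \<in> {0..1}" using c h(2)[of x] by auto
    have est: "\<bar>cell_int (\<lambda>w. ?G ((T ^^ g) w)) x a - a * m\<bar> \<le> a * \<epsilon> + (m + \<epsilon>) / 2 ^ g" if "a \<in> {0..1}" for a
      by (rule cell_int_baker_iterate[OF \<gamma> uG _ m(1) x that]) (rule H)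
    define q where "q = (1::real) / 2 ^ g"
    have q: "0 < q" "q \<le> 1" by (auto simp: q_def)
    \<comment> \<open>One endpoint of the section costs at most 2 \<epsilon> + 2^-g; the lower and
      the upper endpoint together give the stated error.\<close>
    have "a * \<epsilon> + (m + \<epsilon>) / 2 ^ g \<le> 2 * \<epsilon> + q" if "a \<in> {0..1}" for a
    proof -
      have "a * \<epsilon> \<le> 1 * \<epsilon>" using that e by (intro mult_right_mono) auto
      moreover have "(m + \<epsilon>) * q \<le> q + \<epsilon>"
      proof -
        have "m * q \<le> 1 * q" "\<epsilon> * q \<le> \<epsilon> * 1" using m q e by (intro mult_right_mono mult_left_mono; simp)+
        then show ?thesis by (simp add: distrib_right)
      qed
      ultimately show ?thesis by (simp add: q_def)
    qed
    then have "\<bar>cell_int (\<lambda>w. ?G ((T ^^ g) w)) x ?b - ?b * m\<bar> \<le> 2 * \<epsilon> + q"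
      "\<bar>cell_int (\<lambda>w. ?G ((T ^^ g) w)) x ?a - ?a * m\<bar> \<le> 2 * \<epsilon> + q"
      using est[OF ab(2)] est[OF ab(1)] ab by (blast intro: order_trans)+
    moreover have "cell_int ?F x 1 = cell_int (\<lambda>w. ?G ((T ^^ g) w)) x ?b - cell_int (\<lambda>w. ?G ((T ^^ g) w)) x ?a"
      by (rule cell_int_vertical_section[OF uGg x c h(2)])
    moreover have "m * cell_int (indicator ?R) x 1 = ?b * m - ?a * m"
      unfolding cell_int_vertical_section_one[OF x c h(2)] by (simp add: algebra_simps)
    moreover have "2 / 2 ^ g = 2 * q" by (simp add: q_def)
    ultimately show ?thesis by linarith
  qed
  have "AE x in \<nu>. x \<in> {0..1} \<longrightarrow> \<bar>cell_int ?F x 1 - m * cell_int (indicator ?R) x 1\<bar> \<le> 4 * \<epsilon> + 2 / 2 ^ g"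
    by (rule AE_I2, rule impI, rule bound)
  with AE_\<nu> have ae: "AE x in \<nu>. \<bar>cell_int ?F x 1 - m * cell_int (indicator ?R) x 1\<bar> \<le> 4 * \<epsilon> + 2 / 2 ^ g"
    by (rule AE_mp)
  have i: "integrable \<nu> (\<lambda>x. \<bar>cell_int ?F x 1 - m * cell_int (indicator ?R) x 1\<bar>)"
    by (intro integrable_abs Bochner_Integration.integrable_diff integrable_mult_right
        integrable_cell_int uF unit_fun_indicator R)
  have "(\<integral>w. indicator ?R w * G ((T ^^ (g + g)) w) \<partial>\<mu>) - measure \<mu> ?R * (\<integral>w. G w \<partial>\<mu>)
     = (\<integral>x. cell_int ?F x 1 \<partial>\<nu>) - m * (\<integral>x. cell_int (indicator ?R) x 1 \<partial>\<nu>)"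
  proof -
    have "(\<integral>w. indicator ?R w * G ((T ^^ (g + g)) w) \<partial>\<mu>) = (\<integral>x. cell_int ?F x 1 \<partial>\<nu>)"
      using integral_\<mu>[OF uF] by (simp add: funpow_add)
    moreover have "measure \<mu> ?R = (\<integral>x. cell_int (indicator ?R) x 1 \<partial>\<nu>)"
    proof -
      have "?R \<inter> unit_square = ?R" by (auto simp: vertical_section_def)
      then show ?thesis
        using integral_\<mu>[OF unit_fun_indicator[OF R]] integral_indicator_\<mu>[OF R] by simp
    qed
    ultimately show ?thesis by (simp add: m_def mult.commute)
  qed
  also have "\<dots> = (\<integral>x. cell_int ?F x 1 - m * cell_int (indicator ?R) x 1 \<partial>\<nu>)"
    using integrable_cell_int[OF uF] integrable_cell_int[OF unit_fun_indicator[OF R]] by simp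
  finally have eq: "(\<integral>w. indicator ?R w * G ((T ^^ (g + g)) w) \<partial>\<mu>) - measure \<mu> ?R * (\<integral>w. G w \<partial>\<mu>)
     = (\<integral>x. cell_int ?F x 1 - m * cell_int (indicator ?R) x 1 \<partial>\<nu>)" .
  have "(\<integral>x. \<bar>cell_int ?F x 1 - m * cell_int (indicator ?R) x 1\<bar> \<partial>\<nu>) \<le> (\<integral>x. 4 * \<epsilon> + 2 / 2 ^ g \<partial>\<nu>)"
    by (rule integral_mono_AE[OF i _ ae]) simp
  also have "\<dots> = 4 * \<epsilon> + 2 / 2 ^ g" by (simp add: \<nu>.prob_space[unfolded space_\<nu>])
  finally show ?thesis
    unfolding eq by (rule order_trans[OF integral_abs_bound])
qed

text \<open>Enlarging the target of the return to the horizontal strip of half-height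
  \<open>r\<close> makes it look the same on every leaf, so counting the full leaves covered by an
  iterate is exact up to the ends of the segment. Horizontal information is kept for the starting
  point, where it yields the factor \<open>measure \<nu> {x. \<bar>x - z\<bar> < r}\<close>.\<close>

lemma return_bound:
  assumes h: "h \<in> borel_measurable borel" "\<And>x. 0 \<le> h x" "\<And>x. h x \<le> r" "\<And>x. \<bar>x - z\<bar> \<ge> r \<Longrightarrow> h x = 0"
    and c: "c \<in> {0..1}"
  shows "measure \<mu> {w \<in> vertical_section c h. (T ^^ j) w \<in> vertical_section c h}
     \<le> measure \<nu> {x. \<bar>x - z\<bar> < r} * (4 * r\<^sup>2 + 4 * r / 2 ^ j)"
proof -
  let ?R = "vertical_section c h" and ?S = "vertical_section c (\<lambda>_. r)"
  have r: "r \<ge> 0" using h(2,3) order_trans by blast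
  have R: "?R \<in> sets borel" "?S \<in> sets borel" by (auto intro: vertical_section_borel h(1))
  have RS: "?R \<subseteq> ?S" using h(3) by (auto simp: vertical_section_def intro: less_le_trans)
  let ?\<phi> = "indicator ?S :: _ \<Rightarrow> real"
  have u\<phi>: "unit_fun ?\<phi>" by (rule unit_fun_indicator[OF R(2)])
  define k where "k = min 1 (c + r) - max 0 (c - r)"
  have k: "0 \<le> k" "k \<le> 2 * r" using c r by (auto simp: k_def)
  have H: "\<bar>cell_int ?\<phi> x 1 - k\<bar> \<le> 0" if "x \<in> {0..1}" for x
    using cell_int_vertical_section_one[OF that c, of "\<lambda>_. r"] r by (simp add: k_def)
  let ?F = "\<lambda>w. indicator ?R w * ?\<phi> ((T ^^ j) w)"
  have uj: "unit_fun (\<lambda>w. ?\<phi> ((T ^^ j) w))" by (rule unit_fun_baker[OF u\<phi>])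
  have uF: "unit_fun ?F" by (rule unit_fun_mult[OF unit_fun_indicator[OF R(1)] uj])
  have bound: "cell_int ?F x 1 \<le> indicator {x. \<bar>x - z\<bar> < r} x * (4 * r\<^sup>2 + 4 * r / 2 ^ j)"
    if x: "x \<in> {0..1}" for x
  proof -
    let ?b = "min 1 (c + h x)" and ?a = "max 0 (c - h x)"
    have ab: "?a \<in> {0..1}" "?b \<in> {0..1}" using c h(2)[of x] by auto
    have F: "cell_int ?F x 1 = cell_int (\<lambda>w. ?\<phi> ((T ^^ j) w)) x ?b - cell_int (\<lambda>w. ?\<phi> ((T ^^ j) w)) x ?a"
      by (rule cell_int_vertical_section[OF uj x c h(2)])
    show ?thesis
    proof (cases "\<bar>x - z\<bar> < r")
      case False
      then have "h x = 0" using h(4)[of x] by simp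
      then show ?thesis using F c False by (simp add: min_absorb2 max_absorb2)
    next
      case True
      have ba: "0 \<le> ?b - ?a" "?b - ?a \<le> 2 * r" using h(3)[of x] h(2)[of x] c r by auto
      have est: "\<bar>cell_int (\<lambda>w. ?\<phi> ((T ^^ j) w)) x a - a * k\<bar> \<le> a * 0 + (k + 0) / 2 ^ j" if "a \<in> {0..1}" for a
        by (rule cell_int_baker_iterate[OF \<gamma> u\<phi> _ k(1) x that]) (rule H)
      have "\<bar>cell_int (\<lambda>w. ?\<phi> ((T ^^ j) w)) x ?b - ?b * k\<bar> \<le> k / 2 ^ j"
        "\<bar>cell_int (\<lambda>w. ?\<phi> ((T ^^ j) w)) x ?a - ?a * k\<bar> \<le> k / 2 ^ j"
        using est[OF ab(2)] est[OF ab(1)] by simp_all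
      then have "cell_int ?F x 1 \<le> (?b - ?a) * k + 2 * (k / 2 ^ j)"
        unfolding F left_diff_distrib by linarith
      also have "\<dots> \<le> (2 * r) * (2 * r) + 2 * (2 * r / 2 ^ j)"
        using ba k r by (intro add_mono mult_mono divide_right_mono mult_left_mono) auto
      finally show ?thesis using True by (simp add: power2_eq_square)
    qed
  qed
  have "measure \<mu> {w \<in> ?R. (T ^^ j) w \<in> ?R} = (\<integral>w. indicator {w \<in> ?R. (T ^^ j) w \<in> ?R} w \<partial>\<mu>)"
  proof -
    have "{w \<in> ?R. (T ^^ j) w \<in> ?R} = ?R \<inter> ((T ^^ j) -` ?R \<inter> space borel)" by auto
    then have "{w \<in> ?R. (T ^^ j) w \<in> ?R} \<in> sets borel"
      using R(1) measurable_sets[OF measurable_baker_iterate R(1)] by auto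
    moreover have "{w \<in> ?R. (T ^^ j) w \<in> ?R} \<inter> unit_square = {w \<in> ?R. (T ^^ j) w \<in> ?R}"
      by (auto simp: vertical_section_def)
    ultimately show ?thesis by (simp only: integral_indicator_\<mu>)
  qed
  also have "\<dots> \<le> (\<integral>w. ?F w \<partial>\<mu>)"
  proof (rule integral_mono)
    have "{w \<in> ?R. (T ^^ j) w \<in> ?R} = ?R \<inter> ((T ^^ j) -` ?R \<inter> space borel)" by auto
    then have "{w \<in> ?R. (T ^^ j) w \<in> ?R} \<in> sets borel"
      using R(1) measurable_sets[OF measurable_baker_iterate R(1)] by auto
    then show "integrable \<mu> (indicat_real {w \<in> ?R. (T ^^ j) w \<in> ?R})"
      by (intro integrable_unit_fun unit_fun_indicator)
  qed (use RS integrable_unit_fun[OF uF] in \<open>auto simp: indicator_def\<close>)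
  also have "\<dots> = (\<integral>x. cell_int ?F x 1 \<partial>\<nu>)" by (rule integral_\<mu>[OF uF])
  also have "\<dots> \<le> (\<integral>x. indicator {x. \<bar>x - z\<bar> < r} x * (4 * r\<^sup>2 + 4 * r / 2 ^ j) \<partial>\<nu>)"
  proof (rule integral_mono_AE)
    show "AE x in \<nu>. cell_int ?F x 1 \<le> indicator {x. \<bar>x - z\<bar> < r} x * (4 * r\<^sup>2 + 4 * r / 2 ^ j)"
      using AE_\<nu> by (rule AE_mp) (intro AE_I2 impI bound)
    show "integrable \<nu> (\<lambda>x. indicator {x. \<bar>x - z\<bar> < r} x * (4 * r\<^sup>2 + 4 * r / 2 ^ j))"
      by (intro integrable_mult_left integrable_real_indicator) (auto simp: \<nu>.emeasure_finite less_top[symmetric])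
  qed (rule integrable_cell_int[OF uF])
  also have "\<dots> = measure \<nu> {x. \<bar>x - z\<bar> < r} * (4 * r\<^sup>2 + 4 * r / 2 ^ j)"
    by simp
  finally show ?thesis .
qed

end

section \<open>Generating functions of hits\<close>

text \<open>Each further factor changes the product by at most 1 minus that factor, as the product
  before it is at most 1.\<close>

lemma abs_prod_diff_le:
  fixes a :: "nat \<Rightarrow> real"
  assumes "m \<le> n" "\<And>i. 0 \<le> a i" "\<And>i. a i \<le> 1"
  shows "\<bar>(\<Prod>i<n. a i) - (\<Prod>i<m. a i)\<bar> \<le> (\<Sum>i\<in>{m..<n}. 1 - a i)"
  using assms(1)
proof (induction n rule: dec_induct)
  case (step n)
  have "0 \<le> (\<Prod>i<n. a i)" "(\<Prod>i<n. a i) \<le> 1"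
    using assms by (auto intro: prod_nonneg prod_le_1)
  then have "(\<Prod>i<n. a i) * (1 - a n) \<le> 1 * (1 - a n)" "0 \<le> (\<Prod>i<n. a i) * (1 - a n)"
    using assms(3)[of n] mult_right_mono[of "\<Prod>i<n. a i" 1 "1 - a n"] by simp_all
  then have "\<bar>(\<Prod>i<Suc n. a i) - (\<Prod>i<n. a i)\<bar> \<le> 1 - a n" by (simp add: algebra_simps abs_le_iff)
  then show ?case using step by simp
qed simp

text \<open>The induction exhibits the remainder (1 - s) q (s q)^I / (1 - s q) of the geometric
  series; it is at most q^I because (1 - s) q \<le> 1 - s q.\<close>

lemma geometric_partial:
  fixes s q :: real
  assumes "0 \<le> s" "s \<le> 1" "0 \<le> q" "q < 1"
  shows "\<bar>1 + (\<Sum>i\<in>{1..I}. (s ^ i - s ^ (i - 1)) * q ^ i) - (1 - q) / (1 - s * q)\<bar> \<le> q ^ I"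
proof -
  have sq: "s * q \<le> q" using assms by (simp add: mult_left_le_one_le)
  then have d: "1 - s * q > 0" using assms by simp
  have "1 + (\<Sum>i\<in>{1..I}. (s ^ i - s ^ (i - 1)) * q ^ i) = (1 - q) / (1 - s * q) + (1 - s) * q * (s * q) ^ I / (1 - s * q)"
  proof (induction I)
    case 0
    then show ?case using d by (simp add: field_simps)
  next
    case (Suc I)
    have "(\<Sum>i\<in>{1..Suc I}. (s ^ i - s ^ (i - 1)) * q ^ i) = (\<Sum>i\<in>{1..I}. (s ^ i - s ^ (i - 1)) * q ^ i) + (s ^ Suc I - s ^ I) * q ^ Suc I"
      by simp
    moreover have "(s ^ Suc I - s ^ I) * q ^ Suc I = - ((1 - s) * q * (s * q) ^ I)"
      by (simp add: power_mult_distrib algebra_simps)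
    moreover have "x / (1 - s * q) - x = x * (s * q) / (1 - s * q)" for x
      using d by (simp add: field_simps)
    from this[of "(1 - s) * q * (s * q) ^ I"]
    have "(1 - s) * q * (s * q) ^ I / (1 - s * q) - (1 - s) * q * (s * q) ^ I
       = (1 - s) * q * (s * q) ^ Suc I / (1 - s * q)" by (simp add: mult_ac)
    ultimately show ?case using Suc by linarith
  qed
  moreover have "\<bar>(1 - s) * q * (s * q) ^ I / (1 - s * q)\<bar> \<le> q ^ I"
  proof -
    have "0 \<le> (1 - s) * q / (1 - s * q)" "(1 - s) * q / (1 - s * q) \<le> 1"
      using assms d sq by (auto simp: field_simps)
    moreover have "0 \<le> (s * q) ^ I" "(s * q) ^ I \<le> q ^ I" using assms sq by (auto intro: power_mono)
    ultimately have "0 \<le> (1 - s) * q / (1 - s * q) * (s * q) ^ I" "(1 - s) * q / (1 - s * q) * (s * q) ^ I \<le> 1 * q ^ I"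
      using mult_mono[of "(1 - s) * q / (1 - s * q)" 1 "(s * q) ^ I" "q ^ I"] by (simp_all only: mult_nonneg_nonneg)
    then show ?thesis unfolding times_divide_eq_left[symmetric] by (simp only: abs_of_nonneg)
  qed
  ultimately show ?thesis by simp
qed

text \<open>If \<open>w\<close> lies in exactly the first k of the nested sets, both sides equal
  s^k, the right-hand side by telescoping.\<close>

lemma prod_nested_weights:
  fixes s :: real
  assumes "\<And>i. i \<ge> 1 \<Longrightarrow> C (Suc i) \<subseteq> C i"
  shows "(\<Prod>i\<in>{1..I}. hit_weight (C i) s w) = 1 + (\<Sum>i\<in>{1..I}. (s ^ i - s ^ (i - 1)) * indicator (C i) w)"
proof (induction I)
  case (Suc I)
  show ?case
  proof (cases "w \<in> C (Suc I)")
    case False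
    then show ?thesis using Suc by (simp add: hit_weight_def)
  next
    case True
    have all: "w \<in> C i" if "i \<in> {1..Suc I}" for i
    proof -
      have "i \<le> Suc I" "1 \<le> i" using that by auto
      then show ?thesis using True assms by (induction i rule: inc_induct) auto
    qed
    have "1 + (\<Sum>i\<in>{1..n}. (s ^ i - s ^ (i - 1))) = s ^ n" for n by (induction n) auto
    moreover have "(\<Sum>i\<in>{1..Suc I}. (s ^ i - s ^ (i - 1)) * indicator (C i) w) = (\<Sum>i\<in>{1..Suc I}. (s ^ i - s ^ (i - 1)))"
      by (intro sum.cong) (auto simp: all)
    moreover have "(\<Prod>i\<in>{1..Suc I}. hit_weight (C i) s w) = (\<Prod>i\<in>{1..Suc I}. s)"
      by (intro prod.cong) (auto simp: all hit_weight_def)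
    ultimately show ?thesis by (simp only: prod_constant card_atLeastAtMost) simp
  qed
qed simp

text \<open>Among the times 1, ..., I p only multiples of p can be hits, so each block of p
  consecutive times contributes one nontrivial weight, at its last time.\<close>

lemma prod_periodic_hits:
  fixes s :: real
  assumes p: "p \<ge> 1" and hits: "\<And>j. 1 \<le> j \<Longrightarrow> j \<le> I * p \<Longrightarrow> (T ^^ j) w \<in> B \<longleftrightarrow> p dvd j \<and> w \<in> C (j div p)"
  shows "(\<Prod>i<I * p. hit_weight B s ((T ^^ Suc i) w)) = (\<Prod>i\<in>{1..I}. hit_weight (C i) s w)"
  using hits
proof (induction I)
  case (Suc I)
  obtain p' where p': "p = Suc p'" using p by (cases p) auto
  have hw: "hit_weight B s ((T ^^ Suc (I * p + k)) w) = (if k = p' then hit_weight (C (Suc I)) s w else 1)"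
    if "k < p" for k
  proof (cases "k = p'")
    case True
    have eq: "Suc (I * p + p') = Suc I * p" by (simp add: p')
    have "(T ^^ (Suc I * p)) w \<in> B \<longleftrightarrow> w \<in> C (Suc I)"
      using Suc.prems[of "Suc I * p"] p by (simp del: mult_Suc)
    then show ?thesis unfolding True eq hit_weight_def by simp
  next
    case False
    have "\<not> p dvd Suc (I * p + k)"
    proof
      assume "p dvd Suc (I * p + k)"
      then have "p dvd Suc k" by (metis add_Suc_right dvd_add_right_iff dvd_triv_right)
      then show False using that False p' by (auto dest: dvd_imp_le)
    qed
    moreover have "Suc (I * p + k) \<le> Suc I * p" using that by simp
    ultimately show ?thesis using Suc.prems[of "Suc (I * p + k)"] False by (simp add: hit_weight_def)
  qed
  have "{..<Suc I * p} = {..<I * p} \<union> {I * p..<I * p + p}" by auto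
  then have "(\<Prod>i<Suc I * p. hit_weight B s ((T ^^ Suc i) w))
      = (\<Prod>i<I * p. hit_weight B s ((T ^^ Suc i) w)) * (\<Prod>i\<in>{I * p..<I * p + p}. hit_weight B s ((T ^^ Suc i) w))"
    by (simp add: prod.union_disjoint ivl_disj_int)
  also have "(\<Prod>i\<in>{I * p..<I * p + p}. hit_weight B s ((T ^^ Suc i) w)) = (\<Prod>k<p. hit_weight B s ((T ^^ Suc (I * p + k)) w))"
    using prod.shift_bounds_nat_ivl[of "\<lambda>i. hit_weight B s ((T ^^ Suc i) w)" 0 "I * p" p]
    by (simp only: add_0 add.commute lessThan_atLeast0)
  also have "\<dots> = (\<Prod>k<p. if k = p' then hit_weight (C (Suc I)) s w else 1)"
    by (intro prod.cong) (auto simp only: hw lessThan_iff)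
  also have "\<dots> = hit_weight (C (Suc I)) s w" by (simp add: p' prod.delta)
  also have "(\<Prod>i<I * p. hit_weight B s ((T ^^ Suc i) w)) = (\<Prod>i\<in>{1..I}. hit_weight (C i) s w)"
    by (rule Suc.IH) (use Suc.prems in auto)
  finally show ?case by simp
qed simp

text \<open>Block j consists of the times e j, ..., e (j + 1) - 1 and carries the parameter s j. The
  last block is applied to \<open>G\<close> first because \<open>hit_step\<close> adds times in
  front.\<close>

fun cells :: "('a \<Rightarrow> 'a) \<Rightarrow> 'a set \<Rightarrow> (nat \<Rightarrow> real) \<Rightarrow> (nat \<Rightarrow> nat) \<Rightarrow> nat \<Rightarrow> ('a \<Rightarrow> real) \<Rightarrow> 'a \<Rightarrow> real" where
  "cells T B s e 0 G = G"
| "cells T B s e (Suc K) G = cells T B s e K ((hit_step T B (s K) ^^ (e (Suc K) - e K)) G)"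

lemma cells_eq:
  assumes "mono e" "e 0 = 0"
  shows "cells T B s e K G w
    = (\<Prod>j<K. \<Prod>l\<in>{e j..<e (Suc j)}. hit_weight B (s j) ((T ^^ l) w)) * G ((T ^^ e K) w)"
proof (induction K arbitrary: G)
  case 0 then show ?case using assms by simp
next
  case (Suc K)
  have le: "e K \<le> e (Suc K)" using assms(1) by (simp add: monoD)
  have "(\<Prod>i<e (Suc K) - e K. hit_weight B (s K) ((T ^^ i) ((T ^^ e K) w)))
      = (\<Prod>l\<in>{e K..<e (Suc K)}. hit_weight B (s K) ((T ^^ l) w))"
    using prod.shift_bounds_nat_ivl[of "\<lambda>l. hit_weight B (s K) ((T ^^ l) w)" 0 "e K" "e (Suc K) - e K"] le
    by (simp add: funpow_add[symmetric, THEN fun_cong, unfolded o_apply] lessThan_atLeast0)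
  moreover have "(T ^^ (e (Suc K) - e K)) ((T ^^ e K) w) = (T ^^ e (Suc K)) w"
    using le by (simp add: funpow_add[symmetric, THEN fun_cong, unfolded o_apply])
  ultimately show ?case by (simp add: Suc hit_steps_eq mult.assoc)
qed

section \<open>From one time step to blocks of times\<close>

context baker_srb
begin

text \<open>The weight is 1 - (1 - s) times the indicator of \<open>B\<close>, and invariance
  removes T from the term without the indicator.\<close>

lemma integral_hit_step:
  assumes B: "B \<in> sets borel" "B \<subseteq> unit_square" and F: "unit_fun F" and s: "0 \<le> s" "s \<le> 1"
  shows "(\<integral>w. hit_step T B s F w \<partial>\<mu>) = (\<integral>w. F w \<partial>\<mu>) - (1 - s) * (\<integral>w. indicator B w * F (T w) \<partial>\<mu>)"
    and "0 \<le> (\<integral>w. indicator B w * F (T w) \<partial>\<mu>)" "(\<integral>w. indicator B w * F (T w) \<partial>\<mu>) \<le> measure \<mu> B"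
proof -
  have FT: "unit_fun (\<lambda>w. F (T w))" by (rule unit_fun_baker1[OF F])
  have BF: "unit_fun (\<lambda>w. indicator B w * F (T w))" by (rule unit_fun_mult[OF unit_fun_indicator[OF B(1)] FT])
  have "hit_step T B s F w = F (T w) - (1 - s) * (indicator B w * F (T w))" for w
    by (simp add: hit_step_def hit_weight_def indicator_def algebra_simps)
  then have "(\<integral>w. hit_step T B s F w \<partial>\<mu>) = (\<integral>w. F (T w) \<partial>\<mu>) - (1 - s) * (\<integral>w. indicator B w * F (T w) \<partial>\<mu>)"
    using integrable_unit_fun[OF FT] integrable_unit_fun[OF BF] by simp
  then show "(\<integral>w. hit_step T B s F w \<partial>\<mu>) = (\<integral>w. F w \<partial>\<mu>) - (1 - s) * (\<integral>w. indicator B w * F (T w) \<partial>\<mu>)"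
    by (simp add: integral_T[OF F])
  show "0 \<le> (\<integral>w. indicator B w * F (T w) \<partial>\<mu>)" by (rule integral_\<mu>_bounds[OF BF])
  have "(\<integral>w. indicator B w * F (T w) \<partial>\<mu>) \<le> (\<integral>w. indicator B w \<partial>\<mu>)"
    by (rule integral_mono[OF integrable_unit_fun[OF BF] integrable_unit_fun[OF unit_fun_indicator[OF B(1)]]])
       (use unit_funD(3)[OF FT] in \<open>simp add: indicator_def\<close>)
  also have "\<dots> = measure \<mu> B" using integral_indicator_\<mu>[OF B(1)] B(2) by (simp add: Int_absorb2)
  finally show "(\<integral>w. indicator B w * F (T w) \<partial>\<mu>) \<le> measure \<mu> B" .
qed

lemma integral_hit_steps_loss:
  assumes B: "B \<in> sets borel" "B \<subseteq> unit_square" and G: "hit_fun T B G" and s: "0 \<le> s" "s \<le> 1"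
  shows "\<bar>(\<integral>w. (hit_step T B s ^^ k) G w \<partial>\<mu>) - (\<integral>w. G w \<partial>\<mu>)\<bar> \<le> real k * measure \<mu> B"
proof (induction k)
  case (Suc k)
  let ?F = "(hit_step T B s ^^ k) G"
  have F: "unit_fun ?F" by (rule unit_fun_hit_fun[OF hit_fun_steps[OF G s] B(1)])
  have "0 \<le> (1 - s) * (\<integral>w. indicator B w * ?F (T w) \<partial>\<mu>)" "(1 - s) * (\<integral>w. indicator B w * ?F (T w) \<partial>\<mu>) \<le> 1 * measure \<mu> B"
    using integral_hit_step(2,3)[OF B F s] s
      mult_mono[of "1 - s" 1 "\<integral>w. indicator B w * ?F (T w) \<partial>\<mu>" "measure \<mu> B"] by simp_all
  then show ?case using Suc integral_hit_step(1)[OF B F s]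
    by (simp add: distrib_right abs_le_iff)
qed simp

text \<open>Let W_n be the integral after n steps and V_n the integral over \<open>B\<close> of what
  follows; then W_(n+1) = W_n - (1 - s) V_n. The estimate \<open>key\<close> expresses V_n by the
  integral without the \<open>gap\<close> steps in front, which differs from W_n by at most gap
  \<mu>(B), so V_n is \<kappa> \<mu>(B) W_n up to a small error. The first \<open>gap\<close> steps
  have no room for a gap and cost at most \<mu>(B) each.\<close>

lemma one_cell:
  assumes B: "B \<in> sets borel" "B \<subseteq> unit_square" and s: "0 \<le> s" "s \<le> 1" and \<kappa>: "0 \<le> \<kappa>" "\<kappa> \<le> 1" and \<delta>: "0 \<le> \<delta>"
    and key: "\<And>G. hit_fun T B G \<Longrightarrow>
      \<bar>(\<integral>w. indicator B w * (hit_step T B s ^^ gap) G (T w) \<partial>\<mu>) - \<kappa> * measure \<mu> B * (\<integral>w. G w \<partial>\<mu>)\<bar> \<le> \<delta> * measure \<mu> B"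
    and G: "hit_fun T B G"
  shows "\<bar>(\<integral>w. (hit_step T B s ^^ n) G w \<partial>\<mu>) - (1 - (1 - s) * \<kappa> * measure \<mu> B) ^ n * (\<integral>w. G w \<partial>\<mu>)\<bar>
     \<le> real n * (measure \<mu> B * (\<delta> + real gap * measure \<mu> B)) + real (min n gap) * measure \<mu> B"
proof (induction n)
  case (Suc n)
  let ?F = "(hit_step T B s ^^ n) G" and ?b = "measure \<mu> B"
  let ?E = "\<integral>w. G w \<partial>\<mu>" and ?W = "\<integral>w. ?F w \<partial>\<mu>" and ?V = "\<integral>w. indicator B w * ?F (T w) \<partial>\<mu>"
  define c where "c = (1 - s) * \<kappa> * ?b"
  have b: "0 \<le> ?b" "?b \<le> 1" by simp_all
  have hF: "hit_fun T B ?F" by (rule hit_fun_steps[OF G s])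
  have F: "unit_fun ?F" by (rule unit_fun_hit_fun[OF hF B(1)])
  note W = integral_\<mu>_bounds[OF F]
  have "(1 - s) * \<kappa> \<le> 1" using s \<kappa> by (intro mult_le_one) auto
  then have c: "0 \<le> c" "c \<le> 1" using s \<kappa> b unfolding c_def by (auto intro!: mult_le_one)
  have step: "(\<integral>w. (hit_step T B s ^^ Suc n) G w \<partial>\<mu>) - (1 - c) * ?W = - ((1 - s) * (?V - \<kappa> * ?b * ?W))"
    using integral_hit_step(1)[OF B F s] by (simp add: c_def algebra_simps)
  have V: "\<bar>?V - \<kappa> * ?b * ?W\<bar> \<le> ?b * (\<delta> + real gap * ?b) + (if n < gap then ?b else 0)"
  proof (cases "n < gap")
    case True
    have "\<kappa> * ?b * ?W \<le> 1 * ?b * 1" "0 \<le> \<kappa> * ?b * ?W"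
      using \<kappa> b W by (intro mult_mono mult_nonneg_nonneg; simp)+
    then have "\<bar>?V - \<kappa> * ?b * ?W\<bar> \<le> ?b" using integral_hit_step(2,3)[OF B F s] by (simp add: abs_le_iff)
    moreover have "0 \<le> ?b * (\<delta> + real gap * ?b)" using b \<delta> by (intro mult_nonneg_nonneg add_nonneg_nonneg) auto
    ultimately show ?thesis using True by simp
  next
    case False
    let ?G' = "(hit_step T B s ^^ (n - gap)) G"
    have hG': "hit_fun T B ?G'" by (rule hit_fun_steps[OF G s])
    have FG: "?F = (hit_step T B s ^^ gap) ?G'"
      using False by (simp add: funpow_add[symmetric, THEN fun_cong, unfolded o_apply])
    have 1: "\<bar>?V - \<kappa> * ?b * (\<integral>w. ?G' w \<partial>\<mu>)\<bar> \<le> \<delta> * ?b" unfolding FG by (rule key[OF hG'])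
    have 2: "\<bar>?W - (\<integral>w. ?G' w \<partial>\<mu>)\<bar> \<le> real gap * ?b"
      unfolding FG by (rule integral_hit_steps_loss[OF B hG' s])
    have "\<bar>\<kappa> * ?b * (\<integral>w. ?G' w \<partial>\<mu>) - \<kappa> * ?b * ?W\<bar> = (\<kappa> * ?b) * \<bar>?W - (\<integral>w. ?G' w \<partial>\<mu>)\<bar>"
      using \<kappa> b by (simp add: right_diff_distrib[symmetric] abs_mult abs_minus_commute)
    also have "\<dots> \<le> (1 * ?b) * (real gap * ?b)" using 2 \<kappa> b by (intro mult_mono) auto
    finally have "\<bar>\<kappa> * ?b * (\<integral>w. ?G' w \<partial>\<mu>) - \<kappa> * ?b * ?W\<bar> \<le> ?b * (real gap * ?b)" by simp
    then have "\<bar>?V - \<kappa> * ?b * ?W\<bar> \<le> \<delta> * ?b + ?b * (real gap * ?b)" using 1 by linarith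
    then show ?thesis using False by (simp add: algebra_simps)
  qed
  have "\<bar>(\<integral>w. (hit_step T B s ^^ Suc n) G w \<partial>\<mu>) - (1 - c) * ?W\<bar> = (1 - s) * \<bar>?V - \<kappa> * ?b * ?W\<bar>"
    unfolding step using s by (simp add: abs_mult)
  also have "\<dots> \<le> 1 * \<bar>?V - \<kappa> * ?b * ?W\<bar>" using s by (intro mult_right_mono) auto
  finally have A: "\<bar>(\<integral>w. (hit_step T B s ^^ Suc n) G w \<partial>\<mu>) - (1 - c) * ?W\<bar>
      \<le> ?b * (\<delta> + real gap * ?b) + (if n < gap then ?b else 0)"
    using V by (simp only: mult_1_left)
  \<comment> \<open>The factor 1 - c lies in [0,1], so the errors of earlier steps are not amplified
    and the total is a sum.\<close>
  have "\<bar>(1 - c) * ?W - (1 - c) ^ Suc n * ?E\<bar> = (1 - c) * \<bar>?W - (1 - c) ^ n * ?E\<bar>"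
    using c by (simp add: mult.assoc right_diff_distrib[symmetric] abs_mult)
  also have "\<dots> \<le> 1 * \<bar>?W - (1 - c) ^ n * ?E\<bar>" using c by (intro mult_right_mono) auto
  also have "\<dots> \<le> real n * (?b * (\<delta> + real gap * ?b)) + real (min n gap) * ?b"
    using Suc unfolding c_def by simp
  finally have "\<bar>(1 - c) * ?W - (1 - c) ^ Suc n * ?E\<bar> \<le> real n * (?b * (\<delta> + real gap * ?b)) + real (min n gap) * ?b" .
  moreover have "real (min (Suc n) gap) * ?b = real (min n gap) * ?b + (if n < gap then ?b else 0)"
    by (auto simp: min_def algebra_simps)
  moreover have "real (Suc n) * (?b * (\<delta> + real gap * ?b)) = real n * (?b * (\<delta> + real gap * ?b)) + ?b * (\<delta> + real gap * ?b)"
    by (simp add: distrib_right)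
  ultimately show ?case using A unfolding c_def[symmetric] by linarith
qed simp

text \<open>The last block is resolved first, and its error is multiplied by the factors of the
  blocks in front, which are at most 1; hence the errors of the blocks add.\<close>

lemma cells_error:
  assumes B: "B \<in> sets borel" "B \<subseteq> unit_square" and s: "\<And>j. 0 \<le> s j" "\<And>j. s j \<le> 1"
    and \<kappa>: "\<And>j. 0 \<le> \<kappa> j" "\<And>j. \<kappa> j \<le> 1" and \<delta>: "0 \<le> \<delta>"
    and key: "\<And>j G. j < K \<Longrightarrow> hit_fun T B G \<Longrightarrow>
      \<bar>(\<integral>w. indicator B w * (hit_step T B (s j) ^^ gap) G (T w) \<partial>\<mu>) - \<kappa> j * measure \<mu> B * (\<integral>w. G w \<partial>\<mu>)\<bar> \<le> \<delta> * measure \<mu> B"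
    and G: "hit_fun T B G"
  shows "\<bar>(\<integral>w. cells T B s e K G w \<partial>\<mu>)
      - (\<Prod>j<K. (1 - (1 - s j) * \<kappa> j * measure \<mu> B) ^ (e (Suc j) - e j)) * (\<integral>w. G w \<partial>\<mu>)\<bar>
     \<le> (\<Sum>j<K. real (e (Suc j) - e j) * (measure \<mu> B * (\<delta> + real gap * measure \<mu> B)) + real gap * measure \<mu> B)"
  using key G
proof (induction K arbitrary: G)
  case (Suc K)
  let ?b = "measure \<mu> B" and ?n = "e (Suc K) - e K"
  let ?F = "(hit_step T B (s K) ^^ ?n) G"
  let ?x = "\<lambda>j. 1 - (1 - s j) * \<kappa> j * ?b"
  let ?P = "\<Prod>j<K. ?x j ^ (e (Suc j) - e j)"
  have x: "0 \<le> ?x j" "?x j \<le> 1" for j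
  proof -
    have "(1 - s j) * \<kappa> j * ?b \<le> 1" using s[of j] \<kappa>[of j] by (intro mult_le_one) auto
    then show "0 \<le> ?x j" "?x j \<le> 1" using s[of j] \<kappa>[of j] by auto
  qed
  have P: "0 \<le> ?P" "?P \<le> 1"
    using x by (auto intro!: prod_nonneg prod_le_1 power_le_one zero_le_power)
  have hF: "hit_fun T B ?F" by (rule hit_fun_steps[OF Suc.prems(2) s])
  have 1: "\<bar>(\<integral>w. cells T B s e K ?F w \<partial>\<mu>) - ?P * (\<integral>w. ?F w \<partial>\<mu>)\<bar>
     \<le> (\<Sum>j<K. real (e (Suc j) - e j) * (?b * (\<delta> + real gap * ?b)) + real gap * ?b)"
    by (rule Suc.IH[OF _ hF]) (use Suc.prems(1) in auto)
  have "\<bar>(\<integral>w. ?F w \<partial>\<mu>) - ?x K ^ ?n * (\<integral>w. G w \<partial>\<mu>)\<bar>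
     \<le> real ?n * (?b * (\<delta> + real gap * ?b)) + real (min ?n gap) * ?b"
    by (rule one_cell[OF B s \<kappa> \<delta> _ Suc.prems(2)]) (use Suc.prems(1) in auto)
  also have "\<dots> \<le> real ?n * (?b * (\<delta> + real gap * ?b)) + real gap * ?b"
    by (intro add_left_mono mult_right_mono) auto
  finally have "\<bar>(\<integral>w. ?F w \<partial>\<mu>) - ?x K ^ ?n * (\<integral>w. G w \<partial>\<mu>)\<bar>
     \<le> real ?n * (?b * (\<delta> + real gap * ?b)) + real gap * ?b" .
  then have "\<bar>?P * (\<integral>w. ?F w \<partial>\<mu>) - ?P * (?x K ^ ?n * (\<integral>w. G w \<partial>\<mu>))\<bar>
      \<le> 1 * (real ?n * (?b * (\<delta> + real gap * ?b)) + real gap * ?b)"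
    unfolding right_diff_distrib[symmetric] abs_mult using P by (intro mult_mono) auto
  moreover have "\<bar>x - y\<bar> \<le> A \<Longrightarrow> \<bar>y - z\<bar> \<le> A' \<Longrightarrow> \<bar>x - z\<bar> \<le> A + A'" for x y z A A' :: real
    by linarith
  ultimately have "\<bar>(\<integral>w. cells T B s e K ?F w \<partial>\<mu>) - ?P * (?x K ^ ?n * (\<integral>w. G w \<partial>\<mu>))\<bar>
     \<le> (\<Sum>j<K. real (e (Suc j) - e j) * (?b * (\<delta> + real gap * ?b)) + real gap * ?b)
        + 1 * (real ?n * (?b * (\<delta> + real gap * ?b)) + real gap * ?b)"
    using 1 by blast
  then show ?case by (simp add: mult.assoc)
qed simp

text \<open>\<open>C i\<close> is the set of points of \<open>C 0\<close> that return at the times \<open>p, 2 p, \<dots>, i p\<close>, so on the gap the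
  weight is \<open>s\<close> to the power of the number of \<open>C i\<close>, \<open>i \<ge> 1\<close>, that contain the point, and
  \<open>(1 - q) / (1 - s q) = 1 + (\<Sum>i\<ge>1. (s\<^sup>i - s\<^sup>i\<^sup>-\<^sup>1) q\<^sup>i)\<close>.\<close>

lemma key_estimate:
  fixes hh :: "nat \<Rightarrow> real \<Rightarrow> real" and c :: real
  defines "C \<equiv> \<lambda>i. vertical_section c (hh i)"
  assumes hh: "\<And>i. hh i \<in> borel_measurable borel" "\<And>i x. 0 \<le> hh i x" and c: "c \<in> {0..1}"
    and nested: "\<And>i. C (Suc i) \<subseteq> C i"
    and q: "0 \<le> q" "q < 1" and Cq: "\<And>i. i \<le> I \<Longrightarrow> measure \<mu> (C i) = q ^ i * measure \<mu> (C 0)"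
    and p: "p \<ge> 1" and hits: "\<And>w j. w \<in> C 0 \<Longrightarrow> 1 \<le> j \<Longrightarrow> j \<le> I * p \<Longrightarrow> (T ^^ j) w \<in> C 0 \<longleftrightarrow> p dvd j \<and> w \<in> C (j div p)"
    and gap: "Suc gap = g + g" "I * p \<le> gap"
    and D: "\<And>x x'. x \<in> {0..1} \<Longrightarrow> x' \<in> {0..1} \<Longrightarrow> leaf_dist (\<lambda>w. G ((T ^^ g) w)) x x' \<le> \<epsilon>"
    and s: "0 \<le> s" "s \<le> 1" and G: "hit_fun T (C 0) G"
  shows "\<bar>(\<integral>w. indicator (C 0) w * (hit_step T (C 0) s ^^ gap) G (T w) \<partial>\<mu>)
      - (1 - q) / (1 - s * q) * measure \<mu> (C 0) * (\<integral>w. G w \<partial>\<mu>)\<bar>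
    \<le> (\<Sum>j\<in>{I * p..<gap}. measure \<mu> {w \<in> C 0. (T ^^ Suc j) w \<in> C 0})
      + 2 * (4 * \<epsilon> + 2 / 2 ^ g) + q ^ I * measure \<mu> (C 0)"
proof -
  let ?B = "C 0" and ?G = "\<lambda>w. G ((T ^^ (g + g)) w)" and ?m = "\<integral>w. G w \<partial>\<mu>"
  define \<eta> where "\<eta> = 4 * \<epsilon> + 2 / 2 ^ g"
  have CB: "C i \<in> sets borel" "C i \<subseteq> unit_square" for i
    unfolding C_def using vertical_section_borel[OF hh(1)] by (auto simp: vertical_section_def)
  have C0: "C i \<subseteq> ?B" for i
    using nested by (induction i) auto
  have uG0: "unit_fun G" by (rule unit_fun_hit_fun[OF G CB(1)])
  have uG: "unit_fun ?G" by (rule unit_fun_baker[OF uG0])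
  have m: "0 \<le> ?m" "?m \<le> 1" using integral_\<mu>_bounds[OF uG0] by auto
  have dec: "\<bar>(\<integral>w. indicator (C i) w * ?G w \<partial>\<mu>) - measure \<mu> (C i) * ?m\<bar> \<le> \<eta>" for i
    unfolding C_def \<eta>_def by (rule vertical_section_decorrelation[OF hh(1) hh(2) c uG0 D])
  have \<eta>: "0 \<le> \<eta>" using dec[of 0] by linarith
  have uCG: "unit_fun (\<lambda>w. indicator (C i) w * ?G w)" for i
    by (rule unit_fun_mult[OF unit_fun_indicator[OF CB(1)] uG])
  have iCG: "integrable \<mu> (\<lambda>w. indicator (C i) w * ?G w)" for i
    by (rule integrable_unit_fun[OF uCG])
  let ?P = "\<lambda>n w. \<Prod>i<n. hit_weight ?B s ((T ^^ Suc i) w)"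
  let ?A = "\<lambda>j. {w \<in> ?B. (T ^^ Suc j) w \<in> ?B}"
  have A: "?A j \<in> sets borel" for j
  proof -
    have "?A j = ?B \<inter> ((T ^^ Suc j) -` ?B \<inter> space borel)" by auto
    then show ?thesis using CB(1)[of 0] measurable_sets[OF measurable_baker_iterate CB(1)[of 0]] by (metis sets.Int)
  qed
  have iA: "integrable \<mu> (indicat_real (?A j))" for j by (rule integrable_unit_fun[OF unit_fun_indicator[OF A]])
  have hs: "(hit_step T ?B s ^^ gap) G (T w) = ?P gap w * ?G w" for w
    unfolding hit_steps_eq gap(1)[symmetric] by (simp add: funpow_swap1)
  \<comment> \<open>The weight over the first I p times of the gap, expanded along the nested return
    sets.\<close>
  let ?S = "\<lambda>w. indicator ?B w * ?G w + (\<Sum>i\<in>{1..I}. (s ^ i - s ^ (i - 1)) * (indicator (C i) w * ?G w))"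
  have main: "indicator ?B w * (?P (I * p) w * ?G w) = ?S w" for w
  proof (cases "w \<in> ?B")
    case True
    have "?P (I * p) w = (\<Prod>i\<in>{1..I}. hit_weight (C i) s w)"
      by (rule prod_periodic_hits[OF p]) (rule hits[OF True])
    also have "\<dots> = 1 + (\<Sum>i\<in>{1..I}. (s ^ i - s ^ (i - 1)) * indicator (C i) w)"
      by (rule prod_nested_weights[where C = C]) (rule nested)
    finally have eq: "?P (I * p) w = 1 + (\<Sum>i\<in>{1..I}. (s ^ i - s ^ (i - 1)) * indicator (C i) w)" .
    show ?thesis
      by (simp only: eq indicator_simps(1)[OF True] mult_1_left distrib_right sum_distrib_right mult.assoc)
  next
    case False
    then have "w \<notin> C i" for i using C0 by auto
    then show ?thesis by simp
  qed
  \<comment> \<open>After time I p a factor differs from 1 only at a return, so it is enough to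
    count returns.\<close>
  have diff: "\<bar>indicator ?B w * (hit_step T ?B s ^^ gap) G (T w) - ?S w\<bar> \<le> (\<Sum>j\<in>{I * p..<gap}. indicator (?A j) w)" for w
  proof (cases "w \<in> ?B")
    case True
    have "\<bar>?P gap w - ?P (I * p) w\<bar> \<le> (\<Sum>j\<in>{I * p..<gap}. 1 - hit_weight ?B s ((T ^^ Suc j) w))"
      by (rule abs_prod_diff_le[OF gap(2)]) (use s in \<open>auto simp: hit_weight_def\<close>)
    also have "\<dots> \<le> (\<Sum>j\<in>{I * p..<gap}. indicator (?A j) w)"
      by (rule sum_mono) (use s True in \<open>auto simp: hit_weight_def\<close>)
    finally have "\<bar>?P gap w - ?P (I * p) w\<bar> * \<bar>?G w\<bar> \<le> (\<Sum>j\<in>{I * p..<gap}. indicator (?A j) w) * 1"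
      using unit_funD(4)[OF uG] by (intro mult_mono) (auto intro: sum_nonneg)
    then show ?thesis using True unfolding main[symmetric] hs
      by (simp add: left_diff_distrib[symmetric] abs_mult)
  next
    case False
    then show ?thesis unfolding main[symmetric] by (simp add: sum_nonneg)
  qed
  have iS: "integrable \<mu> ?S"
    by (intro Bochner_Integration.integrable_add Bochner_Integration.integrable_sum integrable_mult_right iCG)
  have uF: "unit_fun (\<lambda>w. indicator ?B w * (hit_step T ?B s ^^ gap) G (T w))"
    by (intro unit_fun_mult unit_fun_indicator CB unit_fun_baker1 unit_fun_hit_fun[OF hit_fun_steps[OF G s]])
  note iF = integrable_unit_fun[OF uF]
  have "\<bar>(\<integral>w. indicator ?B w * (hit_step T ?B s ^^ gap) G (T w) \<partial>\<mu>) - (\<integral>w. ?S w \<partial>\<mu>)\<bar>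
      = \<bar>\<integral>w. indicator ?B w * (hit_step T ?B s ^^ gap) G (T w) - ?S w \<partial>\<mu>\<bar>"
    by (subst Bochner_Integration.integral_diff[OF iF iS]) (rule refl)
  also have "\<dots> \<le> (\<integral>w. \<bar>indicator ?B w * (hit_step T ?B s ^^ gap) G (T w) - ?S w\<bar> \<partial>\<mu>)"
    by (rule integral_abs_bound)
  also have "\<dots> \<le> (\<integral>w. (\<Sum>j\<in>{I * p..<gap}. indicator (?A j) w) \<partial>\<mu>)"
    by (rule integral_mono[OF integrable_abs[OF Bochner_Integration.integrable_diff[OF iF iS]] Bochner_Integration.integrable_sum[OF iA] diff])
  also have "\<dots> = (\<Sum>j\<in>{I * p..<gap}. measure \<mu> (?A j))"
  proof (subst Bochner_Integration.integral_sum[OF iA], rule sum.cong[OF refl])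
    fix j
    have "?A j \<inter> unit_square = ?A j" using CB(2)[of 0] by auto
    then show "(\<integral>w. indicator (?A j) w \<partial>\<mu>) = measure \<mu> (?A j)" using integral_indicator_\<mu>[OF A[of j]] by simp
  qed
  finally have 1: "\<bar>(\<integral>w. indicator ?B w * (hit_step T ?B s ^^ gap) G (T w) \<partial>\<mu>) - (\<integral>w. ?S w \<partial>\<mu>)\<bar>
      \<le> (\<Sum>j\<in>{I * p..<gap}. measure \<mu> (?A j))" .
  define a where "a i = s ^ i - s ^ (i - 1)" for i
  define bm where "bm = measure \<mu> ?B * ?m"
  define X where "X i = (\<integral>w. indicator (C i) w * ?G w \<partial>\<mu>)" for i
  define \<kappa>I where "\<kappa>I = 1 + (\<Sum>i\<in>{1..I}. a i * q ^ i)"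
  have IS: "(\<integral>w. ?S w \<partial>\<mu>) = X 0 + (\<Sum>i\<in>{1..I}. a i * X i)"
    unfolding X_def a_def
    by (subst Bochner_Integration.integral_add)
       (auto intro!: Bochner_Integration.integrable_sum integrable_mult_right iCG simp: Bochner_Integration.integral_sum iCG)
  have dX: "\<bar>X i - q ^ i * bm\<bar> \<le> \<eta>" if "i \<le> I" for i
    using dec[of i] Cq[OF that] by (simp add: X_def bm_def mult.assoc)
  have Seq: "X 0 + (\<Sum>i\<in>{1..I}. a i * X i) - \<kappa>I * bm = (X 0 - q ^ 0 * bm) + (\<Sum>i\<in>{1..I}. a i * (X i - q ^ i * bm))"
    by (simp add: \<kappa>I_def right_diff_distrib sum_subtractf distrib_right sum_distrib_right mult.assoc)
  \<comment> \<open>The absolute values of the coefficients telescope to 1 - s^I, so the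
    decorrelation errors do not accumulate with \<open>I\<close>.\<close>
  have "\<bar>\<Sum>i\<in>{1..I}. a i * (X i - q ^ i * bm)\<bar> \<le> (\<Sum>i\<in>{1..I}. (s ^ (i - 1) - s ^ i) * \<eta>)"
  proof (rule order_trans[OF sum_abs sum_mono])
    fix i assume i: "i \<in> {1..I}"
    have "s ^ i \<le> s ^ (i - 1)" using s by (intro power_decreasing) auto
    then show "\<bar>a i * (X i - q ^ i * bm)\<bar> \<le> (s ^ (i - 1) - s ^ i) * \<eta>"
      using dX[of i] i unfolding a_def by (simp add: abs_mult abs_of_nonpos mult_left_mono)
  qed
  also have "\<dots> = (1 - s ^ I) * \<eta>"
    unfolding sum_distrib_right[symmetric] by (rule arg_cong[where f = "\<lambda>t. t * \<eta>"]) (induction I, auto)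
  also have "\<dots> \<le> 1 * \<eta>" using \<eta> s by (intro mult_right_mono) auto
  finally have "\<bar>X 0 + (\<Sum>i\<in>{1..I}. a i * X i) - \<kappa>I * bm\<bar> \<le> 2 * \<eta>"
    unfolding Seq using dX[of 0] by linarith
  then have 2: "\<bar>(\<integral>w. ?S w \<partial>\<mu>) - \<kappa>I * bm\<bar> \<le> 2 * \<eta>" unfolding IS .
  have bm: "0 \<le> bm" "bm \<le> measure \<mu> ?B" using m by (auto simp: bm_def mult_left_le)
  have "\<bar>\<kappa>I * bm - (1 - q) / (1 - s * q) * bm\<bar> = \<bar>\<kappa>I - (1 - q) / (1 - s * q)\<bar> * bm"
    unfolding left_diff_distrib[symmetric] abs_mult using bm by simp
  also have "\<dots> \<le> q ^ I * measure \<mu> ?B"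
    unfolding \<kappa>I_def a_def using geometric_partial[OF s q, of I] bm q by (intro mult_mono) auto
  finally have 3: "\<bar>\<kappa>I * bm - (1 - q) / (1 - s * q) * bm\<bar> \<le> q ^ I * measure \<mu> ?B" .
  have tri: "\<bar>x - y\<bar> \<le> A \<Longrightarrow> \<bar>y - z\<bar> \<le> A' \<Longrightarrow> \<bar>x - z\<bar> \<le> A + A'" for x y z A A' :: real
    by linarith
  from tri[OF tri[OF 1 2] 3] show ?thesis by (simp only: \<eta>_def bm_def mult.assoc)
qed

end

section \<open>Passage to the limit over blocks\<close>

text \<open>Comparison with exp (- k x) by |a^k - b^k| \<le> k |a - b| and |1 - x - exp (- x)| \<le>
  x^2 leaves an error of at most (k x) x, which tends to 0.\<close>

lemma power_exp_limit:
  fixes x :: "nat \<Rightarrow> real" and k :: "nat \<Rightarrow> nat"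
  assumes x: "\<And>n. 0 \<le> x n" "\<And>n. x n \<le> 1" "x \<longlonglongrightarrow> 0" and kx: "(\<lambda>n. real (k n) * x n) \<longlonglongrightarrow> L"
  shows "(\<lambda>n. (1 - x n) ^ k n) \<longlonglongrightarrow> exp (- L)"
proof -
  have q: "\<bar>(1 - x n) - exp (- x n)\<bar> \<le> (x n)\<^sup>2" for n
  proof -
    have "1 - x n \<le> exp (- x n)" using exp_ge_add_one_self[of "- x n"] by simp
    moreover have "exp (- x n) \<le> 1 - x n + (x n)\<^sup>2"
    proof -
      have "exp (- x n) * (1 + x n) \<le> exp (- x n) * exp (x n)"
        using exp_ge_add_one_self[of "x n"] by (intro mult_left_mono) auto
      then have "exp (- x n) * (1 + x n) \<le> 1" by (simp add: exp_minus)
      also have "1 \<le> (1 - x n + (x n)\<^sup>2) * (1 + x n)"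
        using x(1)[of n] by (simp add: algebra_simps power2_eq_square)
      finally show ?thesis using x(1)[of n] by (simp add: mult_le_cancel_right)
    qed
    ultimately show ?thesis by simp
  qed
  have "(\<lambda>n. exp (- (real (k n) * x n))) \<longlonglongrightarrow> exp (- L)"
    by (intro tendsto_intros kx)
  moreover have "(\<lambda>n. (1 - x n) ^ k n - exp (- (real (k n) * x n))) \<longlonglongrightarrow> 0"
  proof (rule Lim_null_comparison)
    show "\<forall>\<^sub>F n in sequentially. norm ((1 - x n) ^ k n - exp (- (real (k n) * x n))) \<le> (real (k n) * x n) * x n"
    proof (rule always_eventually, rule allI)
      fix n
      have "exp (- (real (k n) * x n)) = exp (- x n) ^ k n" by (simp add: exp_of_nat_mult[symmetric])
      then have "norm ((1 - x n) ^ k n - exp (- (real (k n) * x n))) \<le> real (k n) * norm ((1 - x n) - exp (- x n))"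
        using norm_power_diff[of "1 - x n" "exp (- x n)" "k n"] x(1,2)[of n] by simp
      also have "\<dots> \<le> real (k n) * (x n)\<^sup>2" using q[of n] by (intro mult_left_mono) auto
      finally show "norm ((1 - x n) ^ k n - exp (- (real (k n) * x n))) \<le> (real (k n) * x n) * x n"
        by (simp add: power2_eq_square mult.assoc)
    qed
    show "(\<lambda>n. (real (k n) * x n) * x n) \<longlonglongrightarrow> 0" using tendsto_mult[OF kx x(3)] by simp
  qed
  ultimately show ?thesis using tendsto_add by fastforce
qed

lemma sum_half_powers_le: "(\<Sum>j\<in>{a..<b}. (1/2::real) ^ Suc j) \<le> (1/2) ^ a"
proof (cases "a \<le> b")
  case True
  then have "(\<Sum>j\<in>{a..<b}. (1/2::real) ^ Suc j) = (1/2) ^ a - (1/2) ^ b"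
    by (induction b rule: dec_induct) auto
  then show ?thesis by simp
qed simp

text \<open>For v, m > 0 this is the first time l with l / v \<ge> j / m, so the times whose
  rescaled position lies in grid cell j form a block.\<close>

definition cell_start :: "nat \<Rightarrow> nat \<Rightarrow> nat \<Rightarrow> nat" where
  "cell_start m v j = nat \<lceil>real j * real v / real m\<rceil>"

lemma cell_start_le_iff: "m > 0 \<Longrightarrow> cell_start m v j \<le> l \<longleftrightarrow> real j * real v \<le> real l * real m"
  by (simp add: cell_start_def nat_le_iff ceiling_le_iff field_simps)

lemma mono_cell_start: "mono (cell_start m v)"
  unfolding cell_start_def
  by (intro monoI nat_mono ceiling_mono divide_right_mono mult_right_mono) auto

lemma cell_start_0 [simp]: "cell_start m v 0 = 0"
  by (simp add: cell_start_def)

lemma cell_start_approx: "\<bar>real (cell_start m v j) - real j * real v / real m\<bar> \<le> 1"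
proof -
  have "0 \<le> real j * real v / real m" by simp
  then show ?thesis unfolding cell_start_def by linarith
qed

text \<open>\<open>B\<^sub>n\<close> is the vertical section of height \<open>hh n 0\<close>, the points of \<open>B\<^sub>n\<close> that return \<open>i\<close> times with
  period \<open>p\<close> form the one of height \<open>hh n i\<close>, and \<open>2 g(n)\<close> is the length of the gap. A nonperiodic
  point is covered by \<open>q = 0\<close>, \<open>p = 1\<close> and \<open>hh n i = 0\<close> for \<open>i \<ge> 1\<close>.\<close>

locale baker_hits = baker_srb +
  fixes hh :: "nat \<Rightarrow> nat \<Rightarrow> real \<Rightarrow> real" and c :: real and q :: real and p :: nat
    and g :: "nat \<Rightarrow> nat" and v :: "nat \<Rightarrow> nat" and \<tau> K \<rho> C0 :: real and r :: "nat \<Rightarrow> real"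
  assumes hh: "\<And>n i. hh n i \<in> borel_measurable borel" "\<And>n i x. 0 \<le> hh n i x"
    and c: "c \<in> {0..1}"
    and nested: "\<And>n i x. hh n (Suc i) x \<le> hh n i x"
    and q: "0 \<le> q" "q < 1" and p: "p \<ge> 1"
    and rho: "0 \<le> \<rho>" "\<rho> < 1" and C0: "0 \<le> C0" and K: "0 \<le> K"
    and mass: "\<And>I. \<forall>\<^sub>F n in sequentially. \<forall>i\<le>I.
        measure \<mu> (vertical_section c (hh n i)) = q ^ i * measure \<mu> (vertical_section c (hh n 0))"
    and hits: "\<And>I. \<forall>\<^sub>F n in sequentially. \<forall>w j. w \<in> vertical_section c (hh n 0) \<longrightarrow> 1 \<le> j \<longrightarrow> j \<le> I \<longrightarrow>
        ((T ^^ j) w \<in> vertical_section c (hh n 0) \<longleftrightarrow> p dvd j \<and> w \<in> vertical_section c (hh n (j div p)))"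
    and osc: "\<And>n j x x'. x \<in> {0..1} \<Longrightarrow> x' \<in> {0..1} \<Longrightarrow>
        leaf_dist (\<lambda>w. indicator (vertical_section c (hh n 0)) ((T ^^ j) w)) x x' \<le> C0 * \<rho> ^ j"
    and return: "\<forall>\<^sub>F n in sequentially. \<forall>j. measure \<mu> {w \<in> vertical_section c (hh n 0). (T ^^ j) w \<in> vertical_section c (hh n 0)}
        \<le> K * measure \<mu> (vertical_section c (hh n 0)) * (r n + (1/2) ^ j)"
    and g_top: "filterlim g at_top sequentially" and gr: "(\<lambda>n. real (g n) * r n) \<longlonglongrightarrow> 0"
    and g\<beta>: "(\<lambda>n. real (g n) * measure \<mu> (vertical_section c (hh n 0))) \<longlonglongrightarrow> 0"
    and \<rho>g: "(\<lambda>n. \<rho> ^ g n / measure \<mu> (vertical_section c (hh n 0))) \<longlonglongrightarrow> 0"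
    and half_g: "(\<lambda>n. (1/2) ^ g n / measure \<mu> (vertical_section c (hh n 0))) \<longlonglongrightarrow> 0"
    and \<beta>0: "(\<lambda>n. measure \<mu> (vertical_section c (hh n 0))) \<longlonglongrightarrow> 0"
    and \<beta>pos: "\<forall>\<^sub>F n in sequentially. measure \<mu> (vertical_section c (hh n 0)) > 0"
    and r: "\<And>n. 0 \<le> r n"
    and v\<tau>: "(\<lambda>n. real (v n) * measure \<mu> (vertical_section c (hh n 0))) \<longlonglongrightarrow> \<tau>"
begin

abbreviation B :: "nat \<Rightarrow> (real \<times> real) set" where "B n \<equiv> vertical_section c (hh n 0)"
abbreviation \<beta> :: "nat \<Rightarrow> real" where "\<beta> n \<equiv> measure \<mu> (B n)"
abbreviation gap :: "nat \<Rightarrow> nat" where "gap n \<equiv> 2 * g n - 1"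

lemma B_borel: "B n \<in> sets borel" and B_unit: "B n \<subseteq> unit_square"
  using vertical_section_borel[OF hh(1)] by (auto simp: vertical_section_def)

text \<open>All \<open>s\<close> and \<open>G\<close> are covered at one \<open>n\<close>, because
  the estimate is used at every step of every block. The number \<open>I\<close> of returns treated
  exactly is fixed by \<delta> before \<open>n\<close> grows; relative to \<beta> n, the later
  returns in the gap contribute at most K times a geometric tail 2^-I plus 2 g r.\<close>

lemma key_estimate_eventually:
  assumes \<delta>: "\<delta> > 0"
  shows "\<forall>\<^sub>F n in sequentially. \<forall>(s::real) G. 0 \<le> s \<longrightarrow> s \<le> 1 \<longrightarrow> hit_fun T (B n) G \<longrightarrow>
    \<bar>(\<integral>w. indicator (B n) w * (hit_step T (B n) s ^^ gap n) G (T w) \<partial>\<mu>)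
      - (1 - q) / (1 - s * q) * \<beta> n * (\<integral>w. G w \<partial>\<mu>)\<bar> \<le> \<delta> * \<beta> n"
proof -
  have "(\<lambda>I. K * (1/2) ^ I + q ^ I) \<longlonglongrightarrow> K * 0 + 0"
    using q by (intro tendsto_intros LIMSEQ_power_zero) auto
  then have "\<forall>\<^sub>F I in sequentially. K * (1/2) ^ I + q ^ I < \<delta> / 2"
    using \<delta> by (intro order_tendstoD) auto
  then obtain I where I: "K * (1/2) ^ I + q ^ I < \<delta> / 2"
    by (auto simp: eventually_sequentially)
  \<comment> \<open>The part of the error, relative to \<beta> n, that vanishes as \<open>n\<close>
    grows: returns by chance, loss of memory of the leaf, and incomplete leaves.\<close>
  define err where "err n = 2 * K * (real (g n) * r n) + (8 * (C0 / (1 - \<rho>)) * (\<rho> ^ g n / \<beta> n) + 4 * ((1/2) ^ g n / \<beta> n))" for n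
  have "err \<longlonglongrightarrow> 2 * K * 0 + (8 * (C0 / (1 - \<rho>)) * 0 + 4 * 0)"
    unfolding err_def by (intro tendsto_intros gr \<rho>g half_g)
  then have e1: "\<forall>\<^sub>F n in sequentially. err n < \<delta> / 2"
    using \<delta> by (intro order_tendstoD) auto
  have e2: "\<forall>\<^sub>F n in sequentially. g n \<ge> I * p + 1"
    using g_top by (simp add: filterlim_at_top)
  show ?thesis
    using e1 e2 \<beta>pos return mass[of I] hits[of "I * p"]
  proof eventually_elim
    case (elim n)
    show ?case
    proof (intro allI impI)
      fix s :: real and G assume s: "0 \<le> s" "s \<le> 1" and G: "hit_fun T (B n) G"
      have gap: "Suc (gap n) = g n + g n" "I * p \<le> gap n" using elim(2) by auto
      have "\<bar>(\<integral>w. indicator (B n) w * (hit_step T (B n) s ^^ gap n) G (T w) \<partial>\<mu>)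
        - (1 - q) / (1 - s * q) * \<beta> n * (\<integral>w. G w \<partial>\<mu>)\<bar>
        \<le> (\<Sum>j\<in>{I * p..<gap n}. measure \<mu> {w \<in> B n. (T ^^ Suc j) w \<in> B n})
          + 2 * (4 * (C0 * \<rho> ^ g n / (1 - \<rho>)) + 2 / 2 ^ g n) + q ^ I * \<beta> n"
      proof (rule key_estimate[where hh = "hh n", OF hh c _ q _ p _ gap _ s G])
        show "vertical_section c (hh n (Suc i)) \<subseteq> vertical_section c (hh n i)" for i
          using nested[of n i] by (auto simp: vertical_section_def intro: less_le_trans)
        show "leaf_dist (\<lambda>w. G ((T ^^ g n) w)) x x' \<le> C0 * \<rho> ^ g n / (1 - \<rho>)" if "x \<in> {0..1}" "x' \<in> {0..1}" for x x'
          by (rule leaf_dist_hit_fun[OF B_borel rho osc G that])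
        show "measure \<mu> (vertical_section c (hh n i)) = q ^ i * \<beta> n" if "i \<le> I" for i
          using elim(5) that by blast
        show "((T ^^ j) w \<in> B n) = (p dvd j \<and> w \<in> vertical_section c (hh n (j div p)))"
          if "w \<in> B n" "1 \<le> j" "j \<le> I * p" for w j
          using elim(6) that by blast
      qed
      also have "(\<Sum>j\<in>{I * p..<gap n}. measure \<mu> {w \<in> B n. (T ^^ Suc j) w \<in> B n})
          \<le> (\<Sum>j\<in>{I * p..<gap n}. K * \<beta> n * (r n + (1/2) ^ Suc j))"
        using elim(4) by (intro sum_mono) blast
      also have "\<dots> = K * \<beta> n * (real (gap n - I * p) * r n + (\<Sum>j\<in>{I * p..<gap n}. (1/2) ^ Suc j))"
        by (simp add: sum_distrib_left[symmetric] sum.distrib)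
      also have "\<dots> \<le> K * \<beta> n * (2 * real (g n) * r n + (1/2) ^ I)"
      proof (intro mult_left_mono add_mono mult_right_mono)
        have "(\<Sum>j\<in>{I * p..<gap n}. (1/2::real) ^ Suc j) \<le> (1/2) ^ (I * p)" by (rule sum_half_powers_le)
        also have "\<dots> \<le> (1/2) ^ I" using p by (intro power_decreasing) auto
        finally show "(\<Sum>j\<in>{I * p..<gap n}. (1/2::real) ^ Suc j) \<le> (1/2) ^ I" .
      qed (use K r in \<open>auto\<close>)
      finally have "\<bar>(\<integral>w. indicator (B n) w * (hit_step T (B n) s ^^ gap n) G (T w) \<partial>\<mu>)
        - (1 - q) / (1 - s * q) * \<beta> n * (\<integral>w. G w \<partial>\<mu>)\<bar>
        \<le> K * \<beta> n * (2 * real (g n) * r n + (1/2) ^ I)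
          + 2 * (4 * (C0 * \<rho> ^ g n / (1 - \<rho>)) + 2 / 2 ^ g n) + q ^ I * \<beta> n" by simp
      also have "\<dots> = (err n + (K * (1/2) ^ I + q ^ I)) * \<beta> n"
        using elim(3) less_imp_neq[OF rho(2)] unfolding err_def by (simp add: field_simps power_one_over)
      also have "\<dots> \<le> \<delta> * \<beta> n"
        using elim(1,3) I by (intro mult_right_mono) auto
      finally show "\<bar>(\<integral>w. indicator (B n) w * (hit_step T (B n) s ^^ gap n) G (T w) \<partial>\<mu>)
        - (1 - q) / (1 - s * q) * \<beta> n * (\<integral>w. G w \<partial>\<mu>)\<bar> \<le> \<delta> * \<beta> n" .
    qed
  qed
qed

lemma cell_length_limit:
  "(\<lambda>n. real (cell_start m (v n) (Suc j) - cell_start m (v n) j) * \<beta> n) \<longlonglongrightarrow> \<tau> / real m"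
proof -
  have e: "(\<lambda>n. real (cell_start m (v n) i) * \<beta> n) \<longlonglongrightarrow> real i / real m * \<tau>" for i
  proof -
    have "(\<lambda>n. real (cell_start m (v n) i) * \<beta> n - real i / real m * (real (v n) * \<beta> n)) \<longlonglongrightarrow> 0"
    proof (rule Lim_null_comparison[OF always_eventually \<beta>0], rule allI)
      fix n
      have "real (cell_start m (v n) i) * \<beta> n - real i / real m * (real (v n) * \<beta> n)
        = (real (cell_start m (v n) i) - real i * real (v n) / real m) * \<beta> n" by (simp add: left_diff_distrib)
      then show "norm (real (cell_start m (v n) i) * \<beta> n - real i / real m * (real (v n) * \<beta> n)) \<le> \<beta> n"
        using mult_right_mono[OF cell_start_approx[of m "v n" i], of "\<beta> n"] by (simp add: abs_mult)
    qed
    moreover have "(\<lambda>n. real i / real m * (real (v n) * \<beta> n)) \<longlonglongrightarrow> real i / real m * \<tau>"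
      by (intro tendsto_intros v\<tau>)
    ultimately show ?thesis using tendsto_add by fastforce
  qed
  have "(\<lambda>n. real (cell_start m (v n) (Suc j)) * \<beta> n - real (cell_start m (v n) j) * \<beta> n)
     \<longlonglongrightarrow> real (Suc j) / real m * \<tau> - real j / real m * \<tau>"
    by (intro tendsto_diff e)
  moreover have "real (Suc j) / real m * \<tau> - real j / real m * \<tau> = \<tau> / real m"
    by (cases "m = 0") (auto simp: field_simps)
  moreover have "real (cell_start m (v n) (Suc j)) * \<beta> n - real (cell_start m (v n) j) * \<beta> n
     = real (cell_start m (v n) (Suc j) - cell_start m (v n) j) * \<beta> n" for n
    using monoD[OF mono_cell_start[of m "v n"], of j "Suc j"] by (simp add: left_diff_distrib of_nat_diff)
  ultimately show ?thesis by simp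
qed

text \<open>A block has about (\<tau> / m) / \<beta> n steps, each with relative error \<delta> plus
  a correction gap n \<beta> n that tends to 0. In the limit the accumulated error is (\<tau> / m)
  \<delta> for each block, and \<delta> is arbitrary.\<close>

lemma cells_limit:
  assumes s: "\<And>j. 0 \<le> s j" "\<And>j. s j \<le> 1"
  shows "(\<lambda>n. \<integral>w. cells T (B n) s (cell_start m (v n)) J (\<lambda>_. 1) w \<partial>\<mu>)
     \<longlonglongrightarrow> (\<Prod>j<J. exp (- ((1 - s j) * ((1 - q) / (1 - s j * q)) * (\<tau> / real m))))"
proof -
  define \<kappa> where "\<kappa> j = (1 - q) / (1 - s j * q)" for j
  have \<kappa>: "0 \<le> \<kappa> j" "\<kappa> j \<le> 1" for j
  proof -
    have "s j * q \<le> 1 * q" using s q by (intro mult_right_mono) auto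
    then show "0 \<le> \<kappa> j" "\<kappa> j \<le> 1" using q by (auto simp: \<kappa>_def field_simps)
  qed
  let ?e = "\<lambda>n. cell_start m (v n)"
  let ?n = "\<lambda>n j. real (?e n (Suc j) - ?e n j)"
  let ?P = "\<lambda>n. \<Prod>j<J. (1 - (1 - s j) * \<kappa> j * \<beta> n) ^ (?e n (Suc j) - ?e n j)"
  have P: "?P \<longlonglongrightarrow> (\<Prod>j<J. exp (- ((1 - s j) * \<kappa> j * (\<tau> / real m))))"
  proof (intro tendsto_prod power_exp_limit)
    fix j
    show "0 \<le> (1 - s j) * \<kappa> j * \<beta> n" for n using s \<kappa> by simp
    show "(1 - s j) * \<kappa> j * \<beta> n \<le> 1" for n using s \<kappa> by (intro mult_le_one) auto
    have "(\<lambda>n. (1 - s j) * \<kappa> j * \<beta> n) \<longlonglongrightarrow> (1 - s j) * \<kappa> j * 0" by (intro tendsto_intros \<beta>0)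
    then show "(\<lambda>n. (1 - s j) * \<kappa> j * \<beta> n) \<longlonglongrightarrow> 0" by simp
    have "(\<lambda>n. (1 - s j) * \<kappa> j * (?n n j * \<beta> n)) \<longlonglongrightarrow> (1 - s j) * \<kappa> j * (\<tau> / real m)"
      by (intro tendsto_intros cell_length_limit)
    then show "(\<lambda>n. ?n n j * ((1 - s j) * \<kappa> j * \<beta> n)) \<longlonglongrightarrow> (1 - s j) * \<kappa> j * (\<tau> / real m)"
      by (simp add: mult_ac)
  qed
  have "(\<lambda>n. (\<integral>w. cells T (B n) s (?e n) J (\<lambda>_. 1) w \<partial>\<mu>) - ?P n) \<longlonglongrightarrow> 0"
  proof (rule tendstoI)
    fix \<epsilon> :: real assume \<epsilon>: "\<epsilon> > 0"
    \<comment> \<open>The summand 1 keeps the divisor in \<delta> positive, also for J = 0.\<close>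
    define Z where "Z = \<bar>real J * (\<tau> / real m)\<bar> + 1"
    have Z: "Z > 0" "real J * (\<tau> / real m) \<le> Z"
      unfolding Z_def by (rule add_nonneg_pos[OF abs_ge_zero zero_less_one],
        rule add_increasing2[OF zero_le_one abs_ge_self])
    define \<delta> where "\<delta> = \<epsilon> / (2 * Z)"
    have \<delta>: "\<delta> > 0"
      unfolding \<delta>_def using Z \<epsilon> by simp
    have g2: "(\<lambda>n. real (gap n) * \<beta> n) \<longlonglongrightarrow> 0"
    proof (rule Lim_null_comparison[OF always_eventually])
      show "\<forall>n. norm (real (gap n) * \<beta> n) \<le> 2 * (real (g n) * \<beta> n)"
        by (auto simp: abs_mult mult.assoc[symmetric] intro!: mult_right_mono)
      show "(\<lambda>n. 2 * (real (g n) * \<beta> n)) \<longlonglongrightarrow> 0" using tendsto_mult_right_zero[OF g\<beta>] .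
    qed
    let ?err = "\<lambda>n. \<Sum>j<J. ?n n j * (\<beta> n * (\<delta> + real (gap n) * \<beta> n)) + real (gap n) * \<beta> n"
    have "(\<lambda>n. \<Sum>j<J. (?n n j * \<beta> n) * (\<delta> + real (gap n) * \<beta> n) + real (gap n) * \<beta> n)
      \<longlonglongrightarrow> (\<Sum>j<J. (\<tau> / real m) * (\<delta> + 0) + 0)"
      by (intro tendsto_intros cell_length_limit g2)
    then have "?err \<longlonglongrightarrow> real J * (\<tau> / real m) * \<delta>" by (simp add: mult.assoc)
    moreover have "real J * (\<tau> / real m) * \<delta> < \<epsilon>"
    proof -
      have "real J * (\<tau> / real m) * \<delta> \<le> Z * \<delta>"
        by (rule mult_right_mono[OF Z(2) less_imp_le[OF \<delta>]])
      also have "\<dots> = \<epsilon> / 2" using Z by (simp add: \<delta>_def)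
      also have "\<dots> < \<epsilon>" using \<epsilon> by simp
      finally show ?thesis .
    qed
    ultimately have "\<forall>\<^sub>F n in sequentially. ?err n < \<epsilon>" by (rule order_tendstoD)
    then show "\<forall>\<^sub>F n in sequentially. dist ((\<integral>w. cells T (B n) s (?e n) J (\<lambda>_. 1) w \<partial>\<mu>) - ?P n) 0 < \<epsilon>"
      using key_estimate_eventually[OF \<delta>]
    proof eventually_elim
      case (elim n)
      have "\<bar>(\<integral>w. cells T (B n) s (?e n) J (\<lambda>_. 1) w \<partial>\<mu>) - ?P n * (\<integral>w. 1 \<partial>\<mu>)\<bar> \<le> ?err n"
      proof (rule cells_error[OF B_borel B_unit s \<kappa> less_imp_le[OF \<delta>] _ hit_fun.one])
        show "\<bar>(\<integral>w. indicator (B n) w * (hit_step T (B n) (s j) ^^ gap n) G (T w) \<partial>\<mu>)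
          - \<kappa> j * \<beta> n * (\<integral>w. G w \<partial>\<mu>)\<bar> \<le> \<delta> * \<beta> n" if "hit_fun T (B n) G" for j G
          using elim(2) that s unfolding \<kappa>_def by blast
      qed
      then show ?case using elim(1) by (simp add: prob_space)
    qed
  qed
  from tendsto_add[OF this P] show ?thesis by (simp add: \<kappa>_def)
qed

end

section \<open>Balls and their returns\<close>

text \<open>Half the vertical chord of the Euclidean disc; the truncation at 0 makes it vanish off
  the disc.\<close>

definition disc_height :: "real \<Rightarrow> real \<Rightarrow> real \<Rightarrow> real" where
  "disc_height a r x = sqrt (max 0 (r\<^sup>2 - (x - a)\<^sup>2))"

lemma disc_height_borel [measurable]: "disc_height a r \<in> borel_measurable borel"
  unfolding disc_height_def[abs_def] by measurable

lemma disc_height_nonneg: "0 \<le> disc_height a r x"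
  by (simp add: disc_height_def)

text \<open>The boundary of a disc has vertical tangents, so chords are not Lipschitz functions with
  a constant uniform in \<open>r\<close>. The inequality |sqrt A - sqrt B| \<le> sqrt |A - B| gives
  Hoelder exponent 1/2 with a constant that is.\<close>

lemma disc_height_diff:
  assumes "x \<in> {0..1}" "x' \<in> {0..1}" "a \<in> {0..1}"
  shows "\<bar>disc_height a r x - disc_height a r x'\<bar> \<le> sqrt (2 * \<bar>x - x'\<bar>)"
proof -
  have sq: "\<bar>sqrt A - sqrt A'\<bar> \<le> sqrt \<bar>A - A'\<bar>" if "0 \<le> A" "0 \<le> A'" for A A' :: real
    using that
  proof (induction A A' rule: linorder_wlog)
    case (le A A')
    have "sqrt A' = sqrt (A + (A' - A))" by simp
    also have "\<dots> \<le> sqrt A + sqrt (A' - A)" using le by (intro sqrt_add_le_add_sqrt) auto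
    finally show ?case using le by (simp add: abs_if)
  next
    case (sym A A') then show ?case by (simp add: abs_minus_commute)
  qed
  have "(x' - a)\<^sup>2 - (x - a)\<^sup>2 = (x' - x) * ((x' - a) + (x - a))" by (simp add: power2_eq_square algebra_simps)
  then have "\<bar>(x' - a)\<^sup>2 - (x - a)\<^sup>2\<bar> = \<bar>x - x'\<bar> * \<bar>(x' - a) + (x - a)\<bar>" by (simp add: abs_mult abs_minus_commute)
  also have "\<dots> \<le> \<bar>x - x'\<bar> * 2" using assms by (intro mult_left_mono) auto
  finally have d: "\<bar>(x' - a)\<^sup>2 - (x - a)\<^sup>2\<bar> \<le> 2 * \<bar>x - x'\<bar>" by simp
  have "\<bar>disc_height a r x - disc_height a r x'\<bar> \<le> sqrt \<bar>max 0 (r\<^sup>2 - (x - a)\<^sup>2) - max 0 (r\<^sup>2 - (x' - a)\<^sup>2)\<bar>"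
    unfolding disc_height_def by (rule sq) auto
  also have "\<dots> \<le> sqrt (2 * \<bar>x - x'\<bar>)"
    using d by (intro real_sqrt_le_mono) (auto simp: max_def)
  finally show ?thesis .
qed

section \<open>Mass bounds for the transverse measure\<close>

context baker_srb
begin

text \<open>Invariance applied to a function that is constant on leaves; T sends the two halves of
  every leaf to the two branches, each with weight 1/2.\<close>

lemma \<nu>_self_similar:
  assumes S: "S \<in> sets borel"
  shows "measure \<nu> S = (measure \<nu> {x. \<gamma> * x \<in> S} + measure \<nu> {x. 1 - \<gamma> + \<gamma> * x \<in> S}) / 2"
proof -
  let ?\<phi> = "\<lambda>w. indicator S (fst w) :: real"
  have "fst -` S \<inter> space borel \<in> sets (borel :: (real \<times> real) measure)"
    by (rule measurable_sets[OF _ S]) (simp add: borel_prod[symmetric])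
  then have "fst -` S \<in> sets (borel :: (real \<times> real) measure)" by simp
  then have "unit_fun (indicator (fst -` S))" by (rule unit_fun_indicator)
  moreover have e: "?\<phi> = indicator (fst -` S)" by (auto simp: indicator_def)
  ultimately have u: "unit_fun ?\<phi>" unfolding e by simp
  have c: "cell_int ?\<phi> x 1 = indicator S x" for x
    by (simp add: cell_int_def int0_const)
  have m: "{x. \<gamma> * x \<in> S} \<in> sets borel" "{x. 1 - \<gamma> + \<gamma> * x \<in> S} \<in> sets borel"
    using S by measurable
  have "(\<integral>w. ?\<phi> w \<partial>\<mu>) = measure \<nu> S"
    unfolding integral_\<mu>[OF u] c using S by simp
  moreover have "(\<integral>w. ?\<phi> (T w) \<partial>\<mu>) = (\<integral>x. (indicator {x. \<gamma> * x \<in> S} x + indicator {x. 1 - \<gamma> + \<gamma> * x \<in> S} x) / 2 \<partial>\<nu>)"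
  proof -
    have "cell_int (\<lambda>w. ?\<phi> (T w)) x 1 = (indicator {x. \<gamma> * x \<in> S} x + indicator {x. 1 - \<gamma> + \<gamma> * x \<in> S} x) / 2" for x
      using cell_int_baker_high[OF u, of 1 \<gamma> x] unfolding c by (simp add: c) (simp add: indicator_def)
    then show ?thesis unfolding integral_\<mu>[OF unit_fun_baker1[OF u]] by (simp only:)
  qed
  moreover have "\<dots> = (measure \<nu> {x. \<gamma> * x \<in> S} + measure \<nu> {x. 1 - \<gamma> + \<gamma> * x \<in> S}) / 2"
    using m by (simp add: integrable_indicator_iff \<nu>.emeasure_finite less_top[symmetric])
  ultimately show ?thesis using integral_T[OF u] by simp
qed

lemma \<nu>_disjoint_unit:
  assumes "S \<in> sets borel" "S \<inter> {0..1} = {}"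
  shows "measure \<nu> S = 0"
proof -
  have "AE x in \<nu>. x \<notin> S" using AE_\<nu> by eventually_elim (use assms in auto)
  then show ?thesis using assms(1) by (subst (asm) AE_iff_measurable[of S]) (auto simp: measure_def)
qed

text \<open>The images of [0,1] under the two contractions are separated by a gap of length 1 - 2
  \<gamma>. A shorter interval meets at most one of them, so its mass is at most half that of its
  preimage under this contraction, which is longer by the factor 1 / \<gamma>.\<close>

lemma \<nu>_interval_upper:
  assumes "b - a < (1 - 2 * \<gamma>) * \<gamma> ^ k"
  shows "measure \<nu> {a..b} \<le> (1/2) ^ k"
  using assms
proof (induction k arbitrary: a b)
  case (Suc k)
  have i0: "{x. \<gamma> * x \<in> {a..b}} = {a / \<gamma>..b / \<gamma>}" using \<gamma> by (auto simp: field_simps)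
  have i1: "{x. 1 - \<gamma> + \<gamma> * x \<in> {a..b}} = {(a - (1 - \<gamma>)) / \<gamma>..(b - (1 - \<gamma>)) / \<gamma>}"
    using \<gamma> by (auto simp: field_simps)
  have len: "(b - a) / \<gamma> < (1 - 2 * \<gamma>) * \<gamma> ^ k" using Suc.prems \<gamma> by (simp add: field_simps)
  have u0: "measure \<nu> {a / \<gamma>..b / \<gamma>} \<le> (1/2) ^ k"
    using len by (intro Suc.IH) (simp add: diff_divide_distrib)
  have u1: "measure \<nu> {(a - (1 - \<gamma>)) / \<gamma>..(b - (1 - \<gamma>)) / \<gamma>} \<le> (1/2) ^ k"
    using len by (intro Suc.IH) (simp add: diff_divide_distrib)
  have "(1 - 2 * \<gamma>) * \<gamma> ^ Suc k \<le> (1 - 2 * \<gamma>) * 1"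
    using \<gamma> by (intro mult_left_mono power_le_one) auto
  then have "b - a < 1 - 2 * \<gamma>" using Suc.prems by simp
  then have "a > \<gamma> \<or> b < 1 - \<gamma>" by linarith
  then have "measure \<nu> {a / \<gamma>..b / \<gamma>} = 0 \<or> measure \<nu> {(a - (1 - \<gamma>)) / \<gamma>..(b - (1 - \<gamma>)) / \<gamma>} = 0"
  proof
    assume "a > \<gamma>"
    then have "a / \<gamma> > 1" using \<gamma> by simp
    then show ?thesis by (intro disjI1 \<nu>_disjoint_unit) auto
  next
    assume "b < 1 - \<gamma>"
    then have "(b - (1 - \<gamma>)) / \<gamma> < 0" using \<gamma> by (simp add: divide_neg_pos)
    then show ?thesis by (intro disjI2 \<nu>_disjoint_unit) auto
  qed
  then show ?case
    using u0 u1 \<nu>_self_similar[of "{a..b}"] unfolding i0 i1 by auto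
qed simp

text \<open>The topological support of \<open>\<nu>\<close>.\<close>

definition supp :: "real \<Rightarrow> bool" where
  "supp x \<longleftrightarrow> (\<forall>\<epsilon>>0. measure \<nu> {y. \<bar>y - x\<bar> < \<epsilon>} > 0)"

lemma ball_borel [measurable]: "{y :: real. \<bar>y - x\<bar> < \<epsilon>} \<in> sets borel" "{y :: real. \<bar>y - x\<bar> \<le> \<epsilon>} \<in> sets borel"
  by measurable

lemma supp_unit:
  assumes "supp x"
  shows "x \<in> {0..1}"
proof (rule ccontr)
  assume x: "x \<notin> {0..1}"
  define \<epsilon> where "\<epsilon> = (if x < 0 then - x else x - 1)"
  have "\<epsilon> > 0" using x by (auto simp: \<epsilon>_def)
  moreover have "{y. \<bar>y - x\<bar> < \<epsilon>} \<inter> {0..1} = {}" using x by (auto simp: \<epsilon>_def abs_less_iff split: if_splits)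
  ultimately show False using assms \<nu>_disjoint_unit[of "{y. \<bar>y - x\<bar> < \<epsilon>}"] by (auto simp: supp_def)
qed

text \<open>If both candidate preimages had null neighbourhoods, self-similarity would give
  \<open>x\<close> one as well.\<close>

lemma supp_branch:
  assumes "supp x"
  obtains w where "supp w" "x = \<gamma> * w" | w where "supp w" "x = 1 - \<gamma> + \<gamma> * w"
proof -
  let ?w0 = "x / \<gamma>" and ?w1 = "(x - (1 - \<gamma>)) / \<gamma>"
  have i0: "{y. \<gamma> * y \<in> {y. \<bar>y - x\<bar> < \<epsilon>}} = {y. \<bar>y - ?w0\<bar> < \<epsilon> / \<gamma>}" for \<epsilon>
    using \<gamma> by (auto simp: abs_less_iff field_simps)
  have i1: "{y. 1 - \<gamma> + \<gamma> * y \<in> {y. \<bar>y - x\<bar> < \<epsilon>}} = {y. \<bar>y - ?w1\<bar> < \<epsilon> / \<gamma>}" for \<epsilon>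
    using \<gamma> by (auto simp: abs_less_iff field_simps)
  have "supp ?w0 \<or> supp ?w1"
  proof (rule ccontr)
    assume "\<not> (supp ?w0 \<or> supp ?w1)"
    then obtain \<epsilon>0 \<epsilon>1 where e: "\<epsilon>0 > 0" "\<epsilon>1 > 0" "measure \<nu> {y. \<bar>y - ?w0\<bar> < \<epsilon>0} \<le> 0" "measure \<nu> {y. \<bar>y - ?w1\<bar> < \<epsilon>1} \<le> 0"
      by (auto simp: supp_def not_less)
    define \<epsilon> where "\<epsilon> = min \<epsilon>0 \<epsilon>1"
    have \<epsilon>: "\<epsilon> > 0" using e by (simp add: \<epsilon>_def)
    have "measure \<nu> {y. \<bar>y - ?w0\<bar> < \<epsilon>} \<le> measure \<nu> {y. \<bar>y - ?w0\<bar> < \<epsilon>0}"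
      "measure \<nu> {y. \<bar>y - ?w1\<bar> < \<epsilon>} \<le> measure \<nu> {y. \<bar>y - ?w1\<bar> < \<epsilon>1}"
      by (intro \<nu>.finite_measure_mono; auto simp: \<epsilon>_def)+
    moreover have "measure \<nu> {y. \<bar>y - x\<bar> < \<gamma> * \<epsilon>}
        = (measure \<nu> {y. \<bar>y - ?w0\<bar> < \<gamma> * \<epsilon> / \<gamma>} + measure \<nu> {y. \<bar>y - ?w1\<bar> < \<gamma> * \<epsilon> / \<gamma>}) / 2"
      using \<nu>_self_similar[OF ball_borel(1), of x "\<gamma> * \<epsilon>"] unfolding i0 i1 .
    moreover have "\<gamma> * \<epsilon> / \<gamma> = \<epsilon>" using \<gamma> by simp
    ultimately have "measure \<nu> {y. \<bar>y - x\<bar> < \<gamma> * \<epsilon>} \<le> 0" using e by simp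
    moreover have "\<gamma> * \<epsilon> > 0" using \<gamma> \<epsilon> by simp
    ultimately show False using assms by (auto simp: supp_def not_less[symmetric])
  qed
  moreover have "x = \<gamma> * ?w0" "x = 1 - \<gamma> + \<gamma> * ?w1" using \<gamma> by auto
  ultimately show thesis using that by blast
qed

text \<open>Following preimages in the support, \<open>x\<close> lies in an image of [0,1] under k
  contractions, which has length \<gamma>^k and mass at least 2^-k.\<close>

lemma \<nu>_ball_lower:
  assumes "supp x"
  shows "measure \<nu> {y. \<bar>y - x\<bar> \<le> \<gamma> ^ k} \<ge> (1/2) ^ k"
  using assms
proof (induction k arbitrary: x)
  case 0
  have "measure \<nu> {y. \<bar>y - x\<bar> \<le> 1} = 1"
  proof (subst \<nu>.prob_eq_1)
    show "AE y in \<nu>. y \<in> {y. \<bar>y - x\<bar> \<le> 1}"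
      using AE_\<nu> by eventually_elim (use supp_unit[OF 0] in auto)
  qed simp
  then show ?case by simp
next
  case (Suc k)
  let ?S = "{y. \<bar>y - x\<bar> \<le> \<gamma> ^ Suc k}"
  have ss: "measure \<nu> ?S = (measure \<nu> {y. \<gamma> * y \<in> ?S} + measure \<nu> {y. 1 - \<gamma> + \<gamma> * y \<in> ?S}) / 2"
    by (rule \<nu>_self_similar[OF ball_borel(2)])
  have sc: "\<bar>\<gamma> * y - \<gamma> * w\<bar> \<le> \<gamma> ^ Suc k \<longleftrightarrow> \<bar>y - w\<bar> \<le> \<gamma> ^ k" for y w
    using \<gamma> by (simp add: right_diff_distrib[symmetric] abs_mult)
  have half: "(1/2) ^ Suc k = (1/2::real) ^ k / 2" by simp
  have half_le1: "p \<le> a \<Longrightarrow> 0 \<le> b \<Longrightarrow> p / 2 \<le> (a + b) / 2"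
    and half_le2: "p \<le> b \<Longrightarrow> 0 \<le> a \<Longrightarrow> p / 2 \<le> (a + b) / 2" for p a b :: real by simp_all
  from Suc.prems show ?case
  proof (cases rule: supp_branch)
    case (1 w)
    then have "{y. \<gamma> * y \<in> ?S} = {y. \<bar>y - w\<bar> \<le> \<gamma> ^ k}" using sc by auto
    then have "measure \<nu> {y. \<gamma> * y \<in> ?S} \<ge> (1/2) ^ k" using Suc.IH[OF 1(1)] by simp
    moreover have "measure \<nu> {y. 1 - \<gamma> + \<gamma> * y \<in> ?S} \<ge> 0" by simp
    ultimately show ?thesis unfolding ss half by (rule half_le1)
  next
    case (2 w)
    have "\<bar>1 - \<gamma> + \<gamma> * y - x\<bar> = \<bar>\<gamma> * y - \<gamma> * w\<bar>" for y using 2 by simp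
    then have "{y. 1 - \<gamma> + \<gamma> * y \<in> ?S} = {y. \<bar>y - w\<bar> \<le> \<gamma> ^ k}" using sc by auto
    then have "measure \<nu> {y. 1 - \<gamma> + \<gamma> * y \<in> ?S} \<ge> (1/2) ^ k" using Suc.IH[OF 2(1)] by simp
    moreover have "measure \<nu> {y. \<gamma> * y \<in> ?S} \<ge> 0" by simp
    ultimately show ?thesis unfolding ss half by (rule half_le2)
  qed
qed

text \<open>The upper and the lower bound are powers of 2 at scales that are powers of \<gamma>,
  hence comparable at comparable radii. This serves the discs, whose chords are bounded below over
  the inner half of their base.\<close>

lemma \<nu>_doubling:
  obtains C where "C \<ge> 0" "\<And>x r. supp x \<Longrightarrow> 0 < r \<Longrightarrow> r \<le> 1 \<Longrightarrow>
    measure \<nu> {y. \<bar>y - x\<bar> < r} \<le> C * measure \<nu> {y. \<bar>y - x\<bar> < r / 2}"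
proof -
  \<comment> \<open>\<open>c0\<close> is the number of levels lost between the length 2 r \<le> 4
    \<gamma>^j of the interval and the threshold of \<open>\<nu>_interval_upper\<close>.\<close>
  have "\<exists>c0. \<gamma> ^ c0 < (1 - 2 * \<gamma>) / 4" using \<gamma> by (intro real_arch_pow_inv) auto
  then obtain c0 where c0: "\<gamma> ^ c0 < (1 - 2 * \<gamma>) / 4" by blast
  have "measure \<nu> {y. \<bar>y - x\<bar> < r} \<le> 2 ^ (c0 + 1) * measure \<nu> {y. \<bar>y - x\<bar> < r / 2}"
    if x: "supp x" and r: "0 < r" "r \<le> 1" for x r
  proof -
    have ex: "\<exists>k. \<gamma> ^ k < r / 2" using \<gamma> r by (intro real_arch_pow_inv) auto
    define k where "k = (LEAST k. \<gamma> ^ k < r / 2)"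
    have k: "\<gamma> ^ k < r / 2" unfolding k_def by (rule LeastI_ex[OF ex])
    have "k \<noteq> 0" using k r by (cases k) auto
    then obtain j where j: "k = Suc j" by (cases k) auto
    have kj: "\<gamma> ^ j \<ge> r / 2" using not_less_Least[of j "\<lambda>k. \<gamma> ^ k < r / 2"] j unfolding k_def[symmetric] by auto
    have "(1/2) ^ k \<le> measure \<nu> {y. \<bar>y - x\<bar> \<le> \<gamma> ^ k}" by (rule \<nu>_ball_lower[OF x])
    also have "\<dots> \<le> measure \<nu> {y. \<bar>y - x\<bar> < r / 2}"
      using k by (intro \<nu>.finite_measure_mono) auto
    finally have low: "(1/2) ^ k \<le> measure \<nu> {y. \<bar>y - x\<bar> < r / 2}" .
    have "measure \<nu> {y. \<bar>y - x\<bar> < r} \<le> 2 ^ (c0 + 1) * (1/2) ^ k"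
    proof (cases "c0 \<le> j")
      case True
      have "(x + r) - (x - r) \<le> 4 * \<gamma> ^ j" using kj by simp
      also have "\<dots> = 4 * \<gamma> ^ c0 * \<gamma> ^ (j - c0)" using True by (simp add: power_add[symmetric])
      also have "\<dots> < (1 - 2 * \<gamma>) * \<gamma> ^ (j - c0)" using c0 \<gamma> by (intro mult_strict_right_mono) auto
      finally have "measure \<nu> {x - r..x + r} \<le> (1/2) ^ (j - c0)" by (rule \<nu>_interval_upper)
      moreover have "measure \<nu> {y. \<bar>y - x\<bar> < r} \<le> measure \<nu> {x - r..x + r}"
        by (intro \<nu>.finite_measure_mono) auto
      moreover have "(1/2::real) ^ (j - c0) = 2 ^ (c0 + 1) * (1/2) ^ k"
      proof -
        have "k = (j - c0) + (c0 + 1)" using True j by simp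
        then have "(1/2::real) ^ k = (1/2) ^ (j - c0) * (1/2) ^ (c0 + 1)" by (simp only: power_add)
        moreover have "(1/2::real) ^ (c0 + 1) * 2 ^ (c0 + 1) = 1" by (simp only: power_mult_distrib[symmetric]) simp
        moreover have "2 ^ (c0 + 1) * ((1/2::real) ^ (j - c0) * (1/2) ^ (c0 + 1)) = (1/2) ^ (j - c0) * ((1/2) ^ (c0 + 1) * 2 ^ (c0 + 1))"
          by (simp only: mult_ac)
        ultimately show ?thesis by (simp only: mult_1_right)
      qed
      ultimately show ?thesis by simp
    next
      \<comment> \<open>For such radii, bounded below in terms of \<open>c0\<close>, the bound holds
        because a mass is at most 1.\<close>
      case False
      then have "k \<le> c0" using j by simp
      then have "(1/2::real) ^ (c0 + 1) \<le> (1/2) ^ k" by (intro power_decreasing) auto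
      then have "(2::real) ^ (c0 + 1) * (1/2) ^ (c0 + 1) \<le> 2 ^ (c0 + 1) * (1/2) ^ k" by (intro mult_left_mono) auto
      moreover have "(2::real) ^ (c0 + 1) * (1/2) ^ (c0 + 1) = 1" by (simp only: power_mult_distrib[symmetric]) simp
      moreover have "measure \<nu> {y. \<bar>y - x\<bar> < r} \<le> 1" by (rule \<nu>.prob_le_1)
      ultimately show ?thesis by linarith
    qed
    also have "\<dots> \<le> 2 ^ (c0 + 1) * measure \<nu> {y. \<bar>y - x\<bar> < r / 2}" using low by (intro mult_left_mono) auto
    finally show ?thesis .
  qed
  then show thesis by (rule that[rotated]) auto
qed

section \<open>Masses of sections and their oscillation between leaves\<close>

lemma vertical_section_mass:
  assumes h: "h \<in> borel_measurable borel" "\<And>x. 0 \<le> h x" and c: "c \<in> {0..1}"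
  shows "measure \<mu> (vertical_section c h) = (\<integral>x. min 1 (c + h x) - max 0 (c - h x) \<partial>\<nu>)"
proof -
  let ?R = "vertical_section c h"
  have R: "?R \<in> sets borel" by (rule vertical_section_borel[OF h(1)])
  have "?R \<inter> unit_square = ?R" by (auto simp: vertical_section_def)
  then have "measure \<mu> ?R = (\<integral>x. cell_int (indicator ?R) x 1 \<partial>\<nu>)"
    using integral_\<mu>[OF unit_fun_indicator[OF R]] integral_indicator_\<mu>[OF R] by simp
  also have "\<dots> = (\<integral>x. min 1 (c + h x) - max 0 (c - h x) \<partial>\<nu>)"
  proof (rule integral_cong_AE)
    show "AE x in \<nu>. cell_int (indicator ?R) x 1 = min 1 (c + h x) - max 0 (c - h x)"
      using AE_\<nu> by eventually_elim (rule cell_int_vertical_section_one, assumption, rule c, rule h(2))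
    show "(\<lambda>x. cell_int (indicator ?R) x 1) \<in> borel_measurable \<nu>"
      unfolding measurable_cong_sets[OF sets_\<nu> refl] by (rule cell_int_measurable[OF unit_fun_indicator[OF R]])
  qed (use h(1) in \<open>simp add: measurable_cong_sets[OF sets_\<nu> refl]\<close>)
  finally show ?thesis .
qed

text \<open>As \<open>c\<close> lies in [0,1] and s \<le> 1/2, at least one of the segments of
  length s directly above and below \<open>c\<close> stays in the leaf.\<close>

lemma vertical_section_mass_lower:
  assumes h: "h \<in> borel_measurable borel" "\<And>x. 0 \<le> h x" and c: "c \<in> {0..1}"
    and S: "S \<in> sets borel" "\<And>x. x \<in> S \<Longrightarrow> s \<le> h x" and s: "0 \<le> s" "s \<le> 1/2"
  shows "s * measure \<nu> S \<le> measure \<mu> (vertical_section c h)"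
proof -
  have "(\<integral>x. s * indicator S x \<partial>\<nu>) \<le> (\<integral>x. min 1 (c + h x) - max 0 (c - h x) \<partial>\<nu>)"
  proof (rule integral_mono)
    show "integrable \<nu> (\<lambda>x. s * indicat_real S x)"
      using S by (simp add: integrable_indicator_iff \<nu>.emeasure_finite less_top[symmetric])
    show "integrable \<nu> (\<lambda>x. min 1 (c + h x) - max 0 (c - h x))"
    proof (rule \<nu>.integrable_const_bound[of _ 1])
      show "AE x in \<nu>. norm (min 1 (c + h x) - max 0 (c - h x)) \<le> 1"
        using c h(2) by (intro AE_I2) (auto simp: min_def max_def abs_le_iff)
    qed (use h(1) in \<open>simp add: measurable_cong_sets[OF sets_\<nu> refl]\<close>)
    show "s * indicator S x \<le> min 1 (c + h x) - max 0 (c - h x)" for x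
      using c h(2)[of x] S(2)[of x] s by (cases "x \<in> S") (auto simp: min_def max_def)
  qed
  then show ?thesis using S(1) by (simp add: vertical_section_mass[OF h c])
qed

lemma rectangle_mass:
  assumes S: "S \<in> sets borel" and s: "0 \<le> s" and c: "c \<in> {0..1}"
  shows "measure \<mu> (vertical_section c (\<lambda>x. if x \<in> S then s else 0)) = measure \<nu> S * (min 1 (c + s) - max 0 (c - s))"
proof -
  have "(\<lambda>x. if x \<in> S then s else 0) \<in> borel_measurable borel" using S by measurable
  then have "measure \<mu> (vertical_section c (\<lambda>x. if x \<in> S then s else 0))
     = (\<integral>x. min 1 (c + (if x \<in> S then s else 0)) - max 0 (c - (if x \<in> S then s else 0)) \<partial>\<nu>)"
    by (rule vertical_section_mass) (use s c in auto)
  also have "\<dots> = (\<integral>x. (min 1 (c + s) - max 0 (c - s)) * indicator S x \<partial>\<nu>)"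
    using c by (intro Bochner_Integration.integral_cong) (auto simp: min_def max_def)
  finally show ?thesis using S by simp
qed

text \<open>Two intervals with a common centre differ by two pieces, each as long as the difference
  of the half-heights.\<close>

lemma leaf_dist_vertical_section:
  assumes h: "h \<in> borel_measurable borel" and x: "x \<in> {0..1}" "x' \<in> {0..1}" and h0: "0 \<le> h x" "0 \<le> h x'"
  shows "leaf_dist (indicator (vertical_section c h)) x x' \<le> 2 * \<bar>h x - h x'\<bar>"
proof -
  let ?R = "vertical_section c h"
  have uR: "unit_fun (indicator ?R)" by (rule unit_fun_indicator[OF vertical_section_borel[OF h]])
  define lo hi where "lo = min (h x) (h x')" and "hi = max (h x) (h x')"
  have lohi: "lo \<le> hi" "hi - lo = \<bar>h x - h x'\<bar>" by (auto simp: lo_def hi_def)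
  have "leaf_dist (indicator ?R) x x' \<le> (\<integral>y. indicator {c + lo..c + hi} y + indicator {c - hi..c - lo} y \<partial>lborel)"
    unfolding leaf_dist_def int0_def
  proof (rule integral_mono)
    have "(\<lambda>y. \<bar>indicat_real ?R (x, y) - indicator ?R (x', y)\<bar>) \<in> borel_measurable borel"
      using unit_funD(5)[OF uR] by measurable
    then show "integrable lborel (\<lambda>y. indicat_real {0..<1} y * \<bar>indicator ?R (x, y) - indicator ?R (x', y)\<bar>)"
      by (rule integrable_bounded_interval[where C = 1]) (auto simp: indicator_def)
    show "integrable lborel (\<lambda>y. indicat_real {c + lo..c + hi} y + indicat_real {c - hi..c - lo} y)"
      using lohi by (intro Bochner_Integration.integrable_add) (auto simp: integrable_indicator_iff emeasure_lborel_Icc_eq)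
    show "indicat_real {0..<1} y * \<bar>indicator ?R (x, y) - indicator ?R (x', y)\<bar>
       \<le> indicator {c + lo..c + hi} y + indicator {c - hi..c - lo} y" for y
      using x by (auto simp: indicator_def vertical_section_def unit_square_def lo_def hi_def abs_less_iff)
  qed
  also have "\<dots> = 2 * (hi - lo)"
    using lohi by (subst Bochner_Integration.integral_add) (auto simp: integrable_indicator_iff emeasure_lborel_Icc_eq)
  finally show ?thesis using lohi by simp
qed

lemma leaf_dist_iterate_Suc:
  assumes "unit_fun \<phi>"
  shows "leaf_dist (\<lambda>w. \<phi> ((T ^^ Suc j) w)) x x'
   = (leaf_dist (\<lambda>w. \<phi> ((T ^^ j) w)) (\<gamma> * x) (\<gamma> * x') + leaf_dist (\<lambda>w. \<phi> ((T ^^ j) w)) (1 - \<gamma> + \<gamma> * x) (1 - \<gamma> + \<gamma> * x')) / 2"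
  using leaf_dist_baker[OF unit_fun_baker[OF assms, where n = j and \<gamma> = \<gamma>], where \<gamma> = \<gamma> and x = x and x' = x'] by (simp only: funpow_Suc_right o_apply)

text \<open>Every branch brings the two leaves to distance \<gamma>^j |x - x'| after j steps, and
  averaging over branches keeps a common bound. With the Hoelder exponent 1/2 of the chords the
  resulting rate is sqrt \<gamma>.\<close>

lemma leaf_dist_disc:
  assumes a: "a \<in> {0..1}" and x: "x \<in> {0..1}" "x' \<in> {0..1}"
  shows "leaf_dist (\<lambda>w. indicator (vertical_section c (disc_height a r)) ((T ^^ j) w)) x x'
    \<le> 2 * sqrt (2 * (\<gamma> ^ j * \<bar>x - x'\<bar>))"
  using x
proof (induction j arbitrary: x x')
  case 0
  have "leaf_dist (indicator (vertical_section c (disc_height a r))) x x' \<le> 2 * \<bar>disc_height a r x - disc_height a r x'\<bar>"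
    by (rule leaf_dist_vertical_section[OF disc_height_borel 0 disc_height_nonneg disc_height_nonneg])
  also have "\<dots> \<le> 2 * sqrt (2 * \<bar>x - x'\<bar>)" using disc_height_diff[OF 0 a, of r] by simp
  finally show ?case by simp
next
  case (Suc j)
  have e: "\<gamma> ^ j * \<bar>\<gamma> * x - \<gamma> * x'\<bar> = \<gamma> ^ Suc j * \<bar>x - x'\<bar>"
    using \<gamma> by (simp add: right_diff_distrib[symmetric] abs_mult)
  have e': "\<bar>(1 - \<gamma> + \<gamma> * x) - (1 - \<gamma> + \<gamma> * x')\<bar> = \<bar>\<gamma> * x - \<gamma> * x'\<bar>" by simp
  show ?case
    using Suc.IH[OF branch_unit(1)[OF \<gamma> Suc.prems(1)] branch_unit(1)[OF \<gamma> Suc.prems(2)]]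
      Suc.IH[OF branch_unit(2)[OF \<gamma> Suc.prems(1)] branch_unit(2)[OF \<gamma> Suc.prems(2)]]
    unfolding e e' leaf_dist_iterate_Suc[OF unit_fun_indicator[OF vertical_section_borel[OF disc_height_borel]]]
    by simp
qed

lemma leaf_dist_disc_exp:
  assumes a: "a \<in> {0..1}" and x: "x \<in> {0..1}" "x' \<in> {0..1}"
  shows "leaf_dist (\<lambda>w. indicator (vertical_section c (disc_height a r)) ((T ^^ j) w)) x x' \<le> 2 * sqrt 2 * sqrt \<gamma> ^ j"
proof -
  have "2 * (\<gamma> ^ j * \<bar>x - x'\<bar>) \<le> 2 * (\<gamma> ^ j * 1)" using x \<gamma> by (intro mult_left_mono) auto
  then have "sqrt (2 * (\<gamma> ^ j * \<bar>x - x'\<bar>)) \<le> sqrt (2 * \<gamma> ^ j)" by simp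
  also have "\<dots> = sqrt 2 * sqrt \<gamma> ^ j" by (simp add: real_sqrt_mult real_sqrt_power)
  finally show ?thesis using leaf_dist_disc[OF a x, of c r j] by simp
qed

text \<open>The proportion of words of length \<open>n\<close> in the two contractions whose image of the segment between
  \<open>x\<close> and \<open>x'\<close> contains \<open>a\<close>.\<close>

fun separated :: "nat \<Rightarrow> real \<Rightarrow> real \<Rightarrow> real \<Rightarrow> real" where
  "separated 0 a x x' = (if min x x' \<le> a \<and> a \<le> max x x' then 1 else 0)"
| "separated (Suc n) a x x' = (separated n a (\<gamma> * x) (\<gamma> * x') + separated n a (1 - \<gamma> + \<gamma> * x) (1 - \<gamma> + \<gamma> * x')) / 2"

text \<open>The defining recursion peels off the innermost contraction, which moves \<open>x\<close>
  and \<open>x'\<close>. Peeling off the outermost one instead moves \<open>a\<close> by an inverse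
  branch and keeps \<open>x\<close> and \<open>x'\<close> fixed.\<close>

lemma separated_outer:
  "separated (Suc n) a x x' = (separated n (a / \<gamma>) x x' + separated n ((a - (1 - \<gamma>)) / \<gamma>) x x') / 2"
proof (induction n arbitrary: x x')
  case 0
  have "min (\<gamma> * x) (\<gamma> * x') = \<gamma> * min x x'" "max (\<gamma> * x) (\<gamma> * x') = \<gamma> * max x x'"
    "min (1 - \<gamma> + \<gamma> * x) (1 - \<gamma> + \<gamma> * x') = 1 - \<gamma> + \<gamma> * min x x'"
    "max (1 - \<gamma> + \<gamma> * x) (1 - \<gamma> + \<gamma> * x') = 1 - \<gamma> + \<gamma> * max x x'"
    using \<gamma> by (auto simp: min_def max_def)
  then have "separated 0 a (\<gamma> * x) (\<gamma> * x') = separated 0 (a / \<gamma>) x x'"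
    "separated 0 a (1 - \<gamma> + \<gamma> * x) (1 - \<gamma> + \<gamma> * x') = separated 0 ((a - (1 - \<gamma>)) / \<gamma>) x x'"
    using \<gamma> by (auto simp: field_simps)
  then show ?case by simp
next
  case (Suc n)
  show ?case
    by (subst separated.simps(2), subst (1 2) Suc.IH, subst (1 2) separated.simps(2)) (simp add: add_divide_distrib)
qed

lemma separated_outside:
  assumes "a \<notin> {0..1}" "x \<in> {0..1}" "x' \<in> {0..1}"
  shows "separated n a x x' = 0"
  using assms(2,3)
proof (induction n arbitrary: x x')
  case 0 then show ?case using assms(1) by (auto simp: min_def max_def)
next
  case (Suc n)
  then show ?case using branch_unit[OF \<gamma> Suc.prems(1)] branch_unit[OF \<gamma> Suc.prems(2)] by (simp add: Suc.IH)
qed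

text \<open>At most one of the two inverse branches sends \<open>a\<close> into [0,1], so each level
  halves the proportion: among the words of one length at most one has an image of [0,1] that
  contains \<open>a\<close>.\<close>

lemma separated_le:
  assumes "x \<in> {0..1}" "x' \<in> {0..1}"
  shows "separated n a x x' \<le> (1/2) ^ n"
proof (induction n arbitrary: a)
  case (Suc n)
  have "a / \<gamma> \<notin> {0..1} \<or> (a - (1 - \<gamma>)) / \<gamma> \<notin> {0..1}"
  proof (cases "a \<le> \<gamma>")
    case True
    then have "(a - (1 - \<gamma>)) / \<gamma> < 0" using \<gamma> by (intro divide_neg_pos) auto
    then show ?thesis by auto
  next
    case False
    then have "a / \<gamma> > 1" using \<gamma> by simp
    then show ?thesis by auto
  qed
  then have "separated n (a / \<gamma>) x x' = 0 \<or> separated n ((a - (1 - \<gamma>)) / \<gamma>) x x' = 0"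
    using separated_outside assms by blast
  then show ?case unfolding separated_outer using Suc.IH[of "a / \<gamma>"] Suc.IH[of "(a - (1 - \<gamma>)) / \<gamma>"] by auto
qed simp

text \<open>The indicator of a rectangle differs on two leaves only if one of its vertical edges
  separates them. Counting the words for which this happens gives a bound uniform in
  \<open>r\<close>.\<close>

lemma leaf_dist_rectangle:
  assumes x: "x \<in> {0..1}" "x' \<in> {0..1}" and s: "0 \<le> s"
  shows "leaf_dist (\<lambda>w. indicator (vertical_section c (\<lambda>x. if x \<in> {x. \<bar>x - a\<bar> < r} then s else 0)) ((T ^^ j) w)) x x'
    \<le> separated j (a - r) x x' + separated j (a + r) x x'"
  using x
proof (induction j arbitrary: x x')
  case 0
  let ?h = "\<lambda>x. if x \<in> {x. \<bar>x - a\<bar> < r} then s else 0" and ?R = "vertical_section c (\<lambda>x. if x \<in> {x. \<bar>x - a\<bar> < r} then s else 0)"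
  have h: "?h \<in> borel_measurable borel" by measurable
  have uR: "unit_fun (indicator ?R)" by (rule unit_fun_indicator[OF vertical_section_borel[OF h]])
  show ?case
  proof (cases "\<bar>x - a\<bar> < r \<longleftrightarrow> \<bar>x' - a\<bar> < r")
    case True
    then have "leaf_dist (indicator ?R) x x' \<le> 2 * 0"
      using leaf_dist_vertical_section[OF h 0, of c] s by auto
    then show ?thesis by auto
  next
    case False
    have "leaf_dist (indicator ?R) x x' \<le> int0 (\<lambda>_. 1) 1"
      unfolding leaf_dist_def
    proof (rule int0_mono[where C = 1 and C' = 1])
      show "(\<lambda>y. \<bar>indicat_real ?R (x, y) - indicator ?R (x', y)\<bar>) \<in> borel_measurable borel"
        using unit_funD(5)[OF uR] by measurable
    qed (auto simp: indicator_def)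
    also have "\<dots> = 1" by (simp add: int0_const)
    also have "1 \<le> separated 0 (a - r) x x' + separated 0 (a + r) x x'"
      using False by (auto simp: min_def max_def abs_less_iff split: if_splits)
    finally show ?thesis by simp
  qed
next
  case (Suc j)
  have h: "(\<lambda>x. if x \<in> {x. \<bar>x - a\<bar> < r} then s else 0) \<in> borel_measurable borel" by measurable
  have average: "A \<le> p + q \<Longrightarrow> A' \<le> p' + q' \<Longrightarrow> (A + A') / 2 \<le> (p + p') / 2 + (q + q') / 2" for A A' p p' q q' :: real
    by (simp only: add_divide_distrib[symmetric], rule divide_right_mono) auto
  show ?case
    using Suc.IH[OF branch_unit(1)[OF \<gamma> Suc.prems(1)] branch_unit(1)[OF \<gamma> Suc.prems(2)]]
      Suc.IH[OF branch_unit(2)[OF \<gamma> Suc.prems(1)] branch_unit(2)[OF \<gamma> Suc.prems(2)]]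
    unfolding leaf_dist_iterate_Suc[OF unit_fun_indicator[OF vertical_section_borel[OF h]]] separated.simps
    by (rule average)
qed

end

section \<open>Limits of orbit segments across the discontinuity\<close>

text \<open>The closure of the graph of T: both one-sided values are allowed on the line y =
  1/2.\<close>

definition closed_step :: "real \<Rightarrow> ((real \<times> real) \<times> (real \<times> real)) set" where
  "closed_step \<gamma> = {u. snd (fst u) \<le> 1/2 \<and> snd u = (\<gamma> * fst (fst u), 2 * snd (fst u))} \<union>
     {u. snd (fst u) \<ge> 1/2 \<and> snd u = (1 - \<gamma> + \<gamma> * fst (fst u), 2 * snd (fst u) - 1)}"

lemma closed_closed_step: "closed (closed_step \<gamma>)"
  unfolding closed_step_def
  by (intro closed_Un closed_Collect_conj closed_Collect_le closed_Collect_eq continuous_intros)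

lemma baker_closed_step: "(w, baker \<gamma> w) \<in> closed_step \<gamma>"
  by (cases w) (auto simp: closed_step_def baker_def)

lemma baker_unit_square:
  assumes "0 < \<gamma>" "\<gamma> < 1/2" "w \<in> unit_square"
  shows "baker \<gamma> w \<in> unit_square"
  using assms(3) branch_unit[OF assms(1,2), of "fst w"]
  by (cases w) (auto simp: baker_def unit_square_def)

lemma baker_iterate_unit_square:
  assumes "0 < \<gamma>" "\<gamma> < 1/2" "w \<in> unit_square"
  shows "(baker \<gamma> ^^ j) w \<in> unit_square"
  by (induction j) (auto intro: baker_unit_square assms)

lemma compact_unit_square: "compact unit_square"
  unfolding unit_square_def by (intro compact_Times) auto

text \<open>The intermediate points converge along a subsequence because the square is compact, and
  each single step passes to the limit because the relation is closed.\<close>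

lemma closed_step_relpow:
  assumes \<gamma>: "0 < \<gamma>" "\<gamma> < 1/2"
    and "\<And>n. w n \<in> unit_square" "w \<longlonglongrightarrow> a" "(\<lambda>n. (baker \<gamma> ^^ j) (w n)) \<longlonglongrightarrow> b"
  shows "(a, b) \<in> closed_step \<gamma> ^^ j"
  using assms(3-)
proof (induction j arbitrary: w a)
  case 0
  then show ?case using LIMSEQ_unique by auto
next
  case (Suc j)
  have T: "baker \<gamma> (w n) \<in> unit_square" for n by (rule baker_unit_square[OF \<gamma> Suc.prems(1)])
  obtain c \<phi> where c: "strict_mono (\<phi> :: nat \<Rightarrow> nat)" "((\<lambda>n. baker \<gamma> (w n)) \<circ> \<phi>) \<longlonglongrightarrow> c"
    using compact_imp_seq_compact[OF compact_unit_square, unfolded seq_compact_def, rule_format, of "\<lambda>n. baker \<gamma> (w n)"] T by blast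
  have "(\<lambda>n. (w (\<phi> n), baker \<gamma> (w (\<phi> n)))) \<longlonglongrightarrow> (a, c)"
    using LIMSEQ_subseq_LIMSEQ[OF Suc.prems(2) c(1)] c(2) by (intro tendsto_Pair) (auto simp: comp_def)
  then have "(a, c) \<in> closed_step \<gamma>"
    by (rule closed_sequentially[OF closed_closed_step baker_closed_step])
  moreover have "(c, b) \<in> closed_step \<gamma> ^^ j"
  proof (rule Suc.IH[of "\<lambda>n. baker \<gamma> (w (\<phi> n))"])
    show "(\<lambda>n. baker \<gamma> (w (\<phi> n))) \<longlonglongrightarrow> c" using c(2) by (simp add: comp_def)
    show "(\<lambda>n. (baker \<gamma> ^^ j) (baker \<gamma> (w (\<phi> n)))) \<longlonglongrightarrow> b"
      using LIMSEQ_subseq_LIMSEQ[OF Suc.prems(3) c(1)] by (simp add: comp_def funpow_swap1)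
  qed (rule T)
  ultimately show ?case by (rule relpow_Suc_I2)
qed

text \<open>At y = 1 only the upper branch applies, and it keeps y = 1; so from there on the
  relation is the map.\<close>

lemma closed_step_from_top:
  assumes "(a, b) \<in> closed_step \<gamma> ^^ j" "snd a = 1"
  shows "(baker \<gamma> ^^ j) a = b \<and> snd b = 1"
  using assms
proof (induction j arbitrary: a)
  case (Suc j)
  from relpow_Suc_D2[OF Suc.prems(1)] obtain c where c: "(a, c) \<in> closed_step \<gamma>" "(c, b) \<in> closed_step \<gamma> ^^ j" by blast
  have "c = baker \<gamma> a" "snd c = 1" using c(1) Suc.prems(2) by (cases a; auto simp: closed_step_def baker_def)+
  then show ?case using Suc.IH[OF c(2)] by (simp add: funpow_swap1)
qed simp

text \<open>A limit of orbit segments can differ from an orbit only after a limit from below at the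
  discontinuity \<open>y = 1/2\<close>, and from then on it stays at \<open>y = 1\<close>.\<close>

lemma closed_step_orbit:
  assumes "(a, b) \<in> closed_step \<gamma> ^^ j" "snd b \<noteq> 1"
  shows "(baker \<gamma> ^^ j) a = b"
  using assms(1)
proof (induction j arbitrary: a)
  case (Suc j)
  from relpow_Suc_D2[OF Suc.prems(1)] obtain c where c: "(a, c) \<in> closed_step \<gamma>" "(c, b) \<in> closed_step \<gamma> ^^ j" by blast
  have "snd c \<noteq> 1" using closed_step_from_top[OF c(2)] assms(2) by blast
  then have "c = baker \<gamma> a" using c(1) by (cases a) (auto simp: closed_step_def baker_def)
  then show ?case using Suc.IH[OF c(2)] by (simp add: funpow_swap1)
qed simp

text \<open>Points near \<open>z\<close> that return near \<open>z\<close> would yield in the limit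
  a chain of length j from \<open>z\<close> to \<open>z\<close> in the closed relation. Such a chain
  is a genuine orbit: a chain that departs from the map ends at y = 1, and for \<open>z\<close> with
  y = 1 the relation is the map. The orbit of \<open>z\<close> may cross the line y = 1/2.\<close>

lemma no_return:
  assumes \<gamma>: "0 < \<gamma>" "\<gamma> < 1/2" and "(baker \<gamma> ^^ j) z \<noteq> z"
  shows "\<exists>\<delta>>0. \<forall>w\<in>unit_square. dist w z < \<delta> \<longrightarrow> \<not> dist ((baker \<gamma> ^^ j) w) z < \<delta>"
proof (rule ccontr)
  assume "\<not> ?thesis"
  then have "\<exists>w\<in>unit_square. dist w z < 1 / real (Suc n) \<and> dist ((baker \<gamma> ^^ j) w) z < 1 / real (Suc n)" for n
    by (metis divide_pos_pos of_nat_0_less_iff zero_less_Suc zero_less_one)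
  then obtain w where w: "\<And>n. w n \<in> unit_square" "\<And>n. dist (w n) z < 1 / real (Suc n)"
    "\<And>n. dist ((baker \<gamma> ^^ j) (w n)) z < 1 / real (Suc n)" by metis
  have lim: "(\<lambda>n. 1 / real (Suc n)) \<longlonglongrightarrow> 0" using LIMSEQ_inverse_real_of_nat by (simp add: inverse_eq_divide)
  have "w \<longlonglongrightarrow> z" "(\<lambda>n. (baker \<gamma> ^^ j) (w n)) \<longlonglongrightarrow> z"
    by (rule metric_tendsto_imp_tendsto[OF lim]; use w(2,3) in \<open>auto intro!: always_eventually less_imp_le simp: dist_real_def\<close>)+
  from closed_step_relpow[OF \<gamma> w(1) this] have "(z, z) \<in> closed_step \<gamma> ^^ j" .
  then have "(baker \<gamma> ^^ j) z = z" using closed_step_from_top closed_step_orbit by blast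
  then show False using assms(3) by simp
qed

lemma fst_baker: "fst (baker \<gamma> w) = (if snd w < 1/2 then \<gamma> * fst w else 1 - \<gamma> + \<gamma> * fst w)"
  and snd_baker: "snd (baker \<gamma> w) = (if snd w < 1/2 then 2 * snd w else 2 * snd w - 1)"
  by (simp_all add: baker_def split_beta)

text \<open>The branch is decided by the height alone, so points whose heights stay on the same side
  of 1/2 as those of \<open>z\<close> are moved by the same affine maps.\<close>

lemma baker_iterate_affine:
  assumes "0 < \<gamma>" and "\<And>i. i < j \<Longrightarrow> snd ((baker \<gamma> ^^ i) z) \<noteq> 1/2"
  shows "\<exists>\<delta>>0. \<forall>w :: real \<times> real. \<bar>snd w - snd z\<bar> < \<delta> \<longrightarrow>
    fst ((baker \<gamma> ^^ j) w) = fst ((baker \<gamma> ^^ j) z) + \<gamma> ^ j * (fst w - fst z) \<and>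
    snd ((baker \<gamma> ^^ j) w) = snd ((baker \<gamma> ^^ j) z) + 2 ^ j * (snd w - snd z)"
  using assms(2)
proof (induction j)
  case 0 then show ?case by (auto intro!: exI[of _ 1])
next
  case (Suc j)
  then obtain \<delta> where \<delta>: "\<delta> > 0" "\<And>w :: real \<times> real. \<bar>snd w - snd z\<bar> < \<delta> \<Longrightarrow>
    fst ((baker \<gamma> ^^ j) w) = fst ((baker \<gamma> ^^ j) z) + \<gamma> ^ j * (fst w - fst z) \<and>
    snd ((baker \<gamma> ^^ j) w) = snd ((baker \<gamma> ^^ j) z) + 2 ^ j * (snd w - snd z)"
    by (metis less_SucI)
  let ?z = "(baker \<gamma> ^^ j) z"
  \<comment> \<open>The vertical distance of the j-th iterate from the discontinuity; vertical
    distances have grown by 2^j by then.\<close>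
  define \<eta> where "\<eta> = \<bar>snd ?z - 1/2\<bar>"
  have \<eta>: "\<eta> > 0" using Suc.prems[of j] by (simp add: \<eta>_def)
  show ?case
  proof (intro exI[of _ "min \<delta> (\<eta> / 2 ^ j)"] conjI allI impI)
    show "0 < min \<delta> (\<eta> / 2 ^ j)" using \<delta>(1) \<eta> by simp
    fix w :: "real \<times> real" assume w: "\<bar>snd w - snd z\<bar> < min \<delta> (\<eta> / 2 ^ j)"
    let ?w = "(baker \<gamma> ^^ j) w"
    have e: "fst ?w = fst ?z + \<gamma> ^ j * (fst w - fst z)" "snd ?w = snd ?z + 2 ^ j * (snd w - snd z)"
      using \<delta>(2)[of w] w by auto
    have "\<bar>2 ^ j * (snd w - snd z)\<bar> < \<eta>" using w by (simp add: abs_mult pos_less_divide_eq mult.commute)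
    then have side: "snd ?w < 1/2 \<longleftrightarrow> snd ?z < 1/2" unfolding e(2) \<eta>_def by linarith
    show "fst ((baker \<gamma> ^^ Suc j) w) = fst ((baker \<gamma> ^^ Suc j) z) + \<gamma> ^ Suc j * (fst w - fst z)"
      "snd ((baker \<gamma> ^^ Suc j) w) = snd ((baker \<gamma> ^^ Suc j) z) + 2 ^ Suc j * (snd w - snd z)"
      by (simp_all only: funpow.simps o_apply fst_baker snd_baker side) (simp_all add: e algebra_simps)
  qed
qed

text \<open>By the convention at y = 1/2 the next height is 0, and height 0 is kept forever, so a
  periodic orbit could not come back to 1/2.\<close>

lemma periodic_orbit_avoids_half:
  assumes "p \<ge> 1" "(baker \<gamma> ^^ p) z = z"
  shows "snd ((baker \<gamma> ^^ i) z) \<noteq> 1/2"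
proof
  assume h: "snd ((baker \<gamma> ^^ i) z) = 1/2"
  have zero: "snd ((baker \<gamma> ^^ (Suc i + k)) z) = 0" for k
  proof (induction k)
    case 0 then show ?case using h by (simp add: snd_baker)
  next
    case (Suc k) then show ?case by (simp add: snd_baker)
  qed
  obtain p' where "p = Suc p'" using assms(1) by (cases p) auto
  then have "snd ((baker \<gamma> ^^ (i + p)) z) = 0" using zero[of p'] by simp
  moreover have "(baker \<gamma> ^^ (i + p)) z = (baker \<gamma> ^^ i) z" using assms(2) by (simp add: funpow_add)
  ultimately show False using h by simp
qed

lemma minimal_period_dvd:
  assumes "minimal_period T z p" "(T ^^ j) z = z"
  shows "p dvd j"
proof (rule ccontr)
  assume "\<not> p dvd j"
  have p: "p \<ge> 1" "(T ^^ p) z = z" using assms(1) by (auto simp: minimal_period_def)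
  have m: "1 \<le> j mod p" "j mod p < p" using \<open>\<not> p dvd j\<close> p by (auto simp: dvd_eq_mod_eq_0 Suc_le_eq)
  have i: "(T ^^ (k * p)) z = z" for k by (induction k) (auto simp: funpow_add p)
  have "(T ^^ j) z = (T ^^ (j mod p)) ((T ^^ (j div p * p)) z)"
    by (simp add: funpow_add[symmetric, THEN fun_cong, unfolded o_apply])
  then have "(T ^^ (j mod p)) z = z" using i assms(2) by simp
  then show False using assms(1) m by (auto simp: minimal_period_def)
qed

section \<open>The time scale and the length of the gap\<close>

lemma floor_ratio_limit:
  fixes \<beta> :: "nat \<Rightarrow> real"
  assumes "\<tau> > 0" "\<beta> \<longlonglongrightarrow> 0" "\<forall>\<^sub>F n in sequentially. \<beta> n > 0"
  shows "(\<lambda>n. real (nat \<lfloor>\<tau> / \<beta> n\<rfloor>) * \<beta> n) \<longlonglongrightarrow> \<tau>"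
proof (rule tendsto_sandwich)
  show "(\<lambda>n. \<tau> - \<beta> n) \<longlonglongrightarrow> \<tau>" using tendsto_diff[OF tendsto_const assms(2)] by simp
  show "\<forall>\<^sub>F n in sequentially. \<tau> - \<beta> n \<le> real (nat \<lfloor>\<tau> / \<beta> n\<rfloor>) * \<beta> n"
    using assms(3)
  proof eventually_elim
    case (elim n)
    have "\<tau> / \<beta> n - 1 \<le> real (nat \<lfloor>\<tau> / \<beta> n\<rfloor>)" by linarith
    then have "(\<tau> / \<beta> n - 1) * \<beta> n \<le> real (nat \<lfloor>\<tau> / \<beta> n\<rfloor>) * \<beta> n" using elim by (intro mult_right_mono) auto
    then show ?case using elim by (simp add: left_diff_distrib)
  qed
  show "\<forall>\<^sub>F n in sequentially. real (nat \<lfloor>\<tau> / \<beta> n\<rfloor>) * \<beta> n \<le> \<tau>"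
    using assms(3)
  proof eventually_elim
    case (elim n)
    have "0 \<le> \<tau> / \<beta> n" using elim assms(1) by simp
    then have "real (nat \<lfloor>\<tau> / \<beta> n\<rfloor>) \<le> \<tau> / \<beta> n" by linarith
    then have "real (nat \<lfloor>\<tau> / \<beta> n\<rfloor>) * \<beta> n \<le> \<tau> / \<beta> n * \<beta> n" using elim by (intro mult_right_mono) auto
    then show ?case using elim by simp
  qed
qed simp

text \<open>Long enough for exponentials in it to beat powers of \<open>r\<close>, short enough that
  its product with \<open>r\<close> tends to 0.\<close>

definition gap_length :: "real \<Rightarrow> nat" where
  "gap_length r = nat \<lceil>1 / sqrt r\<rceil>"

lemma gap_length_bounds: "0 < r \<Longrightarrow> 1 / sqrt r \<le> real (gap_length r)" "0 < r \<Longrightarrow> real (gap_length r) \<le> 1 / sqrt r + 1"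
proof -
  assume r: "0 < r"
  then have "0 \<le> 1 / sqrt r" by simp
  then show "1 / sqrt r \<le> real (gap_length r)" "real (gap_length r) \<le> 1 / sqrt r + 1"
    unfolding gap_length_def by linarith+
qed

text \<open>In the last claim the exponent 8 comes from g \<ge> r^(-1/2), which gives 1 / \<beta>
  \<le> r^-4 \<le> g^8, while g^8 \<rho>^g tends to 0.\<close>

lemma gap_length_limits:
  fixes r \<beta> :: "nat \<Rightarrow> real"
  assumes r: "\<And>n. 0 < r n" "r \<longlonglongrightarrow> 0"
  shows "filterlim (\<lambda>n. gap_length (r n)) at_top sequentially"
    and "(\<lambda>n. real (gap_length (r n)) * r n) \<longlonglongrightarrow> 0"
    and "0 < \<rho> \<Longrightarrow> \<rho> < 1 \<Longrightarrow> \<forall>\<^sub>F n in sequentially. r n ^ 4 \<le> \<beta> n \<Longrightarrow> (\<lambda>n. \<rho> ^ gap_length (r n) / \<beta> n) \<longlonglongrightarrow> 0"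
proof -
  let ?g = "\<lambda>n. gap_length (r n)"
  have sr: "(\<lambda>n. sqrt (r n)) \<longlonglongrightarrow> 0" using tendsto_real_sqrt[OF r(2)] by simp
  have "filterlim (\<lambda>n. 1 / sqrt (r n)) at_top sequentially"
    using filterlim_inverse_at_top[OF sr] r(1) by (simp add: inverse_eq_divide)
  then have top: "filterlim (\<lambda>n. real (?g n)) at_top sequentially"
    by (rule filterlim_at_top_mono) (auto intro!: always_eventually gap_length_bounds r)
  then show gt: "filterlim ?g at_top sequentially"
    by (simp add: filterlim_sequentially_iff_filterlim_real)
  show "(\<lambda>n. real (?g n) * r n) \<longlonglongrightarrow> 0"
  proof (rule Lim_null_comparison[OF always_eventually])
    show "\<forall>n. norm (real (?g n) * r n) \<le> sqrt (r n) + r n"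
    proof
      fix n
      have "real (?g n) * r n \<le> (1 / sqrt (r n) + 1) * r n"
        using gap_length_bounds(2)[OF r(1)[of n]] less_imp_le[OF r(1)[of n]] by (rule mult_right_mono)
      also have "\<dots> = sqrt (r n) + r n" using less_imp_le[OF r(1)[of n]] by (simp add: distrib_right real_div_sqrt)
      finally show "norm (real (?g n) * r n) \<le> sqrt (r n) + r n" using less_imp_le[OF r(1)[of n]] by simp
    qed
    show "(\<lambda>n. sqrt (r n) + r n) \<longlonglongrightarrow> 0" using tendsto_add[OF sr r(2)] by simp
  qed
  assume \<rho>: "0 < \<rho>" "\<rho> < 1" and \<beta>: "\<forall>\<^sub>F n in sequentially. r n ^ 4 \<le> \<beta> n"
  define k where "k = - ln \<rho>"
  have k: "k > 0" using \<rho> by (simp add: k_def)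
  have "filterlim (\<lambda>n. k * real (?g n)) at_top sequentially"
    by (rule filterlim_tendsto_pos_mult_at_top[OF tendsto_const k top])
  then have "(\<lambda>n. (k * real (?g n)) ^ 8 / exp (k * real (?g n))) \<longlonglongrightarrow> 0"
    by (rule filterlim_compose[OF tendsto_power_div_exp_0])
  then have "(\<lambda>n. (k * real (?g n)) ^ 8 / exp (k * real (?g n)) / k ^ 8) \<longlonglongrightarrow> 0 / k ^ 8"
    by (intro tendsto_divide tendsto_const) (use k in auto)
  moreover have "(k * real (?g n)) ^ 8 / exp (k * real (?g n)) / k ^ 8 = real (?g n) ^ 8 * \<rho> ^ ?g n" for n
  proof -
    have "\<rho> ^ ?g n = exp (real (?g n) * ln \<rho>)" using \<rho> by (simp add: exp_of_nat_mult)
    also have "real (?g n) * ln \<rho> = - (k * real (?g n))" by (simp add: k_def)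
    finally show ?thesis using k by (simp add: power_mult_distrib exp_minus divide_inverse)
  qed
  ultimately have lim: "(\<lambda>n. real (?g n) ^ 8 * \<rho> ^ ?g n) \<longlonglongrightarrow> 0" by simp
  show "(\<lambda>n. \<rho> ^ ?g n / \<beta> n) \<longlonglongrightarrow> 0"
  proof (rule Lim_null_comparison[OF _ lim])
    show "\<forall>\<^sub>F n in sequentially. norm (\<rho> ^ ?g n / \<beta> n) \<le> real (?g n) ^ 8 * \<rho> ^ ?g n"
      using \<beta>
    proof eventually_elim
      case (elim n)
      have r4: "0 < r n ^ 4" using r(1)[of n] by simp
      have "(1 / sqrt (r n)) ^ 8 \<le> real (?g n) ^ 8"
        using gap_length_bounds(1)[OF r(1)[of n]] less_imp_le[OF r(1)[of n]] by (intro power_mono) auto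
      moreover have "sqrt (r n) ^ 8 = r n ^ 4"
      proof -
        have "sqrt (r n) ^ 8 = (sqrt (r n) ^ 2) ^ 4" by (simp only: power_mult[symmetric]) simp
        then show ?thesis using less_imp_le[OF r(1)[of n]] by simp
      qed
      ultimately have "1 / r n ^ 4 \<le> real (?g n) ^ 8" by (simp add: power_divide)
      moreover have "1 / \<beta> n \<le> 1 / r n ^ 4" using elim r4 less_le_trans[OF r4 elim] by (intro divide_left_mono mult_pos_pos) auto
      ultimately have "1 / \<beta> n \<le> real (?g n) ^ 8" by linarith
      then have "1 / \<beta> n * \<rho> ^ ?g n \<le> real (?g n) ^ 8 * \<rho> ^ ?g n" using \<rho> by (intro mult_right_mono) auto
      then show ?case using \<rho> less_le_trans[OF r4 elim] by simp
    qed
  qed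
qed

lemma square_ball_dist:
  assumes "r > 0"
  shows "square_ball dist z r = vertical_section (snd z) (disc_height (fst z) r)"
proof -
  have "dist z w < r \<longleftrightarrow> \<bar>snd w - snd z\<bar> < disc_height (fst z) r (fst w)" for w
  proof -
    have "dist z w < r \<longleftrightarrow> (fst z - fst w)\<^sup>2 + (snd z - snd w)\<^sup>2 < r\<^sup>2"
      using real_sqrt_less_iff[of "(fst z - fst w)\<^sup>2 + (snd z - snd w)\<^sup>2" "r\<^sup>2"] assms
      by (simp add: dist_prod_def dist_real_def)
    also have "\<dots> \<longleftrightarrow> (snd w - snd z)\<^sup>2 < max 0 (r\<^sup>2 - (fst w - fst z)\<^sup>2)"
      by (auto simp: max_def power2_commute not_le dest: le_less_trans[OF zero_le_power2]) (smt (verit) zero_le_power2)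
    also have "\<dots> \<longleftrightarrow> sqrt ((snd w - snd z)\<^sup>2) < disc_height (fst z) r (fst w)"
      by (simp only: disc_height_def real_sqrt_less_iff)
    finally show ?thesis by simp
  qed
  then show ?thesis by (auto simp: square_ball_def vertical_section_def)
qed

lemma square_ball_linf:
  assumes "r > 0"
  shows "square_ball linf_dist z r = vertical_section (snd z) (\<lambda>x. if x \<in> {x. \<bar>x - fst z\<bar> < r} then r else 0)"
  by (auto simp: square_ball_def vertical_section_def linf_dist_def abs_minus_commute split: if_splits)

section \<open>Discs at nonperiodic points and squares at periodic points\<close>

context baker_srb
begin

lemma section_subset_ball:
  assumes "\<And>x. h x \<le> r" "\<And>x. \<bar>x - fst z\<bar> \<ge> r \<Longrightarrow> h x = 0" "w \<in> vertical_section (snd z) h"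
  shows "dist w z < 2 * r"
proof -
  have y: "\<bar>snd w - snd z\<bar> < h (fst w)" using assms(3) by (auto simp: vertical_section_def)
  then have "\<bar>snd w - snd z\<bar> < r" using assms(1)[of "fst w"] by linarith
  moreover have "\<bar>fst w - fst z\<bar> < r" using y assms(2)[of "fst w"] by (cases "\<bar>fst w - fst z\<bar> < r") auto
  moreover have "dist w z \<le> \<bar>fst w - fst z\<bar> + \<bar>snd w - snd z\<bar>"
    unfolding dist_prod_def dist_real_def using sqrt_sum_squares_le_sum_abs[of "fst w - fst z" "snd w - snd z"] by simp
  ultimately show ?thesis by linarith
qed

lemma no_return_eventually:
  fixes h :: "nat \<Rightarrow> real \<Rightarrow> real"
  assumes h: "\<And>n x. h n x \<le> r n" "\<And>n x. \<bar>x - fst z\<bar> \<ge> r n \<Longrightarrow> h n x = 0"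
    and r: "r \<longlonglongrightarrow> 0" and j: "(T ^^ j) z \<noteq> z"
  shows "\<forall>\<^sub>F n in sequentially. \<forall>w\<in>vertical_section (snd z) (h n). (T ^^ j) w \<notin> vertical_section (snd z) (h n)"
proof -
  obtain \<delta> where \<delta>: "\<delta> > 0" "\<And>w. w \<in> unit_square \<Longrightarrow> dist w z < \<delta> \<Longrightarrow> \<not> dist ((T ^^ j) w) z < \<delta>"
    using no_return[OF \<gamma> j] by blast
  have "\<forall>\<^sub>F n in sequentially. r n < \<delta> / 2" using r \<delta>(1) by (intro order_tendstoD) auto
  then show ?thesis
  proof eventually_elim
    case (elim n)
    show ?case
    proof (intro ballI notI)
      fix w assume w: "w \<in> vertical_section (snd z) (h n)" "(T ^^ j) w \<in> vertical_section (snd z) (h n)"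
      have "dist w z < \<delta>" "dist ((T ^^ j) w) z < \<delta>"
        using section_subset_ball[OF h w(1)] section_subset_ball[OF h w(2)] elim by linarith+
      moreover have "w \<in> unit_square" using w(1) by (simp add: vertical_section_def)
      ultimately show False using \<delta>(2) by blast
    qed
  qed
qed

lemma section_measure_le:
  assumes h: "h \<in> borel_measurable borel" "\<And>x. 0 \<le> h x" "\<And>x. h x \<le> r" and c: "c \<in> {0..1}"
  shows "measure \<mu> (vertical_section c h) \<le> 2 * r"
proof -
  have r: "0 \<le> r" using h(2,3) order_trans by blast
  have "(\<integral>x. min 1 (c + h x) - max 0 (c - h x) \<partial>\<nu>) \<le> (\<integral>x. 2 * r \<partial>\<nu>)"
  proof (rule integral_mono)
    show "integrable \<nu> (\<lambda>x. min 1 (c + h x) - max 0 (c - h x))"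
    proof (rule \<nu>.integrable_const_bound[of _ 1])
      show "AE x in \<nu>. norm (min 1 (c + h x) - max 0 (c - h x)) \<le> 1"
        using c h(2) by (intro AE_I2) (auto simp: min_def max_def abs_le_iff)
    qed (use h(1) in \<open>simp add: measurable_cong_sets[OF sets_\<nu> refl]\<close>)
    show "min 1 (c + h x) - max 0 (c - h x) \<le> 2 * r" for x
      using h(2,3)[of x] c by (auto simp: min_def max_def)
  qed simp
  then show ?thesis by (simp add: vertical_section_mass[OF h(1,2) c] \<nu>.prob_space[unfolded space_\<nu>])
qed

text \<open>Small discs have no return within a bounded time, hence q = 0. The return estimate is
  stated relative to the mass of the disc: \<open>r\<close> times the mass of the base is at most 2
  C times that of the disc, by doubling.\<close>

lemma disc_cells_limit:
  fixes r :: "nat \<Rightarrow> real"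
  assumes z: "z \<in> unit_square" "supp (fst z)" and np: "\<not> periodic_point T z" and \<tau>: "\<tau> > 0"
    and r: "\<And>n. 0 < r n" "r \<longlonglongrightarrow> 0"
    and lower: "\<forall>\<^sub>F n in sequentially. r n ^ 4 \<le> measure \<mu> (square_ball dist z (r n))"
    and v: "\<And>n. v n = nat \<lfloor>\<tau> / measure \<mu> (square_ball dist z (r n))\<rfloor>"
    and s: "\<And>j. 0 \<le> s j" "\<And>j. s j \<le> 1"
  shows "(\<lambda>n. \<integral>w. cells T (square_ball dist z (r n)) s (cell_start m (v n)) J (\<lambda>_. 1) w \<partial>\<mu>)
     \<longlonglongrightarrow> (\<Prod>j<J. exp (- ((1 - s j) * (\<tau> / real m))))"
proof -
  let ?c = "snd z" and ?a = "fst z"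
  let ?h = "\<lambda>n. disc_height ?a (r n)"
  define hh where "hh n i = (if i = 0 then ?h n else (\<lambda>_. 0))" for n i :: nat
  let ?B = "\<lambda>n. vertical_section ?c (hh n 0)"
  have ball: "square_ball dist z (r n) = ?B n" for n
    using square_ball_dist[OF r(1)] by (simp add: hh_def)
  have z01: "?c \<in> {0..1}" "?a \<in> {0..1}" using z(1) by (auto simp: unit_square_def)
  have h_le: "?h n x \<le> r n" for n x
    unfolding disc_height_def by (rule real_le_lsqrt) (use less_imp_le[OF r(1)] in auto)
  have h_0: "?h n x = 0" if "\<bar>x - ?a\<bar> \<ge> r n" for n x
  proof -
    have "(r n)\<^sup>2 \<le> (x - ?a)\<^sup>2" using that less_imp_le[OF r(1)[of n]] by (simp add: abs_le_square_iff[symmetric])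
    then show ?thesis by (simp add: disc_height_def)
  qed
  obtain C where C: "C \<ge> 0" "\<And>x r. supp x \<Longrightarrow> 0 < r \<Longrightarrow> r \<le> 1 \<Longrightarrow>
    measure \<nu> {y. \<bar>y - x\<bar> < r} \<le> C * measure \<nu> {y. \<bar>y - x\<bar> < r / 2}" using \<nu>_doubling by blast
  have \<beta>_le: "measure \<mu> (?B n) \<le> 2 * r n" for n
    using section_measure_le[where h = "?h n" and r = "r n", OF disc_height_borel disc_height_nonneg h_le z01(1)]
    by (simp add: hh_def)
  have \<beta>_pos: "\<forall>\<^sub>F n in sequentially. measure \<mu> (?B n) > 0"
    using lower unfolding ball by eventually_elim (use r(1) in \<open>auto intro: less_le_trans[OF zero_less_power]\<close>)
  have \<beta>_0: "(\<lambda>n. measure \<mu> (?B n)) \<longlonglongrightarrow> 0"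
    by (rule Lim_null_comparison[OF always_eventually tendsto_mult_right_zero[OF r(2), of 2]]) (use \<beta>_le in simp)
  have r1: "\<forall>\<^sub>F n in sequentially. r n < 1" using r(2) by (rule order_tendstoD) simp
  note gl = gap_length_limits[OF r]
  interpret baker_hits \<gamma> \<mu> hh ?c 0 1 "\<lambda>n. gap_length (r n)" v \<tau> "8 * C" "sqrt \<gamma>" "2 * sqrt 2" r
  proof
    show "hh n i \<in> borel_measurable borel" "0 \<le> hh n i x" "hh n (Suc i) x \<le> hh n i x" for n i x
      using disc_height_borel disc_height_nonneg by (auto simp: hh_def)
    show "0 \<le> sqrt \<gamma>" "sqrt \<gamma> < 1" using \<gamma> by auto
    show "\<forall>\<^sub>F n in sequentially. \<forall>i\<le>I. measure \<mu> (vertical_section ?c (hh n i)) = 0 ^ i * measure \<mu> (?B n)" for I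
    proof (intro always_eventually allI impI)
      fix n i :: nat
      have "vertical_section ?c (\<lambda>_. 0) = {}" by (auto simp: vertical_section_def)
      then show "measure \<mu> (vertical_section ?c (hh n i)) = 0 ^ i * measure \<mu> (?B n)"
        by (cases i) (auto simp: hh_def)
    qed
    show "\<forall>\<^sub>F n in sequentially. \<forall>w j. w \<in> ?B n \<longrightarrow> 1 \<le> j \<longrightarrow> j \<le> I \<longrightarrow>
        ((T ^^ j) w \<in> ?B n \<longleftrightarrow> 1 dvd j \<and> w \<in> vertical_section ?c (hh n (j div 1)))" for I
    proof -
      have "\<forall>\<^sub>F n in sequentially. \<forall>j\<in>{1..I}. \<forall>w\<in>?B n. (T ^^ j) w \<notin> ?B n"
      proof (subst eventually_ball_finite_distrib, simp, rule ballI)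
        fix j assume "j \<in> {1..I}"
        then have "(T ^^ j) z \<noteq> z" using np by (auto simp: periodic_point_def)
        from no_return_eventually[OF h_le h_0 r(2) this]
        show "\<forall>\<^sub>F n in sequentially. \<forall>w\<in>?B n. (T ^^ j) w \<notin> ?B n" by (simp add: hh_def)
      qed
      then show ?thesis
        by eventually_elim (auto simp: hh_def vertical_section_def)
    qed
    show "leaf_dist (\<lambda>w. indicator (?B n) ((T ^^ j) w)) x x' \<le> 2 * sqrt 2 * sqrt \<gamma> ^ j"
      if "x \<in> {0..1}" "x' \<in> {0..1}" for n j x x'
      using leaf_dist_disc_exp[OF z01(2) that] by (simp add: hh_def)
    show "\<forall>\<^sub>F n in sequentially. \<forall>j. measure \<mu> {w \<in> ?B n. (T ^^ j) w \<in> ?B n}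
        \<le> 8 * C * measure \<mu> (?B n) * (r n + (1/2) ^ j)"
      using r1
    proof (rule eventually_mono, intro allI)
      fix n j assume r1: "r n < 1"
      let ?V = "measure \<nu> {x. \<bar>x - ?a\<bar> < r n}"
      \<comment> \<open>Over the inner half of the base the half-chord is at least r / 2; doubling
        then restores the full base.\<close>
      have "r n / 2 * measure \<nu> {x. \<bar>x - ?a\<bar> < r n / 2} \<le> measure \<mu> (vertical_section ?c (?h n))"
      proof (rule vertical_section_mass_lower[OF disc_height_borel disc_height_nonneg z01(1)])
        show "r n / 2 \<le> ?h n x" if "x \<in> {x. \<bar>x - ?a\<bar> < r n / 2}" for x
        proof -
          have "(x - ?a)\<^sup>2 \<le> (r n / 2)\<^sup>2" using that by (simp add: abs_le_square_iff[symmetric])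
          moreover have "(r n / 2)\<^sup>2 + (r n / 2)\<^sup>2 \<le> (r n)\<^sup>2" by (simp add: power2_eq_square)
          ultimately have "(r n / 2)\<^sup>2 \<le> max 0 ((r n)\<^sup>2 - (x - ?a)\<^sup>2)" by linarith
          then show ?thesis unfolding disc_height_def by (rule real_le_rsqrt)
        qed
      qed (use r1 less_imp_le[OF r(1)] in auto)
      moreover have "?V \<le> C * measure \<nu> {x. \<bar>x - ?a\<bar> < r n / 2}"
        by (rule C(2)[OF z(2) r(1)]) (use r1 in simp)
      ultimately have V: "r n * ?V \<le> 2 * C * measure \<mu> (?B n)"
      proof -
        assume a: "r n / 2 * measure \<nu> {x. \<bar>x - ?a\<bar> < r n / 2} \<le> measure \<mu> (vertical_section ?c (?h n))"
          "?V \<le> C * measure \<nu> {x. \<bar>x - ?a\<bar> < r n / 2}"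
        have "r n * ?V \<le> r n * (C * measure \<nu> {x. \<bar>x - ?a\<bar> < r n / 2})"
          using a(2) less_imp_le[OF r(1)] by (rule mult_left_mono)
        also have "\<dots> = 2 * C * (r n / 2 * measure \<nu> {x. \<bar>x - ?a\<bar> < r n / 2})" by simp
        also have "\<dots> \<le> 2 * C * measure \<mu> (vertical_section ?c (?h n))"
          using a(1) C(1) by (intro mult_left_mono) auto
        finally show ?thesis by (simp add: hh_def)
      qed
      have "measure \<mu> {w \<in> vertical_section ?c (?h n). (T ^^ j) w \<in> vertical_section ?c (?h n)}
          \<le> ?V * (4 * (r n)\<^sup>2 + 4 * r n / 2 ^ j)"
        by (rule return_bound[OF disc_height_borel disc_height_nonneg h_le h_0 z01(1)])
      also have "\<dots> = 4 * (r n * ?V) * (r n + (1/2) ^ j)"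
        by (simp add: power2_eq_square power_one_over algebra_simps)
      also have "\<dots> \<le> 4 * (2 * C * measure \<mu> (?B n)) * (r n + (1/2) ^ j)"
        using V less_imp_le[OF r(1)[of n]] by (intro mult_right_mono mult_left_mono) auto
      finally show "measure \<mu> {w \<in> ?B n. (T ^^ j) w \<in> ?B n} \<le> 8 * C * measure \<mu> (?B n) * (r n + (1/2) ^ j)"
        by (simp add: hh_def mult_ac)
    qed
    show "filterlim (\<lambda>n. gap_length (r n)) at_top sequentially" "(\<lambda>n. real (gap_length (r n)) * r n) \<longlonglongrightarrow> 0"
      by (rule gl(1), rule gl(2))
    show "(\<lambda>n. real (gap_length (r n)) * measure \<mu> (?B n)) \<longlonglongrightarrow> 0"
    proof (rule Lim_null_comparison[OF always_eventually tendsto_mult_right_zero[OF gl(2), of 2]], rule allI)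
      show "norm (real (gap_length (r n)) * measure \<mu> (?B n)) \<le> 2 * (real (gap_length (r n)) * r n)" for n
        using mult_left_mono[OF \<beta>_le[of n], of "real (gap_length (r n))"] by (simp add: abs_mult)
    qed
    show "(\<lambda>n. sqrt \<gamma> ^ gap_length (r n) / measure \<mu> (?B n)) \<longlonglongrightarrow> 0"
      by (rule gl(3)) (use \<gamma> lower in \<open>auto simp: ball\<close>)
    show "(\<lambda>n. (1/2) ^ gap_length (r n) / measure \<mu> (?B n)) \<longlonglongrightarrow> 0"
      by (rule gl(3)) (use lower in \<open>auto simp: ball\<close>)
    show "(\<lambda>n. real (v n) * measure \<mu> (?B n)) \<longlonglongrightarrow> \<tau>"
      unfolding v ball by (rule floor_ratio_limit[OF \<tau> \<beta>_0 \<beta>_pos])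
  qed (use z01 \<beta>_0 \<beta>_pos C(1) less_imp_le[OF r(1)] in auto)
  show ?thesis using cells_limit[OF s] unfolding ball by simp
qed

text \<open>Near a periodic point T^j, for j divisible by p, is affine with fixed point
  \<open>z\<close>, contracts horizontally and expands vertically by 2^j. For small \<open>r\<close>
  a point of the ball therefore returns at time j exactly if its height differs from that of
  \<open>z\<close> by less than r / 2^j; such points fill a rectangle over the same base whose mass
  is 2^-j times that of the ball.\<close>

lemma square_cells_limit:
  fixes r :: "nat \<Rightarrow> real"
  assumes z: "z \<in> unit_square" and per: "minimal_period T z p" and \<tau>: "\<tau> > 0"
    and r: "\<And>n. 0 < r n" "r \<longlonglongrightarrow> 0"
    and lower: "\<forall>\<^sub>F n in sequentially. r n ^ 4 \<le> measure \<mu> (square_ball linf_dist z (r n))"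
    and v: "\<And>n. v n = nat \<lfloor>\<tau> / measure \<mu> (square_ball linf_dist z (r n))\<rfloor>"
  shows "(\<And>j. 0 \<le> s j) \<Longrightarrow> (\<And>j. s j \<le> 1) \<Longrightarrow>
     (\<lambda>n. \<integral>w. cells T (square_ball linf_dist z (r n)) s (cell_start m (v n)) J (\<lambda>_. 1) w \<partial>\<mu>)
     \<longlonglongrightarrow> (\<Prod>j<J. exp (- ((1 - s j) * ((1 - 1 / 2 ^ p) / (1 - s j * (1 / 2 ^ p))) * (\<tau> / real m))))"
    and "(\<lambda>n. measure \<mu> ((T ^^ p) -` square_ball linf_dist z (r n) \<inter> square_ball linf_dist z (r n))
        / measure \<mu> (square_ball linf_dist z (r n))) \<longlonglongrightarrow> 1 / 2 ^ p"
proof -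
  let ?c = "snd z" and ?a = "fst z"
  define S where "S n = {x. \<bar>x - ?a\<bar> < r n}" for n
  \<comment> \<open>The i-th return set keeps the base, and its half-height is divided by the
    vertical expansion 2^(p i).\<close>
  define hh where "hh n i x = (if x \<in> S n then r n / 2 ^ (p * i) else 0)" for n i :: nat and x
  let ?B = "\<lambda>n. vertical_section ?c (hh n 0)"
  have p: "p \<ge> 1" "(T ^^ p) z = z" using per by (auto simp: minimal_period_def)
  have S: "S n \<in> sets borel" for n unfolding S_def by measurable
  have hh0: "hh n 0 = (\<lambda>x. if x \<in> {x. \<bar>x - ?a\<bar> < r n} then r n else 0)" for n
    by (auto simp: hh_def S_def)
  have ball: "square_ball linf_dist z (r n) = ?B n" for n
    unfolding hh0 by (rule square_ball_linf[OF r(1)])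
  have z01: "?c \<in> {0..1}" "?a \<in> {0..1}" using z(1) by (auto simp: unit_square_def)
  have hb: "hh n i \<in> borel_measurable borel" "0 \<le> hh n i x" for n i x
    using S r(1)[of n] unfolding hh_def[abs_def] by (auto simp: less_imp_le)
  have h_le: "hh n 0 x \<le> r n" for n x using r(1)[of n] by (simp add: hh_def)
  have h_0: "hh n 0 x = 0" if "\<bar>x - ?a\<bar> \<ge> r n" for n x using that by (simp add: hh_def S_def)
  have \<beta>_le: "measure \<mu> (?B n) \<le> 2 * r n" for n
    by (rule section_measure_le[OF hb h_le z01(1)])
  have \<beta>_pos: "\<forall>\<^sub>F n in sequentially. measure \<mu> (?B n) > 0"
    using lower unfolding ball by eventually_elim (use r(1) in \<open>auto intro: less_le_trans[OF zero_less_power]\<close>)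
  have \<beta>_0: "(\<lambda>n. measure \<mu> (?B n)) \<longlonglongrightarrow> 0"
    by (rule Lim_null_comparison[OF always_eventually tendsto_mult_right_zero[OF r(2), of 2]]) (use \<beta>_le in simp)
  have r1: "\<forall>\<^sub>F n in sequentially. r n < 1/2" using r(2) by (rule order_tendstoD) simp
  define q where "q = 1 / (2::real) ^ p"
  have q: "0 \<le> q" "q < 1" using p by (auto simp: q_def)
  \<comment> \<open>If \<open>z\<close> lies on the lower or upper side of the unit square, only one
    half of a short vertical segment around it belongs to the square. Up to the half-height
    \<open>s0\<close> there is no further truncation, so the length, and with it the mass, is linear
    in the half-height.\<close>
  define k where "k = (if ?c = 0 \<or> ?c = 1 then 1 else 2::real)"
  define s0 where "s0 = (if ?c = 0 \<or> ?c = 1 then 1 else min ?c (1 - ?c))"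
  have s0: "s0 > 0" using z01 by (auto simp: s0_def)
  have len: "min 1 (?c + t) - max 0 (?c - t) = k * t" if "0 \<le> t" "t \<le> s0" for t
    using that z01 by (auto simp: k_def s0_def min_def max_def split: if_splits)
  have massC: "\<forall>\<^sub>F n in sequentially. \<forall>i. measure \<mu> (vertical_section ?c (hh n i)) = q ^ i * measure \<mu> (?B n)"
  proof -
    have "\<forall>\<^sub>F n in sequentially. r n < s0" using r(2) s0 by (rule order_tendstoD)
    then show ?thesis
    proof (rule eventually_mono, intro allI)
      fix n i assume n: "r n < s0"
      have m: "measure \<mu> (vertical_section ?c (hh n i)) = measure \<nu> (S n) * (k * (r n / 2 ^ (p * i)))" for i
      proof -
        have "r n / 2 ^ (p * i) \<le> r n / 1" using r(1)[of n] by (intro divide_left_mono) auto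
        then have le: "0 \<le> r n / 2 ^ (p * i)" "r n / 2 ^ (p * i) \<le> s0" using n r(1)[of n] by auto
        have "measure \<mu> (vertical_section ?c (\<lambda>x. if x \<in> S n then r n / 2 ^ (p * i) else 0))
          = measure \<nu> (S n) * (k * (r n / 2 ^ (p * i)))"
          unfolding rectangle_mass[OF S le(1) z01(1)] len[OF le] ..
        then show ?thesis by (simp only: hh_def[abs_def])
      qed
      show "measure \<mu> (vertical_section ?c (hh n i)) = q ^ i * measure \<mu> (?B n)"
        unfolding m by (simp add: q_def power_one_over power_mult divide_inverse power_inverse)
    qed
  qed
  have hit: "\<forall>\<^sub>F n in sequentially. \<forall>w\<in>?B n. (T ^^ j) w \<in> ?B n \<longleftrightarrow> p dvd j \<and> w \<in> vertical_section ?c (hh n (j div p))" for j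
  proof (cases "p dvd j")
    case False
    then have "(T ^^ j) z \<noteq> z" using minimal_period_dvd[OF per] by blast
    then have "\<forall>\<^sub>F n in sequentially. \<forall>w\<in>?B n. (T ^^ j) w \<notin> ?B n"
      by (intro no_return_eventually[where h = "\<lambda>n. hh n 0", OF h_le _ r(2)]) (rule h_0)
    then show ?thesis
      by eventually_elim (use False in auto)
  next
    case True
    have Tz: "(T ^^ j) z = z"
    proof -
      obtain i where "j = i * p" using True by (auto simp: dvd_def mult.commute)
      moreover have "(T ^^ (i * p)) z = z" by (induction i) (auto simp: funpow_add p)
      ultimately show ?thesis by simp
    qed
    obtain \<delta> where \<delta>: "\<delta> > 0" "\<And>w. \<bar>snd w - snd z\<bar> < \<delta> \<Longrightarrow>
      fst ((T ^^ j) w) = ?a + \<gamma> ^ j * (fst w - ?a) \<and> snd ((T ^^ j) w) = ?c + 2 ^ j * (snd w - ?c)"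
      using baker_iterate_affine[OF \<gamma>(1) periodic_orbit_avoids_half[OF p], of j] unfolding Tz by blast
    have "\<forall>\<^sub>F n in sequentially. r n < \<delta>" using r(2) \<delta>(1) by (rule order_tendstoD)
    then show ?thesis
    proof (rule eventually_mono, intro ballI)
      fix n w assume n: "r n < \<delta>" and w: "w \<in> ?B n"
      have y: "\<bar>snd w - ?c\<bar> < r n" and x: "fst w \<in> S n" and X: "w \<in> unit_square"
        using w by (auto simp: vertical_section_def hh_def split: if_splits)
      have T: "fst ((T ^^ j) w) = ?a + \<gamma> ^ j * (fst w - ?a)" "snd ((T ^^ j) w) = ?c + 2 ^ j * (snd w - ?c)"
        using \<delta>(2)[of w] y n by auto
      \<comment> \<open>Horizontally the point moves towards \<open>?a\<close> and stays over the
        base, so the height alone decides about the return.\<close>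
      have "\<bar>\<gamma> ^ j * (fst w - ?a)\<bar> \<le> 1 * \<bar>fst w - ?a\<bar>"
        unfolding abs_mult using \<gamma> by (intro mult_right_mono) (auto intro: power_le_one)
      then have "fst ((T ^^ j) w) \<in> S n" using x by (simp add: T S_def)
      then have "(T ^^ j) w \<in> ?B n \<longleftrightarrow> \<bar>2 ^ j * (snd w - ?c)\<bar> < r n"
        using baker_iterate_unit_square[OF \<gamma> X, of j] by (simp add: vertical_section_def hh_def T)
      also have "\<dots> \<longleftrightarrow> \<bar>snd w - ?c\<bar> < r n / 2 ^ j"
        by (simp add: abs_mult pos_less_divide_eq mult.commute)
      also have "\<dots> \<longleftrightarrow> w \<in> vertical_section ?c (hh n (j div p))"
        using X x True by (simp add: vertical_section_def hh_def)
      finally show "(T ^^ j) w \<in> ?B n \<longleftrightarrow> p dvd j \<and> w \<in> vertical_section ?c (hh n (j div p))" using True by simp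
    qed
  qed
  note gl = gap_length_limits[OF r]
  interpret baker_hits \<gamma> \<mu> hh ?c q p "\<lambda>n. gap_length (r n)" v \<tau> 4 "1/2" 2 r
  proof
    show "hh n (Suc i) x \<le> hh n i x" for n i x
      using r(1)[of n] by (auto simp: hh_def intro!: divide_left_mono)
    show "\<forall>\<^sub>F n in sequentially. \<forall>i\<le>I. measure \<mu> (vertical_section ?c (hh n i)) = q ^ i * measure \<mu> (?B n)" for I
      using massC by eventually_elim blast
    show "\<forall>\<^sub>F n in sequentially. \<forall>w j. w \<in> ?B n \<longrightarrow> 1 \<le> j \<longrightarrow> j \<le> I \<longrightarrow>
        ((T ^^ j) w \<in> ?B n \<longleftrightarrow> p dvd j \<and> w \<in> vertical_section ?c (hh n (j div p)))" for I
    proof -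
      have "\<forall>\<^sub>F n in sequentially. \<forall>j\<in>{1..I}. \<forall>w\<in>?B n. (T ^^ j) w \<in> ?B n \<longleftrightarrow> p dvd j \<and> w \<in> vertical_section ?c (hh n (j div p))"
        by (subst eventually_ball_finite_distrib, simp, intro ballI hit)
      then show ?thesis
      proof (rule eventually_mono, intro allI impI)
        fix n w and j :: nat
        assume "\<forall>j\<in>{1..I}. \<forall>w\<in>?B n. (T ^^ j) w \<in> ?B n \<longleftrightarrow> p dvd j \<and> w \<in> vertical_section ?c (hh n (j div p))"
          and "w \<in> ?B n" "1 \<le> j" "j \<le> I"
        moreover from this have "j \<in> {1..I}" by simp
        ultimately show "(T ^^ j) w \<in> ?B n \<longleftrightarrow> p dvd j \<and> w \<in> vertical_section ?c (hh n (j div p))" by blast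
      qed
    qed
    \<comment> \<open>Each of the two vertical edges contributes at most (1/2)^j.\<close>
    show "leaf_dist (\<lambda>w. indicator (?B n) ((T ^^ j) w)) x x' \<le> 2 * (1/2) ^ j"
      if x: "x \<in> {0..1}" "x' \<in> {0..1}" for n j x x'
      using leaf_dist_rectangle[OF x less_imp_le[OF r(1)[of n]], of ?c ?a "r n" j]
        separated_le[OF x, of j "?a - r n"] separated_le[OF x, of j "?a + r n"]
      unfolding hh0 by linarith
    show "\<forall>\<^sub>F n in sequentially. \<forall>j. measure \<mu> {w \<in> ?B n. (T ^^ j) w \<in> ?B n}
        \<le> 4 * measure \<mu> (?B n) * (r n + (1/2) ^ j)"
      using r1
    proof (rule eventually_mono, intro allI)
      fix n j assume r1: "r n < 1/2"
      let ?V = "measure \<nu> {x. \<bar>x - ?a\<bar> < r n}"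
      have V: "r n * ?V \<le> measure \<mu> (?B n)"
        unfolding S_def[symmetric]
        by (rule vertical_section_mass_lower[OF hb z01(1) S]) (use r1 r(1)[of n] in \<open>auto simp: hh_def\<close>)
      have "measure \<mu> {w \<in> ?B n. (T ^^ j) w \<in> ?B n} \<le> ?V * (4 * (r n)\<^sup>2 + 4 * r n / 2 ^ j)"
        by (rule return_bound[OF hb h_le h_0 z01(1)])
      also have "\<dots> = 4 * (r n * ?V) * (r n + (1/2) ^ j)"
        by (simp add: power2_eq_square power_one_over algebra_simps)
      also have "\<dots> \<le> 4 * measure \<mu> (?B n) * (r n + (1/2) ^ j)"
        using V less_imp_le[OF r(1)[of n]] by (intro mult_right_mono mult_left_mono) auto
      finally show "measure \<mu> {w \<in> ?B n. (T ^^ j) w \<in> ?B n} \<le> 4 * measure \<mu> (?B n) * (r n + (1/2) ^ j)" .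
    qed
    show "filterlim (\<lambda>n. gap_length (r n)) at_top sequentially" "(\<lambda>n. real (gap_length (r n)) * r n) \<longlonglongrightarrow> 0"
      by (rule gl(1), rule gl(2))
    show "(\<lambda>n. real (gap_length (r n)) * measure \<mu> (?B n)) \<longlonglongrightarrow> 0"
    proof (rule Lim_null_comparison[OF always_eventually tendsto_mult_right_zero[OF gl(2), of 2]], rule allI)
      show "norm (real (gap_length (r n)) * measure \<mu> (?B n)) \<le> 2 * (real (gap_length (r n)) * r n)" for n
        using mult_left_mono[OF \<beta>_le[of n], of "real (gap_length (r n))"] by (simp add: abs_mult)
    qed
    show "(\<lambda>n. (1/2) ^ gap_length (r n) / measure \<mu> (?B n)) \<longlonglongrightarrow> 0"
      by (rule gl(3)) (use lower in \<open>auto simp: ball\<close>)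
    show "(\<lambda>n. real (v n) * measure \<mu> (?B n)) \<longlonglongrightarrow> \<tau>"
      unfolding v ball by (rule floor_ratio_limit[OF \<tau> \<beta>_0 \<beta>_pos])
  qed (use z01 \<beta>_0 \<beta>_pos less_imp_le[OF r(1)] hb q p in auto)
  show "(\<lambda>n. \<integral>w. cells T (square_ball linf_dist z (r n)) s (cell_start m (v n)) J (\<lambda>_. 1) w \<partial>\<mu>)
     \<longlonglongrightarrow> (\<Prod>j<J. exp (- ((1 - s j) * ((1 - 1 / 2 ^ p) / (1 - s j * (1 / 2 ^ p))) * (\<tau> / real m))))"
    if "\<And>j. 0 \<le> s j" "\<And>j. s j \<le> 1"
    using cells_limit[OF that] unfolding ball q_def .
  show "(\<lambda>n. measure \<mu> ((T ^^ p) -` square_ball linf_dist z (r n) \<inter> square_ball linf_dist z (r n))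
        / measure \<mu> (square_ball linf_dist z (r n))) \<longlonglongrightarrow> 1 / 2 ^ p"
    unfolding ball
  proof (rule tendsto_eventually)
    show "\<forall>\<^sub>F n in sequentially. measure \<mu> ((T ^^ p) -` ?B n \<inter> ?B n) / measure \<mu> (?B n) = 1 / 2 ^ p"
      using hit[of p] massC \<beta>_pos
    proof eventually_elim
      case (elim n)
      have "vertical_section ?c (hh n 1) \<subseteq> ?B n"
        using nested[of n 0] by (auto simp: vertical_section_def intro: less_le_trans)
      then have "(T ^^ p) -` ?B n \<inter> ?B n = vertical_section ?c (hh n 1)" using elim(1) p by auto
      then have "measure \<mu> ((T ^^ p) -` ?B n \<inter> ?B n) = q ^ 1 * measure \<mu> (?B n)" using elim(2) by metis
      then show ?case using elim(3) by (simp add: q_def)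
    qed
  qed
qed

end

section \<open>Compound point processes\<close>

text \<open>The nonnegative integral turns the expectation into the series without a separate
  integrability argument.\<close>

lemma expectation_nat_pmf_sums:
  fixes p :: "nat pmf"
  assumes f: "\<And>n. 0 \<le> f n" and S: "(\<lambda>n. pmf p n * f n) sums S"
  shows "measure_pmf.expectation p f = S"
proof -
  have "(\<integral>\<^sup>+n. ennreal (f n) \<partial>measure_pmf p) = (\<Sum>n. ennreal (pmf p n) * ennreal (f n))"
    by (simp add: nn_integral_measure_pmf nn_integral_count_space_nat)
  also have "\<dots> = (\<Sum>n. ennreal (pmf p n * f n))" using f by (simp add: ennreal_mult)
  also have "\<dots> = ennreal S"
    using S f by (subst suminf_ennreal2) (auto simp: sums_iff)
  finally have nn: "(\<integral>\<^sup>+n. ennreal (f n) \<partial>measure_pmf p) = ennreal S" .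
  have "0 \<le> S" using S f by (auto simp: sums_iff intro!: suminf_nonneg)
  then show ?thesis
    using f nn by (subst integral_eq_nn_integral) auto
qed

definition pgf :: "nat pmf \<Rightarrow> real \<Rightarrow> real" where
  "pgf p s = measure_pmf.expectation p (\<lambda>k. s ^ k)"

lemma integrable_power_pmf:
  fixes p :: "'k pmf" and f :: "'k \<Rightarrow> nat" and s :: real
  assumes "0 \<le> s" "s \<le> 1"
  shows "integrable (measure_pmf p) (\<lambda>k. s ^ f k)"
  by (rule measure_pmf.integrable_const_bound[of _ 1]) (use assms in \<open>auto simp: power_le_one\<close>)

lemma pgf_bounds:
  assumes "0 \<le> s" "s \<le> 1"
  shows "0 \<le> pgf p s" "pgf p s \<le> 1"
proof -
  show "0 \<le> pgf p s" unfolding pgf_def using assms by (intro Bochner_Integration.integral_nonneg) auto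
  have "pgf p s \<le> measure_pmf.expectation p (\<lambda>k. 1)" unfolding pgf_def
    by (rule integral_mono[OF integrable_power_pmf[OF assms]]) (use assms in \<open>auto simp: power_le_one\<close>)
  then show "pgf p s \<le> 1" by simp
qed

lemma nn_pgf: "0 \<le> s \<Longrightarrow> s \<le> 1 \<Longrightarrow> (\<integral>\<^sup>+k. ennreal (s ^ k) \<partial>measure_pmf p) = ennreal (pgf p s)"
  unfolding pgf_def by (rule nn_integral_eq_integral[OF integrable_power_pmf]) auto

lemma pgf_poisson:
  assumes "0 < t" "0 \<le> s"
  shows "pgf (poisson_pmf t) s = exp (- t * (1 - s))"
  unfolding pgf_def
proof (rule expectation_nat_pmf_sums)
  have "(\<lambda>n. exp (- t) * ((t * s) ^ n /\<^sub>R fact n)) sums (exp (- t) * exp (t * s))"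
    by (intro sums_mult exp_converges)
  moreover have "exp (- t) * ((t * s) ^ n /\<^sub>R fact n) = pmf (poisson_pmf t) n * s ^ n" for n
    using assms by (simp add: power_mult_distrib divide_inverse mult_ac)
  moreover have "exp (- t) * exp (t * s) = exp (- t * (1 - s))"
    by (simp add: exp_add[symmetric] algebra_simps)
  ultimately show "(\<lambda>n. pmf (poisson_pmf t) n * s ^ n) sums exp (- t * (1 - s))" by simp
qed (use assms in simp)

lemma pgf_return: "pgf (return_pmf n) s = s ^ n"
  by (simp add: pgf_def)

text \<open>Cluster sizes start at 1 while \<open>geometric_pmf\<close> starts at 0, hence the shift
  by \<open>Suc\<close>.\<close>

lemma pgf_shifted_geometric:
  assumes \<theta>: "0 < \<theta>" "\<theta> \<le> 1" and s: "0 \<le> s" "s \<le> 1"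
  shows "pgf (map_pmf Suc (geometric_pmf \<theta>)) s = \<theta> * s / (1 - (1 - \<theta>) * s)"
proof -
  have "(1 - \<theta>) * s \<le> (1 - \<theta>) * 1" using \<theta> s by (intro mult_left_mono) auto
  then have "norm ((1 - \<theta>) * s) < 1" using \<theta> s by simp
  then have "(\<lambda>n. \<theta> * s * ((1 - \<theta>) * s) ^ n) sums (\<theta> * s * (1 / (1 - (1 - \<theta>) * s)))"
    by (intro sums_mult geometric_sums)
  moreover have "\<theta> * s * ((1 - \<theta>) * s) ^ n = pmf (geometric_pmf \<theta>) n * s ^ Suc n" for n
    using \<theta> by (simp add: geometric_pmf.rep_eq power_mult_distrib)
  ultimately have "(\<lambda>n. pmf (geometric_pmf \<theta>) n * s ^ Suc n) sums (\<theta> * s / (1 - (1 - \<theta>) * s))" by simp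
  then have "measure_pmf.expectation (geometric_pmf \<theta>) (\<lambda>n. s ^ Suc n) = \<theta> * s / (1 - (1 - \<theta>) * s)"
    by (intro expectation_nat_pmf_sums) (use s in auto)
  then show ?thesis by (simp add: pgf_def)
qed

lemma nn_pgf_sum_list:
  assumes "0 \<le> s" "s \<le> 1"
  shows "(\<integral>\<^sup>+xs. ennreal (s ^ sum_list xs) \<partial>measure_pmf (replicate_pmf n P)) = ennreal (pgf P s ^ n)"
proof (induction n)
  case (Suc n)
  have "(\<integral>\<^sup>+xs. ennreal (s ^ sum_list xs) \<partial>measure_pmf (replicate_pmf (Suc n) P))
     = (\<integral>\<^sup>+x. \<integral>\<^sup>+xs. ennreal (s ^ x) * ennreal (s ^ sum_list xs) \<partial>measure_pmf (replicate_pmf n P) \<partial>measure_pmf P)"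
    using assms by (simp add: power_add ennreal_mult)
  also have "\<dots> = (\<integral>\<^sup>+x. ennreal (s ^ x) * ennreal (pgf P s ^ n) \<partial>measure_pmf P)"
    by (simp add: nn_integral_cmult Suc)
  also have "\<dots> = ennreal (pgf P s) * ennreal (pgf P s ^ n)"
    using assms by (simp add: nn_integral_multc nn_pgf)
  also have "\<dots> = ennreal (pgf P s ^ Suc n)"
    using pgf_bounds[OF assms, of P] by (simp add: ennreal_mult)
  finally show ?case .
qed simp

text \<open>Given K = k the generating function is the k-th power of that of \<open>P\<close>, so
  the Poisson generating function is evaluated at \<open>pgf P s\<close>.\<close>

lemma pgf_compound_poisson:
  assumes \<lambda>: "0 \<le> l" and s: "0 \<le> s" "s \<le> 1"
  shows "pgf (compound_poisson_pmf l P) s = exp (- l * (1 - pgf P s))"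
proof -
  let ?K = "if l = 0 then return_pmf 0 else poisson_pmf l"
  note b = pgf_bounds[OF s, of P]
  have "ennreal (pgf (compound_poisson_pmf l P) s) = (\<integral>\<^sup>+k. ennreal (s ^ k) \<partial>measure_pmf (compound_poisson_pmf l P))"
    by (rule nn_pgf[OF s, symmetric])
  also have "\<dots> = (\<integral>\<^sup>+k. ennreal (pgf P s ^ k) \<partial>measure_pmf ?K)"
    unfolding compound_poisson_pmf_def by (simp add: nn_pgf_sum_list[OF s])
  also have "\<dots> = ennreal (pgf ?K (pgf P s))" by (rule nn_pgf[OF b])
  also have "pgf ?K (pgf P s) = exp (- l * (1 - pgf P s))"
    using \<lambda> b by (auto simp: pgf_return pgf_poisson)
  finally show ?thesis using pgf_bounds[OF s] by simp
qed

text \<open>Clusters are nonempty, so a total of k needs at most k of them and the mixture is a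
  finite sum. This form makes continuity in the rate visible.\<close>

lemma pmf_compound_poisson:
  assumes \<lambda>: "0 \<le> l" and P: "pmf P 0 = 0"
  shows "pmf (compound_poisson_pmf l P) k
    = (\<Sum>j\<le>k. l ^ j / fact j * exp (- l) * pmf (map_pmf sum_list (replicate_pmf j P)) k)"
proof -
  let ?K = "if l = 0 then return_pmf 0 else poisson_pmf l"
  have K: "pmf ?K j = l ^ j / fact j * exp (- l)" for j
    using \<lambda> by (cases j) auto
  have z: "pmf (map_pmf sum_list (replicate_pmf j P)) k = 0" if "j > k" for j
  proof -
    have "k \<notin> set_pmf (map_pmf sum_list (replicate_pmf j P))"
    proof
      assume "k \<in> set_pmf (map_pmf sum_list (replicate_pmf j P))"
      then obtain xs where xs: "k = sum_list xs" "length xs = j" "set xs \<subseteq> set_pmf P"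
        by (auto simp: set_replicate_pmf lists_eq_set)
      have "length ys \<le> sum_list ys" if "set ys \<subseteq> set_pmf P" for ys
        using that
      proof (induction ys)
        case (Cons y ys)
        have "y \<noteq> 0"
        proof
          assume "y = 0"
          then show False using Cons.prems P by (auto simp: set_pmf_iff)
        qed
        then show ?case using Cons by simp
      qed simp
      then show False using xs \<open>j > k\<close> by force
    qed
    then show ?thesis unfolding set_pmf_iff by blast
  qed
  have "pmf (compound_poisson_pmf l P) k = measure_pmf.expectation ?K (\<lambda>j. pmf (map_pmf sum_list (replicate_pmf j P)) k)"
    unfolding compound_poisson_pmf_def pmf_bind ..
  also have "\<dots> = (\<Sum>j\<le>k. pmf (map_pmf sum_list (replicate_pmf j P)) k * pmf ?K j)"
    by (rule integral_measure_pmf_real) (use z not_le in auto)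
  finally show ?thesis by (simp only: K mult.commute)
qed

lemma prob_compound_poisson_tendsto:
  assumes "\<And>n. 0 \<le> l n" "l \<longlonglongrightarrow> l'" "pmf P 0 = 0"
  shows "(\<lambda>n. measure_pmf.prob (compound_poisson_pmf (l n) P) {..k}) \<longlonglongrightarrow> measure_pmf.prob (compound_poisson_pmf l' P) {..k}"
proof -
  have l': "0 \<le> l'" using assms(1,2) by (intro LIMSEQ_le_const) auto
  show ?thesis
    unfolding measure_measure_pmf_finite[OF finite_atMost] pmf_compound_poisson[OF assms(1,3)] pmf_compound_poisson[OF l' assms(3)]
    by (intro tendsto_intros assms(2)) auto
qed

lemma compound_poisson_return_one: "compound_poisson_pmf l (return_pmf 1) = (if l = 0 then return_pmf 0 else poisson_pmf l)"
proof -
  have "replicate_pmf k (return_pmf 1) = return_pmf (replicate k (1::nat))" for k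
    by (induction k) (auto simp: bind_return_pmf)
  then show ?thesis unfolding compound_poisson_pmf_def by (simp add: sum_list_replicate bind_return_pmf')
qed

text \<open>The integrand depends on finitely many coordinates, so the infinite product is replaced
  by its finite marginal, where Fubini's theorem applies.\<close>

lemma expectation_prod_PiM:
  fixes f :: "'i \<Rightarrow> 'b \<Rightarrow> real"
  assumes M: "\<And>i. prob_space (M i)" and J: "finite J" and f: "\<And>i. i \<in> J \<Longrightarrow> f i \<in> borel_measurable (M i)"
    "\<And>i x. i \<in> J \<Longrightarrow> 0 \<le> f i x" "\<And>i x. i \<in> J \<Longrightarrow> f i x \<le> 1"
  shows "(\<integral>x. (\<Prod>i\<in>J. f i (x i)) \<partial>PiM UNIV M) = (\<Prod>i\<in>J. \<integral>y. f i y \<partial>M i)"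
proof -
  interpret product_prob_space M UNIV by (rule product_prob_spaceI) (rule M)
  have int: "integrable (M i) (f i)" if "i \<in> J" for i
    by (rule finite_measure.integrable_const_bound[of _ _ 1])
       (use M f that in \<open>auto intro: prob_space.finite_measure\<close>)
  have meas: "(\<lambda>x. \<Prod>i\<in>J. f i (x i)) \<in> borel_measurable (PiM J M)"
    using f(1) by (intro borel_measurable_prod) (auto intro: measurable_compose[OF measurable_component_singleton])
  have "(\<Prod>i\<in>J. \<integral>y. f i y \<partial>M i) = (\<integral>x. (\<Prod>i\<in>J. f i (x i)) \<partial>PiM J M)"
    by (rule product_integral_prod[OF J int, symmetric])
  also have "PiM J M = distr (PiM UNIV M) (PiM J M) (\<lambda>x. restrict x J)"
    using distr_PiM_restrict_finite[OF J] by simp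
  also have "(\<integral>x. (\<Prod>i\<in>J. f i (x i)) \<partial>\<dots>) = (\<integral>x. (\<Prod>i\<in>J. f i (restrict x J i)) \<partial>PiM UNIV M)"
    using meas by (intro integral_distr measurable_restrict_subset) auto
  finally show ?thesis by simp
qed

section \<open>Construction of the limit process\<close>

definition count_in :: "real set \<Rightarrow> real measure \<Rightarrow> nat" where
  "count_in A \<nu> = nat \<lfloor>measure \<nu> A\<rfloor>"

lemma count_in_measurable [measurable]:
  "A \<in> sets half_line \<Longrightarrow> count_in A \<in> measurable counting_measure_space (count_space UNIV)"
  unfolding count_in_def[abs_def] measure_def by measurable

lemma emeasure_eq_count_in:
  assumes "\<nu> \<in> counting_measures" "A \<in> sets half_line" "bounded A"
  shows "emeasure \<nu> A = of_nat (count_in A \<nu>)"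
proof -
  obtain k :: nat where "emeasure \<nu> A = of_nat k" using counting_measure_bounded[OF assms] by blast
  then show ?thesis by (simp add: count_in_def measure_def)
qed

text \<open>The points \<open>(1/2)\<^sup>a\<close> suffice, since linear combinations of the functions \<open>n \<mapsto> (1/2)\<^sup>a\<^sup>n\<close> approximate
  the indicator of a finite set of natural numbers uniformly.\<close>

definition cluster_law :: "real \<Rightarrow> nat pmf \<Rightarrow> real measure measure \<Rightarrow> bool" where
  "cluster_law t P M \<longleftrightarrow> prob_space M \<and> sets M = sets counting_measure_space \<and>
     (\<forall>(J :: nat set) A (a :: nat \<Rightarrow> nat) R. finite J \<longrightarrow> (\<forall>j\<in>J. A j \<in> sets half_line \<and> A j \<subseteq> {..<real R}) \<longrightarrow>
        disjoint_family_on A J \<longrightarrow>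
        (\<integral>\<nu>. (\<Prod>j\<in>J. (1/2) ^ (a j * count_in (A j) \<nu>)) \<partial>M)
          = (\<Prod>j\<in>J. exp (- (t * measure lborel (A j)) * (1 - pgf P ((1/2) ^ a j)))))"

lemma half_power_integrand:
  fixes J :: "nat set"
  assumes "finite J" "\<And>j. j \<in> J \<Longrightarrow> A j \<in> sets half_line"
  shows "(\<lambda>\<nu>. \<Prod>j\<in>J. (1/2::real) ^ (a j * count_in (A j) \<nu>)) \<in> borel_measurable counting_measure_space"
  by (intro borel_measurable_prod measurable_compose[OF count_in_measurable]) (use assms in auto)

text \<open>The law of a single cluster of cell i: its place and its size are independent.\<close>

definition marked_cell :: "nat pmf \<Rightarrow> nat \<Rightarrow> (real \<times> nat) measure" where
  "marked_cell P i = uniform_measure lborel {real i..<real i + 1} \<Otimes>\<^sub>M measure_pmf P"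

text \<open>A uniform place falls outside the cell on a null set; there it is replaced by the left
  endpoint, so that every sample, not only almost every one, gives a locally finite measure.\<close>

definition position :: "nat \<Rightarrow> real \<Rightarrow> real" where
  "position i y = (if y \<in> {real i..<real i + 1} then y else real i)"

lemma position_bounds: "real i \<le> position i y" "position i y < real i + 1"
  by (auto simp: position_def)

lemma position_measurable [measurable]: "position i \<in> borel_measurable borel"
  unfolding position_def[abs_def] by measurable

lemma prob_space_cell: "prob_space (uniform_measure lborel {real i..<real i + 1})"
  by (rule prob_space_uniform_measure) auto

lemma prob_space_marked_cell: "prob_space (marked_cell P i)"
proof -
  interpret U: prob_space "uniform_measure lborel {real i..<real i + 1}" by (rule prob_space_cell)
  interpret pair_prob_space "uniform_measure lborel {real i..<real i + 1}" "measure_pmf P" ..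
  show ?thesis unfolding marked_cell_def by unfold_locales
qed

lemma sets_marked_cell: "sets (marked_cell P i) = sets (borel \<Otimes>\<^sub>M count_space UNIV)"
  unfolding marked_cell_def by (rule sets_pair_measure_cong) auto

text \<open>The sets are disjoint, so at most one factor differs from 1 and the product is 1 minus a
  sum with one term for each set.\<close>

lemma marked_cell_generating_function:
  fixes J :: "nat set" and i :: nat
  assumes J: "finite J" and A: "\<And>j. j \<in> J \<Longrightarrow> A j \<in> sets borel" and disj: "disjoint_family_on A J"
    and z: "\<And>j. 0 \<le> z j" "\<And>j. z j \<le> 1"
  defines "h \<equiv> \<lambda>w. \<Prod>j\<in>J. (if position i (fst w) \<in> A j then z j ^ snd w else 1)"
  shows "h \<in> borel_measurable (marked_cell P i)"
    and "(\<integral>w. h w \<partial>marked_cell P i) = 1 - (\<Sum>j\<in>J. (1 - pgf P (z j)) * measure lborel ({real i..<real i + 1} \<inter> A j))"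
proof -
  let ?U = "uniform_measure lborel {real i..<real i + 1}"
  interpret U: prob_space ?U by (rule prob_space_cell)
  interpret pair_prob_space ?U "measure_pmf P" ..
  have h1: "0 \<le> h w" "h w \<le> 1" for w
    unfolding h_def using z by (auto intro!: prod_nonneg prod_le_1 power_le_one)
  have hm: "h \<in> borel_measurable (borel \<Otimes>\<^sub>M count_space UNIV)"
    unfolding h_def
  proof (intro borel_measurable_prod)
    fix j assume "j \<in> J"
    then have [measurable]: "A j \<in> sets borel" by (rule A)
    show "(\<lambda>w. if position i (fst w) \<in> A j then z j ^ snd w else 1) \<in> borel_measurable (borel \<Otimes>\<^sub>M count_space UNIV)"
      by measurable
  qed
  then show m: "h \<in> borel_measurable (marked_cell P i)"
    by (simp add: measurable_cong_sets[OF sets_marked_cell refl])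
  have inner: "(\<integral>c. h (y, c) \<partial>measure_pmf P) = 1 - (\<Sum>j\<in>J. (1 - pgf P (z j)) * indicator (A j) (position i y))" for y
  proof (cases "\<exists>j\<in>J. position i y \<in> A j")
    case False
    then have "h (y, c) = 1" for c by (simp add: h_def)
    moreover have "(\<Sum>j\<in>J. (1 - pgf P (z j)) * indicator (A j) (position i y)) = 0"
      using False by (intro sum.neutral) auto
    ultimately show ?thesis by simp
  next
    case True
    then obtain j where j: "j \<in> J" "position i y \<in> A j" by blast
    have u: "position i y \<in> A j' \<longleftrightarrow> j' = j" if "j' \<in> J" for j'
      using disj j that by (auto simp: disjoint_family_on_def)
    have "h (y, c) = (\<Prod>j'\<in>J. if j' = j then z j ^ c else 1)" for c
      unfolding h_def using u by (intro prod.cong) auto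
    then have "h (y, c) = z j ^ c" for c using J j by simp
    moreover have "(\<Sum>j'\<in>J. (1 - pgf P (z j')) * indicator (A j') (position i y)) = (\<Sum>j'\<in>J. if j' = j then 1 - pgf P (z j) else 0)"
      using u by (intro sum.cong) (auto simp: indicator_def)
    ultimately show ?thesis using J j by (simp add: pgf_def)
  qed
  have "(\<integral>w. h w \<partial>marked_cell P i) = (\<integral>y. (\<integral>c. h (y, c) \<partial>measure_pmf P) \<partial>?U)"
    unfolding marked_cell_def
    by (rule integral_fst'[symmetric], rule integrable_const_bound[of _ 1])
       (use h1 m in \<open>auto simp: marked_cell_def\<close>)
  also have "\<dots> = (\<integral>y. 1 - (\<Sum>j\<in>J. (1 - pgf P (z j)) * indicator (A j) (position i y)) \<partial>?U)"
    unfolding inner ..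
  also have "\<dots> = (\<integral>y. 1 - (\<Sum>j\<in>J. (1 - pgf P (z j)) * indicator (A j) y) \<partial>?U)"
  proof (rule integral_cong_AE)
    have [measurable]: "\<And>j. j \<in> J \<Longrightarrow> A j \<in> sets borel" by (rule A)
    show "AE y in ?U. 1 - (\<Sum>j\<in>J. (1 - pgf P (z j)) * indicator (A j) (position i y))
        = 1 - (\<Sum>j\<in>J. (1 - pgf P (z j)) * indicator (A j) y)"
      by (rule AE_uniform_measureI) (auto simp: position_def)
    have "(\<lambda>y. indicator (A j) (position i y) :: real) \<in> borel_measurable borel" if "j \<in> J" for j
      by (rule measurable_compose[OF position_measurable borel_measurable_indicator[OF A[OF that]]])
    then show "(\<lambda>y. 1 - (\<Sum>j\<in>J. (1 - pgf P (z j)) * indicator (A j) (position i y))) \<in> borel_measurable ?U"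
      by (intro borel_measurable_diff borel_measurable_sum borel_measurable_times borel_measurable_const) simp_all
    show "(\<lambda>y. 1 - (\<Sum>j\<in>J. (1 - pgf P (z j)) * indicator (A j) y)) \<in> borel_measurable ?U"
      using A by (intro borel_measurable_diff borel_measurable_sum borel_measurable_times borel_measurable_const) simp_all
  qed
  also have "\<dots> = 1 - (\<Sum>j\<in>J. (1 - pgf P (z j)) * measure ?U (A j))"
  proof -
    have i: "integrable ?U (indicat_real (A j))" if "j \<in> J" for j
      by (rule integrable_real_indicator)
         (use A[OF that] U.emeasure_finite[of "A j"] in \<open>simp_all add: less_top[symmetric] del: emeasure_uniform_measure\<close>)
    have "(\<integral>y. (\<Sum>j\<in>J. (1 - pgf P (z j)) * indicator (A j) y) \<partial>?U) = (\<Sum>j\<in>J. (1 - pgf P (z j)) * measure ?U (A j))"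
      using i A by (subst Bochner_Integration.integral_sum) (auto intro!: sum.cong)
    moreover have "integrable ?U (\<lambda>y. \<Sum>j\<in>J. (1 - pgf P (z j)) * indicator (A j) y)"
      using i by (intro Bochner_Integration.integrable_sum integrable_mult_right)
    moreover have "(\<integral>y. (1::real) \<partial>?U) = 1"
      by (simp only: lebesgue_integral_const U.prob_space scaleR_one)
    ultimately show ?thesis by (subst Bochner_Integration.integral_diff) simp_all
  qed
  also have "(\<Sum>j\<in>J. (1 - pgf P (z j)) * measure ?U (A j)) = (\<Sum>j\<in>J. (1 - pgf P (z j)) * measure lborel ({real i..<real i + 1} \<inter> A j))"
    using A by (intro sum.cong) (auto simp: measure_uniform_measure)
  finally show "(\<integral>w. h w \<partial>marked_cell P i) = 1 - (\<Sum>j\<in>J. (1 - pgf P (z j)) * measure lborel ({real i..<real i + 1} \<inter> A j))" .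
qed

lemma sum_measure_cells:
  assumes A: "A \<in> sets borel" "A \<subseteq> {0..<real R}"
  shows "(\<Sum>i<R. measure lborel ({real i..<real i + 1} \<inter> A)) = measure lborel A"
proof -
  have "measure lborel (\<Union>i\<in>{..<R}. {real i..<real i + 1} \<inter> A) = (\<Sum>i<R. measure lborel ({real i..<real i + 1} \<inter> A))"
  proof (rule measure_finite_Union)
    show "disjoint_family_on (\<lambda>i. {real i..<real i + 1} \<inter> A) {..<R}"
      by (auto simp: disjoint_family_on_def)
    show "emeasure lborel ({real i..<real i + 1} \<inter> A) \<noteq> \<infinity>" for i
      using emeasure_bounded_finite[of "{real i..<real i + 1} \<inter> A"] by (auto simp: bounded_Int)
  qed (use A in auto)
  moreover have "(\<Union>i\<in>{..<R}. {real i..<real i + 1} \<inter> A) = A"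
  proof -
    have "\<exists>i<R. real i \<le> x \<and> x < real i + 1" if "x \<in> A" for x
      using A(2) that by (intro exI[of _ "nat \<lfloor>x\<rfloor>"]) (auto simp: subset_iff nat_less_iff floor_less_iff, linarith?)
    then show ?thesis by fastforce
  qed
  ultimately show ?thesis by simp
qed

lemma cluster_law_exists:
  assumes t: "0 < t"
  shows "\<exists>M. cluster_law t P M"
proof -
  txt \<open>In each cell \<open>[i, i + 1)\<close> there is a Poisson number of clusters, and the cluster \<open>j\<close> of the cell
    consists of points at one uniformly distributed place, as many as its \<open>P\<close>-distributed mark.\<close>
  define Mk where "Mk = PiM UNIV (\<lambda>i::nat. measure_pmf (poisson_pmf t))"
  define Mu where "Mu = PiM UNIV (\<lambda>ij::nat \<times> nat. marked_cell P (fst ij))"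
  \<comment> \<open>The index (i, j, l) is the l-th point of cluster j in cell i; the points of one
    cluster coincide, and the extra index records the multiplicity.\<close>
  define I where "I \<omega> = {(i, j, l). j < fst \<omega> i \<and> l < snd (snd \<omega> (i, j))}"
    for \<omega> :: "(nat \<Rightarrow> nat) \<times> (nat \<times> nat \<Rightarrow> real \<times> nat)"
  define x where "x \<omega> = (\<lambda>(i, j, l :: nat). position i (fst (snd \<omega> (i, j))))"
    for \<omega> :: "(nat \<Rightarrow> nat) \<times> (nat \<times> nat \<Rightarrow> real \<times> nat)"
  define N where "N \<omega> = distr (count_space (I \<omega>)) half_line (x \<omega>)" for \<omega>
  interpret Mk: prob_space Mk unfolding Mk_def by (rule prob_space_PiM) (rule measure_pmf.prob_space_axioms)
  interpret Mu: prob_space Mu unfolding Mu_def by (rule prob_space_PiM) (rule prob_space_marked_cell)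
  interpret O: pair_prob_space Mk Mu ..
  let ?\<Omega> = "Mk \<Otimes>\<^sub>M Mu"
  have "0 \<le> position i y" for i y
    by (rule order_trans[OF of_nat_0_le_iff position_bounds(1)])
  then have x0: "x \<omega> \<in> I \<omega> \<rightarrow> {0..}" for \<omega>
    by (auto simp: x_def)
  have N_CM: "N \<omega> \<in> counting_measures" for \<omega>
    unfolding N_def
  proof (rule distr_count_space_counting_measure[OF x0])
    fix T :: real
    have "{ijl \<in> I \<omega>. x \<omega> ijl \<le> T} \<subseteq> (SIGMA i:{..nat \<lfloor>T\<rfloor>}. SIGMA j:{..<fst \<omega> i}. {..<snd (snd \<omega> (i, j))})"
    proof (clarsimp simp: I_def x_def)
      fix i j assume "position i (fst (snd \<omega> (i, j))) \<le> T"
      then have "real i \<le> T" using position_bounds(1) order_trans by blast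
      then show "i \<le> nat \<lfloor>T\<rfloor>" by linarith
    qed
    then show "finite {ijl \<in> I \<omega>. x \<omega> ijl \<le> T}" by (rule finite_subset) auto
  qed
  \<comment> \<open>The number of points in \<open>A\<close> that come from cell i.\<close>
  define X where "X i A \<omega> = (\<Sum>j<fst \<omega> i. if position i (fst (snd \<omega> (i, j))) \<in> A then snd (snd \<omega> (i, j)) else 0)"
    for i A and \<omega> :: "(nat \<Rightarrow> nat) \<times> (nat \<times> nat \<Rightarrow> real \<times> nat)"
  have emN: "emeasure (N \<omega>) A = of_nat (\<Sum>i<R. X i A \<omega>)" if A: "A \<in> sets half_line" "A \<subseteq> {..<real R}" for A R \<omega>
  proof -
    let ?S = "SIGMA i:{..<R}. SIGMA j:{j. j < fst \<omega> i \<and> position i (fst (snd \<omega> (i, j))) \<in> A}. {..<snd (snd \<omega> (i, j))}"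
    have "emeasure (N \<omega>) A = emeasure (count_space (I \<omega>)) (x \<omega> -` A \<inter> I \<omega>)"
      unfolding N_def using A x0[of \<omega>] by (subst emeasure_distr) auto
    also have "x \<omega> -` A \<inter> I \<omega> = ?S"
    proof -
      have "i < R" if "position i y \<in> A" for i y
      proof -
        have "real i < real R" using that A(2) position_bounds(1)[of i y] by (auto intro: le_less_trans)
        then show ?thesis by simp
      qed
      then show ?thesis by (auto simp: I_def x_def)
    qed
    also have "emeasure (count_space (I \<omega>)) ?S = of_nat (card ?S)"
      using \<open>x \<omega> -` A \<inter> I \<omega> = ?S\<close> by (intro emeasure_count_space_finite) auto
    also have "card ?S = (\<Sum>i<R. X i A \<omega>)"
    proof (subst card_SigmaI, simp, simp, rule sum.cong[OF refl])
      fix i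
      have "(\<Sum>j\<in>{j \<in> {..<fst \<omega> i}. position i (fst (snd \<omega> (i, j))) \<in> A}. snd (snd \<omega> (i, j))) = X i A \<omega>"
        unfolding X_def by (rule sum.inter_filter) simp
      then show "card (SIGMA j:{j. j < fst \<omega> i \<and> position i (fst (snd \<omega> (i, j))) \<in> A}. {..<snd (snd \<omega> (i, j))}) = X i A \<omega>"
        by (subst card_SigmaI) simp_all
    qed
    finally show ?thesis .
  qed
  have mk: "(\<lambda>\<omega>. fst \<omega> i) \<in> measurable ?\<Omega> (count_space UNIV)" for i
  proof -
    have "(\<lambda>k. k i) \<in> measurable Mk (measure_pmf (poisson_pmf t))"
      unfolding Mk_def by (rule measurable_component_singleton) simp
    then have "(\<lambda>k. k i) \<in> measurable Mk (count_space UNIV)"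
      by (simp add: measurable_def)
    then show ?thesis by (rule measurable_compose[OF measurable_fst])
  qed
  have mu: "(\<lambda>\<omega>. snd \<omega> (i, j)) \<in> measurable ?\<Omega> (borel \<Otimes>\<^sub>M count_space UNIV)" for i j
  proof -
    have "(\<lambda>u. u (i, j)) \<in> measurable Mu (marked_cell P (fst (i, j)))"
      unfolding Mu_def by (rule measurable_component_singleton) simp
    then have "(\<lambda>u. u (i, j)) \<in> measurable Mu (borel \<Otimes>\<^sub>M count_space UNIV)"
      by (simp add: measurable_cong_sets[OF refl sets_marked_cell])
    then show ?thesis by (rule measurable_compose[OF measurable_snd])
  qed
  have X_meas: "X i A \<in> measurable ?\<Omega> (count_space UNIV)" if "A \<in> sets borel" for i A
    unfolding X_def
  proof (rule measurable_compose_countable[OF _ mk])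
    fix k
    have "(\<lambda>\<omega>. if position i (fst (snd \<omega> (i, j))) \<in> A then snd (snd \<omega> (i, j)) else 0) \<in> measurable ?\<Omega> (count_space UNIV)" for j
    proof -
      have "(\<lambda>w. if position i (fst w) \<in> A then snd w else 0) \<in> measurable (borel \<Otimes>\<^sub>M count_space UNIV) (count_space (UNIV :: nat set))"
        using that by measurable
      then show ?thesis by (rule measurable_compose[OF mu])
    qed
    then show "(\<lambda>\<omega>. \<Sum>j<k. if position i (fst (snd \<omega> (i, j))) \<in> A then snd (snd \<omega> (i, j)) else 0) \<in> measurable ?\<Omega> (count_space UNIV)"
      by (intro measurable_sum_nat)
  qed
  have half_borel: "A \<in> sets borel" "A \<subseteq> {0..}" if "A \<in> sets half_line" for A
    using that by (simp_all add: sets_half_line_iff)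
  have N_meas: "N \<in> measurable ?\<Omega> counting_measure_space"
  proof (rule measurable_counting_measure_spaceI[OF N_CM])
    fix A assume A: "A \<in> sets half_line"
    have AR: "A \<inter> {..<real R} \<in> sets half_line" for R using A by (auto simp: sets_half_line_iff)
    \<comment> \<open>Unbounded sets are exhausted by bounded ones, on which the count is a finite
      sum over cells.\<close>
    have "emeasure (N \<omega>) A = (SUP R. emeasure (N \<omega>) (A \<inter> {..<real R}))" for \<omega>
    proof (subst SUP_emeasure_incseq)
      show "range (\<lambda>R. A \<inter> {..<real R}) \<subseteq> sets (N \<omega>)"
        using AR sets_counting_measure[OF N_CM] by auto
      show "incseq (\<lambda>R. A \<inter> {..<real R})" by (auto simp: incseq_def)
      have "(\<Union>R. A \<inter> {..<real R}) = A" using reals_Archimedean2 by auto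
      then show "emeasure (N \<omega>) A = emeasure (N \<omega>) (\<Union>R. A \<inter> {..<real R})" by simp
    qed
    moreover have "(\<lambda>\<omega>. emeasure (N \<omega>) (A \<inter> {..<real R})) \<in> borel_measurable ?\<Omega>" for R
    proof -
      have "(\<lambda>\<omega>. \<Sum>i<R. X i (A \<inter> {..<real R}) \<omega>) \<in> measurable ?\<Omega> (count_space UNIV)"
        by (intro measurable_sum_nat X_meas half_borel AR)
      then have "(\<lambda>\<omega>. of_nat (\<Sum>i<R. X i (A \<inter> {..<real R}) \<omega>) :: ennreal) \<in> borel_measurable ?\<Omega>"
        by (rule measurable_compose) simp
      then show ?thesis unfolding emN[OF AR Int_lower2] .
    qed
    ultimately show "(\<lambda>\<omega>. emeasure (N \<omega>) A) \<in> borel_measurable ?\<Omega>" by simp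
  qed
  have "cluster_law t P (distr ?\<Omega> counting_measure_space N)"
    unfolding cluster_law_def
  proof (intro conjI allI impI)
    show "prob_space (distr ?\<Omega> counting_measure_space N)" by (rule O.prob_space_distr[OF N_meas])
    fix J :: "nat set" and A and a :: "nat \<Rightarrow> nat" and R
    assume J: "finite J" and "\<forall>j\<in>J. A j \<in> sets half_line \<and> A j \<subseteq> {..<real R}" and disj: "disjoint_family_on A J"
    then have A: "\<And>j. j \<in> J \<Longrightarrow> A j \<in> sets half_line" "\<And>j. j \<in> J \<Longrightarrow> A j \<subseteq> {..<real R}" by auto
    define z :: "nat \<Rightarrow> real" where "z j = (1/2) ^ a j" for j
    have z: "0 \<le> z j" "z j \<le> 1" for j by (auto simp: z_def power_le_one)
    define h where "h i w = (\<Prod>j\<in>J. (if position i (fst w) \<in> A j then z j ^ snd w else 1))" for i and w :: "real \<times> nat"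
    define H where "H i = (\<integral>w. h i w \<partial>marked_cell P i)" for i
    have h_meas: "h i \<in> borel_measurable (marked_cell P i)" for i
      unfolding h_def[abs_def] using marked_cell_generating_function(1)[OF J half_borel(1)[OF A(1)] disj z] by simp
    have Hi: "H i = 1 - (\<Sum>j\<in>J. (1 - pgf P (z j)) * measure lborel ({real i..<real i + 1} \<inter> A j))" for i
      unfolding H_def h_def[abs_def] using marked_cell_generating_function(2)[OF J half_borel(1)[OF A(1)] disj z] by simp
    have h1: "0 \<le> h i w" "h i w \<le> 1" for i w
      unfolding h_def using z by (auto intro!: prod_nonneg prod_le_1 power_le_one)
    have H1: "0 \<le> H i" "H i \<le> 1" for i
    proof -
      interpret prob_space "marked_cell P i" by (rule prob_space_marked_cell)
      have int: "integrable (marked_cell P i) (h i)"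
        by (rule integrable_const_bound[of _ 1]) (use h1 h_meas in auto)
      show "0 \<le> H i" unfolding H_def using h1 by (intro Bochner_Integration.integral_nonneg)
      have "H i \<le> (\<integral>w. 1 \<partial>marked_cell P i)" unfolding H_def
        by (rule integral_mono[OF int]) (use h1 in auto)
      then show "H i \<le> 1" using prob_space by simp
    qed
    let ?f = "\<lambda>\<omega>. \<Prod>i<R. \<Prod>m<fst \<omega> i. h i (snd \<omega> (i, m))"
    have f_eq: "(\<Prod>j\<in>J. (1/2) ^ (a j * count_in (A j) (N \<omega>))) = ?f \<omega>" for \<omega>
    proof -
      have "count_in (A j) (N \<omega>) = (\<Sum>i<R. X i (A j) \<omega>)" if "j \<in> J" for j
        using emN[OF A(1)[OF that] A(2)[OF that], of \<omega>] by (simp add: count_in_def measure_def del: of_nat_sum)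
      then have "(\<Prod>j\<in>J. (1/2::real) ^ (a j * count_in (A j) (N \<omega>))) = (\<Prod>j\<in>J. z j ^ (\<Sum>i<R. X i (A j) \<omega>))"
        by (intro prod.cong) (auto simp: z_def power_mult)
      also have "\<dots> = (\<Prod>j\<in>J. \<Prod>i<R. \<Prod>m<fst \<omega> i. if position i (fst (snd \<omega> (i, m))) \<in> A j then z j ^ snd (snd \<omega> (i, m)) else 1)"
        unfolding X_def power_sum by (intro prod.cong) auto
      also have "\<dots> = (\<Prod>i<R. \<Prod>j\<in>J. \<Prod>m<fst \<omega> i. if position i (fst (snd \<omega> (i, m))) \<in> A j then z j ^ snd (snd \<omega> (i, m)) else 1)"
        by (rule prod.swap)
      also have "\<dots> = ?f \<omega>"
        unfolding h_def by (intro prod.cong refl prod.swap)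
      finally show ?thesis .
    qed
    have f_meas: "?f \<in> borel_measurable ?\<Omega>"
    proof -
      have "(\<lambda>\<omega>. \<Prod>j\<in>J. (1/2::real) ^ (a j * count_in (A j) (N \<omega>))) \<in> borel_measurable ?\<Omega>"
        by (rule measurable_compose[OF N_meas half_power_integrand[OF J A(1)]])
      then show ?thesis unfolding f_eq .
    qed
    have f1: "norm (?f \<omega>) \<le> 1" for \<omega>
    proof -
      have "0 \<le> ?f \<omega>" "?f \<omega> \<le> 1" by (intro prod_nonneg prod_le_1 ballI conjI h1)+
      then show ?thesis by (simp only: real_norm_def abs_of_nonneg)
    qed
    \<comment> \<open>With the numbers of clusters fixed, the clusters are independent and each
      cluster of cell i contributes a factor \<open>H i\<close>.\<close>
    have inner: "(\<integral>u. ?f (k, u) \<partial>Mu) = (\<Prod>i<R. H i ^ k i)" for k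
    proof -
      let ?F = "SIGMA i:{..<R}. {..<k i}"
      have "(\<integral>u. ?f (k, u) \<partial>Mu) = (\<integral>u. (\<Prod>ij\<in>?F. h (fst ij) (u ij)) \<partial>Mu)"
        by (intro Bochner_Integration.integral_cong refl) (simp add: prod.Sigma split_beta)
      also have "\<dots> = (\<Prod>ij\<in>?F. \<integral>w. h (fst ij) w \<partial>marked_cell P (fst ij))"
        unfolding Mu_def
        by (rule expectation_prod_PiM[where M = "\<lambda>ij. marked_cell P (fst ij)" and f = "\<lambda>ij. h (fst ij)"])
           (auto intro: prob_space_marked_cell h_meas h1)
      also have "\<dots> = (\<Prod>i<R. \<Prod>m<k i. H i)"
        unfolding H_def[symmetric] by (subst prod.Sigma) (simp_all add: split_beta)
      finally show ?thesis by simp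
    qed
    have "(\<integral>\<nu>. (\<Prod>j\<in>J. (1/2) ^ (a j * count_in (A j) \<nu>)) \<partial>distr ?\<Omega> counting_measure_space N) = (\<integral>\<omega>. ?f \<omega> \<partial>?\<Omega>)"
      unfolding f_eq[symmetric] by (rule integral_distr[OF N_meas half_power_integrand[OF J A(1)]])
    also have "\<dots> = (\<integral>k. (\<integral>u. ?f (k, u) \<partial>Mu) \<partial>Mk)"
      by (rule O.integral_fst'[symmetric], rule O.integrable_const_bound[of _ 1, OF AE_I2[OF f1] f_meas])
    also have "\<dots> = (\<integral>k. (\<Prod>i<R. H i ^ k i) \<partial>Mk)" unfolding inner ..
    also have "\<dots> = (\<Prod>i<R. measure_pmf.expectation (poisson_pmf t) (\<lambda>k. H i ^ k))"
      unfolding Mk_def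
      by (rule expectation_prod_PiM[where M = "\<lambda>i. measure_pmf (poisson_pmf t)" and f = "\<lambda>i k. H i ^ k"])
         (auto intro: measure_pmf.prob_space_axioms H1 power_le_one zero_le_power)
    \<comment> \<open>The Poisson number of clusters turns the powers into exponentials; the cells
      then add up in the exponent to the full Lebesgue measure.\<close>
    also have "\<dots> = (\<Prod>i<R. exp (- t * (1 - H i)))"
      using pgf_poisson[OF t H1(1)] by (simp add: pgf_def)
    also have "\<dots> = exp (\<Sum>i<R. - t * (1 - H i))" by (rule exp_sum[symmetric]) simp
    also have "(\<Sum>i<R. - t * (1 - H i)) = (\<Sum>i<R. \<Sum>j\<in>J. - (t * measure lborel ({real i..<real i + 1} \<inter> A j)) * (1 - pgf P (z j)))"
      unfolding Hi by (simp add: sum_distrib_left mult_ac sum_negf)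
    also have "\<dots> = (\<Sum>j\<in>J. \<Sum>i<R. - (t * measure lborel ({real i..<real i + 1} \<inter> A j)) * (1 - pgf P (z j)))"
      by (rule sum.swap)
    also have "\<dots> = (\<Sum>j\<in>J. - (t * measure lborel (A j)) * (1 - pgf P (z j)))"
    proof (rule sum.cong[OF refl])
      fix j assume j: "j \<in> J"
      have "A j \<subseteq> {0..<real R}" using half_borel(2)[OF A(1)[OF j]] A(2)[OF j] by auto
      from sum_measure_cells[OF half_borel(1)[OF A(1)[OF j]] this]
      show "(\<Sum>i<R. - (t * measure lborel ({real i..<real i + 1} \<inter> A j)) * (1 - pgf P (z j))) = - (t * measure lborel (A j)) * (1 - pgf P (z j))"
        by (simp add: sum_distrib_right[symmetric] sum_distrib_left[symmetric] sum_negf)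
    qed
    also have "exp \<dots> = (\<Prod>j\<in>J. exp (- (t * measure lborel (A j)) * (1 - pgf P (z j))))"
      by (rule exp_sum[OF J])
    finally show "(\<integral>\<nu>. (\<Prod>j\<in>J. (1/2) ^ (a j * count_in (A j) \<nu>)) \<partial>distr ?\<Omega> counting_measure_space N)
       = (\<Prod>j\<in>J. exp (- (t * measure lborel (A j)) * (1 - pgf P ((1/2) ^ a j))))"
      unfolding z_def .
  qed simp
  then show ?thesis by blast
qed

section \<open>Laws and independence of the counts\<close>

lemma counting_measure_values:
  assumes "\<nu> \<in> counting_measures" "A \<in> sets half_line"
  shows "emeasure \<nu> A = \<infinity> \<or> (\<exists>k::nat. emeasure \<nu> A = of_nat k)"
proof -
  obtain I :: "nat set" and x where \<nu>: "\<nu> = distr (count_space I) half_line x" and x: "x \<in> I \<rightarrow> {0..}"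
    using assms(1) by (auto simp: counting_measures_def)
  have "emeasure \<nu> A = emeasure (count_space I) (x -` A \<inter> I)"
    unfolding \<nu> using assms(2) x by (subst emeasure_distr) auto
  then show ?thesis by (auto simp: emeasure_count_space)
qed

lemma counting_measure_value_Suc:
  assumes "\<nu> \<in> counting_measures" "A \<in> sets half_line"
  shows "emeasure \<nu> A = of_nat (Suc m) \<longleftrightarrow> emeasure \<nu> A \<le> of_nat (Suc m) \<and> \<not> emeasure \<nu> A \<le> of_nat m"
proof -
  consider "emeasure \<nu> A = \<infinity>" | k where "emeasure \<nu> A = of_nat k"
    using counting_measure_values[OF assms] by blast
  then show ?thesis
  proof cases
    case 1
    have "\<not> (\<top>::ennreal) \<le> of_nat (Suc m)"
      using of_nat_less_top[of "Suc m"] by (simp only: not_le)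
    then show ?thesis using 1 by auto
  next
    case 2
    then show ?thesis by (simp only: of_nat_le_iff of_nat_eq_iff) auto
  qed
qed

lemma measure_lborel_truncation:
  assumes "A \<in> sets borel" "emeasure lborel A < \<infinity>"
  shows "(\<lambda>R. measure lborel (A \<inter> {..<real R})) \<longlonglongrightarrow> measure lborel A"
proof -
  have "(\<lambda>R. measure lborel (A \<inter> {..<real R})) \<longlonglongrightarrow> measure lborel (\<Union>R. A \<inter> {..<real R})"
  proof (rule Lim_measure_incseq)
    have "(\<Union>R. A \<inter> {..<real R}) = A" using reals_Archimedean2 by auto
    then show "emeasure lborel (\<Union>R. A \<inter> {..<real R}) \<noteq> \<infinity>" using assms by auto
  qed (use assms in \<open>auto simp: incseq_def\<close>)
  moreover have "(\<Union>R. A \<inter> {..<real R}) = A" using reals_Archimedean2 by auto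
  ultimately show ?thesis by simp
qed

text \<open>The canonical version of the process: the sample space is the space of counting measures
  with law \<open>M\<close>, and the process is the identity.\<close>

locale cluster_process =
  fixes t :: real and P :: "nat pmf" and M :: "real measure measure"
  assumes t: "0 < t" and law: "cluster_law t P M"
begin

sublocale prob_space M using law by (simp add: cluster_law_def)

lemma sets_M: "sets M = sets counting_measure_space"
  using law by (simp add: cluster_law_def)

lemma space_M: "space M = counting_measures"
  using sets_eq_imp_space_eq[OF sets_M] by simp

lemma point_process_id: "point_process M (\<lambda>\<nu>. \<nu>)"
  unfolding point_process_def using prob_space_axioms measurable_ident_sets[OF sets_M] by simp

lemma measurable_M: "f \<in> measurable counting_measure_space N \<Longrightarrow> f \<in> measurable M N"
  by (simp add: measurable_cong_sets[OF sets_M refl])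

lemma generating_function:
  fixes J :: "nat set" and a :: "nat \<Rightarrow> nat"
  assumes "finite J" "\<And>j. j \<in> J \<Longrightarrow> A j \<in> sets half_line" "\<And>j. j \<in> J \<Longrightarrow> A j \<subseteq> {..<real R}" "disjoint_family_on A J"
  shows "(\<integral>\<nu>. (\<Prod>j\<in>J. (1/2) ^ (a j * count_in (A j) \<nu>)) \<partial>M)
          = (\<Prod>j\<in>J. exp (- (t * measure lborel (A j)) * (1 - pgf P ((1/2) ^ a j))))"
  using law assms unfolding cluster_law_def by blast

text \<open>The generating functions agree with those of independent compound Poisson variables,
  realised by \<open>Pi_pmf\<close>; the convergence criterion, applied to a constant sequence, then
  identifies the joint law.\<close>

lemma joint_counts:
  fixes J :: "nat set"
  assumes J: "finite J" and A: "\<And>j. j \<in> J \<Longrightarrow> A j \<in> sets half_line" "\<And>j. j \<in> J \<Longrightarrow> A j \<subseteq> {..<real R}"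
    and disj: "disjoint_family_on A J" and S: "\<And>j. j \<in> J \<Longrightarrow> finite (S j)"
  shows "measure M {\<nu> \<in> space M. \<forall>j\<in>J. count_in (A j) \<nu> \<in> S j}
    = (\<Prod>j\<in>J. measure_pmf.prob (compound_poisson_pmf (t * measure lborel (A j)) P) (S j))"
proof -
  let ?p = "\<lambda>j. compound_poisson_pmf (t * measure lborel (A j)) P"
  let ?Q = "Pi_pmf J 0 ?p"
  have "(\<lambda>n::nat. measure M {\<nu> \<in> space M. \<forall>j\<in>J. count_in (A j) \<nu> \<in> S j})
     \<longlonglongrightarrow> measure_pmf.prob ?Q {f \<in> space (measure_pmf ?Q). \<forall>j\<in>J. f j \<in> S j}"
  proof (rule tendsto_prod_indicator_of_half_powers[where X = "\<lambda>n j. count_in (A j)" and X' = "\<lambda>j f. f j"])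
    fix a :: "nat \<Rightarrow> nat"
    have "measure_pmf.expectation ?Q (\<lambda>f. \<Prod>j\<in>J. (1/2::real) ^ (a j * f j))
      = (\<Prod>j\<in>J. measure_pmf.expectation (?p j) (\<lambda>y. (1/2) ^ (a j * y)))"
      by (rule expectation_prod_Pi_pmf[OF J]) (auto intro: integrable_power_pmf)
    also have "\<dots> = (\<Prod>j\<in>J. pgf (?p j) ((1/2) ^ a j))"
      unfolding pgf_def by (simp add: power_mult)
    also have "\<dots> = (\<Prod>j\<in>J. exp (- (t * measure lborel (A j)) * (1 - pgf P ((1/2) ^ a j))))"
      using t by (intro prod.cong refl pgf_compound_poisson) (auto simp: power_le_one)
    also have "\<dots> = (\<integral>\<nu>. (\<Prod>j\<in>J. (1/2) ^ (a j * count_in (A j) \<nu>)) \<partial>M)"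
      by (rule generating_function[OF J A disj, symmetric])
    finally show "(\<lambda>n::nat. \<integral>\<nu>. (\<Prod>j\<in>J. (1/2) ^ (a j * count_in (A j) \<nu>)) \<partial>M)
      \<longlonglongrightarrow> measure_pmf.expectation ?Q (\<lambda>f. \<Prod>j\<in>J. (1/2::real) ^ (a j * f j))" by simp
  qed (use J S A prob_space_axioms in \<open>auto intro: measurable_M count_in_measurable measure_pmf.prob_space_axioms\<close>)
  then have "measure M {\<nu> \<in> space M. \<forall>j\<in>J. count_in (A j) \<nu> \<in> S j}
     = measure_pmf.prob ?Q {f \<in> space (measure_pmf ?Q). \<forall>j\<in>J. f j \<in> S j}"
    by (rule LIMSEQ_unique[OF tendsto_const])
  also have "{f \<in> space (measure_pmf ?Q). \<forall>j\<in>J. f j \<in> S j} = Pi J S" by (auto simp: Pi_def)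
  finally show ?thesis by (simp add: measure_Pi_pmf_Pi[OF J])
qed

text \<open>For an unbounded set the events that the truncated count is at most n decrease to the
  event for the whole set. Events of equality are not monotone in the truncation, so distribution
  functions are used.\<close>

lemma joint_le_limit:
  fixes J :: "nat set" and n :: "nat \<Rightarrow> nat"
  assumes J: "finite J" and A: "\<And>j. j \<in> J \<Longrightarrow> A j \<in> sets half_line" and disj: "disjoint_family_on A J"
  shows "(\<lambda>R. \<Prod>j\<in>J. measure_pmf.prob (compound_poisson_pmf (t * measure lborel (A j \<inter> {..<real R})) P) {..n j})
     \<longlonglongrightarrow> measure M {\<nu> \<in> space M. \<forall>j\<in>J. emeasure \<nu> (A j) \<le> of_nat (n j)}"
proof -
  let ?A = "\<lambda>R j. A j \<inter> {..<real R}"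
  have AR: "?A R j \<in> sets half_line" if "j \<in> J" for R j using A[OF that] by (auto simp: sets_half_line_iff)
  have bd: "bounded (?A R j)" if "j \<in> J" for R j
    by (rule bounded_subset[of "{0..real R}"]) (use A[OF that] in \<open>auto simp: sets_half_line_iff\<close>)
  define D where "D R = {\<nu> \<in> space M. \<forall>j\<in>J. emeasure \<nu> (?A R j) \<le> of_nat (n j)}" for R
  have D: "D R \<in> sets M" for R
    unfolding D_def using J
    by (intro sets.sets_Collect_finite_All) (auto intro!: borel_measurable_le measurable_M measurable_emeasure_counting_measure_space AR)
  have prob: "measure M (D R) = (\<Prod>j\<in>J. measure_pmf.prob (compound_poisson_pmf (t * measure lborel (?A R j)) P) {..n j})" for R
  proof -
    have "D R = {\<nu> \<in> space M. \<forall>j\<in>J. count_in (?A R j) \<nu> \<in> {..n j}}"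
      unfolding D_def using emeasure_eq_count_in[OF _ AR bd] by (auto simp: space_M)
    moreover have "disjoint_family_on (?A R) J" using disj by (auto simp: disjoint_family_on_def)
    ultimately show ?thesis
      using joint_counts[where S = "\<lambda>j. {..n j}" and A = "?A R" and R = R, OF J AR] by simp
  qed
  have "(\<lambda>R. measure M (D R)) \<longlonglongrightarrow> measure M (\<Inter>R. D R)"
  proof (rule finite_Lim_measure_decseq)
    show "decseq D"
    proof (rule decseq_SucI, rule subsetI)
      fix R \<nu> assume \<nu>: "\<nu> \<in> D (Suc R)"
      have "emeasure \<nu> (?A R j) \<le> emeasure \<nu> (?A (Suc R) j)" if "j \<in> J" for j
        using AR[OF that, of "Suc R"] \<nu> sets_counting_measure[of \<nu>] by (intro emeasure_mono) (auto simp: D_def space_M)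
      then show "\<nu> \<in> D R" using \<nu> by (auto simp: D_def intro: order_trans)
    qed
  qed (use D in auto)
  also have "(\<Inter>R. D R) = {\<nu> \<in> space M. \<forall>j\<in>J. emeasure \<nu> (A j) \<le> of_nat (n j)}"
  proof -
    have "emeasure \<nu> (A j) = (SUP R. emeasure \<nu> (?A R j))" if "\<nu> \<in> space M" "j \<in> J" for \<nu> j
    proof (subst SUP_emeasure_incseq)
      show "range (\<lambda>R. ?A R j) \<subseteq> sets \<nu>" using AR that sets_counting_measure[of \<nu>] by (auto simp: space_M)
      have "(\<Union>R. ?A R j) = A j" using reals_Archimedean2 by auto
      then show "emeasure \<nu> (A j) = emeasure \<nu> (\<Union>R. ?A R j)" by simp
    qed (auto simp: incseq_def)
    then show ?thesis unfolding D_def by (auto simp: SUP_le_iff)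
  qed
  finally show ?thesis unfolding prob .
qed

text \<open>Both sides are limits of the same products over truncated sets; the individual factors
  converge by the case of a single set.\<close>

lemma joint_le_indep:
  fixes J :: "nat set" and n :: "nat \<Rightarrow> nat"
  assumes J: "finite J" and A: "\<And>j. j \<in> J \<Longrightarrow> A j \<in> sets half_line" and disj: "disjoint_family_on A J"
  shows "measure M {\<nu> \<in> space M. \<forall>j\<in>J. emeasure \<nu> (A j) \<le> of_nat (n j)}
    = (\<Prod>j\<in>J. measure M {\<nu> \<in> space M. emeasure \<nu> (A j) \<le> of_nat (n j)})"
proof (rule LIMSEQ_unique[OF joint_le_limit[OF J A disj]])
  show "(\<lambda>R. \<Prod>j\<in>J. measure_pmf.prob (compound_poisson_pmf (t * measure lborel (A j \<inter> {..<real R})) P) {..n j})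
     \<longlonglongrightarrow> (\<Prod>j\<in>J. measure M {\<nu> \<in> space M. emeasure \<nu> (A j) \<le> of_nat (n j)})"
  proof (rule tendsto_prod)
    fix j assume "j \<in> J"
    then show "(\<lambda>R. measure_pmf.prob (compound_poisson_pmf (t * measure lborel (A j \<inter> {..<real R})) P) {..n j})
      \<longlonglongrightarrow> measure M {\<nu> \<in> space M. emeasure \<nu> (A j) \<le> of_nat (n j)}"
      using joint_le_limit[of "{j}" A n] A by (simp add: disjoint_family_on_def)
  qed
qed

text \<open>The events that a count is at most n form an intersection-stable family and generate all
  the information in the count, including the value \<infinity>.\<close>

lemma indep_counts:
  fixes I :: "nat set"
  assumes A: "\<And>i. i \<in> I \<Longrightarrow> A i \<in> sets half_line" and disj: "disjoint_family_on A I"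
  shows "indep_vars (\<lambda>_. borel) (\<lambda>i \<nu>. emeasure \<nu> (A i)) I"
proof -
  let ?E = "\<lambda>i n. {\<nu> \<in> space M. emeasure \<nu> (A i) \<le> of_nat (n :: nat)}"
  define G where "G i = range (?E i)" for i
  have meas: "(\<lambda>\<nu>. emeasure \<nu> (A i)) \<in> borel_measurable M" if "i \<in> I" for i
    by (rule measurable_M[OF measurable_emeasure_counting_measure_space[OF A[OF that]]])
  have E: "?E i n \<in> events" if "i \<in> I" for i n
    using borel_measurable_le[OF meas[OF that] borel_measurable_const] by simp
  have "indep_sets G I"
  proof (rule indep_setsI)
    show "G i \<subseteq> events" if "i \<in> I" for i using E[OF that] by (auto simp: G_def)
    fix D J assume J: "J \<noteq> {}" "J \<subseteq> I" "finite J" "\<forall>j\<in>J. D j \<in> G j"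
    then have "\<forall>j\<in>J. \<exists>n. D j = ?E j n" by (auto simp: G_def)
    then obtain n where n: "\<And>j. j \<in> J \<Longrightarrow> D j = ?E j (n j)" by metis
    have "(\<Inter>j\<in>J. D j) = {\<nu> \<in> space M. \<forall>j\<in>J. emeasure \<nu> (A j) \<le> of_nat (n j)}"
      using J(1) n by auto
    moreover have "disjoint_family_on A J" using disj J(2) by (auto simp: disjoint_family_on_def)
    moreover have "A j \<in> sets half_line" if "j \<in> J" for j using A J(2) that by blast
    ultimately have "prob (\<Inter>j\<in>J. D j) = (\<Prod>j\<in>J. prob (?E j (n j)))"
      using joint_le_indep[OF J(3), of A n] by simp
    then show "prob (\<Inter>j\<in>J. D j) = (\<Prod>j\<in>J. prob (D j))"
      using n by (simp cong: prod.cong)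
  qed
  moreover have "Int_stable (G i)" for i
  proof (rule Int_stableI)
    fix a b assume "a \<in> G i" "b \<in> G i"
    then obtain m n where "a = ?E i m" "b = ?E i n" by (auto simp: G_def)
    moreover have min_le: "of_nat (min m n) = (min (of_nat m) (of_nat n) :: ennreal)"
      by (simp add: min_def of_nat_le_iff)
    ultimately have "a \<inter> b = ?E i (min m n)"
      by (auto simp: min_le)
    then show "a \<inter> b \<in> G i" by (simp add: G_def)
  qed
  ultimately have sig: "indep_sets (\<lambda>i. sigma_sets (space M) (G i)) I"
    by (intro indep_sets_sigma) auto
  have "{(\<lambda>\<nu>. emeasure \<nu> (A i)) -` S \<inter> space M | S. S \<in> sets borel} \<subseteq> sigma_sets (space M) (G i)" if i: "i \<in> I" for i
  proof safe
    fix S :: "ennreal set"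
    interpret S: sigma_algebra "space M" "sigma_sets (space M) (G i)"
      by (rule sigma_algebra_sigma_sets) (auto simp: G_def)
    have Es: "?E i n \<in> sigma_sets (space M) (G i)" for n by (rule sigma_sets.Basic) (auto simp: G_def)
    \<comment> \<open>The level sets of the finite values; an infinite count is the complement of
      their union.\<close>
    define V where "V n = {\<nu> \<in> space M. emeasure \<nu> (A i) = of_nat n}" for n :: nat
    have V: "V n \<in> sigma_sets (space M) (G i)" for n
    proof (cases n)
      case 0
      then have "V n = ?E i 0" by (auto simp: V_def)
      then show ?thesis using Es[of 0] by simp
    next
      case (Suc m)
      have "V n = ?E i (Suc m) - ?E i m"
      proof (rule set_eqI)
        fix \<nu>
        show "\<nu> \<in> V n \<longleftrightarrow> \<nu> \<in> ?E i (Suc m) - ?E i m"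
        proof (cases "\<nu> \<in> space M")
          case True
          then show ?thesis
            using counting_measure_value_Suc[OF _ A[OF i], of \<nu> m]
            unfolding V_def space_M Suc by blast
        qed (auto simp: V_def)
      qed
      then show ?thesis using Es by (simp only: S.Diff)
    qed
    have U: "(\<Union>n. V n) \<in> sigma_sets (space M) (G i)" using V by auto
    have "(\<lambda>\<nu>. emeasure \<nu> (A i)) -` S \<inter> space M
      = (\<Union>n. if of_nat n \<in> S then V n else {}) \<union> (if \<infinity> \<in> S then space M - (\<Union>n. V n) else {})"
    proof (rule set_eqI)
      fix \<nu>
      show "\<nu> \<in> (\<lambda>\<nu>. emeasure \<nu> (A i)) -` S \<inter> space M \<longleftrightarrow>
        \<nu> \<in> (\<Union>n. if of_nat n \<in> S then V n else {}) \<union> (if \<infinity> \<in> S then space M - (\<Union>n. V n) else {})"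
      proof (cases "\<nu> \<in> space M")
        case True
        from counting_measure_values[OF _ A[OF i], of \<nu>] True
        consider "emeasure \<nu> (A i) = \<infinity>" | k where "emeasure \<nu> (A i) = of_nat k" by (auto simp: space_M)
        then show ?thesis
        proof cases
          case 1
          then have "\<nu> \<notin> V n" for n using of_nat_less_top[of n] by (auto simp: V_def)
          then show ?thesis using 1 True by simp
        next
          case 2
          then have "\<nu> \<in> V n \<longleftrightarrow> n = k" for n using True by (auto simp: V_def)
          moreover have "(of_nat k :: ennreal) \<noteq> \<infinity>" using of_nat_less_top[of k] by simp
          ultimately show ?thesis using 2 True by simp
        qed
      qed (auto simp: V_def split: if_splits)
    qed
    also have "\<dots> \<in> sigma_sets (space M) (G i)"
    proof (rule S.Un)
      show "(\<Union>n. if of_nat n \<in> S then V n else {}) \<in> sigma_sets (space M) (G i)"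
        using V by (intro sigma_sets.Union) (simp add: sigma_sets.Empty)
      show "(if \<infinity> \<in> S then space M - (\<Union>n. V n) else {}) \<in> sigma_sets (space M) (G i)"
        using S.Diff[OF S.top U] by (simp add: sigma_sets.Empty)
    qed
    finally show "(\<lambda>\<nu>. emeasure \<nu> (A i)) -` S \<inter> space M \<in> sigma_sets (space M) (G i)" .
  qed
  then have "indep_sets (\<lambda>i. {(\<lambda>\<nu>. emeasure \<nu> (A i)) -` S \<inter> space M | S. S \<in> sets borel}) I"
    by (rule indep_sets_mono_sets[OF sig])
  then show ?thesis unfolding indep_vars_def2 using meas by auto
qed

text \<open>A set of finite length may be unbounded: the law on it is the limit of the laws on
  truncated sets, and continuity in the rate identifies this limit. Point probabilities are
  differences of consecutive values of the distribution function.\<close>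

lemma count_distribution:
  assumes P: "pmf P 0 = 0" and A: "A \<in> sets half_line" "emeasure lborel A < \<infinity>"
  shows "measure M {\<nu> \<in> space M. emeasure \<nu> A = of_nat k} = pmf (compound_poisson_pmf (t * measure lborel A) P) k"
proof -
  let ?p = "compound_poisson_pmf (t * measure lborel A) P"
  have Ab: "A \<in> sets borel" using A by (simp add: sets_half_line_iff)
  have le: "measure M {\<nu> \<in> space M. emeasure \<nu> A \<le> of_nat n} = measure_pmf.prob ?p {..n}" for n
  proof (rule LIMSEQ_unique)
    show "(\<lambda>R. measure_pmf.prob (compound_poisson_pmf (t * measure lborel (A \<inter> {..<real R})) P) {..n})
      \<longlonglongrightarrow> measure M {\<nu> \<in> space M. emeasure \<nu> A \<le> of_nat n}"
      using joint_le_limit[of "{0}" "\<lambda>_. A" "\<lambda>_. n"] A by (simp add: disjoint_family_on_def)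
    show "(\<lambda>R. measure_pmf.prob (compound_poisson_pmf (t * measure lborel (A \<inter> {..<real R})) P) {..n})
      \<longlonglongrightarrow> measure_pmf.prob ?p {..n}"
      by (rule prob_compound_poisson_tendsto[OF _ _ P])
         (use t measure_lborel_truncation[OF Ab A(2)] in \<open>auto intro: tendsto_mult_left\<close>)
  qed
  have meas: "(\<lambda>\<nu>. emeasure \<nu> A) \<in> borel_measurable M"
    by (rule measurable_M[OF measurable_emeasure_counting_measure_space[OF A(1)]])
  have E: "{\<nu> \<in> space M. emeasure \<nu> A \<le> of_nat n} \<in> events" for n :: nat
    using borel_measurable_le[OF meas borel_measurable_const] by simp
  show ?thesis
  proof (cases k)
    case 0
    have "{\<nu> \<in> space M. emeasure \<nu> A = of_nat k} = {\<nu> \<in> space M. emeasure \<nu> A \<le> of_nat 0}" using 0 by auto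
    then show ?thesis using le[of 0] 0 by (simp add: measure_pmf_single atMost_0)
  next
    case (Suc m)
    have "{\<nu> \<in> space M. emeasure \<nu> A = of_nat k}
      = {\<nu> \<in> space M. emeasure \<nu> A \<le> of_nat k} - {\<nu> \<in> space M. emeasure \<nu> A \<le> of_nat m}"
    proof (rule set_eqI)
      fix \<nu>
      show "\<nu> \<in> {\<nu> \<in> space M. emeasure \<nu> A = of_nat k} \<longleftrightarrow>
        \<nu> \<in> {\<nu> \<in> space M. emeasure \<nu> A \<le> of_nat k} - {\<nu> \<in> space M. emeasure \<nu> A \<le> of_nat m}"
        using counting_measure_value_Suc[OF _ A(1), of \<nu> m] unfolding space_M Suc by blast
    qed
    moreover have "{\<nu> \<in> space M. emeasure \<nu> A \<le> of_nat m} \<subseteq> {\<nu> \<in> space M. emeasure \<nu> A \<le> of_nat k}"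
      using Suc by (auto intro: order_trans)
    ultimately have "measure M {\<nu> \<in> space M. emeasure \<nu> A = of_nat k}
      = measure_pmf.prob ?p {..k} - measure_pmf.prob ?p {..m}"
      using finite_measure_Diff[OF E E] by (simp only: le)
    also have "\<dots> = pmf ?p k" using Suc by (simp add: measure_measure_pmf_finite)
    finally show ?thesis .
  qed
qed

lemma compound_point_process_id:
  assumes P: "pmf P 0 = 0" and \<rho>: "\<And>l. l \<ge> 1 \<Longrightarrow> pmf P l = \<rho> l"
  shows "compound_point_process M (\<lambda>\<nu>. \<nu>) t \<rho>"
  unfolding compound_point_process_def
proof (intro conjI allI impI t point_process_id exI[of _ P] ballI)
  show "indep_vars (\<lambda>_. borel) (\<lambda>i \<nu>. emeasure \<nu> (A i)) {..<k}"
    if "(\<forall>i<k. A i \<in> sets half_line) \<and> disjoint_family_on A {..<k}" for k and A :: "nat \<Rightarrow> real set"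
    using that by (intro indep_counts) auto
  show "measure M {\<nu> \<in> space M. emeasure \<nu> A = of_nat k} = pmf (compound_poisson_pmf (t * measure lborel A) P) k"
    if "A \<in> sets half_line" "emeasure lborel A < \<infinity>" for A k
    by (rule count_distribution[OF P that])
qed (use P \<rho> in auto)

text \<open>With clusters of size 1 the compound law is the Poisson law, and finitely many bounded
  sets lie in one common window.\<close>

lemma poisson_process_id:
  assumes P: "P = return_pmf 1"
  shows "poisson_process M (\<lambda>\<nu>. \<nu>) t"
  unfolding poisson_process_def
proof (intro conjI allI impI t point_process_id)
  fix m :: nat and I :: "nat \<Rightarrow> real set" and k :: "nat \<Rightarrow> nat"
  assume "(\<forall>l<m. I l \<in> sets half_line \<and> bounded (I l)) \<and> disjoint_family_on I {..<m}"
  then have I: "\<And>l. l \<in> {..<m} \<Longrightarrow> I l \<in> sets half_line" "\<And>l. l \<in> {..<m} \<Longrightarrow> bounded (I l)"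
    and disj: "disjoint_family_on I {..<m}" by auto
  have "bounded (\<Union>l\<in>{..<m}. I l)" using I(2) by (intro bounded_UN) auto
  then obtain b where b: "\<And>x. x \<in> (\<Union>l\<in>{..<m}. I l) \<Longrightarrow> \<bar>x\<bar> \<le> b" by (auto simp: bounded_iff)
  obtain R :: nat where R: "b < real R" using reals_Archimedean2 by blast
  have IR: "I l \<subseteq> {..<real R}" if "l \<in> {..<m}" for l
  proof
    fix x assume "x \<in> I l"
    then have "\<bar>x\<bar> \<le> b" using b that by blast
    then show "x \<in> {..<real R}" using R by simp
  qed
  have "{\<nu> \<in> space M. \<forall>l<m. emeasure \<nu> (I l) = of_nat (k l)} = {\<nu> \<in> space M. \<forall>l\<in>{..<m}. count_in (I l) \<nu> \<in> {k l}}"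
    using emeasure_eq_count_in[OF _ I] by (auto simp: space_M)
  then have "measure M {\<nu> \<in> space M. \<forall>l<m. emeasure \<nu> (I l) = of_nat (k l)}
     = (\<Prod>l<m. measure_pmf.prob (compound_poisson_pmf (t * measure lborel (I l)) P) {k l})"
    using joint_counts[where S = "\<lambda>l. {k l}", OF finite_lessThan I(1) IR disj] by simp
  also have "\<dots> = (\<Prod>l<m. exp (- t * measure lborel (I l)) * (t * measure lborel (I l)) ^ k l / fact (k l))"
  proof (rule prod.cong[OF refl])
    fix l
    define L where "L = t * measure lborel (I l)"
    have "0 \<le> L" unfolding L_def using t by simp
    then have "pmf (if L = 0 then return_pmf 0 else poisson_pmf L) (k l) = exp (- L) * L ^ k l / fact (k l)"
      by (cases "L = 0"; cases "k l") (simp_all add: poisson_pmf.rep_eq field_simps)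
    then show "measure_pmf.prob (compound_poisson_pmf (t * measure lborel (I l)) P) {k l}
      = exp (- t * measure lborel (I l)) * (t * measure lborel (I l)) ^ k l / fact (k l)"
      unfolding P compound_poisson_return_one measure_pmf_single
      by (simp only: L_def mult_minus_left)
  qed
  finally show "measure M {\<nu> \<in> space M. \<forall>l<m. emeasure \<nu> (I l) = of_nat (k l)}
    = (\<Prod>l<m. exp (- t * measure lborel (I l)) * (t * measure lborel (I l)) ^ k l / fact (k l))" .
qed

end

section \<open>The hit process\<close>

lemma emeasure_hit_process:
  assumes "v > 0" and A: "A \<in> sets half_line"
  shows "emeasure (hit_process T B v x) A = emeasure (count_space UNIV) {l. (T ^^ l) x \<in> B \<and> real l / real v \<in> A}"
proof -
  have "emeasure (hit_process T B v x) A
    = emeasure (count_space {l. (T ^^ l) x \<in> B}) ((\<lambda>l. real l / real v) -` A \<inter> {l. (T ^^ l) x \<in> B})"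
    unfolding hit_process_eq_distr[OF assms(1)] using A by (subst emeasure_distr) auto
  also have "\<dots> = emeasure (count_space UNIV) ((\<lambda>l. real l / real v) -` A \<inter> {l. (T ^^ l) x \<in> B})"
    by (simp add: emeasure_count_space)
  also have "(\<lambda>l. real l / real v) -` A \<inter> {l. (T ^^ l) x \<in> B} = {l. (T ^^ l) x \<in> B \<and> real l / real v \<in> A}"
    by auto
  finally show ?thesis .
qed

text \<open>For \<open>v = 0\<close> the defining set function assigns the same value to \<open>{0}\<close>, \<open>{1}\<close> and
  \<open>{0, 1}\<close>, so it is additive only if it vanishes.\<close>

lemma hit_process_zero: "hit_process T B 0 x = distr (count_space ({} :: nat set)) half_line (\<lambda>_. 0)"
proof (rule measure_eqI)
  define f :: "real set \<Rightarrow> ennreal" where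
    "f = (\<lambda>J. \<Sum>l::nat. indicator ((\<lambda>s. real 0 * s) ` J) (real l) * indicator B ((T ^^ l) x))"
  have sig: "sigma_sets {0..} (sets half_line) = sets half_line"
    using sets.sigma_sets_eq[of half_line] by simp
  have sub: "sets half_line \<subseteq> Pow {0..}" using sets.space_closed[of half_line] by simp
  have hp: "hit_process T B 0 x = measure_of {0..} (sets half_line) f" by (simp add: hit_process_def f_def)
  show "sets (hit_process T B 0 x) = sets (distr (count_space {}) half_line (\<lambda>_. 0))"
    unfolding hp using sub sig by simp
  fix J assume "J \<in> sets (hit_process T B 0 x)"
  then have J: "J \<in> sets half_line" unfolding hp using sub sig by simp
  have f: "f J = (if J = {} then 0 else indicator B x)" for J
  proof -
    have "f J = (\<Sum>l\<in>{0::nat}. indicator ((\<lambda>s. real 0 * s) ` J) (real l) * indicator B ((T ^^ l) x))"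
      unfolding f_def by (rule suminf_finite) (auto simp: indicator_def)
    then show ?thesis by (auto simp: indicator_def)
  qed
  have "f J = 0" if ms: "measure_space {0..} (sets half_line) f"
  proof -
    interpret sigma_algebra "{0..}" "sets half_line" using ms by (simp add: measure_space_def)
    have "additive (sets half_line) f"
      using ms by (intro countably_additive_additive) (auto simp: measure_space_def)
    moreover have "{0} \<in> sets half_line" "{1} \<in> sets half_line" by (auto simp: sets_half_line_iff)
    ultimately have "f ({0} \<union> {1}) = f {0} + f {1}" by (intro additiveD) auto
    then have "x \<notin> B" by (auto simp: f indicator_def one_add_one[symmetric] simp del: one_add_one)
    then show ?thesis by (simp add: f)
  qed
  then have "emeasure (hit_process T B 0 x) J = 0"
    unfolding hp emeasure_measure_of_conv sig by auto
  then show "emeasure (hit_process T B 0 x) J = emeasure (distr (count_space ({} :: nat set)) half_line (\<lambda>_. 0)) J"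
    using J by (simp add: emeasure_distr)
qed

lemma hit_process_counting_measure: "hit_process T B v x \<in> counting_measures"
proof (cases "v = 0")
  case True
  then show ?thesis
    using distr_count_space_counting_measure[of "\<lambda>_. 0" "{} :: nat set"] by (simp add: hit_process_zero)
next
  case False
  have "finite {l \<in> {l. (T ^^ l) x \<in> B}. real l / real v \<le> t}" for t
  proof (rule finite_subset)
    show "{l \<in> {l. (T ^^ l) x \<in> B}. real l / real v \<le> t} \<subseteq> {..nat \<lfloor>t * real v\<rfloor>}"
      using False by (auto simp: divide_le_eq le_nat_floor)
  qed simp
  then show ?thesis
    using False by (simp add: hit_process_eq_distr distr_count_space_counting_measure)
qed

lemma hit_process_measurable:
  assumes T[measurable]: "T \<in> measurable M M" and B[measurable]: "B \<in> sets M"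
  shows "hit_process T B v \<in> measurable M counting_measure_space"
proof (rule measurable_counting_measure_spaceI[OF hit_process_counting_measure])
  fix A assume A: "A \<in> sets half_line"
  show "(\<lambda>x. emeasure (hit_process T B v x) A) \<in> borel_measurable M"
  proof (cases "v = 0")
    case True
    then show ?thesis by (simp add: hit_process_zero)
  next
    case False
    have "emeasure (hit_process T B v x) A = (\<Sum>l. indicator A (real l / real v) * indicator B ((T ^^ l) x))" for x
    proof -
      have "emeasure (hit_process T B v x) A
        = (\<integral>\<^sup>+ l. indicator {l. (T ^^ l) x \<in> B \<and> real l / real v \<in> A} l \<partial>count_space UNIV)"
        using False A by (simp add: emeasure_hit_process)
      also have "\<dots> = (\<Sum>l. indicator {l. (T ^^ l) x \<in> B \<and> real l / real v \<in> A} l)"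
        by (rule nn_integral_count_space_nat)
      also have "\<dots> = (\<Sum>l. indicator A (real l / real v) * indicator B ((T ^^ l) x))"
        by (intro suminf_cong) (auto simp: indicator_def)
      finally show ?thesis .
    qed
    moreover have "(\<lambda>x. indicator B ((T ^^ l) x) :: ennreal) \<in> borel_measurable M" for l
      by (rule measurable_compose[OF measurable_compose_n[OF T] borel_measurable_indicator[OF B]])
    ultimately show ?thesis by simp
  qed
qed

text \<open>The rescaled time l / v lies in grid cell j exactly if l lies between consecutive values
  of \<open>cell_start\<close>, so grid counts are numbers of hits in blocks of times.\<close>

lemma count_in_grid_hit_process:
  assumes v: "v > 0" and m: "m > 0"
  shows "count_in (grid m j) (hit_process T B v x)
    = card {l \<in> {cell_start m v j..<cell_start m v (Suc j)}. (T ^^ l) x \<in> B}"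
proof -
  have "real l / real v \<in> grid m j \<longleftrightarrow> l \<in> {cell_start m v j..<cell_start m v (Suc j)}" for l
  proof -
    have "real l / real v \<in> grid m j \<longleftrightarrow> real j * real v \<le> real l * real m \<and> \<not> real (Suc j) * real v \<le> real l * real m"
      using v m by (auto simp: grid_def field_simps)
    then show ?thesis by (simp only: cell_start_le_iff[OF m, symmetric] atLeastLessThan_iff not_le)
  qed
  then have "{l. (T ^^ l) x \<in> B \<and> real l / real v \<in> grid m j}
    = {l \<in> {cell_start m v j..<cell_start m v (Suc j)}. (T ^^ l) x \<in> B}" by auto
  then have "emeasure (hit_process T B v x) (grid m j)
    = of_nat (card {l \<in> {cell_start m v j..<cell_start m v (Suc j)}. (T ^^ l) x \<in> B})"
    unfolding emeasure_hit_process[OF v grid_sets] by (simp add: emeasure_count_space_finite)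
  then show ?thesis by (simp add: count_in_def measure_def)
qed

lemma cells_hit_process:
  assumes v: "v > 0" and m: "m > 0"
  shows "cells T B (\<lambda>j. s ^ a j) (cell_start m v) J (\<lambda>_. 1) x
    = (\<Prod>j<J. s ^ (a j * count_in (grid m j) (hit_process T B v x)))"
proof -
  have "(\<Prod>l\<in>{cell_start m v j..<cell_start m v (Suc j)}. hit_weight B (s ^ a j) ((T ^^ l) x))
    = s ^ (a j * count_in (grid m j) (hit_process T B v x))" for j
    by (simp add: hit_weight_def count_in_grid_hit_process[OF v m] power_mult flip: prod.inter_filter)
  then show ?thesis by (simp add: cells_eq[OF mono_cell_start cell_start_0])
qed

lemma grid_counts_eq_iff:
  "grid_counts m \<nu> = l \<longleftrightarrow> length l = m * m \<and> (\<forall>j\<in>{..<m * m}. count_in (grid m j) \<nu> \<in> {l ! j})"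
  by (auto simp: grid_counts_def count_in_def list_eq_iff_nth_eq)

text \<open>The block integrals at the parameters (1/2)^a are the joint generating functions of the
  grid counts, and their limit is that of the cluster process, because every cell has length 1 /
  m.\<close>

lemma (in cluster_process) hit_process_converges:
  fixes T :: "'a \<Rightarrow> 'a"
  assumes \<mu>: "prob_space \<mu>" and T: "T \<in> measurable \<mu> \<mu>" and B: "\<And>n. B n \<in> sets \<mu>"
    and v: "\<forall>\<^sub>F n in sequentially. v n > 0"
    and lim: "\<And>a m. m > 0 \<Longrightarrow> (\<lambda>n. \<integral>w. cells T (B n) (\<lambda>j. (1/2) ^ a j) (cell_start m (v n)) (m * m) (\<lambda>_. 1) w \<partial>\<mu>)
      \<longlonglongrightarrow> (\<Prod>j<m * m. exp (- (t * (1 / real m)) * (1 - pgf P ((1/2) ^ a j))))"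
  shows "converges_in_distribution \<mu> (\<lambda>n. hit_process T (B n) (v n)) M (\<lambda>\<nu>. \<nu>)"
proof (rule converges_in_distribution_gridI[OF _ point_process_id])
  show "point_process \<mu> (hit_process T (B n) (v n))" for n
    unfolding point_process_def using \<mu> hit_process_measurable[OF T B] by simp
  fix m :: nat and l assume m: "m > 0"
  let ?c = "\<lambda>j. count_in (grid m j)"
  have conv: "(\<lambda>n. measure \<mu> {\<omega> \<in> space \<mu>. \<forall>j\<in>{..<m * m}. ?c j (hit_process T (B n) (v n) \<omega>) \<in> {l ! j}})
    \<longlonglongrightarrow> measure M {\<omega> \<in> space M. \<forall>j\<in>{..<m * m}. ?c j \<omega> \<in> {l ! j}}"
  proof (rule tendsto_prod_indicator_of_half_powers[OF _ _ \<mu> _ prob_space_axioms])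
    show "(\<lambda>\<omega>. ?c j (hit_process T (B n) (v n) \<omega>)) \<in> measurable \<mu> (count_space UNIV)" for n j
      by (rule measurable_compose[OF hit_process_measurable[OF T B] count_in_measurable[OF grid_sets]])
    show "?c j \<in> measurable M (count_space UNIV)" for j
      by (rule measurable_M[OF count_in_measurable[OF grid_sets]])
    fix a :: "nat \<Rightarrow> nat"
    have "measure lborel (grid m j) = 1 / real m" for j
      using m by (simp add: grid_def divide_right_mono diff_divide_distrib[symmetric])
    moreover have "grid m j \<subseteq> {..<real m}" if "j < m * m" for j
    proof -
      have "real (Suc j) \<le> real (m * m)" using that by (simp only: of_nat_le_iff)
      then have "real (Suc j) / real m \<le> real m" using m by (simp add: divide_le_eq)
      then show ?thesis by (auto simp: grid_def)
    qed
    ultimately have "(\<integral>\<nu>. (\<Prod>j\<in>{..<m * m}. (1/2) ^ (a j * ?c j \<nu>)) \<partial>M)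
      = (\<Prod>j<m * m. exp (- (t * (1 / real m)) * (1 - pgf P ((1/2) ^ a j))))"
      using generating_function[OF finite_lessThan grid_sets _ disjoint_grid, of "m * m" m m a] by simp
    moreover have "\<forall>\<^sub>F n in sequentially.
      (\<integral>w. cells T (B n) (\<lambda>j. (1/2) ^ a j) (cell_start m (v n)) (m * m) (\<lambda>_. 1) w \<partial>\<mu>)
      = (\<integral>\<omega>. (\<Prod>j\<in>{..<m * m}. (1/2::real) ^ (a j * ?c j (hit_process T (B n) (v n) \<omega>))) \<partial>\<mu>)"
      using v by eventually_elim (simp only: cells_hit_process[OF _ m])
    ultimately show "(\<lambda>n. \<integral>\<omega>. (\<Prod>j\<in>{..<m * m}. (1/2::real) ^ (a j * ?c j (hit_process T (B n) (v n) \<omega>))) \<partial>\<mu>)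
      \<longlonglongrightarrow> (\<integral>\<nu>. (\<Prod>j\<in>{..<m * m}. (1/2) ^ (a j * ?c j \<nu>)) \<partial>M)"
      using Lim_transform_eventually[OF lim[OF m]] by simp
  qed auto
  show "(\<lambda>n. measure \<mu> {\<omega> \<in> space \<mu>. grid_counts m (hit_process T (B n) (v n) \<omega>) = l})
    \<longlonglongrightarrow> measure M {\<omega> \<in> space M. grid_counts m \<omega> = l}"
    unfolding grid_counts_eq_iff using conv by (cases "length l = m * m") simp_all
qed

section \<open>Consequences of the local dimension\<close>

lemma square_ball_mono: "r \<le> s \<Longrightarrow> square_ball D z r \<subseteq> square_ball D z s"
  by (auto simp: square_ball_def)

context baker_srb begin

lemma square_ball_sets:
  assumes "D = dist \<or> D = linf_dist"
  shows "square_ball D z r \<in> sets \<mu>"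
proof (rule sets_\<mu>_I)
  have "continuous_on UNIV (D z)"
    using assms unfolding linf_dist_def by (auto intro!: continuous_intros)
  then have "open (D z -` {..<r})" by (auto simp: continuous_on_open_vimage)
  moreover have "square_ball D z r = unit_square \<inter> D z -` {..<r}" by (auto simp: square_ball_def)
  ultimately show "square_ball D z r \<in> sets borel" by simp
qed (auto simp: square_ball_def)

text \<open>For a ball of mass 0 the quotient of logarithms would be 0, as \<open>ln 0 = 0\<close>,
  so the positive limit forces positive mass of small balls and hence of all. Projecting balls to
  the horizontal axis puts \<open>fst z\<close> into the support.\<close>

lemma local_dimension_supp:
  assumes D: "D = dist \<or> D = linf_dist" and d: "0 < d"
    and dim: "((\<lambda>r. ln (measure \<mu> (square_ball D z r)) / ln r) \<longlongrightarrow> d) (at_right 0)"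
  shows "\<And>r. 0 < r \<Longrightarrow> 0 < measure \<mu> (square_ball D z r)" and "supp (fst z)"
proof -
  show pos: "0 < measure \<mu> (square_ball D z r)" if "0 < r" for r
  proof -
    have "\<forall>\<^sub>F s in at_right 0. 0 < ln (measure \<mu> (square_ball D z s)) / ln s"
      using order_tendstoD(1)[OF dim d] .
    moreover have "\<forall>\<^sub>F s in at_right 0. s < r"
      using eventually_at_right_less order_tendstoD(2)[OF tendsto_ident_at that] by auto
    ultimately have "\<forall>\<^sub>F s in at_right 0. 0 < ln (measure \<mu> (square_ball D z s)) / ln s \<and> s < r"
      by (rule eventually_conj)
    then obtain s where s: "0 < ln (measure \<mu> (square_ball D z s)) / ln s" "s < r"
      using eventually_happens'[OF trivial_limit_at_right_real] by blast
    then have "measure \<mu> (square_ball D z s) \<noteq> 0" by (intro notI) simp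
    then have "0 < measure \<mu> (square_ball D z s)" using measure_nonneg[of \<mu>] by (simp add: less_le)
    also have "\<dots> \<le> measure \<mu> (square_ball D z r)"
      by (rule finite_measure_mono[OF square_ball_mono square_ball_sets[OF D]]) (use s in simp)
    finally show ?thesis .
  qed
  show "supp (fst z)" unfolding supp_def
  proof (intro allI impI)
    fix \<epsilon> :: real assume "\<epsilon> > 0"
    have le: "\<bar>fst w - fst z\<bar> \<le> D z w" for w
      using D dist_fst_le[of z w] by (auto simp: linf_dist_def dist_real_def abs_minus_commute)
    have "square_ball D z \<epsilon> \<subseteq> fst -` {y. \<bar>y - fst z\<bar> < \<epsilon>} \<inter> space \<mu>"
      using le by (fastforce simp: square_ball_def space_\<mu> intro: le_less_trans)
    then have "measure \<mu> (square_ball D z \<epsilon>) \<le> measure \<mu> (fst -` {y. \<bar>y - fst z\<bar> < \<epsilon>} \<inter> space \<mu>)"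
      by (rule finite_measure_mono) (rule measurable_sets[OF fst_measurable ball_borel(1)])
    also have "\<dots> = measure \<nu> {y. \<bar>y - fst z\<bar> < \<epsilon>}"
      unfolding \<nu>_def by (rule measure_distr[OF fst_measurable ball_borel(1), symmetric])
    finally show "measure \<nu> {y. \<bar>y - fst z\<bar> < \<epsilon>} > 0" using pos[OF \<open>\<epsilon> > 0\<close>] by linarith
  qed
qed

text \<open>Balls of a fixed radius have positive mass while \<mu>(B_n) tends to 0, so the radii
  tend to 0. For small radii the quotient is below 4, and multiplying by ln r < 0 gives r^4 \<le>
  \<mu>(B_n).\<close>

lemma shrinking_balls:
  assumes D: "D = dist \<or> D = linf_dist" and d: "0 < d" "d < 4"
    and dim: "((\<lambda>r. ln (measure \<mu> (square_ball D z r)) / ln r) \<longlongrightarrow> d) (at_right 0)"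
    and r: "\<And>n. 0 < r n" and \<tau>: "\<tau> > 0"
    and rate: "(\<lambda>n. real n * measure \<mu> (square_ball D z (r n))) \<longlonglongrightarrow> \<tau>"
  shows "r \<longlonglongrightarrow> 0" and "\<forall>\<^sub>F n in sequentially. r n ^ 4 \<le> measure \<mu> (square_ball D z (r n))"
    and "\<forall>\<^sub>F n in sequentially. nat \<lfloor>\<tau> / measure \<mu> (square_ball D z (r n))\<rfloor> > 0"
proof -
  let ?\<beta> = "\<lambda>n. measure \<mu> (square_ball D z (r n))"
  note pos = local_dimension_supp(1)[OF D d(1) dim]
  have "(\<lambda>n. (real n * ?\<beta> n) * (1 / real n)) \<longlonglongrightarrow> \<tau> * 0"
    by (intro tendsto_mult rate lim_1_over_n)
  moreover have "\<forall>\<^sub>F n in sequentially. (real n * ?\<beta> n) * (1 / real n) = ?\<beta> n"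
    using eventually_gt_at_top[of 0] by eventually_elim simp
  ultimately have \<beta>0: "?\<beta> \<longlonglongrightarrow> 0" using Lim_transform_eventually by force
  show r0: "r \<longlonglongrightarrow> 0"
  proof (rule order_tendstoI)
    fix \<epsilon> :: real assume "0 < \<epsilon>"
    show "\<forall>\<^sub>F n in sequentially. r n < \<epsilon>"
      using order_tendstoD(2)[OF \<beta>0 pos[OF \<open>0 < \<epsilon>\<close>]]
    proof eventually_elim
      case (elim n)
      show ?case
      proof (rule ccontr)
        assume "\<not> r n < \<epsilon>"
        then have "measure \<mu> (square_ball D z \<epsilon>) \<le> ?\<beta> n"
          by (intro finite_measure_mono square_ball_mono square_ball_sets[OF D]) simp
        then show False using elim by simp
      qed
    qed
  next
    fix \<epsilon> :: real assume "\<epsilon> < 0"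
    then show "\<forall>\<^sub>F n in sequentially. \<epsilon> < r n" using r by (auto intro: always_eventually less_trans)
  qed
  have "filterlim r (at_right 0) sequentially"
    by (rule tendsto_imp_filterlim_at_right[OF r0]) (use r in auto)
  then have "\<forall>\<^sub>F n in sequentially. ln (?\<beta> n) / ln (r n) < 4"
    using order_tendstoD(2)[OF dim d(2)] by (auto simp: filterlim_iff)
  moreover have "\<forall>\<^sub>F n in sequentially. r n < 1" using order_tendstoD(2)[OF r0] by simp
  ultimately show "\<forall>\<^sub>F n in sequentially. r n ^ 4 \<le> ?\<beta> n"
  proof eventually_elim
    case (elim n)
    have "ln (r n) < 0" using r elim(2) by simp
    then have "4 * ln (r n) < ln (?\<beta> n)" using elim(1) by (simp add: neg_divide_less_eq)
    moreover have "ln (r n ^ 4) = 4 * ln (r n)" using r by (simp add: ln_realpow)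
    ultimately have "ln (r n ^ 4) < ln (?\<beta> n)" by simp
    then show ?case using r[of n] pos[OF r[of n]] by (subst (asm) ln_less_cancel_iff) auto
  qed
  show "\<forall>\<^sub>F n in sequentially. nat \<lfloor>\<tau> / ?\<beta> n\<rfloor> > 0"
    using order_tendstoD(2)[OF \<beta>0 \<tau>]
  proof eventually_elim
    case (elim n)
    then have "1 \<le> \<tau> / ?\<beta> n" using pos[OF r[of n]] by (simp add: le_divide_eq)
    then show ?case by (simp add: le_floor_iff zero_less_nat_eq flip: zless_iff_Suc_zadd)
  qed
qed

end

section \<open>The Poisson limit and the Polya-Aeppli limit\<close>

theorem proposition7p6:
  fixes \<gamma> \<tau> d :: real
    and \<mu> :: "(real \<times> real) measure"
    and D :: "real \<times> real \<Rightarrow> real \<times> real \<Rightarrow> real"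
    and z :: "real \<times> real"
    and u :: "nat \<Rightarrow> real"
    and B :: "nat \<Rightarrow> (real \<times> real) set"
    and p :: nat
    and v :: "nat \<Rightarrow> nat"
    and N :: "nat \<Rightarrow> real \<times> real \<Rightarrow> real measure"
  assumes "0 < \<gamma>" and "\<gamma> < 1/2"
    and "srb_measure \<gamma> \<mu>"
    and "\<tau> > 0"
    and "D = dist \<or> D = linf_dist"
    and "z \<in> unit_square"
    and "d = 1 + ln 2 / ln (1 / \<gamma>)"
    and "((\<lambda>r. ln (measure \<mu> (square_ball D z r)) / ln r) \<longlongrightarrow> d) (at_right 0)"
    and "\<And>n. B n = square_ball D z (exp (- u n))"
    and "(\<lambda>n. real n * measure \<mu> (B n)) \<longlonglongrightarrow> \<tau>"
    and "\<And>n. v n = nat \<lfloor>\<tau> / measure \<mu> (B n)\<rfloor>"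
    and "\<And>n. N n = hit_process (baker \<gamma>) (B n) (v n)"
  shows "(\<not> periodic_point (baker \<gamma>) z \<and> D = dist \<longrightarrow>
            (\<exists>(M :: real measure measure) N'.
               poisson_process M N' \<tau> \<and> converges_in_distribution \<mu> N M N')) \<and>
         (minimal_period (baker \<gamma>) z p \<and> D = linf_dist \<longrightarrow>
            (\<exists>\<theta>. (\<lambda>n. measure \<mu> ((baker \<gamma> ^^ p) -` B n \<inter> B n) / measure \<mu> (B n))
                    \<longlonglongrightarrow> 1 - \<theta> \<and>
               (\<exists>(M :: real measure measure) N'.
                  compound_point_process M N' (\<tau> * \<theta>) (\<lambda>l. \<theta> * (1 - \<theta>) ^ (l - 1)) \<and>
                  converges_in_distribution \<mu> N M N')))"
proof -
  interpret baker_srb \<gamma> \<mu> by unfold_locales fact+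
  define r where "r n = exp (- u n)" for n
  have r: "0 < r n" for n by (simp add: r_def)
  note B = assms(9)[folded r_def]
  have v: "\<And>n. v n = nat \<lfloor>\<tau> / measure \<mu> (square_ball D z (r n))\<rfloor>" using assms(11) B by simp
  \<comment> \<open>\<gamma> < 1/2 gives 1 \<le> d < 2, within the range (0, 4) that
    \<open>shrinking_balls\<close> asks for.\<close>
  have "ln 2 < ln (1 / \<gamma>)" using assms(1,2) by (subst ln_less_cancel_iff) (auto simp: field_simps)
  then have "ln 2 / ln (1 / \<gamma>) < 1" "0 \<le> ln 2 / ln (1 / \<gamma>)"
    using divide_less_eq_1_pos[of "ln (1 / \<gamma>)" "ln 2"] divide_nonneg_nonneg[of "ln 2" "ln (1 / \<gamma>)"]
      ln_gt_zero[of "2::real"] by linarith+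
  then have d: "0 < d" "d < 4" using assms(7) by linarith+
  have "(\<lambda>n. real n * measure \<mu> (square_ball D z (r n))) \<longlonglongrightarrow> \<tau>" using assms(10) B by simp
  note balls = shrinking_balls[OF assms(5) d assms(8) r assms(4) this]
  have vpos: "\<forall>\<^sub>F n in sequentially. v n > 0" using balls(3) v by simp
  have Bsets: "B n \<in> sets \<mu>" for n unfolding B by (rule square_ball_sets[OF assms(5)])
  have N: "N = (\<lambda>n. hit_process T (B n) (v n))" using assms(12) by auto
  have half: "0 \<le> (1/2::real) ^ a" "(1/2::real) ^ a \<le> 1" for a by (auto simp: power_le_one)
  show ?thesis
  proof (intro conjI impI; elim conjE)
    assume np: "\<not> periodic_point T z" and D: "D = dist"
    \<comment> \<open>Without periodic returns every cluster consists of one point.\<close>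
    obtain M where "cluster_law \<tau> (return_pmf 1) M" using cluster_law_exists[OF assms(4)] by blast
    then interpret Q: cluster_process \<tau> "return_pmf 1" M using assms(4) by unfold_locales
    have "converges_in_distribution \<mu> N M (\<lambda>\<nu>. \<nu>)" unfolding N
    proof (rule Q.hit_process_converges[OF prob_space_axioms T_measurable Bsets vpos])
      fix a :: "nat \<Rightarrow> nat" and m :: nat
      show "(\<lambda>n. \<integral>w. cells T (B n) (\<lambda>j. (1/2) ^ a j) (cell_start m (v n)) (m * m) (\<lambda>_. 1) w \<partial>\<mu>)
        \<longlonglongrightarrow> (\<Prod>j<m * m. exp (- (\<tau> * (1 / real m)) * (1 - pgf (return_pmf 1) ((1/2) ^ a j))))"
        using disc_cells_limit[OF assms(6) local_dimension_supp(2)[OF assms(5) d(1) assms(8)] np assms(4)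
          r balls(1) balls(2)[unfolded D] v[unfolded D], of "\<lambda>j. (1/2) ^ a j" m "m * m"] half
        by (simp add: B D pgf_return mult.commute)
    qed
    then show "\<exists>(M :: real measure measure) N'. poisson_process M N' \<tau> \<and> converges_in_distribution \<mu> N M N'"
      using Q.poisson_process_id[OF refl] by blast
  next
    assume per: "minimal_period T z p" and D: "D = linf_dist"
    define q \<theta> where "q = (1 / 2 ^ p :: real)" and "\<theta> = 1 - q"
    have p: "p \<ge> 1" using per by (simp add: minimal_period_def)
    have q: "0 < q" "q \<le> 1/2"
      using power_increasing[OF p, of "2::real"] by (auto simp: q_def field_simps)
    then have \<theta>: "0 < \<theta>" "\<theta> < 1" "1 - \<theta> = q" by (auto simp: \<theta>_def)
    note limits = square_cells_limit[OF assms(6) per assms(4) r balls(1) balls(2)[unfolded D] v[unfolded D]]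
    let ?P = "map_pmf Suc (geometric_pmf \<theta>)"
    have \<tau>\<theta>: "0 < \<tau> * \<theta>" using assms(4) \<theta> by simp
    obtain M where "cluster_law (\<tau> * \<theta>) ?P M" using cluster_law_exists[OF \<tau>\<theta>] by blast
    then interpret Q: cluster_process "\<tau> * \<theta>" ?P M using \<tau>\<theta> by unfold_locales
    \<comment> \<open>The exponents of the block limit and of the compound Poisson law agree, since
      1 - pgf ?P s = (1 - s) / (1 - s q) and \<theta> = 1 - q.\<close>
    have rate: "(1 - s) * ((1 - q) / (1 - s * q)) * (\<tau> / m) = \<tau> * \<theta> * (1 / m) * (1 - pgf ?P s)"
      if s: "0 \<le> s" "s \<le> 1" for s m :: real
    proof -
      have "s * q \<le> 1 * q" using s q by (intro mult_right_mono) auto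
      then have "1 - s * q \<noteq> 0" using q by linarith
      then show ?thesis
        using pgf_shifted_geometric[OF \<theta>(1) _ s] \<theta> by (simp add: \<theta>_def divide_simps) (simp add: algebra_simps)
    qed
    have conv: "converges_in_distribution \<mu> N M (\<lambda>\<nu>. \<nu>)" unfolding N
    proof (rule Q.hit_process_converges[OF prob_space_axioms T_measurable Bsets vpos])
      fix a :: "nat \<Rightarrow> nat" and m :: nat
      have "(\<Prod>j<m * m. exp (- ((1 - (1/2) ^ a j) * ((1 - q) / (1 - (1/2) ^ a j * q)) * (\<tau> / real m))))
        = (\<Prod>j<m * m. exp (- (\<tau> * \<theta> * (1 / real m)) * (1 - pgf ?P ((1/2) ^ a j))))"
        by (intro prod.cong refl) (simp only: rate[OF half] mult_minus_left)
      then show "(\<lambda>n. \<integral>w. cells T (B n) (\<lambda>j. (1/2) ^ a j) (cell_start m (v n)) (m * m) (\<lambda>_. 1) w \<partial>\<mu>)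
        \<longlonglongrightarrow> (\<Prod>j<m * m. exp (- (\<tau> * \<theta> * (1 / real m)) * (1 - pgf ?P ((1/2) ^ a j))))"
        using limits(1)[of "\<lambda>j. (1/2) ^ a j" m "m * m"] half by (simp only: B D q_def)
    qed
    have compound: "compound_point_process M (\<lambda>\<nu>. \<nu>) (\<tau> * \<theta>) (\<lambda>l. \<theta> * (1 - \<theta>) ^ (l - 1))"
    proof (rule Q.compound_point_process_id)
      show "pmf ?P 0 = 0" by (auto simp: pmf_eq_0_set_pmf)
      fix l :: nat assume "l \<ge> 1"
      then obtain k where "l = Suc k" by (cases l) auto
      then show "pmf ?P l = \<theta> * (1 - \<theta>) ^ (l - 1)"
        using \<theta> pmf_map_inj'[of Suc "geometric_pmf \<theta>" k] by simp
    qed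
    have return: "(\<lambda>n. measure \<mu> ((T ^^ p) -` B n \<inter> B n) / measure \<mu> (B n)) \<longlonglongrightarrow> 1 - \<theta>"
      using limits(2) unfolding B D \<theta>(3) q_def .
    show "\<exists>\<theta>. (\<lambda>n. measure \<mu> ((T ^^ p) -` B n \<inter> B n) / measure \<mu> (B n)) \<longlonglongrightarrow> 1 - \<theta> \<and>
      (\<exists>(M :: real measure measure) N'.
        compound_point_process M N' (\<tau> * \<theta>) (\<lambda>l. \<theta> * (1 - \<theta>) ^ (l - 1)) \<and> converges_in_distribution \<mu> N M N')"
      by (intro exI conjI) (rule return compound conv)+
  qed
qed

end
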